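(* Let $k\ge1$ be a fixed integer and let $\alpha>-1$, $\beta>0$ be fixed (independent of $n$). For the Jacobi ensemble on $\mathrm{GL}(n,\mathbb{C})$, i.e. the bi-unitarily invariant ensemble whose squared singular values form the Pólya ensemble with weight $w_{\rm Jac}(x)=x^\alpha(1-x)^{\beta+n-1}\Theta(1-x)$, the point-wise limit $$\mathrm{cov}_{1,k\,{\rm SH}}^{(\infty)}(r;a_1,\ldots,a_k):=\lim_{n\to\infty}n^{3/2-k}\,\mathrm{cov}_{1,k}\left(\frac12-\frac r{\sqrt n};1-\frac{a_1}{n^2},\ldots,1-\frac{a_k}{n^2}\right)$$ of the $1,k$-cross-covariance density between one squared eigenradius and $k$ squared singular values is given, for all fixed $(r,a_1,\ldots,a_k)\in\mathbb{R}\times\mathbb{R}_+^k$, by $$\mathrm{cov}_{1,k\,{\rm SH}}^{(\infty)}(r;a_1,\ldots,a_k)=\frac4{\sqrt\pi}e^{-4r^2}\,\partial_\mu\det\left[\int_0^1dt\,J_\beta(2\sqrt{a_bt})J_\beta(2\sqrt{a_ct})+\mu J_\beta(2\sqrt{a_b})J_\beta(2\sqrt{a_c})\right]_{b,c=1}^k\Bigg|_{\mu=0}$$ $$=-\frac{4^k}{\sqrt\pi}e^{-4r^2}\det\begin{pmatrix} 0 & J_\beta(2\sqrt{a_c}) \\ J_\beta(2\sqrt{a_b}) & K_\beta^{\mathrm{Bes}}(4a_b,4a_c) \end{pmatrix}_{b,c=1}^k.$$ In particular, in the case $k=1$, the limiting cross-covariance reads $$\mathrm{cov}^{(\infty)}_{\rm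 SH}(r;a)=\frac4{\sqrt\pi}e^{-4r^2}J_\beta(2\sqrt a)^2.$$
   Context: **Notation.** $\mathbb{R}_+=[0,\infty)$, $\Theta$ is the Heaviside step function, $J_\beta$ is the Bessel function of the first kind of order $\beta$, and $K_\beta^{\mathrm{Bes}}(x,y)=\frac14\int_0^1dt\,J_\beta(\sqrt{xt})J_\beta(\sqrt{yt})$ is the Bessel kernel. The last determinant for general $k$ is of a $(k+1)\times(k+1)$ matrix, with one first row, one first column and a $k\times k$ block indexed by $b,c$. **Ensemble.** The Jacobi ensemble has density on $\mathrm{GL}(n,\mathbb{C})$ proportional to $\det(X^\dagger X)^\alpha\det(\mathbf 1_n-X^\dagger X)^\beta\,\Theta(\mathbf 1_n-X^\dagger X)$ ($\Theta$ of a matrix is $1$ if it is positive definite, $0$ otherwise). Squared eigenradii of $X$ are $r_j(X)=|z_j|^2$, $z_j$ the eigenvalues; squared singular values $a_1(X),\dots,a_n(X)$ are the eigenvalues of $X^\dagger X$. The squared singular values form a determinantal point process with joint density $\frac1{n!}\det[K_n(x_j,x_k)]_{j,k=1}^n$ on $[0,1]^n$, where $K_n$ is chosen to be a polynomial of degree $n-1$ in its second argument: $$K_n(x,y)=a_nx^\alpha(1-x)^\beta\,\frac{P_n^{(\alpha,\beta)}(1-2x)P_{n-1}^{(\alpha,\beta)}(1-2y)-P_{n-1}^{(\alpha,\beta)}(1-2x)P_n^{(\alpha,\beta)}(1-2y)}{x-y},$$ $$a_n=-\frac{\Gamma(n+1)\Gamma(n+\alpha+\beta+1)}{(\alpha+\beta+2n)\Gamma(n+\alpha)\Gamma(n+\beta)},$$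 with $P_n^{(\alpha,\beta)}$ the usual Jacobi polynomials on $[-1,1]$ (and $a_n$ here the displayed coefficient). **Correlation functions.** The $1,k$-point function $f_{1,k}$ ($n>2$, $n\ge k$) is the probability density on $\mathbb{R}_+^{1+k}$ defined weakly by $$\mathbb{E}\Big[\frac1n\sum_{j=1}^n\frac1{n!}\sum_{\pi\in S_n}\phi(r_j(X);a_{\pi(1)}(X),\dots,a_{\pi(k)}(X))\Big]=\int_{\mathbb{R}_+^{1+k}}\phi(r;a_1,\dots,a_k)f_{1,k}(r;a_1,\dots,a_k)\,dr\,da_1\cdots da_k$$ for all bounded continuous $\phi$; $f_{1,0}$ and $f_{0,k}$ are its marginals on the squared eigenradius and on the $k$ squared singular values, and $$\mathrm{cov}_{1,k}(r;a_1,\dots,a_k):=f_{1,k}(r;a_1,\dots,a_k)-f_{1,0}(r)f_{0,k}(a_1,\dots,a_k).$$ It is known that, as pointwise-defined densities, $$f_{1,k}(r;a_1,\dots,a_k)=\frac{(n-k)!}{(n-1)!}\int_0^\infty dt\int_0^r\frac{dv}{v}\varphi_n\left(\tfrac vr,t\right)\det\begin{pmatrix} K_n(v,-rt) & K_n(v,a_c)-\delta(v-a_c) \\ K_n(a_b,-rt) & K_n(a_b,a_c) \end{pmatrix}_{b,c=1}^k,$$ $$\varphi_n(x,t)=x(1-x)^{n-2}(1+t)^{-(n+2)}\left[\left(1-\tfrac xn\right)(1+t)-(1-x)\left(1+\tfrac1n\right)\right],$$ $f_{1,0}(r)=n\int_0^\infty dt\int_0^r\frac{dv}{v}\varphi_n(\frac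 vr,t)K_n(v,-rt)$ and $f_{0,k}(a_1,\dots,a_k)=\frac{(n-k)!}{n!}\det[K_n(a_b,a_c)]_{b,c=1}^k$; here $\delta$ is the Dirac delta (acting on the $v$-integral), and pointwise values are understood through these formulas. *)

theory Defs
  imports
    "HOL-Analysis.Analysis"
    "Jordan_Normal_Form.Schur_Decomposition"
begin

text \<open>Tuples \<open>(a\<^sub>1, \<dots>, a\<^sub>k)\<close> are functions on \<open>nat\<close> of which only the values at
  \<open>0, \<dots>, k - 1\<close> matter; an integral over such tuples is taken with respect to a product measure
  indexed by \<open>{..<k}\<close>. Determinants are those of \<open>Jordan_Normal_Form\<close>, whose matrices have
  their size as a value and not as a type, because the matrix size \<open>n\<close> tends to infinity.\<close>

subsection \<open>Bessel functions and Jacobi polynomials\<close>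

text \<open>Bessel function of the first kind, used for \<open>x \<ge> 0\<close> and \<open>\<beta> > 0\<close> only.\<close>

definition bessel_J :: "real \<Rightarrow> real \<Rightarrow> real" where
  "bessel_J \<beta> x =
     (x / 2) powr \<beta> * (\<Sum>m. (-1) ^ m / (fact m * Gamma (real m + \<beta> + 1)) * (x / 2) ^ (2 * m))"

definition bessel_kernel :: "real \<Rightarrow> real \<Rightarrow> real \<Rightarrow> real" where
  "bessel_kernel \<beta> x y = 1 / 4 * (LBINT t:{0..1}. bessel_J \<beta> (sqrt (x * t)) * bessel_J \<beta> (sqrt (y * t)))"

definition jacobi_P :: "nat \<Rightarrow> real \<Rightarrow> real \<Rightarrow> real \<Rightarrow> real" where
  "jacobi_P n \<alpha> \<beta> x =
     (\<Sum>s\<le>n. ((real n + \<alpha>) gchoose (n - s)) * ((real n + \<beta>) gchoose s)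
             * ((x - 1) / 2) ^ s * ((x + 1) / 2) ^ (n - s))"

subsection \<open>The Jacobi ensemble\<close>

definition positive_definite :: "complex mat \<Rightarrow> bool" where
  "positive_definite M \<longleftrightarrow> mat_adjoint M = M \<and>
     (\<forall>v \<in> carrier_vec (dim_row M). v \<noteq> 0\<^sub>v (dim_row M) \<longrightarrow> 0 < Re ((M *\<^sub>v v) \<bullet>c v))"

text \<open>A complex \<open>n \<times> n\<close> matrix is given by its entries, a function on
  \<open>{..<n} \<times> {..<n}\<close>, so that \<open>\<complex>\<^bsup>n\<times>n\<^esup>\<close> carries the (flat) Lebesgue measure below.\<close>

definition matrix_lborel :: "nat \<Rightarrow> (nat \<times> nat \<Rightarrow> complex) measure" where
  "matrix_lborel n = (\<Pi>\<^sub>M ij \<in> {..<n} \<times> {..<n}. lborel)"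

definition jacobi_weight :: "nat \<Rightarrow> real \<Rightarrow> real \<Rightarrow> (nat \<times> nat \<Rightarrow> complex) \<Rightarrow> real" where
  "jacobi_weight n \<alpha> \<beta> x =
     (let X = mat n n x; G = mat_adjoint X * X in
      if Determinant.det X \<noteq> 0 \<and> positive_definite (1\<^sub>m n - G)
      then Re (Determinant.det G) powr \<alpha> * Re (Determinant.det (1\<^sub>m n - G)) powr \<beta> else 0)"

definition jacobi_ensemble :: "nat \<Rightarrow> real \<Rightarrow> real \<Rightarrow> (nat \<times> nat \<Rightarrow> complex) measure" where
  "jacobi_ensemble n \<alpha> \<beta> =
     density (matrix_lborel n)
       (\<lambda>x. ennreal (jacobi_weight n \<alpha> \<beta> x / (\<integral>y. jacobi_weight n \<alpha> \<beta> y \<partial>matrix_lborel n)))"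

text \<open>Eigenvalues are listed with algebraic multiplicity, in an unspecified order: they are only
  used in expressions that are symmetric under permutations.\<close>

definition eigenvalue_list :: "complex mat \<Rightarrow> complex list" where
  "eigenvalue_list X = (SOME zs. mset zs = proots (char_poly X))"

definition squared_eigenradii :: "complex mat \<Rightarrow> real list" where
  "squared_eigenradii X = map (\<lambda>z. (cmod z)\<^sup>2) (eigenvalue_list X)"

definition squared_singular_values :: "complex mat \<Rightarrow> real list" where
  "squared_singular_values X = map Re (eigenvalue_list (mat_adjoint X * X))"

subsection \<open>Correlation functions, as defined weakly\<close>

abbreviation tuple_lborel :: "nat \<Rightarrow> (nat \<Rightarrow> real) measure" where
  "tuple_lborel k \<equiv> (\<Pi>\<^sub>M i \<in> {..<k}. lborel)"

abbreviation nonneg_tuples :: "nat \<Rightarrow> (nat \<Rightarrow> real) set" where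
  "nonneg_tuples k \<equiv> (\<Pi>\<^sub>E i \<in> {..<k}. {0..})"

text \<open>The test functions are continuous for the product topology on \<open>nat \<Rightarrow> real\<close>; restricted
  to \<open>[0, \<infinity>)\<close> and \<open>nonneg_tuples k\<close> they are exactly the bounded continuous
  functions of \<open>1 + k\<close> nonnegative variables.\<close>

definition is_point_function ::
  "nat \<Rightarrow> nat \<Rightarrow> real \<Rightarrow> real \<Rightarrow> (real \<Rightarrow> (nat \<Rightarrow> real) \<Rightarrow> real) \<Rightarrow> bool" where
  "is_point_function k n \<alpha> \<beta> f \<longleftrightarrow>
     set_integrable (lborel \<Otimes>\<^sub>M tuple_lborel k) ({0..} \<times> nonneg_tuples k) (\<lambda>(r, a). f r a) \<and>
     (AE (r, a) in lborel \<Otimes>\<^sub>M tuple_lborel k. (r, a) \<in> {0..} \<times> nonneg_tuples k \<longrightarrow> 0 \<le> f r a) \<and>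
     (\<forall>\<phi> :: real \<times> (nat \<Rightarrow> real) \<Rightarrow> real. continuous_on UNIV \<phi> \<longrightarrow> bounded (range \<phi>) \<longrightarrow>
        (\<integral>x. (let X = mat n n x in
              1 / real n * (\<Sum>j<n. 1 / fact n * (\<Sum>\<pi> | \<pi> permutes {..<n}.
                \<phi> (squared_eigenradii X ! j, \<lambda>i\<in>{..<k}. squared_singular_values X ! \<pi> i))))
            \<partial>jacobi_ensemble n \<alpha> \<beta>)
        = (LINT (r, a) : {0..} \<times> nonneg_tuples k | (lborel \<Otimes>\<^sub>M tuple_lborel k). \<phi> (r, a) * f r a))"

definition is_eigenradius_marginal ::
  "nat \<Rightarrow> (real \<Rightarrow> (nat \<Rightarrow> real) \<Rightarrow> real) \<Rightarrow> (real \<Rightarrow> real) \<Rightarrow> bool" where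
  "is_eigenradius_marginal k f g \<longleftrightarrow>
     (AE r in lborel. 0 \<le> r \<longrightarrow> g r = (LINT a : nonneg_tuples k | tuple_lborel k. f r a))"

definition is_singular_value_marginal ::
  "nat \<Rightarrow> (real \<Rightarrow> (nat \<Rightarrow> real) \<Rightarrow> real) \<Rightarrow> ((nat \<Rightarrow> real) \<Rightarrow> real) \<Rightarrow> bool" where
  "is_singular_value_marginal k f h \<longleftrightarrow>
     (AE a in tuple_lborel k. a \<in> nonneg_tuples k \<longrightarrow> h a = (LBINT r:{0..}. f r a))"

definition cross_covariance ::
  "(real \<Rightarrow> (nat \<Rightarrow> real) \<Rightarrow> real) \<Rightarrow> (real \<Rightarrow> real) \<Rightarrow> ((nat \<Rightarrow> real) \<Rightarrow> real)
    \<Rightarrow> real \<Rightarrow> (nat \<Rightarrow> real) \<Rightarrow> real" where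
  "cross_covariance f g h r a = f r a - g r * h a"

subsection \<open>Explicit pointwise versions of the correlation functions\<close>

definition jacobi_coeff :: "nat \<Rightarrow> real \<Rightarrow> real \<Rightarrow> real" where
  "jacobi_coeff n \<alpha> \<beta> =
     - (Gamma (real n + 1) * Gamma (real n + \<alpha> + \<beta> + 1)) /
       ((\<alpha> + \<beta> + 2 * real n) * Gamma (real n + \<alpha>) * Gamma (real n + \<beta>))"

definition jacobi_quotient :: "nat \<Rightarrow> real \<Rightarrow> real \<Rightarrow> real \<Rightarrow> real \<Rightarrow> real" where
  "jacobi_quotient n \<alpha> \<beta> x y =
     (jacobi_P n \<alpha> \<beta> (1 - 2 * x) * jacobi_P (n - 1) \<alpha> \<beta> (1 - 2 * y)
      - jacobi_P (n - 1) \<alpha> \<beta> (1 - 2 * x) * jacobi_P n \<alpha> \<beta> (1 - 2 * y)) / (x - y)"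

text \<open>The weight in the first argument is supported on \<open>[0, 1]\<close>. The kernel is a polynomial in its
  second argument, so on the diagonal, where the quotient degenerates to \<open>0 / 0\<close>, it takes the
  limiting value.\<close>

definition jacobi_K :: "nat \<Rightarrow> real \<Rightarrow> real \<Rightarrow> real \<Rightarrow> real \<Rightarrow> real" where
  "jacobi_K n \<alpha> \<beta> x y =
     (if 0 \<le> x \<and> x \<le> 1 then
        jacobi_coeff n \<alpha> \<beta> * x powr \<alpha> * (1 - x) powr \<beta> *
        (if x = y then Lim (at x) (jacobi_quotient n \<alpha> \<beta> x) else jacobi_quotient n \<alpha> \<beta> x y)
      else 0)"

definition phi_n :: "nat \<Rightarrow> real \<Rightarrow> real \<Rightarrow> real" where
  "phi_n n x t =
     x * (1 - x) ^ (n - 2) / (1 + t) ^ (n + 2) *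
     ((1 - x / real n) * (1 + t) - (1 - x) * (1 + 1 / real n))"

definition bordered_mat ::
  "nat \<Rightarrow> real \<Rightarrow> (nat \<Rightarrow> real) \<Rightarrow> (nat \<Rightarrow> real) \<Rightarrow> (nat \<Rightarrow> nat \<Rightarrow> real) \<Rightarrow> real mat" where
  "bordered_mat k p u w B = mat (k + 1) (k + 1)
     (\<lambda>(i, j). if i = 0 then (if j = 0 then p else u (j - 1))
               else (if j = 0 then w (i - 1) else B (i - 1) (j - 1)))"

text \<open>The Dirac deltas occur only in the first row of the determinant, which is linear in that row.
  So the first row splits into the delta-free row and, for each \<open>c\<close>, minus \<open>\<delta>(v - a\<^sub>c)\<close> times
  the unit row with its \<open>1\<close> in the column of \<open>a\<^sub>c\<close>; integrating the latter over \<open>0 < v < r\<close>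
  sets \<open>v = a\<^sub>c\<close> if \<open>0 < a\<^sub>c < r\<close> and gives zero otherwise. (The end point \<open>a\<^sub>c = r\<close> is
  immaterial, since \<open>phi_n n 1 t = 0\<close> for \<open>n > 2\<close>.)\<close>

definition point_function_formula ::
  "nat \<Rightarrow> nat \<Rightarrow> real \<Rightarrow> real \<Rightarrow> real \<Rightarrow> (nat \<Rightarrow> real) \<Rightarrow> real" where
  "point_function_formula k n \<alpha> \<beta> r a =
     (let K = jacobi_K n \<alpha> \<beta>;
          D = (\<lambda>t p u. Determinant.det
                 (bordered_mat k p u (\<lambda>b. K (a b) (- r * t)) (\<lambda>b c. K (a b) (a c))))
      in fact (n - k) / fact (n - 1) *
         (LBINT t:{0..}.
            (LBINT v:{0<..<r}. 1 / v * phi_n n (v / r) t * D t (K v (- r * t)) (\<lambda>c. K v (a c)))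
            - (\<Sum>c | c < k \<and> 0 < a c \<and> a c < r.
                1 / a c * phi_n n (a c / r) t * D t 0 (\<lambda>c'. if c' = c then 1 else 0))))"

definition eigenradius_formula :: "nat \<Rightarrow> real \<Rightarrow> real \<Rightarrow> real \<Rightarrow> real" where
  "eigenradius_formula n \<alpha> \<beta> r =
     real n * (LBINT t:{0..}. (LBINT v:{0<..<r}. 1 / v * phi_n n (v / r) t * jacobi_K n \<alpha> \<beta> v (- r * t)))"

definition singular_value_formula ::
  "nat \<Rightarrow> nat \<Rightarrow> real \<Rightarrow> real \<Rightarrow> (nat \<Rightarrow> real) \<Rightarrow> real" where
  "singular_value_formula k n \<alpha> \<beta> a =
     fact (n - k) / fact n * Determinant.det (mat k k (\<lambda>(b, c). jacobi_K n \<alpha> \<beta> (a b) (a c)))"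

end

theory Submission
  imports Defs "HOL-Library.Landau_Symbols"
begin

text \<open>
Write \<open>\<rho> = 1/2 - r/sqrt n\<close>, \<open>x\<^sub>i = 1 - a\<^sub>i/n\<^sup>2\<close>, and \<open>K\<close> for the kernel \<open>jacobi_K n \<alpha> \<beta>\<close>. For large \<open>n\<close> every
\<open>x\<^sub>i\<close> lies to the right of \<open>\<rho>\<close>, so the Dirac terms drop out. Expand the bordered determinant along its
first row and its first column. The corner entry gives \<open>det [K(x\<^sub>b, x\<^sub>c)]\<close> times the eigenradius density,
and this is exactly what the covariance subtracts. What is left is a finite sum: each cofactor of
the block \<open>[K(x\<^sub>b, x\<^sub>c)]\<close> is multiplied by the double integral of \<open>\<phi>\<^sub>n(v/\<rho>, t)/v K(v, x\<^sub>c) K(x\<^sub>b, -\<rho>t)\<close>. Since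
\<open>\<phi>\<^sub>n(v/\<rho>, t)/v\<close> is a difference of two products of a function of \<open>v\<close> and a function of \<open>t\<close>, that integral is
\<open>A(x\<^sub>c) B\<^sub>n\<^sub>+\<^sub>1(x\<^sub>b) - A'(x\<^sub>c) B\<^sub>n\<^sub>+\<^sub>2(x\<^sub>b)\<close>, where \<open>A\<close>, \<open>A'\<close> are averages of \<open>K(v, x\<^sub>c)\<close> over \<open>0 < v < \<rho>\<close> and
\<open>B\<^sub>N(x) = \<integral> K(x, -\<rho>t) (1+t)\<^sup>-\<^sup>N dt\<close> (lemma \<open>cross_covariance_cofactors\<close>).

Both averages are computed up to a relative error \<open>O(1/n)\<close> by rewriting the Christoffel-Darboux
numerator. In the \<open>v\<close> average, \<open>P\<^sub>n\<^sub>-\<^sub>1\<close> is traded for the polynomial of degree \<open>n\<close> with \<open>\<beta>\<close> lowered by one.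
The kernel then is an \<open>n\<close>-th derivative (Rodrigues) plus terms with the factor \<open>1/(y - v)\<close>. Repeated
integration by parts against \<open>(1 - v/\<rho>)\<^sup>e\<close>, \<open>e\<close> equal to \<open>n - 1\<close> or \<open>n - 2\<close>, leaves only boundary values at \<open>\<rho>\<close> and
makes the latter terms small (\<open>v_average_approx\<close>). In the \<open>t\<close> average, \<open>P\<^sub>n\<^sub>-\<^sub>1\<close> is traded for the polynomial
with \<open>\<beta>\<close> raised by one. Its monomials integrate to beta integrals, and the result is a negative binomial
series cut off after \<open>n\<close> terms (\<open>t_average_approx\<close>, \<open>p_moment_eq\<close>).

The two products of main terms are of order one, but in their difference the leading order cancels.
The ratio of consecutive coefficients of the negative binomial series gives a linear recurrence
(\<open>nb_recurrence\<close>), and after its use only the cut-off term survives. It is \<open>(4\<rho>(1-\<rho>))\<^sup>n\<close> times a quotient of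
Gamma functions of central binomial type; at \<open>\<rho> = 1/2 - r/sqrt n\<close> this produces the Gaussian \<open>exp(-4r\<^sup>2)\<close>, the
factor \<open>4/sqrt \<pi>\<close> and the decay \<open>1/sqrt n\<close> (\<open>main_factor_tendsto\<close>, \<open>paired_averages_tendsto\<close>).

At the hard edge the Mehler-Heine asymptotics turn Jacobi polynomials into Bessel functions, and
\<open>K(x\<^sub>b, x\<^sub>c)/n\<^sup>2\<close> into the Bessel kernel (\<open>edge_P_tendsto\<close>, \<open>jacobi_K_edge_tendsto\<close>). So the sum of cofactors tends
to the Laplace expansion of the bordered Bessel determinant (\<open>scaled_covariance_tendsto\<close>). By the formula
for rank one updates this determinant is minus the derivative in \<open>\<mu>\<close> that defines the limit.
\<close>

section \<open>Jacobi polynomials: contiguous relations and expansions\<close>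

text \<open>With \<open>Y - X = 1\<close> this raises the degree of a homogeneous form without changing its value. It
makes polynomials of degree \<open>n - 1\<close> and \<open>n\<close> comparable coefficient by coefficient.\<close>

lemma homogeneous_shift:
  fixes X Y :: real
  shows "(Y - X) * (\<Sum>s\<le>m. g s * X ^ s * Y ^ (m - s)) =
    (\<Sum>s\<le>Suc m. ((if s \<le> m then g s else 0) - (if s = 0 then 0 else g (s - 1))) * X ^ s * Y ^ (Suc m - s))"
proof -
  have "Y * (\<Sum>s\<le>m. g s * X ^ s * Y ^ (m - s)) = (\<Sum>s\<le>m. g s * X ^ s * Y ^ (Suc m - s))"
    by (simp add: sum_distrib_left Suc_diff_le mult_ac)
  also have "\<dots> = (\<Sum>s\<le>Suc m. (if s \<le> m then g s else 0) * X ^ s * Y ^ (Suc m - s))"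
    by simp
  finally have 1: "Y * (\<Sum>s\<le>m. g s * X ^ s * Y ^ (m - s)) = \<dots>" .
  have "X * (\<Sum>s\<le>m. g s * X ^ s * Y ^ (m - s)) = (\<Sum>s\<le>m. g s * X ^ Suc s * Y ^ (m - s))"
    by (simp add: sum_distrib_left mult_ac)
  also have "\<dots> = (\<Sum>s\<le>Suc m. (if s = 0 then 0 else g (s - 1)) * X ^ s * Y ^ (Suc m - s))"
    by (subst sum.atMost_Suc_shift) simp
  finally have 2: "X * (\<Sum>s\<le>m. g s * X ^ s * Y ^ (m - s)) = \<dots>" .
  show ?thesis
    unfolding left_diff_distrib 1 2 sum_subtractf[symmetric] by simp
qed

lemma jacobi_P_eq_sum:
  "jacobi_P n \<alpha> \<beta> (1 - 2 * y) =
     (\<Sum>s\<le>n. ((real n + \<alpha>) gchoose (n - s)) * ((real n + \<beta>) gchoose s) * (- y) ^ s * (1 - y) ^ (n - s))"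
proof -
  have "(1 - 2 * y - 1) / 2 = - y" "(1 - 2 * y + 1) / 2 = 1 - y" by (simp_all add: field_simps)
  then show ?thesis unfolding jacobi_P_def by (simp only:)
qed

text \<open>In the homogeneous basis \<open>(-y)\<^sup>s (1-y)\<^sup>n\<^sup>-\<^sup>s\<close> the relation holds for each coefficient separately, by
Pascal's rule and the absorption identities for binomial coefficients. It is used to eliminate
\<open>P\<^sub>n\<^sub>-\<^sub>1\<close> from the Christoffel-Darboux numerator.\<close>

lemma jacobi_P_lower_beta:
  assumes "n \<ge> 1"
  shows "(2 * real n + \<alpha> + \<beta>) * jacobi_P n \<alpha> (\<beta> - 1) (1 - 2 * y) =
    (real n + \<alpha> + \<beta>) * jacobi_P n \<alpha> \<beta> (1 - 2 * y) + (real n + \<alpha>) * jacobi_P (n - 1) \<alpha> \<beta> (1 - 2 * y)"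
proof -
  obtain m where n: "n = Suc m" using assms by (cases n) auto
  define X where "X = - y"
  define Y where "Y = 1 - y"
  have YX: "Y - X = 1" by (simp add: X_def Y_def)
  define g where "g s = ((real m + \<alpha>) gchoose (m - s)) * ((real m + \<beta>) gchoose s)" for s
  have P1: "jacobi_P m \<alpha> \<beta> (1 - 2 * y) = (\<Sum>s\<le>Suc m. ((if s \<le> m then g s else 0) - (if s = 0 then 0 else g (s - 1))) * X ^ s * Y ^ (Suc m - s))"
    using homogeneous_shift[of Y X g m] unfolding YX
    by (simp add: jacobi_P_eq_sum g_def X_def Y_def)
  have c: "(2 * real n + \<alpha> + \<beta>) * (((real n + \<alpha>) gchoose (n - s)) * ((real n + (\<beta> - 1)) gchoose s)) =
     (real n + \<alpha> + \<beta>) * (((real n + \<alpha>) gchoose (n - s)) * ((real n + \<beta>) gchoose s)) +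
     (real n + \<alpha>) * ((if s \<le> m then g s else 0) - (if s = 0 then 0 else g (s - 1)))" if s: "s \<le> n" for s
  proof -
    define A where "A = real n + \<alpha>"
    define B where "B = real n + \<beta>"
    define C where "C = A gchoose (n - s)"
    define e where "e = (B - 1) gchoose s"
    define f where "f = (if s = 0 then 0 else (B - 1) gchoose (s - 1))"
    have mA: "real m + \<alpha> = A - 1" "real m + \<beta> = B - 1" "real n + (\<beta> - 1) = B - 1" by (auto simp: n A_def B_def)
    have B1: "B gchoose s = e + f"
    proof (cases s)
      case (Suc t)
      then show ?thesis using gbinomial_Suc_Suc[of "B - 1" t] by (simp add: e_def f_def)
    qed (simp add: e_def f_def)
    have ef: "real s * e = (B - real s) * f"
    proof (cases s)
      case (Suc t)
      have "of_nat (Suc t) * ((B-1) gchoose Suc t) = (B - 1 - of_nat t) * ((B - 1) gchoose t)"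
        using gbinomial_mult_1[of "B-1" t] by (simp add: algebra_simps)
      then show ?thesis using Suc by (simp add: e_def f_def algebra_simps)
    qed (simp add: f_def)
    have g1: "A * (if s \<le> m then g s else 0) = (real n - real s) * C * e"
    proof (cases "s \<le> m")
      case True
      then have "n - s = Suc (m - s)" using n by auto
      then have "A * ((A - 1) gchoose (m - s)) = (real n - real s) * C"
        using gbinomial_absorption[of "m - s" A] True n unfolding C_def by (simp add: of_nat_diff algebra_simps)
      then show ?thesis using True by (simp add: g_def mA e_def)
    next
      case False
      then have "s = n" using s n by auto
      then show ?thesis using False by simp
    qed
    have g2: "A * (if s = 0 then 0 else g (s - 1)) = (\<alpha> + real s) * C * f"
    proof (cases s)
      case (Suc t)
      then have ms: "m - t = n - s" using n by auto
      have "A * ((A - 1) gchoose (n - s)) = (A - real (n - s)) * C"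
        unfolding C_def using gbinomial_absorb_comp[of A "n - s"] by simp
      also have "A - real (n - s) = \<alpha> + real s" using s by (simp add: A_def of_nat_diff)
      finally show ?thesis using Suc ms by (simp add: g_def mA f_def)
    qed (simp add: f_def)
    have "(2 * real n + \<alpha> + \<beta>) * (C * e) = (real n + \<alpha> + \<beta>) * (C * (e + f)) + ((real n - real s) * C * e - (\<alpha> + real s) * C * f)"
      using arg_cong[OF ef, of "\<lambda>z. C * z"] by (simp add: B_def algebra_simps)
    then show ?thesis
      unfolding mA A_def[symmetric] B_def[symmetric] C_def[symmetric] e_def[symmetric] B1
      using g1 g2 by (simp add: right_diff_distrib)
  qed
  have "(2 * real n + \<alpha> + \<beta>) * jacobi_P n \<alpha> (\<beta> - 1) (1 - 2 * y) =
     (\<Sum>s\<le>n. (2 * real n + \<alpha> + \<beta>) * (((real n + \<alpha>) gchoose (n - s)) * ((real n + (\<beta> - 1)) gchoose s)) * X ^ s * Y ^ (n - s))"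
    unfolding jacobi_P_eq_sum sum_distrib_left X_def Y_def by (simp only: mult.assoc)
  also have "\<dots> = (\<Sum>s\<le>n. ((real n + \<alpha> + \<beta>) * (((real n + \<alpha>) gchoose (n - s)) * ((real n + \<beta>) gchoose s)) +
     (real n + \<alpha>) * ((if s \<le> m then g s else 0) - (if s = 0 then 0 else g (s - 1)))) * X ^ s * Y ^ (n - s))"
    by (intro sum.cong refl) (subst c, auto)
  also have "\<dots> = (real n + \<alpha> + \<beta>) * jacobi_P n \<alpha> \<beta> (1 - 2 * y) + (real n + \<alpha>) * jacobi_P m \<alpha> \<beta> (1 - 2 * y)"
    unfolding P1 unfolding jacobi_P_eq_sum X_def[symmetric] Y_def[symmetric] n[symmetric] sum_distrib_left
    by (simp only: sum.distrib[symmetric] distrib_right mult.assoc)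
  finally show ?thesis by (simp add: n)
qed

text \<open>The counterpart of \<open>jacobi_P_lower_beta\<close>, proved in the same way; here Pascal's rule is applied to the
binomial coefficient that contains \<open>\<alpha>\<close>.\<close>

lemma jacobi_P_raise_beta:
  assumes "n \<ge> 1"
  shows "(2 * real n + \<alpha> + \<beta>) * ((1 - y) * jacobi_P (n - 1) \<alpha> (\<beta> + 1) (1 - 2 * y)) =
    real n * jacobi_P n \<alpha> \<beta> (1 - 2 * y) + (real n + \<beta>) * jacobi_P (n - 1) \<alpha> \<beta> (1 - 2 * y)"
proof -
  obtain m where n: "n = Suc m" using assms by (cases n) auto
  define X where "X = - y"
  define Y where "Y = 1 - y"
  have YX: "Y - X = 1" by (simp add: X_def Y_def)
  define g where "g s = ((real m + \<alpha>) gchoose (m - s)) * ((real m + \<beta>) gchoose s)" for s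
  define c' where "c' s = (if s \<le> m then (real m + \<alpha>) gchoose (m - s) else 0)" for s
  have P1: "jacobi_P m \<alpha> \<beta> (1 - 2 * y) = (\<Sum>s\<le>Suc m. ((if s \<le> m then g s else 0) - (if s = 0 then 0 else g (s - 1))) * X ^ s * Y ^ (Suc m - s))"
    using homogeneous_shift[of Y X g m] unfolding YX
    by (simp add: jacobi_P_eq_sum g_def X_def Y_def)
  have c: "(2 * real n + \<alpha> + \<beta>) * (c' s * ((real n + \<beta>) gchoose s)) =
     real n * (((real n + \<alpha>) gchoose (n - s)) * ((real n + \<beta>) gchoose s)) +
     (real n + \<beta>) * ((if s \<le> m then g s else 0) - (if s = 0 then 0 else g (s - 1)))" if s: "s \<le> n" for s
  proof -
    define A where "A = real n + \<alpha>"
    define B where "B = real n + \<beta>"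
    define C where "C = B gchoose s"
    define d where "d = (A - 1) gchoose (n - s)"
    have mA: "real m + \<alpha> = A - 1" "real m + \<beta> = B - 1" by (auto simp: n A_def B_def)
    have A1: "A gchoose (n - s) = c' s + d"
    proof (cases "s \<le> m")
      case True
      then have "n - s = Suc (m - s)" using n by auto
      then show ?thesis using True gbinomial_Suc_Suc[of "A - 1" "m - s"] by (simp add: c'_def d_def mA)
    next
      case False
      then have "s = n" using s n by auto
      then show ?thesis using False by (simp add: c'_def d_def)
    qed
    have cd: "(real n - real s) * d = (\<alpha> + real s) * c' s"
    proof (cases "s \<le> m")
      case True
      then have ms: "n - s = Suc (m - s)" using n by auto
      have "of_nat (Suc (m - s)) * ((A-1) gchoose Suc (m - s)) = (A - 1 - of_nat (m - s)) * ((A - 1) gchoose (m - s))"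
        using gbinomial_mult_1[of "A-1" "m - s"] by (simp add: algebra_simps)
      then show ?thesis using True ms by (simp add: c'_def d_def mA A_def n of_nat_diff algebra_simps)
    next
      case False
      then have "s = n" using s n by auto
      then show ?thesis using False by (simp add: c'_def)
    qed
    have g1: "B * (if s \<le> m then g s else 0) = (B - real s) * C * c' s"
      using gbinomial_absorb_comp[of B s] by (simp add: g_def c'_def mA C_def)
    have g2: "B * (if s = 0 then 0 else g (s - 1)) = real s * C * d"
    proof (cases s)
      case (Suc t)
      then have ms: "m - t = n - s" using n by auto
      have "B * ((B - 1) gchoose t) = real s * C"
        using gbinomial_absorption[of t B] Suc unfolding C_def by simp
      then show ?thesis using Suc ms by (simp add: g_def mA d_def)
    qed simp
    have "(2 * real n + \<alpha> + \<beta>) * (c' s * C) = real n * ((c' s + d) * C) + ((B - real s) * C * c' s - real s * C * d)"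
      using arg_cong[OF cd, of "\<lambda>z. C * z"] by (simp add: B_def algebra_simps)
    then show ?thesis
      unfolding A_def[symmetric] B_def[symmetric] C_def[symmetric] A1
      using g1 g2 by (simp add: right_diff_distrib)
  qed
  have nB: "real m + (\<beta> + 1) = real n + \<beta>" by (simp add: n)
  have "(1 - y) * jacobi_P m \<alpha> (\<beta> + 1) (1 - 2 * y) = (\<Sum>s\<le>m. c' s * ((real n + \<beta>) gchoose s) * X ^ s * Y ^ (n - s))"
    unfolding jacobi_P_eq_sum X_def[symmetric] Y_def[symmetric] sum_distrib_left nB
    by (intro sum.cong refl) (simp add: c'_def n Suc_diff_le)
  also have "\<dots> = (\<Sum>s\<le>n. c' s * ((real n + \<beta>) gchoose s) * X ^ s * Y ^ (n - s))"
    unfolding n by (simp add: c'_def)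
  finally have "(2 * real n + \<alpha> + \<beta>) * ((1 - y) * jacobi_P m \<alpha> (\<beta> + 1) (1 - 2 * y)) =
     (\<Sum>s\<le>n. (2 * real n + \<alpha> + \<beta>) * (c' s * ((real n + \<beta>) gchoose s)) * X ^ s * Y ^ (n - s))"
    by (simp add: sum_distrib_left mult_ac)
  also have "\<dots> = (\<Sum>s\<le>n. (real n * (((real n + \<alpha>) gchoose (n - s)) * ((real n + \<beta>) gchoose s)) +
     (real n + \<beta>) * ((if s \<le> m then g s else 0) - (if s = 0 then 0 else g (s - 1)))) * X ^ s * Y ^ (n - s))"
    by (intro sum.cong refl) (subst c, auto)
  also have "\<dots> = real n * jacobi_P n \<alpha> \<beta> (1 - 2 * y) + (real n + \<beta>) * jacobi_P m \<alpha> \<beta> (1 - 2 * y)"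
    unfolding P1 unfolding jacobi_P_eq_sum X_def[symmetric] Y_def[symmetric] n[symmetric] sum_distrib_left
    by (simp only: sum.distrib[symmetric] distrib_right mult.assoc)
  finally show ?thesis by (simp add: n)
qed

text \<open>Expand \<open>(1-y)\<^sup>n\<^sup>-\<^sup>s\<close>, revise the trinomial product so that one factor depends on \<open>j\<close> only, and sum over \<open>s\<close> by
Vandermonde's identity.\<close>

lemma jacobi_P_expansion:
  "jacobi_P n \<alpha> \<beta> (1 - 2 * y) =
     (\<Sum>j\<le>n. ((real n + \<alpha>) gchoose (n - j)) * ((real (n + j) + \<alpha> + \<beta>) gchoose j) * (- y) ^ j)"
proof -
  have bin: "(1 - y) ^ (n - s) = (\<Sum>j\<in>{s..n}. of_nat ((n - s) choose (j - s)) * (- y) ^ (j - s))" if "s \<le> n" for s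
  proof -
    have "(1 - y) ^ (n - s) = (\<Sum>i\<le>n - s. of_nat ((n - s) choose i) * (- y) ^ i)"
      using binomial_ring[of "- y" 1 "n - s"] by simp
    also have "\<dots> = (\<Sum>j\<in>{s..n}. of_nat ((n - s) choose (j - s)) * (- y) ^ (j - s))"
      by (rule sum.reindex_bij_witness[of _ "\<lambda>j. j - s" "\<lambda>i. i + s"]) (use that in auto)
    finally show ?thesis .
  qed
  define A where "A = real n + \<alpha>"
  define B where "B = real n + \<beta>"
  have "jacobi_P n \<alpha> \<beta> (1 - 2 * y) =
     (\<Sum>s\<le>n. \<Sum>j\<in>{s..n}. (A gchoose (n - s)) * (B gchoose s) * (- y) ^ s * (of_nat ((n - s) choose (j - s)) * (- y) ^ (j - s)))"
    unfolding jacobi_P_eq_sum A_def B_def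
    by (intro sum.cong refl) (simp add: bin sum_distrib_left)
  also have "\<dots> = (\<Sum>s\<le>n. \<Sum>j\<in>{s..n}. (A gchoose (n - j)) * (B gchoose s) * ((\<alpha> + real j) gchoose (j - s)) * (- y) ^ j)"
  proof (intro sum.cong refl)
    fix s j assume s: "s \<in> {..n}" and j: "j \<in> {s..n}"
    have "(A gchoose (n - s)) * (of_nat (n - s) gchoose (n - j)) = (A gchoose (n - j)) * ((A - of_nat (n - j)) gchoose (n - s - (n - j)))"
      using s j by (intro gbinomial_trinomial_revision) auto
    moreover have "n - s - (n - j) = j - s" using j s by auto
    moreover have "A - of_nat (n - j) = \<alpha> + real j" using j by (simp add: A_def of_nat_diff)
    moreover have "(n - s) choose (n - j) = (n - s) choose (j - s)"
      using binomial_symmetric[of "n - j" "n - s"] s j \<open>n - s - (n - j) = j - s\<close> diff_le_mono2[of s j n] by simp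
    ultimately have t: "(A gchoose (n - s)) * of_nat ((n - s) choose (j - s)) = (A gchoose (n - j)) * ((\<alpha> + real j) gchoose (j - s))"
      by (simp add: binomial_gbinomial[symmetric])
    have p: "(- y) ^ s * (- y) ^ (j - s) = (- y) ^ j" using j by (simp add: power_add[symmetric])
    have "(A gchoose (n - s)) * (B gchoose s) * (- y) ^ s * (of_nat ((n - s) choose (j - s)) * (- y) ^ (j - s))
        = ((A gchoose (n - s)) * of_nat ((n - s) choose (j - s))) * (B gchoose s) * ((- y) ^ s * (- y) ^ (j - s))"
      by (simp only: mult_ac)
    then show "(A gchoose (n - s)) * (B gchoose s) * (- y) ^ s * (of_nat ((n - s) choose (j - s)) * (- y) ^ (j - s))
      = (A gchoose (n - j)) * (B gchoose s) * ((\<alpha> + real j) gchoose (j - s)) * (- y) ^ j"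
      unfolding t p by (simp only: mult_ac)
  qed
  also have "\<dots> = (\<Sum>j\<le>n. \<Sum>s\<le>j. (A gchoose (n - j)) * (B gchoose s) * ((\<alpha> + real j) gchoose (j - s)) * (- y) ^ j)"
    unfolding sum.Sigma[OF finite_atMost ballI[OF finite_atLeastAtMost]] sum.Sigma[OF finite_atMost ballI[OF finite_atMost]]
    by (rule sum.reindex_bij_witness[of _ "\<lambda>(a, b). (b, a)" "\<lambda>(a, b). (b, a)"]) auto
  also have "\<dots> = (\<Sum>j\<le>n. (A gchoose (n - j)) * ((real (n + j) + \<alpha> + \<beta>) gchoose j) * (- y) ^ j)"
  proof (intro sum.cong refl)
    fix j assume "j \<in> {..n}"
    have "(real (n + j) + \<alpha> + \<beta>) gchoose j = (B + (\<alpha> + real j)) gchoose j"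
      by (rule arg_cong[of _ _ "\<lambda>z. z gchoose j"]) (simp add: B_def)
    also have "\<dots> = (\<Sum>s\<le>j. (B gchoose s) * ((\<alpha> + real j) gchoose (j - s)))"
      using gbinomial_Vandermonde[of B "\<alpha> + real j" j] by (simp add: atLeast0AtMost)
    finally have V: "(real (n + j) + \<alpha> + \<beta>) gchoose j = (\<Sum>s\<le>j. (B gchoose s) * ((\<alpha> + real j) gchoose (j - s)))" .
    show "(\<Sum>s\<le>j. (A gchoose (n - j)) * (B gchoose s) * ((\<alpha> + real j) gchoose (j - s)) * (- y) ^ j) =
      (A gchoose (n - j)) * ((real (n + j) + \<alpha> + \<beta>) gchoose j) * (- y) ^ j"
      unfolding V by (simp only: sum_distrib_left sum_distrib_right mult.assoc)
  qed
  finally show ?thesis unfolding A_def .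
qed

lemma jacobi_P_reflect: "jacobi_P n \<alpha> \<beta> (- x) = (- 1) ^ n * jacobi_P n \<beta> \<alpha> x"
proof -
  have "jacobi_P n \<alpha> \<beta> (- x) = (\<Sum>s\<le>n. ((real n + \<alpha>) gchoose (n - s)) * ((real n + \<beta>) gchoose s)
             * ((- x - 1) / 2) ^ s * ((- x + 1) / 2) ^ (n - s))"
    by (simp add: jacobi_P_def)
  also have "\<dots> = (\<Sum>s\<le>n. ((real n + \<alpha>) gchoose s) * ((real n + \<beta>) gchoose (n - s))
             * ((- x - 1) / 2) ^ (n - s) * ((- x + 1) / 2) ^ s)"
    by (rule sum.reindex_bij_witness[of _ "\<lambda>s. n - s" "\<lambda>s. n - s"]) auto
  also have "\<dots> = (\<Sum>s\<le>n. (- 1) ^ n * (((real n + \<beta>) gchoose (n - s)) * ((real n + \<alpha>) gchoose s)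
             * ((x - 1) / 2) ^ s * ((x + 1) / 2) ^ (n - s)))"
  proof (intro sum.cong refl)
    fix s assume s: "s \<in> {..n}"
    have 1: "(- x - 1) / 2 = (- 1) * ((x + 1) / 2)" "(- x + 1) / 2 = (- 1) * ((x - 1) / 2)"
      by (simp_all add: field_simps)
    have 2: "(- 1 :: real) ^ (n - s) * (- 1) ^ s = (- 1) ^ n" using s by (simp add: power_add[symmetric])
    show "((real n + \<alpha>) gchoose s) * ((real n + \<beta>) gchoose (n - s)) * ((- x - 1) / 2) ^ (n - s) * ((- x + 1) / 2) ^ s =
      (- 1) ^ n * (((real n + \<beta>) gchoose (n - s)) * ((real n + \<alpha>) gchoose s) * ((x - 1) / 2) ^ s * ((x + 1) / 2) ^ (n - s))"
      unfolding 1 power_mult_distrib 2[symmetric] by (simp only: mult_ac)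
  qed
  finally show ?thesis by (simp add: jacobi_P_def sum_distrib_left)
qed

text \<open>Powers of the distance \<open>u\<close> to the hard edge: the expansion suited to \<open>u = a/n\<^sup>2\<close>.\<close>

lemma jacobi_P_expansion_at_1:
  "jacobi_P n \<alpha> \<beta> (1 - 2 * (1 - u)) =
     (- 1) ^ n * (\<Sum>j\<le>n. ((real n + \<beta>) gchoose (n - j)) * ((real (n + j) + \<alpha> + \<beta>) gchoose j) * (- u) ^ j)"
proof -
  have "1 - 2 * (1 - u) = - (1 - 2 * u)" by simp
  then show ?thesis
    by (simp only: jacobi_P_reflect jacobi_P_expansion add.commute add.left_commute)
qed

section \<open>Bordered determinants\<close>

lemma det_scale_rows_cols:
  fixes f g :: "nat \<Rightarrow> real"
  shows "Determinant.det (mat n n (\<lambda>(i, j). f i * g j * A i j)) =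
    (\<Prod>i<n. f i) * (\<Prod>j<n. g j) * Determinant.det (mat n n (\<lambda>(i, j). A i j))"
proof -
  have "(\<Prod>i = 0..<n. mat n n (\<lambda>(i, j). f i * g j * A i j) $$ (i, p i)) =
     (\<Prod>i<n. f i) * (\<Prod>j<n. g j) * (\<Prod>i = 0..<n. mat n n (\<lambda>(i, j). A i j) $$ (i, p i))"
    if p: "p permutes {0..<n}" for p
  proof -
    have in_range: "p i < n" if "i < n" for i using permutes_in_image[OF p, of i] that by simp
    have "(\<Prod>i = 0..<n. mat n n (\<lambda>(i, j). f i * g j * A i j) $$ (i, p i)) =
       (\<Prod>i = 0..<n. f i * g (p i) * A i (p i))"
      by (intro prod.cong refl) (simp add: in_range)
    also have "\<dots> = (\<Prod>i = 0..<n. f i) * (\<Prod>i = 0..<n. g (p i)) * (\<Prod>i = 0..<n. A i (p i))"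
      by (simp add: prod.distrib)
    also have "(\<Prod>i = 0..<n. g (p i)) = (\<Prod>i = 0..<n. g i)"
      using prod.permute[OF p, of g] by (simp add: o_def)
    also have "(\<Prod>i = 0..<n. A i (p i)) = (\<Prod>i = 0..<n. mat n n (\<lambda>(i, j). A i j) $$ (i, p i))"
      by (intro prod.cong refl) (simp add: in_range)
    finally show ?thesis by (simp add: lessThan_atLeast0)
  qed
  then have eq: "signof p * (\<Prod>i = 0..<n. mat n n (\<lambda>(i, j). f i * g j * A i j) $$ (i, p i)) =
     (\<Prod>i<n. f i) * (\<Prod>j<n. g j) * (signof p * (\<Prod>i = 0..<n. mat n n (\<lambda>(i, j). A i j) $$ (i, p i)))"
    if "p permutes {0..<n}" for p
    using that by (simp only: mult_ac)
  have "(\<Sum>p\<in>{p. p permutes {0..<n}}. signof p * (\<Prod>i = 0..<n. mat n n (\<lambda>(i, j). f i * g j * A i j) $$ (i, p i))) =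
     (\<Sum>p\<in>{p. p permutes {0..<n}}. (\<Prod>i<n. f i) * (\<Prod>j<n. g j) * (signof p * (\<Prod>i = 0..<n. mat n n (\<lambda>(i, j). A i j) $$ (i, p i))))"
    by (intro sum.cong refl eq) simp
  then show ?thesis
    by (simp only: Determinant.det_def mat_carrier dim_row_mat dim_col_mat refl if_True sum_distrib_left)
qed

lemma tendsto_det_mat:
  fixes A :: "'x \<Rightarrow> nat \<Rightarrow> nat \<Rightarrow> real"
  assumes "\<And>i j. i < m \<Longrightarrow> j < m \<Longrightarrow> ((\<lambda>x. A x i j) \<longlongrightarrow> L i j) F"
  shows "((\<lambda>x. Determinant.det (mat m m (\<lambda>(i, j). A x i j))) \<longlongrightarrow>
    Determinant.det (mat m m (\<lambda>(i, j). L i j))) F"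
proof -
  have "((\<lambda>x. \<Prod>i = 0..<m. mat m m (\<lambda>(i, j). A x i j) $$ (i, p i)) \<longlongrightarrow>
     (\<Prod>i = 0..<m. mat m m (\<lambda>(i, j). L i j) $$ (i, p i))) F" if p: "p permutes {0..<m}" for p
    using permutes_in_image[OF p] by (intro tendsto_prod) (simp add: assms)
  then show ?thesis
    unfolding Determinant.det_def by (auto intro!: tendsto_sum tendsto_mult)
qed

text \<open>Up to sign the \<open>(b, c)\<close> minor of the block; the signed version is the bordered determinant itself, with
unit vectors as border, so that signs and index shifts never have to be spelled out.\<close>

definition bordered_cofactor :: "nat \<Rightarrow> (nat \<Rightarrow> nat \<Rightarrow> real) \<Rightarrow> nat \<Rightarrow> nat \<Rightarrow> real" where
  "bordered_cofactor k B b c = Determinant.det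
     (bordered_mat k 0 (\<lambda>j. if j = c then 1 else 0) (\<lambda>i. if i = b then 1 else 0) B)"

lemma bordered_mat_carrier [simp]: "bordered_mat k p u w B \<in> carrier_mat (Suc k) (Suc k)"
  by (simp add: bordered_mat_def)

lemma mat_delete_cong:
  assumes "A \<in> carrier_mat n n" "B \<in> carrier_mat n n"
    and "\<And>i' j'. i' < n \<Longrightarrow> j' < n \<Longrightarrow> i' \<noteq> i \<Longrightarrow> j' \<noteq> j \<Longrightarrow> A $$ (i', j') = B $$ (i', j')"
  shows "mat_delete A i j = mat_delete B i j"
  using assms unfolding mat_delete_def by (intro eq_matI) auto

text \<open>Laplace expansion along the first row. The cofactors of that row do not see it, so they are those of
the matrix with first row zero, and specializing the row to a unit vector identifies them.\<close>

lemma det_bordered_first_row: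
  "Determinant.det (bordered_mat k p u w B) =
     p * Determinant.det (mat k k (\<lambda>(b, c). B b c)) +
     (\<Sum>c<k. u c * Determinant.det (bordered_mat k 0 (\<lambda>j. if j = c then 1 else 0) w B))"
proof -
  define N where "N = bordered_mat k 0 (\<lambda>_. 0) w B"
  have cof: "cofactor (bordered_mat k p' u' w B) 0 j = cofactor N 0 j" for p' u' j
    unfolding cofactor_def N_def
    by (subst mat_delete_cong[of _ "Suc k" "bordered_mat k 0 (\<lambda>_. 0) w B"]) (auto simp: bordered_mat_def)
  have ex: "Determinant.det (bordered_mat k p' u' w B) = p' * cofactor N 0 0 + (\<Sum>c<k. u' c * cofactor N 0 (Suc c))" for p' u'
  proof -
    have "Determinant.det (bordered_mat k p' u' w B) =
      (\<Sum>j<Suc k. bordered_mat k p' u' w B $$ (0, j) * cofactor (bordered_mat k p' u' w B) 0 j)"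
      by (rule laplace_expansion_row) simp_all
    also have "\<dots> = (\<Sum>j<Suc k. (if j = 0 then p' else u' (j - 1)) * cofactor N 0 j)"
      unfolding cof by (intro sum.cong refl) (simp add: bordered_mat_def)
    also have "\<dots> = p' * cofactor N 0 0 + (\<Sum>c<k. u' c * cofactor N 0 (Suc c))"
      by (subst sum.lessThan_Suc_shift) simp
    finally show ?thesis .
  qed
  have "mat_delete N 0 0 = mat k k (\<lambda>(b, c). B b c)"
    unfolding mat_delete_def N_def by (intro eq_matI) (auto simp: bordered_mat_def)
  then have "cofactor N 0 0 = Determinant.det (mat k k (\<lambda>(b, c). B b c))"
    by (simp add: cofactor_def)
  moreover have "Determinant.det (bordered_mat k 0 (\<lambda>j. if j = c then 1 else 0) w B) = cofactor N 0 (Suc c)" if "c < k" for c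
    using that by (simp add: ex if_distrib[of "\<lambda>z. z * _"] cong: if_cong)
  ultimately show ?thesis by (simp add: ex)
qed

lemma det_bordered_first_column:
  "Determinant.det (bordered_mat k 0 u w B) =
     (\<Sum>b<k. w b * Determinant.det (bordered_mat k 0 u (\<lambda>i. if i = b then 1 else 0) B))"
proof -
  define N where "N = bordered_mat k 0 u (\<lambda>_. 0) B"
  have cof: "cofactor (bordered_mat k 0 u w' B) j 0 = cofactor N j 0" for w' j
    unfolding cofactor_def N_def
    by (subst mat_delete_cong[of _ "Suc k" "bordered_mat k 0 u (\<lambda>_. 0) B"]) (auto simp: bordered_mat_def)
  have ex: "Determinant.det (bordered_mat k 0 u w' B) = (\<Sum>b<k. w' b * cofactor N (Suc b) 0)" for w'
  proof -
    have "Determinant.det (bordered_mat k 0 u w' B) =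
      (\<Sum>i<Suc k. bordered_mat k 0 u w' B $$ (i, 0) * cofactor (bordered_mat k 0 u w' B) i 0)"
      by (rule laplace_expansion_column) simp_all
    also have "\<dots> = (\<Sum>i<Suc k. (if i = 0 then 0 else w' (i - 1)) * cofactor N i 0)"
      unfolding cof by (intro sum.cong refl) (simp add: bordered_mat_def)
    also have "\<dots> = (\<Sum>b<k. w' b * cofactor N (Suc b) 0)"
      by (subst sum.lessThan_Suc_shift) simp
    finally show ?thesis .
  qed
  have "Determinant.det (bordered_mat k 0 u (\<lambda>i. if i = b then 1 else 0) B) = cofactor N (Suc b) 0" if "b < k" for b
    using that by (simp add: ex if_distrib[of "\<lambda>z. z * _"] cong: if_cong)
  then show ?thesis by (simp add: ex)
qed

text \<open>The corner splits off the determinant of the block; the rest is bilinear in the border.\<close>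

lemma det_bordered_expand:
  "Determinant.det (bordered_mat k p u w B) =
     p * Determinant.det (mat k k (\<lambda>(b, c). B b c)) +
     (\<Sum>c<k. \<Sum>b<k. u c * w b * bordered_cofactor k B b c)"
  unfolding det_bordered_first_row[of k p u w B] bordered_cofactor_def
  by (subst det_bordered_first_column) (simp add: sum_distrib_left mult_ac)

lemma det_bordered_scale:
  "Determinant.det (bordered_mat k 0 (\<lambda>c. s c * u c) (\<lambda>b. t b * w b) (\<lambda>b c. t b * s c * B b c)) =
    (\<Prod>b<k. t b) * (\<Prod>c<k. s c) * Determinant.det (bordered_mat k 0 u w B)"
proof -
  define f where "f i = (if i = 0 then 1 else t (i - 1))" for i :: nat
  define g where "g i = (if i = 0 then 1 else s (i - 1))" for i :: nat
  define E where "E i j = (if i = 0 then (if j = 0 then 0 else u (j - 1))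
               else (if j = 0 then w (i - 1) else B (i - 1) (j - 1)))" for i j :: nat
  have "bordered_mat k 0 (\<lambda>c. s c * u c) (\<lambda>b. t b * w b) (\<lambda>b c. t b * s c * B b c)
      = mat (Suc k) (Suc k) (\<lambda>(i, j). f i * g j * E i j)"
    unfolding bordered_mat_def by (intro eq_matI) (auto simp: f_def g_def E_def)
  moreover have "bordered_mat k 0 u w B = mat (Suc k) (Suc k) (\<lambda>(i, j). E i j)"
    unfolding bordered_mat_def by (intro eq_matI) (auto simp: E_def)
  moreover have "(\<Prod>i<Suc k. f i) = (\<Prod>b<k. t b)" "(\<Prod>i<Suc k. g i) = (\<Prod>b<k. s b)"
    by (subst prod.lessThan_Suc_shift; simp add: f_def g_def)+
  ultimately show ?thesis by (simp only: det_scale_rows_cols)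
qed

text \<open>The factor is \<open>t\<^sup>k\<^sup>-\<^sup>1\<close> because the minor has one row fewer than the block. It is obtained by scaling
all \<open>k\<close> lower rows, including the border column, and dividing by the factor of that column.\<close>

lemma bordered_cofactor_scale:
  assumes "k \<ge> 1" "t \<noteq> 0"
  shows "bordered_cofactor k (\<lambda>b c. t * B b c) b c = t ^ (k - 1) * bordered_cofactor k B b c"
proof -
  define e where "e = (\<lambda>b i :: nat. if i = b then 1 else 0 :: real)"
  have "Determinant.det (bordered_mat k 0 (e c) (\<lambda>i. t * e b i) (\<lambda>b c. t * B b c)) =
      t ^ k * bordered_cofactor k B b c"
    using det_bordered_scale[of k "\<lambda>_. 1" "e c" "\<lambda>_. t" "e b" B]
    by (simp add: bordered_cofactor_def e_def)
  moreover have "Determinant.det (bordered_mat k 0 (e c) (\<lambda>i. t * e b i) (\<lambda>b c. t * B b c)) =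
      t * bordered_cofactor k (\<lambda>b c. t * B b c) b c"
    unfolding bordered_cofactor_def e_def
    by (subst (1 2) det_bordered_first_column) (simp add: sum_distrib_left mult_ac)
  ultimately have "t * bordered_cofactor k (\<lambda>b c. t * B b c) b c = t * (t ^ (k - 1) * bordered_cofactor k B b c)"
    using assms(1) by (cases k) auto
  then show ?thesis using assms(2) by simp
qed

lemma tendsto_bordered_cofactor:
  assumes "\<And>b c. b < k \<Longrightarrow> c < k \<Longrightarrow> ((\<lambda>x. B x b c) \<longlongrightarrow> L b c) F"
  shows "((\<lambda>x. bordered_cofactor k (B x) b c) \<longlongrightarrow> bordered_cofactor k L b c) F"
  unfolding bordered_cofactor_def bordered_mat_def
  by (rule tendsto_det_mat) (auto intro: assms)

text \<open>One block elimination: adding multiples of the first row to the others turns the bordered matrix with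
corner \<open>1\<close>, row \<open>u\<close> and column \<open>- \<mu> w\<close> into a block triangular one whose block is the updated matrix.\<close>

lemma det_rank_one_update:
  "Determinant.det (mat k k (\<lambda>(b, c). B b c + \<mu> * w b * u c)) =
    Determinant.det (mat k k (\<lambda>(b, c). B b c)) - \<mu> * Determinant.det (bordered_mat k 0 u w B)"
proof -
  define N where "N = bordered_mat k 1 u (\<lambda>b. - \<mu> * w b) B"
  \<comment> \<open>the elimination: \<open>\<mu> w\<close> times the first row is added to the rows below\<close>
  define L where "L = mat (Suc k) (Suc k) (\<lambda>(i, j). if i = j then 1 else if j = 0 then \<mu> * w (i - 1) else 0)"
  define U where "U = bordered_mat k 1 u (\<lambda>_. 0) (\<lambda>b c. B b c + \<mu> * w b * u c)"
  have LU: "L * N = U"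
  proof (rule eq_matI)
    fix i j assume "i < dim_row U" "j < dim_col U"
    then have ij: "i < Suc k" "j < Suc k" by (auto simp: U_def bordered_mat_def)
    have "(L * N) $$ (i, j) = (\<Sum>l<Suc k. L $$ (i, l) * N $$ (l, j))"
      using ij by (simp add: L_def N_def bordered_mat_def scalar_prod_def lessThan_atLeast0)
    also have "\<dots> = L $$ (i, 0) * N $$ (0, j) + (\<Sum>l<k. L $$ (i, Suc l) * N $$ (Suc l, j))"
      by (subst sum.lessThan_Suc_shift) simp
    also have "\<dots> = U $$ (i, j)"
    proof (cases i)
      case 0
      then show ?thesis using ij by (simp add: L_def N_def U_def bordered_mat_def)
    next
      case (Suc i')
      have "(\<Sum>l<k. L $$ (i, Suc l) * N $$ (Suc l, j)) = (\<Sum>l<k. if l = i' then N $$ (Suc l, j) else 0)"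
        using ij Suc by (intro sum.cong refl) (auto simp: L_def)
      also have "\<dots> = N $$ (i, j)" using ij Suc by simp
      finally show ?thesis using ij Suc by (auto simp: L_def N_def U_def bordered_mat_def algebra_simps)
    qed
    finally show "(L * N) $$ (i, j) = U $$ (i, j)" .
  qed (auto simp: L_def N_def U_def bordered_mat_def)
  have "Determinant.det L = prod_list (diag_mat L)"
    by (rule det_lower_triangular[of "Suc k"]) (auto simp: L_def)
  also have "diag_mat L = map (\<lambda>_. 1) [0..<Suc k]"
    unfolding diag_mat_def by (auto simp: L_def simp del: upt_Suc)
  also have "prod_list \<dots> = (1::real)" by (simp add: map_replicate_const del: upt_Suc)
  finally have "Determinant.det L = 1" .
  then have "Determinant.det N = Determinant.det U"
    using det_mult[of L "Suc k" N] unfolding LU by (simp add: L_def N_def)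
  also have "Determinant.det U = Determinant.det (mat k k (\<lambda>(b, c). B b c + \<mu> * w b * u c))"
    unfolding U_def by (simp add: det_bordered_expand)
  finally have "Determinant.det (mat k k (\<lambda>(b, c). B b c + \<mu> * w b * u c)) = Determinant.det N" ..
  then show ?thesis
    unfolding N_def by (simp add: det_bordered_expand sum_distrib_left mult_ac sum_negf)
qed

section \<open>Rodrigues derivatives and integration by parts\<close>

text \<open>For \<open>0 < v < 1\<close> this is \<open>(1/m!) d\<^sup>m/dv\<^sup>m (v\<^sup>A (1-v)\<^sup>B)\<close>, written out by Leibniz' rule.\<close>

definition rodrigues :: "real \<Rightarrow> real \<Rightarrow> nat \<Rightarrow> real \<Rightarrow> real" where
  "rodrigues A B m v =
     (\<Sum>s\<le>m. (A gchoose (m - s)) * (B gchoose s) * (- 1) ^ s *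
        (v powr (A - real m + real s) * (1 - v) powr (B - real s)))"

lemma rodrigues_0: "rodrigues A B 0 v = v powr A * (1 - v) powr B"
  by (simp add: rodrigues_def)

lemma rodrigues_at_0 [simp]: "rodrigues A B m 0 = 0"
  by (simp add: rodrigues_def)

text \<open>Rodrigues' formula; the weight and \<open>P\<^sub>n\<close> together are an \<open>n\<close>-th derivative.\<close>

lemma rodrigues_eq_jacobi_P:
  assumes "0 < v" "v < 1"
  shows "rodrigues (real n + \<alpha>) (real n + \<beta>) n v =
    v powr \<alpha> * (1 - v) powr \<beta> * jacobi_P n \<alpha> \<beta> (1 - 2 * v)"
proof -
  have *: "v powr (real n + \<alpha> - real n + real s) = v powr \<alpha> * v ^ s" if "s \<le> n" for s
    using assms by (simp add: powr_add powr_realpow)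
  have **: "(1 - v) powr (real n + \<beta> - real s) = (1 - v) powr \<beta> * (1 - v) ^ (n - s)" if "s \<le> n" for s
  proof -
    have e: "real n + \<beta> - real s = \<beta> + real (n - s)" using that by (simp add: of_nat_diff)
    have "(1 - v) powr (real n + \<beta> - real s) = (1 - v) powr \<beta> * (1 - v) powr real (n - s)"
      unfolding e by (rule powr_add)
    also have "(1 - v) powr real (n - s) = (1 - v) ^ (n - s)"
      using assms by (intro powr_realpow) auto
    finally show ?thesis .
  qed
  have h: "(1 - 2 * v - 1) / 2 = - v" "(1 - 2 * v + 1) / 2 = 1 - v" by (simp_all add: field_simps)
  have m: "(- v) ^ s = (- 1) ^ s * v ^ s" for s by (rule power_minus)
  show ?thesis
    unfolding rodrigues_def jacobi_P_def h m sum_distrib_left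
    by (intro sum.cong refl) (simp only: * ** atMost_iff mult_ac)
qed

text \<open>Differentiating the two powers shifts the index \<open>s\<close> by zero or one. The two binomial recursions turn
the shifted sums into \<open>(m+1-s)\<close> and \<open>s\<close> times the same term, and these weights add up to \<open>m+1\<close>.\<close>

lemma rodrigues_has_derivative:
  assumes v: "0 < v" "v < 1"
  shows "(rodrigues A B m has_real_derivative (real m + 1) * rodrigues A B (Suc m) v) (at v)"
proof -
  define P where "P s = v powr (A - real (Suc m) + real s)" for s :: nat
  define Q where "Q s = (1 - v) powr (B - real s)" for s :: nat
  have t: "((\<lambda>v. v powr (A - real m + real s) * (1 - v) powr (B - real s)) has_real_derivative
     (A - real m + real s) * P s * Q s + P (Suc s) * (- (B - real s) * Q (Suc s))) (at v)" for s
  proof -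
    have p: "((\<lambda>v. v powr (A - real m + real s)) has_real_derivative (A - real m + real s) * P s) (at v)"
      using has_real_derivative_powr[OF v(1), of "A - real m + real s"]
      by (simp add: P_def algebra_simps)
    have d: "((\<lambda>v. 1 - v) has_real_derivative - 1) (at v)"
      by (auto intro!: derivative_eq_intros)
    have q0: "((\<lambda>w. w powr (B - real s)) has_real_derivative (B - real s) * Q (Suc s)) (at (1 - v))"
      using has_real_derivative_powr[of "1 - v" "B - real s"] v by (simp add: Q_def algebra_simps)
    note q = DERIV_chain2[OF q0 d]
    have e: "A - real m + real s = A - real (Suc m) + real (Suc s)" by simp
    have PQ: "v powr (A - real m + real s) = P (Suc s)" "(1 - v) powr (B - real s) = Q s"
      unfolding P_def Q_def e by (rule refl)+
    show ?thesis
      using DERIV_mult[OF p q] unfolding PQ by (simp add: algebra_simps)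
  qed
  have d: "(rodrigues A B m has_real_derivative
     (\<Sum>s\<le>m. (A gchoose (m - s)) * (B gchoose s) * (- 1) ^ s *
        ((A - real m + real s) * P s * Q s + P (Suc s) * (- (B - real s) * Q (Suc s))))) (at v)"
    unfolding rodrigues_def by (intro DERIV_sum DERIV_cmult t)
  have s1: "(\<Sum>s\<le>m. (A gchoose (m - s)) * (B gchoose s) * (- 1) ^ s * ((A - real m + real s) * P s * Q s)) =
      (\<Sum>s\<le>Suc m. (real (Suc m) - real s) * ((A gchoose (Suc m - s)) * (B gchoose s) * (- 1) ^ s * (P s * Q s)))"
  proof -
    have "(A gchoose (m - s)) * (B gchoose s) * (- 1) ^ s * ((A - real m + real s) * P s * Q s) =
       (real (Suc m) - real s) * ((A gchoose (Suc m - s)) * (B gchoose s) * (- 1) ^ s * (P s * Q s))" if "s \<le> m" for s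
    proof -
      have "of_nat (Suc (m - s)) * (A gchoose Suc (m - s)) = (A - of_nat (m - s)) * (A gchoose (m - s))"
        using gbinomial_mult_1[of A "m - s"] by (simp add: algebra_simps)
      then have e: "(A gchoose (m - s)) * (A - real m + real s) = (real (Suc m) - real s) * (A gchoose (Suc m - s))"
        using that by (simp add: of_nat_diff Suc_diff_le algebra_simps)
      have "(A gchoose (m - s)) * (B gchoose s) * (- 1) ^ s * ((A - real m + real s) * P s * Q s) =
         ((A gchoose (m - s)) * (A - real m + real s)) * ((B gchoose s) * (- 1) ^ s * P s * Q s)"
        by (simp only: mult_ac)
      then show ?thesis unfolding e by (simp only: mult_ac)
    qed
    then have "(\<Sum>s\<le>m. (A gchoose (m - s)) * (B gchoose s) * (- 1) ^ s * ((A - real m + real s) * P s * Q s)) =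
      (\<Sum>s\<le>m. (real (Suc m) - real s) * ((A gchoose (Suc m - s)) * (B gchoose s) * (- 1) ^ s * (P s * Q s)))"
      by (intro sum.cong refl) simp_all
    then show ?thesis by (subst sum.atMost_Suc) simp
  qed
  have s2: "(\<Sum>s\<le>m. (A gchoose (m - s)) * (B gchoose s) * (- 1) ^ s * (P (Suc s) * (- (B - real s) * Q (Suc s)))) =
      (\<Sum>s\<le>Suc m. real s * ((A gchoose (Suc m - s)) * (B gchoose s) * (- 1) ^ s * (P s * Q s)))"
  proof -
    have "(A gchoose (m - s)) * (B gchoose s) * (- 1) ^ s * (P (Suc s) * (- (B - real s) * Q (Suc s))) =
       real (Suc s) * ((A gchoose (m - s)) * (B gchoose Suc s) * (- 1) ^ Suc s * (P (Suc s) * Q (Suc s)))" for s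
    proof -
      have e: "real (Suc s) * (B gchoose Suc s) = (B - real s) * (B gchoose s)"
        using gbinomial_mult_1[of B s] by (simp add: algebra_simps)
      have "(A gchoose (m - s)) * (B gchoose s) * (- 1) ^ s * (P (Suc s) * (- (B - real s) * Q (Suc s)))
         = (A gchoose (m - s)) * ((B - real s) * (B gchoose s)) * (- 1) ^ Suc s * (P (Suc s) * Q (Suc s))"
        by (simp add: algebra_simps)
      then show ?thesis unfolding e[symmetric] by (simp only: mult_ac)
    qed
    then have "(\<Sum>s\<le>m. (A gchoose (m - s)) * (B gchoose s) * (- 1) ^ s * (P (Suc s) * (- (B - real s) * Q (Suc s)))) =
      (\<Sum>s\<le>m. real (Suc s) * ((A gchoose (m - s)) * (B gchoose Suc s) * (- 1) ^ Suc s * (P (Suc s) * Q (Suc s))))"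
      by (intro sum.cong refl)
    then show ?thesis by (subst sum.atMost_Suc_shift) simp
  qed
  have "(\<Sum>s\<le>m. (A gchoose (m - s)) * (B gchoose s) * (- 1) ^ s *
        ((A - real m + real s) * P s * Q s + P (Suc s) * (- (B - real s) * Q (Suc s)))) =
     (\<Sum>s\<le>Suc m. real (Suc m) * ((A gchoose (Suc m - s)) * (B gchoose s) * (- 1) ^ s * (P s * Q s)))"
    unfolding distrib_left sum.distrib s1 s2 unfolding sum.distrib[symmetric] distrib_right[symmetric] by simp
  also have "\<dots> = (real m + 1) * rodrigues A B (Suc m) v"
    unfolding rodrigues_def P_def Q_def sum_distrib_left by (simp add: add.commute[of 1])
  finally show ?thesis using d by simp
qed

lemma set_integrable_powr_times_continuous:
  fixes g :: "real \<Rightarrow> real"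
  assumes p: "p > - 1" and r: "r \<ge> 0" and g: "continuous_on {0..r} g"
  shows "set_integrable lborel {0<..<r} (\<lambda>v. v powr p * g v)"
proof -
  have "(\<lambda>v. v powr p) integrable_on {0..r}"
    using integrable_on_powr_from_0[OF p r] .
  then have "(\<lambda>v. v powr p) integrable_on {0<..<r}"
    by (simp add: integrable_on_Icc_iff_Ioo)
  then have "(\<lambda>v. v powr p) absolutely_integrable_on {0<..<r}"
    by (rule nonnegative_absolutely_integrable_1) auto
  then have "set_integrable lborel {0<..<r} (\<lambda>v. v powr p)"
    unfolding set_integrable_def
    by (subst (asm) integrable_completion) auto
  then have int: "set_integrable lborel {0<..<r} (\<lambda>v. C * v powr p)" for C
    by simp
  obtain C where "\<forall>z\<in>g ` {0..r}. norm z \<le> C"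
    using compact_imp_bounded[OF compact_continuous_image[OF g compact_Icc]]
    unfolding bounded_iff by blast
  then have C: "\<bar>g v\<bar> \<le> C" if "v \<in> {0..r}" for v
    using that by auto
  have meas: "set_borel_measurable lborel {0<..<r} (\<lambda>v. v powr p * g v)"
  proof -
    have "continuous_on {0<..<r} (\<lambda>v. v powr p * g v)"
      by (intro continuous_intros continuous_on_subset[OF g]) auto
    then show ?thesis
      using borel_measurable_continuous_on_indicator[of "{0<..<r}" "\<lambda>v. v powr p * g v"]
      unfolding set_borel_measurable_def by simp
  qed
  show ?thesis
  proof (rule set_integrable_bound[OF int meas])
    show "AE x in lborel. x \<in> {0<..<r} \<longrightarrow> norm (x powr p * g x) \<le> norm (C * x powr p)"
    proof (intro AE_I2 impI)
      fix x assume "x \<in> {0<..<r}"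
      then have "\<bar>g x\<bar> \<le> C" using C[of x] by auto
      then have "\<bar>g x\<bar> \<le> \<bar>C\<bar>" by linarith
      then show "norm (x powr p * g x) \<le> norm (C * x powr p)"
        by (simp add: abs_mult mult.commute[of _ "x powr p"] mult_left_mono)
    qed
  qed
qed

lemma set_integrable_rodrigues:
  assumes A: "A - real m > - 1" and r: "0 \<le> r" "r < 1" and h: "continuous_on {0..r} h"
  shows "set_integrable lborel {0<..<r} (\<lambda>v. h v * rodrigues A B m v)"
proof -
  have "set_integrable lborel {0<..<r} (\<lambda>v. \<Sum>s\<le>m. v powr (A - real m + real s) *
     (h v * ((A gchoose (m - s)) * (B gchoose s) * (- 1) ^ s * (1 - v) powr (B - real s))))"
    unfolding set_integrable_def scaleR_sum_right
    by (intro Bochner_Integration.integrable_sum set_integrable_powr_times_continuous[unfolded set_integrable_def]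
          continuous_intros h) (use A r in auto)
  then show ?thesis
    by (simp add: rodrigues_def sum_distrib_left mult_ac)
qed

lemma continuous_on_rodrigues:
  assumes "A > real m" "0 \<le> r" "r < 1"
  shows "continuous_on {0..r} (rodrigues A B m)"
proof -
  have "continuous_on {0..r} (\<lambda>v. v powr (A - real m + real s))" for s
    by (rule continuous_on_powr') (use assms in \<open>auto intro: continuous_on_id continuous_on_const\<close>)
  moreover have "continuous_on {0..r} (\<lambda>v. (1 - v) powr (B - real s))" for s
    by (rule continuous_on_powr') (use assms in \<open>auto intro: continuous_intros\<close>)
  ultimately show ?thesis
    unfolding rodrigues_def by (intro continuous_on_sum continuous_on_mult continuous_on_const)
qed

text \<open>There is no boundary term at \<open>0\<close>: as \<open>A > m\<close>, the derivative of order \<open>m\<close> vanishes there.\<close>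

lemma rodrigues_integral_by_parts:
  assumes A: "A > real m" and r: "0 \<le> r" "r < 1"
    and h: "\<And>v. v \<in> {0..r} \<Longrightarrow> (h has_real_derivative h' v) (at v)" "continuous_on {0..r} h'"
  shows "(real m + 1) * (LBINT v:{0<..<r}. h v * rodrigues A B (Suc m) v) =
    h r * rodrigues A B m r - (LBINT v:{0<..<r}. h' v * rodrigues A B m v)"
proof -
  have ch: "continuous_on {0..r} h"
    using h(1) by (intro continuous_at_imp_continuous_on ballI DERIV_isCont) auto
  define G' where "G' v = h' v * rodrigues A B m v + (real m + 1) * (h v * rodrigues A B (Suc m) v)" for v
  have i1: "set_integrable lborel {0<..<r} (\<lambda>v. h' v * rodrigues A B m v)"
    using A r h by (intro set_integrable_rodrigues) auto
  have i2: "set_integrable lborel {0<..<r} (\<lambda>v. h v * rodrigues A B (Suc m) v)"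
    using A r ch by (intro set_integrable_rodrigues) auto
  have i: "set_integrable lborel {0<..<r} G'"
    unfolding G'_def using i1 i2 by (intro set_integral_add set_integrable_mult_right) auto
  have "(G' has_integral (h r * rodrigues A B m r - h 0 * rodrigues A B m 0)) {0..r}"
  proof (rule fundamental_theorem_of_calculus_interior)
    show "continuous_on {0..r} (\<lambda>v. h v * rodrigues A B m v)"
      using A r ch by (intro continuous_on_mult continuous_on_rodrigues) auto
    fix v assume v: "v \<in> {0<..<r}"
    have "((\<lambda>v. h v * rodrigues A B m v) has_real_derivative G' v) (at v)"
      unfolding G'_def
      using DERIV_mult[OF h(1) rodrigues_has_derivative, of v A B m] v r by (simp add: mult_ac)
    then show "((\<lambda>v. h v * rodrigues A B m v) has_vector_derivative G' v) (at v)"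
      by (simp add: has_real_derivative_iff_has_vector_derivative)
  qed (use r in auto)
  then have "integral {0<..<r} G' = h r * rodrigues A B m r"
    by (simp add: has_integral_Icc_iff_Ioo integral_unique)
  moreover have "(LBINT v:{0<..<r}. G' v) = integral {0<..<r} G'"
    using set_borel_integral_eq_integral[OF i] by simp
  moreover have "(LBINT v:{0<..<r}. G' v) = (LBINT v:{0<..<r}. h' v * rodrigues A B m v) +
      (real m + 1) * (LBINT v:{0<..<r}. h v * rodrigues A B (Suc m) v)"
    unfolding G'_def using i1 i2 by (subst set_integral_add) auto
  ultimately show ?thesis by simp
qed

text \<open>After \<open>k\<close> integrations by parts the power of \<open>r - v\<close> is used up. The boundary terms at \<open>r\<close> vanish until
the last one, which is the only value that remains.\<close>

lemma rodrigues_integral_power: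
  assumes "A > real m" "0 \<le> r" "r < 1" "k \<le> m"
  shows "fact (Suc m) * (LBINT v:{0<..<r}. (r - v) ^ k * rodrigues A B (Suc m) v) =
    fact k * fact (m - k) * rodrigues A B (m - k) r"
  using assms(1,4)
proof (induction k arbitrary: m)
  case 0
  have "(real m + 1) * (LBINT v:{0<..<r}. 1 * rodrigues A B (Suc m) v) =
    1 * rodrigues A B m r - (LBINT v:{0<..<r}. 0 * rodrigues A B m v)"
    by (rule rodrigues_integral_by_parts) (use 0 assms(2,3) in auto)
  then show ?case by (simp add: mult_ac add.commute)
next
  case (Suc k)
  then obtain m' where m: "m = Suc m'" by (cases m) auto
  have "(real m + 1) * (LBINT v:{0<..<r}. (r - v) ^ Suc k * rodrigues A B (Suc m) v) =
    (r - r) ^ Suc k * rodrigues A B m r - (LBINT v:{0<..<r}. - (real (Suc k) * (r - v) ^ k) * rodrigues A B m v)"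
  proof (rule rodrigues_integral_by_parts)
    fix v
    have "((\<lambda>v. r - v) has_real_derivative - 1) (at v)" by (auto intro!: derivative_eq_intros)
    from DERIV_power[OF this, of "Suc k"]
    show "((\<lambda>v. (r - v) ^ Suc k) has_real_derivative - (real (Suc k) * (r - v) ^ k)) (at v)"
      by (simp del: power_Suc)
  qed (use Suc.prems assms(2,3) in \<open>auto intro!: continuous_intros\<close>)
  also have "\<dots> = - (LBINT v:{0<..<r}. (- real (Suc k)) * ((r - v) ^ k * rodrigues A B m v))"
    by (simp only: minus_mult_left mult.assoc) simp
  also have "\<dots> = real (Suc k) * (LBINT v:{0<..<r}. (r - v) ^ k * rodrigues A B m v)"
    unfolding set_integral_mult_right by (simp only: minus_mult_left[symmetric] minus_minus)
  finally have "fact (Suc m) * (LBINT v:{0<..<r}. (r - v) ^ Suc k * rodrigues A B (Suc m) v) =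
     real (Suc k) * (fact m * (LBINT v:{0<..<r}. (r - v) ^ k * rodrigues A B m v))"
    by (simp only: fact_Suc of_nat_Suc mult_ac add.commute)
  also have "fact m * (LBINT v:{0<..<r}. (r - v) ^ k * rodrigues A B m v) = fact k * fact (m' - k) * rodrigues A B (m' - k) r"
    using Suc.IH[of m'] Suc.prems m by simp
  finally show ?case by (simp add: m mult_ac)
qed

text \<open>All \<open>m\<close> derivatives are moved to the inverse power; each step contributes a boundary value at \<open>r\<close>.\<close>

lemma rodrigues_integral_inverse_power:
  assumes "A > real m - 1" "0 \<le> r" "r < 1" "r < y"
  shows "fact m * fact i * (LBINT v:{0<..<r}. 1 / (y - v) ^ Suc i * rodrigues A B m v) =
    (\<Sum>l<m. (- 1) ^ l * fact (i + l) * fact (m - 1 - l) * rodrigues A B (m - 1 - l) r / (y - r) ^ (i + l + 1))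
    + (- 1) ^ m * fact (i + m) * (LBINT v:{0<..<r}. 1 / (y - v) ^ Suc (i + m) * rodrigues A B 0 v)"
  using assms(1)
proof (induction m arbitrary: i)
  case 0
  then show ?case by simp
next
  case (Suc m)
  define b where "b l = (- 1) ^ l * fact (i + l) * fact (Suc m - 1 - l) * rodrigues A B (Suc m - 1 - l) r / (y - r) ^ (i + l + 1)" for l
  have "(real m + 1) * (LBINT v:{0<..<r}. 1 / (y - v) ^ Suc i * rodrigues A B (Suc m) v) =
     1 / (y - r) ^ Suc i * rodrigues A B m r - (LBINT v:{0<..<r}. real (Suc i) * (1 / (y - v) ^ Suc (Suc i)) * rodrigues A B m v)"
  proof (rule rodrigues_integral_by_parts)
    fix v assume v: "v \<in> {0..r}"
    then have nz: "y - v \<noteq> 0" using assms by auto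
    have "((\<lambda>v. y - v) has_real_derivative - 1) (at v)" by (auto intro!: derivative_eq_intros)
    from DERIV_inverse_fun[OF DERIV_power[OF this, of "Suc i"]] nz
    have "((\<lambda>v. inverse ((y - v) ^ Suc i)) has_real_derivative
        - (real (Suc i) * (- 1 * (y - v) ^ i) * inverse (((y - v) ^ Suc i) ^ 2))) (at v)"
      by (simp add: numeral_2_eq_2 del: power_Suc)
    also have "- (real (Suc i) * (- 1 * (y - v) ^ i) * inverse (((y - v) ^ Suc i) ^ 2)) = real (Suc i) * (1 / (y - v) ^ Suc (Suc i))"
    proof -
      define z where "z = y - v"
      have "z \<noteq> 0" using nz by (simp add: z_def)
      then show ?thesis unfolding z_def[symmetric] by (simp add: field_simps power2_eq_square)
    qed
    finally show "((\<lambda>v. 1 / (y - v) ^ Suc i) has_real_derivative real (Suc i) * (1 / (y - v) ^ Suc (Suc i))) (at v)"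
      by (simp only: inverse_eq_divide)
  qed (use Suc.prems assms in \<open>auto intro!: continuous_intros\<close>)
  also have "\<dots> = rodrigues A B m r / (y - r) ^ Suc i - real (Suc i) * (LBINT v:{0<..<r}. 1 / (y - v) ^ Suc (Suc i) * rodrigues A B m v)"
    by (simp only: mult.assoc set_integral_mult_right) simp
  finally have *: "(real m + 1) * (LBINT v:{0<..<r}. 1 / (y - v) ^ Suc i * rodrigues A B (Suc m) v) = \<dots>" .
  have "fact (Suc m) * fact i * (LBINT v:{0<..<r}. 1 / (y - v) ^ Suc i * rodrigues A B (Suc m) v) =
     fact m * fact i * ((real m + 1) * (LBINT v:{0<..<r}. 1 / (y - v) ^ Suc i * rodrigues A B (Suc m) v))"
    by (simp only: fact_Suc of_nat_Suc mult_ac add.commute)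
  also have "\<dots> = fact m * fact i * rodrigues A B m r / (y - r) ^ Suc i
      - fact m * fact (Suc i) * (LBINT v:{0<..<r}. 1 / (y - v) ^ Suc (Suc i) * rodrigues A B m v)"
    unfolding * by (simp add: right_diff_distrib mult_ac del: power_Suc)
  also have "fact m * fact (Suc i) * (LBINT v:{0<..<r}. 1 / (y - v) ^ Suc (Suc i) * rodrigues A B m v) =
     - (\<Sum>l<m. b (Suc l)) + (- 1) ^ m * fact (i + Suc m) * (LBINT v:{0<..<r}. 1 / (y - v) ^ Suc (i + Suc m) * rodrigues A B 0 v)"
    using Suc.prems by (subst Suc.IH) (simp_all add: b_def sum_negf)
  also have "fact m * fact i * rodrigues A B m r / (y - r) ^ Suc i = b 0"
    by (simp add: b_def)
  finally show ?case
    unfolding b_def[symmetric] by (subst sum.lessThan_Suc_shift) simp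
qed

text \<open>Induction on \<open>e\<close> with \<open>(r - v)/(y - v) = 1 - (y - r)/(y - v)\<close>. The part without denominator is
\<open>rodrigues_integral_power\<close>, and it cancels the first summand of the sum, so each step shortens the sum
by one and gains a factor \<open>- (y - r)\<close>. For \<open>e\<close> close to \<open>n\<close> at most two boundary values are left.\<close>

lemma rodrigues_integral_power_quotient:
  assumes A: "A > real n - 1" and r: "0 \<le> r" "r < 1" "r < y" and e: "e \<le> n"
  shows "fact n * (LBINT v:{0<..<r}. (r - v) ^ e / (y - v) * rodrigues A B n v) =
    (- (y - r)) ^ e * ((\<Sum>i\<in>{e..<n}. (- 1) ^ i * fact i * fact (n - 1 - i) * rodrigues A B (n - 1 - i) r / (y - r) ^ (i + 1))
      + (- 1) ^ n * fact n * (LBINT v:{0<..<r}. 1 / (y - v) ^ Suc n * rodrigues A B 0 v))"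
  using e
proof (induction e)
  case 0
  show ?case
    using rodrigues_integral_inverse_power[OF A r, of 0 B] by (simp add: lessThan_atLeast0)
next
  case (Suc e)
  define c where "c = y - r"
  have c: "c > 0" using r by (simp add: c_def)
  obtain m where n: "n = Suc m" using Suc.prems by (cases n) auto
  define V where "V = (- 1) ^ n * fact n * (LBINT v:{0<..<r}. 1 / (y - v) ^ Suc n * rodrigues A B 0 v)"
  define b where "b i = (- 1) ^ i * fact i * fact (n - 1 - i) * rodrigues A B (n - 1 - i) r / c ^ (i + 1)" for i
  have i1: "set_integrable lborel {0<..<r} (\<lambda>v. (r - v) ^ e * rodrigues A B n v)"
    using A r by (intro set_integrable_rodrigues continuous_intros) auto
  have i2: "set_integrable lborel {0<..<r} (\<lambda>v. (r - v) ^ e / (y - v) * rodrigues A B n v)"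
    using A r by (intro set_integrable_rodrigues continuous_intros) auto
  have "(LBINT v:{0<..<r}. (r - v) ^ Suc e / (y - v) * rodrigues A B n v) =
      (LBINT v:{0<..<r}. (r - v) ^ e * rodrigues A B n v - c * ((r - v) ^ e / (y - v) * rodrigues A B n v))"
    using r by (intro set_lebesgue_integral_cong) (auto simp: c_def field_simps)
  also have "\<dots> = (LBINT v:{0<..<r}. (r - v) ^ e * rodrigues A B n v)
      - c * (LBINT v:{0<..<r}. (r - v) ^ e / (y - v) * rodrigues A B n v)"
    using i1 i2 by (simp only: set_integral_diff(2) set_integrable_mult_right set_integral_mult_right)
  finally have E: "(LBINT v:{0<..<r}. (r - v) ^ Suc e / (y - v) * rodrigues A B n v) = \<dots>" .
  have "fact n * (LBINT v:{0<..<r}. (r - v) ^ Suc e / (y - v) * rodrigues A B n v) =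
     fact n * (LBINT v:{0<..<r}. (r - v) ^ e * rodrigues A B n v)
     - c * (fact n * (LBINT v:{0<..<r}. (r - v) ^ e / (y - v) * rodrigues A B n v))"
    unfolding E by (simp only: right_diff_distrib mult.left_commute)
  also have "fact n * (LBINT v:{0<..<r}. (r - v) ^ e * rodrigues A B n v) = fact e * fact (m - e) * rodrigues A B (m - e) r"
    unfolding n using rodrigues_integral_power[of m A r e B] A r Suc.prems n by simp
  also have "fact e * fact (m - e) * rodrigues A B (m - e) r = (- c) ^ e * c * b e"
  proof -
    have "(- c) ^ e * (- 1) ^ e = c ^ e" by (simp flip: power_mult_distrib)
    then have "(- c) ^ e * c * b e = c ^ e * c * (fact e * fact (n - 1 - e) * rodrigues A B (n - 1 - e) r) / c ^ (e + 1)"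
      unfolding b_def by (simp only: times_divide_eq_right mult.assoc[symmetric]) (simp only: mult_ac)
    then show ?thesis using c n by simp
  qed
  also have "fact n * (LBINT v:{0<..<r}. (r - v) ^ e / (y - v) * rodrigues A B n v) = (- c) ^ e * ((\<Sum>i\<in>{e..<n}. b i) + V)"
    unfolding b_def c_def V_def using Suc by simp
  also have "(\<Sum>i\<in>{e..<n}. b i) = b e + (\<Sum>i\<in>{Suc e..<n}. b i)"
    using Suc.prems by (intro sum.atLeast_Suc_lessThan) auto
  finally show ?case
    unfolding b_def[symmetric] c_def[symmetric] V_def[symmetric] by (simp add: algebra_simps)
qed

section \<open>Quotients of Gamma functions\<close>

lemma tendsto_add_const_over_n: "(\<lambda>n. (real n + c) / real n) \<longlonglongrightarrow> 1"
proof (rule Lim_transform_eventually)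
  show "(\<lambda>n. 1 + c / real n) \<longlonglongrightarrow> 1"
    using tendsto_add[OF tendsto_const lim_const_over_n[of c], of 1] by simp
  show "\<forall>\<^sub>F n in sequentially. 1 + c / real n = (real n + c) / real n"
    using eventually_gt_at_top[of 0] by eventually_elim (simp add: field_simps)
qed

lemma tendsto_pochhammer_over_power:
  "(\<lambda>n. pochhammer (real n + c) m / real n ^ m) \<longlonglongrightarrow> 1"
proof -
  have "(\<lambda>n. \<Prod>i<m. (real n + (c + real i)) / real n) \<longlonglongrightarrow> (\<Prod>i<m. 1)"
    by (intro tendsto_prod tendsto_add_const_over_n)
  then show ?thesis
    by (simp add: pochhammer_prod prod_dividef add_ac lessThan_atLeast0)
qed

lemma eventually_plus_const_pos: "\<forall>\<^sub>F n in sequentially. 0 < real n + c"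
proof -
  have "\<forall>\<^sub>F n in sequentially. real n > - c"
    using filterlim_real_sequentially by (simp add: filterlim_at_top_dense)
  then show ?thesis by eventually_elim auto
qed

lemma Gamma_pochhammer:
  assumes "(x::real) > 0"
  shows "Gamma (x + real m) = pochhammer x m * Gamma x"
proof -
  have "x \<notin> \<int>\<^sub>\<le>\<^sub>0" using assms by (auto elim!: nonpos_Ints_cases)
  then show ?thesis using pochhammer_Gamma[of x m] Gamma_real_pos[OF assms] by (simp add: field_simps)
qed

text \<open>Gauss' product for \<open>Gamma z\<close> with \<open>z = c + K - 1\<close>. The integer \<open>K\<close> only serves to make \<open>z\<close> positive; it is
removed by the functional equation.\<close>

lemma Gamma_ratio_tendsto:
  "(\<lambda>n. Gamma (real n + c) / (Gamma (real n) * real n powr c)) \<longlonglongrightarrow> 1"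
proof -
  obtain K :: nat where K: "real K > 1 - c" using reals_Archimedean2 by blast
  define z where "z = c + real K - 1"
  have z: "z > 0" using K by (simp add: z_def)
  have z': "z \<notin> \<int>\<^sub>\<le>\<^sub>0" using z by (auto elim!: nonpos_Ints_cases)
  have "(\<lambda>n. Gamma_series z n / Gamma z) \<longlonglongrightarrow> Gamma z / Gamma z"
    using Gamma_real_pos[OF z] by (intro tendsto_divide Gamma_series_LIMSEQ tendsto_const) auto
  then have "(\<lambda>n. inverse (Gamma_series z n / Gamma z)) \<longlonglongrightarrow> inverse 1"
    using Gamma_real_pos[OF z] by (intro tendsto_inverse) auto
  then have 1: "(\<lambda>n. inverse (Gamma_series z n / Gamma z)) \<longlonglongrightarrow> 1" by simp
  have 2: "(\<lambda>n. inverse (Gamma_series z n / Gamma z) / (pochhammer (real n + c) K / real n ^ K)) \<longlonglongrightarrow> 1 / 1"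
    by (intro tendsto_divide 1 tendsto_pochhammer_over_power) auto
  have "\<forall>\<^sub>F n in sequentially. inverse (Gamma_series z n / Gamma z) / (pochhammer (real n + c) K / real n ^ K) =
      Gamma (real n + c) / (Gamma (real n) * real n powr c)"
    using eventually_gt_at_top[of 0] eventually_plus_const_pos[of c]
  proof eventually_elim
    case (elim n)
    have p: "pochhammer z (n + 1) * Gamma z = Gamma (real n + c + real K)"
      using Gamma_pochhammer[OF z, of "n + 1"] by (simp add: z_def algebra_simps)
    have q: "Gamma (real n + c + real K) = pochhammer (real n + c) K * Gamma (real n + c)"
      using Gamma_pochhammer[OF elim(2), of K] by simp
    have f: "fact n = real n * Gamma (real n)"
      using Gamma_fact[of n, where 'a = real] Gamma_pochhammer[of "real n" 1] elim(1) by (simp add: add.commute)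
    have e: "exp (z * ln (real n)) = real n powr c * real n ^ K / real n"
    proof -
      have "exp (z * ln (real n)) = real n powr (c + real K - 1)"
        using elim(1) by (simp add: powr_def z_def)
      also have "\<dots> = real n powr c * real n ^ K / real n"
        using elim(1) by (simp add: powr_diff powr_add powr_realpow)
      finally show ?thesis .
    qed
    have "pochhammer (real n + c) K > 0" "Gamma (real n) > 0" "Gamma z > 0"
      using elim z by (auto intro: pochhammer_pos)
    then have pos: "pochhammer (real n + c) K \<noteq> 0" "Gamma (real n) \<noteq> 0" "Gamma z \<noteq> 0"
      by (metis less_irrefl)+
    have "inverse (Gamma_series z n / Gamma z) = pochhammer z (n + 1) * Gamma z / (fact n * exp (z * ln (real n)))"
      by (simp add: Gamma_series_def divide_inverse mult_ac)
    also have "\<dots> = pochhammer (real n + c) K * Gamma (real n + c) / (Gamma (real n) * (real n powr c * real n ^ K))"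
      unfolding p q f e using pos by (simp add: field_simps)
    finally have X: "inverse (Gamma_series z n / Gamma z) = \<dots>" .
    show ?case unfolding X using pos elim(1) by (simp add: divide_simps)
  qed
  then show ?thesis using Lim_transform_eventually[OF 2] by simp
qed

lemma Gamma_quotient_tendsto:
  "(\<lambda>n. Gamma (real n + c) / Gamma (real n + d) / real n powr (c - d)) \<longlonglongrightarrow> 1"
proof -
  have 1: "(\<lambda>n. (Gamma (real n + c) / (Gamma (real n) * real n powr c)) /
     (Gamma (real n + d) / (Gamma (real n) * real n powr d))) \<longlonglongrightarrow> 1 / 1"
    by (intro tendsto_divide Gamma_ratio_tendsto) auto
  have "\<forall>\<^sub>F n in sequentially. (Gamma (real n + c) / (Gamma (real n) * real n powr c)) /
     (Gamma (real n + d) / (Gamma (real n) * real n powr d)) = Gamma (real n + c) / Gamma (real n + d) / real n powr (c - d)"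
    using eventually_gt_at_top[of 0] eventually_plus_const_pos[of d]
  proof eventually_elim
    case (elim n)
    then have "Gamma (real n) > 0" "Gamma (real n + d) > 0" by (auto intro: Gamma_real_pos)
    then have "Gamma (real n) \<noteq> 0" "Gamma (real n + d) \<noteq> 0" by (metis less_irrefl)+
    then show ?case using elim by (simp add: powr_diff divide_simps)
  qed
  then show ?thesis using Lim_transform_eventually[OF 1] by simp
qed

text \<open>Legendre's duplication formula, transferred from the complex to the real Gamma function.\<close>

lemma Gamma_double_real:
  assumes "(z::real) > 0"
  shows "Gamma (2 * z) = 2 powr (2 * z - 1) * Gamma z * Gamma (z + 1 / 2) / sqrt pi"
proof -
  have n: "complex_of_real z \<notin> \<int>\<^sub>\<le>\<^sub>0" "complex_of_real (z + 1 / 2) \<notin> \<int>\<^sub>\<le>\<^sub>0"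
    using assms by (simp_all only: of_real_in_nonpos_Ints_iff) (auto elim!: nonpos_Ints_cases)
  have "complex_of_real (Gamma z * Gamma (z + 1 / 2)) = Gamma (of_real z) * Gamma (of_real z + 1 / 2)"
    by (simp flip: Gamma_complex_of_real)
  also have "\<dots> = exp ((1 - 2 * of_real z) * of_real (ln 2)) * of_real (sqrt pi) * Gamma (2 * of_real z)"
    using n by (intro Gamma_legendre_duplication) auto
  also have "\<dots> = complex_of_real (exp ((1 - 2 * z) * ln 2) * sqrt pi * Gamma (2 * z))"
    by (simp flip: Gamma_complex_of_real exp_of_real)
  finally have "Gamma z * Gamma (z + 1 / 2) = exp ((1 - 2 * z) * ln 2) * sqrt pi * Gamma (2 * z)"
    by (simp only: of_real_eq_iff)
  moreover have "2 powr (2 * z - 1) * exp ((1 - 2 * z) * ln 2) = 1"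
    by (simp add: powr_def algebra_simps flip: exp_add)
  ultimately have "2 powr (2 * z - 1) * (Gamma z * Gamma (z + 1 / 2)) = sqrt pi * Gamma (2 * z)"
    by (metis (no_types, opaque_lifting) mult.assoc mult_1)
  then show ?thesis by (simp add: field_simps)
qed

text \<open>The asymptotics of a central binomial coefficient: duplication writes \<open>Gamma (2n + \<alpha> + \<beta> + 1)\<close> as a product
of two Gamma functions near \<open>n\<close>, which are then compared with those in the denominator. This is the
source of the factor \<open>1/sqrt \<pi>\<close> of the limit.\<close>

lemma central_Gamma_quotient_tendsto:
  "(\<lambda>n. Gamma (2 * real n + \<alpha> + \<beta> + 1) / (Gamma (real n + \<alpha>) * Gamma (real n + \<beta> + 1)) / (4 ^ n * sqrt (real n)))
     \<longlonglongrightarrow> 2 powr (\<alpha> + \<beta>) / sqrt pi"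
proof -
  \<comment> \<open>half the shift of the argument, so that \<open>2 n + \<alpha> + \<beta> + 1 = 2 (n + d)\<close>\<close>
  define d where "d = (\<alpha> + \<beta> + 1) / 2"
  have 1: "(\<lambda>n. (2 powr (\<alpha> + \<beta>) / sqrt pi) * ((Gamma (real n + d) / Gamma (real n + \<alpha>) / real n powr (d - \<alpha>)) *
      (Gamma (real n + (d + 1 / 2)) / Gamma (real n + (\<beta> + 1)) / real n powr (d + 1 / 2 - (\<beta> + 1))))) \<longlonglongrightarrow>
      (2 powr (\<alpha> + \<beta>) / sqrt pi) * (1 * 1)"
    by (intro tendsto_mult tendsto_const Gamma_quotient_tendsto)
  have "\<forall>\<^sub>F n in sequentially. (2 powr (\<alpha> + \<beta>) / sqrt pi) * ((Gamma (real n + d) / Gamma (real n + \<alpha>) / real n powr (d - \<alpha>)) *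
      (Gamma (real n + (d + 1 / 2)) / Gamma (real n + (\<beta> + 1)) / real n powr (d + 1 / 2 - (\<beta> + 1)))) =
     Gamma (2 * real n + \<alpha> + \<beta> + 1) / (Gamma (real n + \<alpha>) * Gamma (real n + \<beta> + 1)) / (4 ^ n * sqrt (real n))"
    using eventually_gt_at_top[of 0] eventually_plus_const_pos[of d]
  proof eventually_elim
    case (elim n)
    have e: "2 * real n + \<alpha> + \<beta> + 1 = 2 * (real n + d)" by (simp add: d_def field_simps)
    have G: "Gamma (2 * real n + \<alpha> + \<beta> + 1) = 2 powr (2 * (real n + d) - 1) * Gamma (real n + d) * Gamma (real n + d + 1 / 2) / sqrt pi"
      unfolding e by (rule Gamma_double_real) (use elim in auto)
    have t: "2 powr (2 * (real n + d) - 1) = 2 powr (\<alpha> + \<beta>) * 4 ^ n"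
    proof -
      have "2 * (real n + d) - 1 = (\<alpha> + \<beta>) + real (2 * n)" by (simp add: d_def field_simps)
      then have "2 powr (2 * (real n + d) - 1) = 2 powr (\<alpha> + \<beta>) * 2 powr real (2 * n)" by (simp only: powr_add)
      also have "2 powr real (2 * n) = (2 ^ (2 * n) :: real)" by (rule powr_realpow) simp
      also have "\<dots> = 4 ^ n" by (simp add: power_mult)
      finally show ?thesis .
    qed
    have s: "real n powr (d - \<alpha>) * real n powr (d + 1 / 2 - (\<beta> + 1)) = sqrt (real n)"
    proof -
      have "(d - \<alpha>) + (d + 1 / 2 - (\<beta> + 1)) = 1 / 2" by (simp add: d_def field_simps)
      then show ?thesis by (simp only: powr_add[symmetric]) (simp add: powr_half_sqrt)
    qed
    show ?case unfolding G t s[symmetric] by (simp add: add.assoc)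
  qed
  then show ?thesis using Lim_transform_eventually[OF 1] by simp
qed

section \<open>Bessel functions and Jacobi polynomials at the hard edge\<close>

text \<open>Tannery's theorem with an exponential series as majorant.\<close>

lemma tendsto_power_series:
  fixes c :: "nat \<Rightarrow> nat \<Rightarrow> real"
  assumes lim: "\<And>m. (\<lambda>n. c n m) \<longlonglongrightarrow> l m"
    and bound: "\<forall>\<^sub>F n in sequentially. \<forall>m. \<bar>c n m\<bar> \<le> C * D ^ m / fact m"
    and D: "D \<ge> 0"
  shows "(\<lambda>n. \<Sum>m. c n m * a ^ m) \<longlonglongrightarrow> (\<Sum>m. l m * a ^ m)"
proof -
  have "\<forall>\<^sub>F (k, n) in at_top \<times>\<^sub>F sequentially. norm (c n k * a ^ k) \<le> C * ((D * \<bar>a\<bar>) ^ k / fact k)"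
    unfolding eventually_prod_filter
  proof (rule exI[of _ "\<lambda>_. True"], rule exI[of _ "\<lambda>n. \<forall>m. \<bar>c n m\<bar> \<le> C * D ^ m / fact m"], intro conjI allI impI bound)
    show "\<forall>\<^sub>F x :: nat in at_top. True" by simp
    fix k n assume "\<forall>m. \<bar>c n m\<bar> \<le> C * D ^ m / fact m"
    then have "\<bar>c n k\<bar> * \<bar>a\<bar> ^ k \<le> (C * D ^ k / fact k) * \<bar>a\<bar> ^ k"
      by (intro mult_right_mono) auto
    then show "case (k, n) of (k, n) \<Rightarrow> norm (c n k * a ^ k) \<le> C * ((D * \<bar>a\<bar>) ^ k / fact k)"
      by (simp add: abs_mult power_abs power_mult_distrib mult_ac)
  qed
  moreover have "summable (\<lambda>k. C * ((D * \<bar>a\<bar>) ^ k / fact k))"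
    using summable_exp[of "D * \<bar>a\<bar>"] by (intro summable_mult) (simp add: divide_inverse mult_ac)
  ultimately show ?thesis
    using tannerys_theorem[of "\<lambda>k n. c n k * a ^ k" "\<lambda>k. l k * a ^ k" sequentially
        "\<lambda>k. C * ((D * \<bar>a\<bar>) ^ k / fact k)", OF tendsto_mult[OF lim tendsto_const]] by auto
qed

text \<open>The Bessel-Clifford function: the entire factor of \<open>J\<^sub>b(2 sqrt x) = x\<^sup>b\<^sup>/\<^sup>2 C\<^sub>b(x)\<close>. It has no branch point at
\<open>x = 0\<close>, which is why the limits are first taken in terms of it.\<close>

definition bessel_C :: "real \<Rightarrow> real \<Rightarrow> real" where
  "bessel_C b x = (\<Sum>m. (- 1) ^ m / (fact m * Gamma (real m + b + 1)) * x ^ m)"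

lemma bessel_J_eq: "0 \<le> a \<Longrightarrow> bessel_J \<beta> (2 * sqrt a) = a powr (\<beta> / 2) * bessel_C \<beta> a"
proof -
  assume a: "0 \<le> a"
  have "sqrt a powr \<beta> = a powr (\<beta> / 2)"
    using a by (simp add: powr_half_sqrt[symmetric] powr_powr)
  moreover have "sqrt a ^ (2 * m) = a ^ m" for m using a by (simp add: power_mult)
  ultimately show ?thesis by (simp add: bessel_J_def bessel_C_def)
qed

lemma pochhammer_lower_bound:
  assumes "(x::real) > 0"
  shows "min 1 x \<le> pochhammer x m"
proof (cases m)
  case (Suc k)
  have "1 \<le> pochhammer (x + 1) k"
    unfolding pochhammer_prod using assms by (intro prod_ge_1) auto
  then have "x * 1 \<le> x * pochhammer (x + 1) k" using assms by (intro mult_left_mono) auto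
  then show ?thesis by (simp add: Suc pochhammer_rec min.coboundedI2)
qed simp

lemma Gamma_lower_bound:
  assumes "b > - 1"
  shows "Gamma (b + 1) * min 1 (b + 1) \<le> Gamma (real m + b + 1)" "0 < Gamma (b + 1) * min 1 (b + 1)"
proof -
  have g: "Gamma (b + 1) > 0" using assms by (intro Gamma_real_pos) auto
  have "Gamma (real m + b + 1) = pochhammer (b + 1) m * Gamma (b + 1)"
    using Gamma_pochhammer[of "b + 1" m] assms by (simp add: add_ac)
  then show "Gamma (b + 1) * min 1 (b + 1) \<le> Gamma (real m + b + 1)"
    using g pochhammer_lower_bound[of "b + 1" m] assms by (simp add: mult.commute mult_left_mono)
  show "0 < Gamma (b + 1) * min 1 (b + 1)" using g assms by simp
qed

lemma summable_bessel_C: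
  assumes "b > - 1"
  shows "summable (\<lambda>m. (- 1) ^ m / (fact m * Gamma (real m + b + 1)) * x ^ m)"
proof (rule summable_comparison_test')
  define \<delta> where "\<delta> = Gamma (b + 1) * min 1 (b + 1)"
  note \<delta> = Gamma_lower_bound[OF assms, folded \<delta>_def]
  show "summable (\<lambda>m. 1 / \<delta> * (inverse (fact m) * \<bar>x\<bar> ^ m))"
    using summable_exp[of "\<bar>x\<bar>"] by (intro summable_mult) (simp add: divide_inverse mult_ac)
  fix m :: nat
  have G: "0 < Gamma (real m + b + 1)" using \<delta> less_le_trans by blast
  have "1 / Gamma (real m + b + 1) \<le> 1 / \<delta>" using \<delta> G by (intro divide_left_mono mult_pos_pos) auto
  then have "1 / Gamma (real m + b + 1) * (inverse (fact m) * \<bar>x\<bar> ^ m) \<le> 1 / \<delta> * (inverse (fact m) * \<bar>x\<bar> ^ m)"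
    by (intro mult_right_mono) auto
  moreover have "norm ((- 1) ^ m / (fact m * Gamma (real m + b + 1)) * x ^ m) = 1 / Gamma (real m + b + 1) * (inverse (fact m) * \<bar>x\<bar> ^ m)"
    using G by (simp add: abs_mult power_abs divide_inverse mult_ac)
  ultimately show "norm ((- 1) ^ m / (fact m * Gamma (real m + b + 1)) * x ^ m) \<le> 1 / \<delta> * (inverse (fact m) * \<bar>x\<bar> ^ m)"
    by simp
qed

lemma bessel_C_coeff_shift:
  "diffs (\<lambda>m. (- 1) ^ m / (fact m * Gamma (real m + b + 1))) = (\<lambda>m. - ((- 1) ^ m / (fact m * Gamma (real m + (b + 1) + 1))))"
  by (auto simp: diffs_def fun_eq_iff add_ac)

lemma bessel_C_has_derivative:
  assumes "b > - 1"
  shows "(bessel_C b has_real_derivative - bessel_C (b + 1) x) (at x)"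
proof -
  have "((\<lambda>x. \<Sum>m. (- 1) ^ m / (fact m * Gamma (real m + b + 1)) * x ^ m) has_real_derivative
     (\<Sum>m. - ((- 1) ^ m / (fact m * Gamma (real m + (b + 1) + 1))) * x ^ m)) (at x)"
    using termdiffs_strong_converges_everywhere[OF summable_bessel_C[OF assms], of x]
    unfolding bessel_C_coeff_shift .
  also have "(\<Sum>m. - ((- 1) ^ m / (fact m * Gamma (real m + (b + 1) + 1))) * x ^ m) = - bessel_C (b + 1) x"
    unfolding bessel_C_def using summable_bessel_C[of "b + 1" x] assms
    by (subst suminf_minus[symmetric]) auto
  finally show ?thesis unfolding bessel_C_def .
qed

text \<open>The three-term recurrence of the Bessel functions, read off from the coefficients.\<close>

lemma bessel_C_recurrence:
  assumes "b > - 1"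
  shows "(b + 1) * bessel_C (b + 1) x - x * bessel_C (b + 2) x = bessel_C b x"
proof -
  define t where "t c m = (- 1) ^ m / (fact m * Gamma (real m + c + 1)) * x ^ m" for c :: real and m :: nat
  have S: "summable (t (b + 1))" "summable (t (b + 2))" "summable (t b)"
    unfolding t_def using summable_bessel_C[of "b + 1" x] summable_bessel_C[of "b + 2" x] summable_bessel_C[of b x] assms
    by auto
  have G: "Gamma (real m + b + 2) = (real m + b + 1) * Gamma (real m + b + 1)" for m
    using Gamma_pochhammer[of "real m + b + 1" 1] assms by (simp add: add_ac)
  have shift: "x * t (b + 2) m = - (real (Suc m) * t (b + 1) (Suc m))" for m
    by (simp add: t_def add_ac)
  have "(\<lambda>m. (b + 1) * t (b + 1) (Suc m) - x * t (b + 2) m) = (\<lambda>m. t b (Suc m))"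
  proof
    fix m
    have "(b + 1) * t (b + 1) (Suc m) - x * t (b + 2) m = (real (Suc m) + b + 1) * t (b + 1) (Suc m)"
      unfolding shift by (simp add: algebra_simps)
    also have "\<dots> = t b (Suc m)"
    proof -
      have "real (Suc m) + b + 1 \<noteq> 0" using assms by auto
      then show ?thesis
        using G[of "Suc m"] by (simp add: t_def add_ac)
    qed
    finally show "(b + 1) * t (b + 1) (Suc m) - x * t (b + 2) m = t b (Suc m)" .
  qed
  then have "(\<Sum>m. (b + 1) * t (b + 1) (Suc m) - x * t (b + 2) m) = (\<Sum>m. t b (Suc m))" by simp
  also have "(\<Sum>m. (b + 1) * t (b + 1) (Suc m) - x * t (b + 2) m) = (b + 1) * (\<Sum>m. t (b + 1) (Suc m)) - x * (\<Sum>m. t (b + 2) m)"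
  proof -
    have S1: "summable (\<lambda>m. t (b + 1) (Suc m))" using S summable_Suc_iff[of "t (b + 1)"] by simp
    show ?thesis
      by (simp only: suminf_diff[symmetric] suminf_mult[symmetric] summable_mult S S1)
  qed
  finally have "(b + 1) * (suminf (t (b + 1)) - t (b + 1) 0) - x * suminf (t (b + 2)) = suminf (t b) - t b 0"
    using S by (simp add: suminf_split_head)
  moreover have "(b + 1) * t (b + 1) 0 = t b 0"
    using G[of 0] assms by (simp add: t_def add_ac)
  ultimately show ?thesis
    unfolding bessel_C_def t_def[symmetric] by (simp add: algebra_simps)
qed

text \<open>Coefficients of \<open>P\<^sub>n\<^sub>-\<^sub>d\<close> near the hard edge, normalized so that they converge: \<open>n\<^sup>b\<close> is the size of the
polynomial there, and \<open>n\<^sup>2\<^sup>m\<close> comes from the \<open>m\<close>-th power of the distance \<open>a/n\<^sup>2\<close>. The shift \<open>d\<close> is \<open>0\<close> or \<open>1\<close>.\<close>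

definition edge_coeff :: "real \<Rightarrow> real \<Rightarrow> nat \<Rightarrow> nat \<Rightarrow> nat \<Rightarrow> real" where
  "edge_coeff \<alpha> b d n m =
     (if m \<le> n - d then (- 1) ^ m * ((real (n - d) + b) gchoose (n - d - m)) *
        ((real (n - d + m) + \<alpha> + b) gchoose m) / (real n powr b * real n ^ (2 * m)) else 0)"

definition edge_P :: "real \<Rightarrow> real \<Rightarrow> nat \<Rightarrow> nat \<Rightarrow> real \<Rightarrow> real" where
  "edge_P \<alpha> b d n a = (\<Sum>m. edge_coeff \<alpha> b d n m * a ^ m)"

lemma edge_P_sum: "edge_P \<alpha> b d n a = (\<Sum>m\<le>n - d. edge_coeff \<alpha> b d n m * a ^ m)"
  unfolding edge_P_def by (rule suminf_finite) (auto simp: edge_coeff_def)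

lemma jacobi_P_edge:
  assumes "n \<ge> 1"
  shows "jacobi_P (n - d) \<alpha> b (1 - 2 * (1 - a / (real n)\<^sup>2)) = (- 1) ^ (n - d) * real n powr b * edge_P \<alpha> b d n a"
  unfolding jacobi_P_expansion_at_1 edge_P_sum mult.assoc sum_distrib_left
  using assms
  by (intro arg_cong[of _ _ "\<lambda>z. _ * z"] sum.cong refl)
     (simp add: edge_coeff_def power_divide power_minus[of "a / _"] power_minus[of a] power_mult[symmetric] mult.commute[of 2])

lemma edge_coeff_tendsto:
  assumes b: "b > - 1"
  shows "(\<lambda>n. edge_coeff \<alpha> b d n m) \<longlonglongrightarrow> (- 1) ^ m / (fact m * Gamma (real m + b + 1))"
proof -
  define l where "l = (- 1) ^ m / (fact m * Gamma (real m + b + 1))"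
  have 1: "(\<lambda>n. l * (Gamma (real n + (b + 1 - real d)) / Gamma (real n + (1 - real d - real m)) / real n powr (b + real m))
      * (pochhammer (real n + (\<alpha> + b + 1 - real d)) m / real n ^ m)) \<longlonglongrightarrow> l * 1 * 1"
    using Gamma_quotient_tendsto[of "b + 1 - real d" "1 - real d - real m"]
    by (intro tendsto_mult tendsto_const tendsto_pochhammer_over_power) (simp add: algebra_simps)
  have "\<forall>\<^sub>F n in sequentially. l * (Gamma (real n + (b + 1 - real d)) / Gamma (real n + (1 - real d - real m)) / real n powr (b + real m))
      * (pochhammer (real n + (\<alpha> + b + 1 - real d)) m / real n ^ m) = edge_coeff \<alpha> b d n m"
    using eventually_gt_at_top[of "d + m"]
  proof eventually_elim
    case (elim n)
    have np: "real (n - d) + b + 1 \<notin> \<int>\<^sub>\<le>\<^sub>0" using b by (auto elim!: nonpos_Ints_cases)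
    have g1: "(real (n - d) + b) gchoose (n - d - m) =
       Gamma (real n + (b + 1 - real d)) / (Gamma (real n + (1 - real d - real m)) * Gamma (real m + b + 1))"
    proof -
      have e1: "real (n - d) + b + 1 = real n + (b + 1 - real d)"
        and e2: "real (n - d) + b - real (n - d - m) + 1 = real m + b + 1"
        using elim by (simp_all add: of_nat_diff)
      have "fact (n - d - m) = Gamma (real n + (1 - real d - real m))"
        using Gamma_fact[of "n - d - m", where 'a = real] elim by (simp add: of_nat_diff algebra_simps)
      then show ?thesis using gbinomial_Gamma[OF np, of "n - d - m"] unfolding e1 e2 by simp
    qed
    have g2: "(real (n - d + m) + \<alpha> + b) gchoose m = pochhammer (real n + (\<alpha> + b + 1 - real d)) m / fact m"
      unfolding gbinomial_pochhammer'
      using elim by (simp add: of_nat_diff algebra_simps)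
    have "real n powr (b + real m) * real n ^ m = real n powr b * real n ^ (2 * m)"
      using elim by (simp add: powr_add powr_realpow mult_2 power_add)
    then show ?case
      using elim unfolding edge_coeff_def g1 g2 l_def by (simp add: divide_simps)
  qed
  then show ?thesis using Lim_transform_eventually[OF 1] by (simp add: l_def)
qed

text \<open>The bound \<open>C D\<^sup>m / m!\<close> is uniform in \<open>n\<close>: the first binomial coefficient is at most of order \<open>n\<^sup>b n\<^sup>m\<close>, and
the second one is a product of \<open>m\<close> factors of size at most \<open>D n\<close>, divided by \<open>m!\<close>.\<close>

lemma edge_coeff_bound:
  assumes b: "b > - 1"
  shows "\<exists>C D. D \<ge> 0 \<and> (\<forall>\<^sub>F n in sequentially. \<forall>m. \<bar>edge_coeff \<alpha> b d n m\<bar> \<le> C * D ^ m / fact m)"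
proof -
  define D where "D = 3 + \<bar>\<alpha>\<bar> + \<bar>b\<bar>"
  define \<delta> where "\<delta> = Gamma (b + 1) * min 1 (b + 1)"
  note \<delta> = Gamma_lower_bound[OF b, folded \<delta>_def]
  have "(\<lambda>n. Gamma (real n + (b + 1 - real d)) / Gamma (real n + (1 - real d)) / real n powr b) \<longlonglongrightarrow> 1"
    using Gamma_quotient_tendsto[of "b + 1 - real d" "1 - real d"] by simp
  then have ev: "\<forall>\<^sub>F n in sequentially. Gamma (real n + (b + 1 - real d)) / Gamma (real n + (1 - real d)) / real n powr b < 2"
    by (rule order_tendstoD) simp
  have "\<forall>\<^sub>F n in sequentially. \<forall>m. \<bar>edge_coeff \<alpha> b d n m\<bar> \<le> (2 / \<delta>) * D ^ m / fact m"
    using ev eventually_gt_at_top[of d] eventually_gt_at_top[of 0]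
  proof eventually_elim
    case (elim n)
    show ?case
    proof
      fix m
      show "\<bar>edge_coeff \<alpha> b d n m\<bar> \<le> (2 / \<delta>) * D ^ m / fact m"
      proof (cases "m \<le> n - d")
        case False
        then show ?thesis using \<delta>(2) by (simp add: edge_coeff_def D_def)
      next
        case True
        define N where "N = n - d"
        have N: "m \<le> N" "N \<le> n" using True by (auto simp: N_def)
        have np: "real N + b + 1 \<notin> \<int>\<^sub>\<le>\<^sub>0" using b by (auto elim!: nonpos_Ints_cases)
        have "real N + b - real (N - m) + 1 = real m + b + 1" using N by (simp add: of_nat_diff)
        then have g1: "(real N + b) gchoose (N - m) = Gamma (real N + b + 1) / (fact (N - m) * Gamma (real m + b + 1))"
          using gbinomial_Gamma[OF np, of "N - m"] by (simp only:)
        have g1a: "Gamma (real N + b + 1) \<le> 2 * fact N * real n powr b"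
        proof -
          have "Gamma (real n + (1 - real d)) = fact N"
            using Gamma_fact[of N, where 'a = real] elim(2) by (simp add: N_def of_nat_diff algebra_simps)
          moreover have "real n + (b + 1 - real d) = real N + b + 1" using elim(2) by (simp add: N_def of_nat_diff)
          ultimately have "Gamma (real N + b + 1) / fact N / real n powr b < 2" using elim(1) by (simp only:)
          then show ?thesis using elim(3) by (simp add: divide_simps mult_ac)
        qed
        have g1b: "fact N \<le> real n ^ m * fact (N - m)"
        proof -
          have "fact N = (fact N div fact (N - m)) * (fact (N - m) :: nat)"
            using N by (simp add: fact_dvd)
          also have "\<dots> \<le> N ^ m * fact (N - m)"
            by (intro mult_le_mono1 fact_div_fact_le_pow[OF N(1)])
          also have "\<dots> \<le> n ^ m * fact (N - m)" using N by (intro mult_le_mono1 power_mono) auto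
          finally have "real (fact N) \<le> real (n ^ m * fact (N - m))" by (simp only: of_nat_le_iff)
          then show ?thesis by simp
        qed
        have Gpos: "Gamma (real N + b + 1) > 0" "Gamma (real m + b + 1) > 0"
          using b by (auto intro!: Gamma_real_pos)
        have G1: "\<bar>(real N + b) gchoose (N - m)\<bar> \<le> 2 / \<delta> * (real n powr b * real n ^ m)"
        proof -
          have "\<bar>(real N + b) gchoose (N - m)\<bar> = Gamma (real N + b + 1) / (fact (N - m) * Gamma (real m + b + 1))"
            using Gpos by (simp add: g1)
          also have "\<dots> \<le> (2 * (real n ^ m * fact (N - m)) * real n powr b) / (fact (N - m) * \<delta>)"
          proof (rule frac_le)
            have "2 * fact N * real n powr b \<le> 2 * (real n ^ m * fact (N - m)) * real n powr b"
              using g1b by (intro mult_right_mono mult_left_mono) auto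
            then show "Gamma (real N + b + 1) \<le> 2 * (real n ^ m * fact (N - m)) * real n powr b" using g1a by linarith
          qed (use \<delta> in auto)
          finally show ?thesis by (simp add: mult_ac)
        qed
        have G2: "\<bar>(real (N + m) + \<alpha> + b) gchoose m\<bar> \<le> (D * real n) ^ m / fact m"
        proof -
          have "\<bar>pochhammer (real (N + m) + \<alpha> + b - real m + 1) m\<bar> = (\<Prod>i = 0..<m. \<bar>real (N + m) + \<alpha> + b - real m + 1 + real i\<bar>)"
            by (simp add: pochhammer_prod abs_prod)
          also have "\<dots> \<le> (\<Prod>i = 0..<m. D * real n)"
          proof (intro prod_mono conjI)
            fix i assume "i \<in> {0..<m}"
            then have i: "real i \<le> real n" using N by auto
            have n: "1 \<le> real n" "real N \<le> real n" using elim N by auto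
            have "\<bar>\<alpha>\<bar> * 1 \<le> \<bar>\<alpha>\<bar> * real n" "\<bar>b\<bar> * 1 \<le> \<bar>b\<bar> * real n" using n by (intro mult_left_mono; simp)+
            then have "real N + \<bar>\<alpha>\<bar> + \<bar>b\<bar> + 1 + real i \<le> 3 * real n + \<bar>\<alpha>\<bar> * real n + \<bar>b\<bar> * real n"
              using i n by linarith
            also have "\<dots> = D * real n" by (simp add: D_def distrib_right)
            finally have "real N + \<bar>\<alpha>\<bar> + \<bar>b\<bar> + 1 + real i \<le> D * real n" .
            then show "\<bar>real (N + m) + \<alpha> + b - real m + 1 + real i\<bar> \<le> D * real n"
              using abs_ge_self[of \<alpha>] abs_ge_minus_self[of \<alpha>] abs_ge_self[of b] abs_ge_minus_self[of b]
              by (simp add: abs_le_iff)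
          qed auto
          finally show ?thesis unfolding gbinomial_pochhammer' by (simp add: divide_right_mono)
        qed
        have "\<bar>edge_coeff \<alpha> b d n m\<bar> = \<bar>(real N + b) gchoose (N - m)\<bar> * \<bar>(real (N + m) + \<alpha> + b) gchoose m\<bar> / (real n powr b * real n ^ (2 * m))"
          using True by (simp add: edge_coeff_def N_def abs_mult)
        also have "\<dots> \<le> (2 / \<delta> * (real n powr b * real n ^ m)) * ((D * real n) ^ m / fact m) / (real n powr b * real n ^ (2 * m))"
          using G1 G2 \<delta> by (intro divide_right_mono mult_mono) auto
        also have "\<dots> = (2 / \<delta>) * D ^ m / fact m"
        proof -
          define p where "p = real n powr b"
          define q where "q = real n ^ m"
          have pq: "p \<noteq> 0" "q \<noteq> 0" using elim(3) by (auto simp: p_def q_def)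
          have e: "real n ^ (2 * m) = q * q" "(D * real n) ^ m = D ^ m * q"
            by (simp_all add: q_def power_mult_distrib mult_2 power_add)
          show ?thesis unfolding e p_def[symmetric] q_def[symmetric] using pq by simp
        qed
        finally show ?thesis .
      qed
    qed
  qed
  then show ?thesis by (intro exI[of _ "2 / \<delta>"] exI[of _ D]) (auto simp: D_def)
qed

text \<open>The Mehler-Heine formula.\<close>

lemma edge_P_tendsto:
  assumes "b > - 1"
  shows "(\<lambda>n. edge_P \<alpha> b d n a) \<longlonglongrightarrow> bessel_C b a"
proof -
  obtain C D where "D \<ge> 0" "\<forall>\<^sub>F n in sequentially. \<forall>m. \<bar>edge_coeff \<alpha> b d n m\<bar> \<le> C * D ^ m / fact m"
    using edge_coeff_bound[OF assms] by blast
  then show ?thesis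
    unfolding edge_P_def bessel_C_def by (intro tendsto_power_series edge_coeff_tendsto[OF assms])
qed

lemma edge_P_has_derivative:
  "(edge_P \<alpha> b d n has_real_derivative (\<Sum>m. diffs (edge_coeff \<alpha> b d n) m * a ^ m)) (at a)"
  unfolding edge_P_def
  by (rule termdiffs_strong_converges_everywhere) (auto intro!: summable_finite[of "{..n - d}"] simp: edge_coeff_def split: if_splits)

text \<open>The derivative is needed on the diagonal of the kernel, where the difference quotient degenerates.\<close>

lemma edge_P_derivative_tendsto:
  assumes b: "b > - 1"
  shows "(\<lambda>n. \<Sum>m. diffs (edge_coeff \<alpha> b d n) m * a ^ m) \<longlonglongrightarrow> - bessel_C (b + 1) a"
proof -
  obtain C D where CD: "D \<ge> 0" "\<forall>\<^sub>F n in sequentially. \<forall>m. \<bar>edge_coeff \<alpha> b d n m\<bar> \<le> C * D ^ m / fact m"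
    using edge_coeff_bound[OF assms] by blast
  have "(\<lambda>n. \<Sum>m. diffs (edge_coeff \<alpha> b d n) m * a ^ m) \<longlonglongrightarrow>
      (\<Sum>m. diffs (\<lambda>m. (- 1) ^ m / (fact m * Gamma (real m + b + 1))) m * a ^ m)"
  proof (rule tendsto_power_series[OF _ _ CD(1)])
    show "(\<lambda>n. diffs (edge_coeff \<alpha> b d n) m) \<longlonglongrightarrow> diffs (\<lambda>m. (- 1) ^ m / (fact m * Gamma (real m + b + 1))) m" for m
      unfolding diffs_def by (intro tendsto_mult tendsto_const edge_coeff_tendsto[OF b])
    show "\<forall>\<^sub>F n in sequentially. \<forall>m. \<bar>diffs (edge_coeff \<alpha> b d n) m\<bar> \<le> (C * D) * D ^ m / fact m"
      using CD(2)
    proof eventually_elim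
      case (elim n)
      show ?case
      proof
        fix m
        have "\<bar>diffs (edge_coeff \<alpha> b d n) m\<bar> = real (Suc m) * \<bar>edge_coeff \<alpha> b d n (Suc m)\<bar>"
          by (simp add: diffs_def abs_mult)
        also have "\<dots> \<le> real (Suc m) * (C * D ^ Suc m / fact (Suc m))"
          by (rule mult_left_mono) (use elim in blast, simp)
        also have "\<dots> = (C * D) * D ^ m / fact m" by (simp add: divide_simps)
        finally show "\<bar>diffs (edge_coeff \<alpha> b d n) m\<bar> \<le> (C * D) * D ^ m / fact m" .
      qed
    qed
  qed
  also have "(\<Sum>m. diffs (\<lambda>m. (- 1) ^ m / (fact m * Gamma (real m + b + 1))) m * a ^ m) = - bessel_C (b + 1) a"
    unfolding bessel_C_coeff_shift bessel_C_def using summable_bessel_C[of "b + 1" a] assms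
    by (subst suminf_minus[symmetric]) auto
  finally show ?thesis .
qed

section \<open>The Bessel kernel as limit of the Jacobi kernel\<close>

lemma bessel_C_continuous:
  assumes "b > - 1"
  shows "continuous_on S (bessel_C b)"
  using bessel_C_has_derivative[OF assms] by (meson DERIV_isCont continuous_at_imp_continuous_on)

lemma bessel_C_scaled_has_derivative:
  assumes "b > - 1"
  shows "((\<lambda>t. bessel_C b (a * t)) has_real_derivative - a * bessel_C (b + 1) (a * t)) (at t)"
proof -
  have "((\<lambda>t. a * t) has_real_derivative a) (at t)"
    using DERIV_cmult_Id by blast
  from DERIV_chain2[OF bessel_C_has_derivative[OF assms] this] show ?thesis
    by (simp add: mult.commute)
qed

text \<open>The antiderivative is written \<open>t\<^sup>\<beta>\<^sup>+\<^sup>1 \<Phi>(t)\<close>, so that it vanishes at \<open>0\<close> and only \<open>\<Phi>(1)\<close> remains.\<close>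

lemma bessel_C_integral_FTC:
  assumes \<beta>: "\<beta> > 0"
    and cont: "continuous_on {0..1} \<Phi>"
    and deriv: "\<And>t. 0 < t \<Longrightarrow> t < 1 \<Longrightarrow>
      ((\<lambda>t. t powr (\<beta> + 1) * \<Phi> t) has_real_derivative c * (t powr \<beta> * bessel_C \<beta> (a * t) * bessel_C \<beta> (b * t))) (at t)"
  shows "c * (LBINT t:{0..1}. t powr \<beta> * bessel_C \<beta> (a * t) * bessel_C \<beta> (b * t)) = \<Phi> 1"
proof -
  define f where "f t = t powr \<beta> * bessel_C \<beta> (a * t) * bessel_C \<beta> (b * t)" for t
  have p: "continuous_on {0..1} (\<lambda>t. t powr q)" if "q > 0" for q :: real
    by (rule continuous_on_powr') (use that in \<open>auto intro: continuous_intros\<close>)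
  have J: "continuous_on {0..1} (\<lambda>t. bessel_C \<beta> (x * t))" for x
    by (intro continuous_on_compose2[OF bessel_C_continuous[of \<beta> UNIV]] continuous_intros) (use \<beta> in auto)
  have "continuous_on {0..1} f"
    unfolding f_def by (intro continuous_on_mult p J \<beta>)
  then have i: "set_integrable lborel {0..1} f" by (rule borel_integrable_atLeastAtMost')
  have "((\<lambda>t. c * f t) has_integral (1 powr (\<beta> + 1) * \<Phi> 1 - 0 powr (\<beta> + 1) * \<Phi> 0)) {0..1}"
  proof (rule fundamental_theorem_of_calculus_interior)
    show "continuous_on {0..1} (\<lambda>t. t powr (\<beta> + 1) * \<Phi> t)"
      using \<beta> by (intro continuous_on_mult p cont) auto
    fix t :: real assume "t \<in> {0<..<1}"
    then show "((\<lambda>t. t powr (\<beta> + 1) * \<Phi> t) has_vector_derivative c * f t) (at t)"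
      unfolding f_def has_real_derivative_iff_has_vector_derivative[symmetric] by (intro deriv) auto
  qed simp
  from integral_unique[OF this] have "c * integral {0..1} f = \<Phi> 1" by simp
  moreover have "(LBINT t:{0..1}. f t) = integral {0..1} f"
    using set_borel_integral_eq_integral[OF i] by simp
  ultimately show ?thesis unfolding f_def by simp
qed

lemma powr_Suc_mult_has_derivative:
  assumes t: "0 < t" and d: "(\<Phi> has_real_derivative D) (at t)"
  shows "((\<lambda>t. t powr (\<beta> + 1) * \<Phi> t) has_real_derivative t powr \<beta> * ((\<beta> + 1) * \<Phi> t + t * D)) (at t)"
proof -
  have "((\<lambda>t. t powr (\<beta> + 1)) has_real_derivative (\<beta> + 1) * t powr \<beta>) (at t)"
    using has_real_derivative_powr[OF t, of "\<beta> + 1"] by simp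
  from DERIV_mult[OF this d] show ?thesis
    using t by (simp add: powr_add algebra_simps)
qed

definition bessel_C_kernel :: "real \<Rightarrow> real \<Rightarrow> real \<Rightarrow> real" where
  "bessel_C_kernel \<beta> a b = (LBINT t:{0..1}. t powr \<beta> * bessel_C \<beta> (a * t) * bessel_C \<beta> (b * t))"

text \<open>Lommel's integral. The antiderivative is the Wronskian-like numerator at \<open>(at, bt)\<close>; the recurrence
removes the functions of order \<open>\<beta> + 2\<close> that its derivative contains.\<close>

lemma bessel_C_kernel_off_diagonal:
  assumes "\<beta> > 0" "a \<noteq> b"
  shows "bessel_C_kernel \<beta> a b =
    (bessel_C \<beta> a * (b * bessel_C (\<beta> + 1) b) - a * bessel_C (\<beta> + 1) a * bessel_C \<beta> b) / (b - a)"
proof -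
  define \<Phi> where "\<Phi> t = bessel_C \<beta> (a * t) * (b * bessel_C (\<beta> + 1) (b * t)) - a * bessel_C (\<beta> + 1) (a * t) * bessel_C \<beta> (b * t)" for t
  have d: "(\<Phi> has_real_derivative
      b * (bessel_C \<beta> (a * t) * (- b * bessel_C (\<beta> + 2) (b * t))) + a * (a * bessel_C (\<beta> + 2) (a * t) * bessel_C \<beta> (b * t))) (at t)" for t
  proof -
    note A0 = bessel_C_scaled_has_derivative[of \<beta> a t] and A1 = bessel_C_scaled_has_derivative[of "\<beta> + 1" a t]
      and B0 = bessel_C_scaled_has_derivative[of \<beta> b t] and B1 = bessel_C_scaled_has_derivative[of "\<beta> + 1" b t]
    show ?thesis unfolding \<Phi>_def
      by (rule DERIV_cong[OF DERIV_diff[OF DERIV_mult[OF A0 DERIV_cmult[OF B1]] DERIV_mult[OF DERIV_cmult[OF A1] B0]]])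
         (use assms in \<open>auto simp: algebra_simps\<close>)
  qed
  have "(b - a) * (LBINT t:{0..1}. t powr \<beta> * bessel_C \<beta> (a * t) * bessel_C \<beta> (b * t)) = \<Phi> 1"
  proof (rule bessel_C_integral_FTC[OF assms(1)])
    show "continuous_on {0..1} \<Phi>"
      using d by (meson DERIV_isCont continuous_at_imp_continuous_on)
    fix t :: real assume t: "0 < t" "t < 1"
    have rec: "(\<beta> + 1) * bessel_C (\<beta> + 1) (x * t) - bessel_C \<beta> (x * t) = x * t * bessel_C (\<beta> + 2) (x * t)" for x
      using bessel_C_recurrence[of \<beta> "x * t"] assms by (simp add: algebra_simps)
    have "(\<beta> + 1) * \<Phi> t + t * (b * (bessel_C \<beta> (a * t) * (- b * bessel_C (\<beta> + 2) (b * t))) + a * (a * bessel_C (\<beta> + 2) (a * t) * bessel_C \<beta> (b * t)))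
       = (\<beta> + 1) * \<Phi> t - b * bessel_C \<beta> (a * t) * (b * t * bessel_C (\<beta> + 2) (b * t)) + a * bessel_C \<beta> (b * t) * (a * t * bessel_C (\<beta> + 2) (a * t))"
      by (simp add: algebra_simps)
    also have "\<dots> = (b - a) * (bessel_C \<beta> (a * t) * bessel_C \<beta> (b * t))"
      unfolding rec[symmetric] \<Phi>_def by (simp add: algebra_simps)
    finally show "((\<lambda>t. t powr (\<beta> + 1) * \<Phi> t) has_real_derivative (b - a) * (t powr \<beta> * bessel_C \<beta> (a * t) * bessel_C \<beta> (b * t))) (at t)"
      using powr_Suc_mult_has_derivative[OF t(1) d, of \<beta>] by (simp add: mult_ac)
  qed
  then show ?thesis using assms(2) by (simp add: bessel_C_kernel_def \<Phi>_def field_simps)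
qed

text \<open>The case \<open>a = b\<close> of Lommel's integral, with an antiderivative of its own, since the quotient by \<open>b - a\<close> is
lost. The value is written as the limit \<open>b \<rightarrow> a\<close> of the off-diagonal formula, because this is the
form in which the Jacobi kernel converges.\<close>

lemma bessel_C_kernel_diagonal:
  assumes "\<beta> > 0"
  shows "bessel_C_kernel \<beta> a a =
    bessel_C \<beta> a * (bessel_C (\<beta> + 1) a - a * bessel_C (\<beta> + 2) a) + a * bessel_C (\<beta> + 1) a * bessel_C (\<beta> + 1) a"
proof -
  define A where "A i t = bessel_C (\<beta> + real i) (a * t)" for i t
  have rec: "(\<beta> + 1) * A 1 t - A 0 t = a * t * A 2 t" for t
    using bessel_C_recurrence[of \<beta> "a * t"] assms by (simp add: A_def algebra_simps)
  have dA: "(A i has_real_derivative - a * A (Suc i) t) (at t)" for i t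
    using bessel_C_scaled_has_derivative[of "\<beta> + real i" a t] assms
    unfolding A_def by (simp add: add_ac)
  \<comment> \<open>found by the ansatz of a quadratic form in orders \<open>\<beta>\<close>, \<open>\<beta> + 1\<close> with coefficients affine in \<open>t\<close>\<close>
  define \<Phi> where "\<Phi> t = A 0 t * A 0 t + (a * t) * (A 1 t * A 1 t) - \<beta> * (A 0 t * A 1 t)" for t
  have id: "((\<lambda>t. a * t) has_real_derivative a) (at t)" for t
    using DERIV_cmult_Id by blast
  have d: "(\<Phi> has_real_derivative - 2 * a * (A 0 t * A 1 t) + a * (A 1 t * A 1 t) + (a * t) * (- 2 * a * (A 1 t * A 2 t))
      - \<beta> * (- a * (A 1 t * A 1 t) - a * (A 0 t * A 2 t))) (at t)" for t
    unfolding \<Phi>_def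
    by (rule DERIV_cong[OF DERIV_diff[OF DERIV_add[OF DERIV_mult[OF dA dA] DERIV_mult[OF id DERIV_mult[OF dA dA]]]
         DERIV_cmult[OF DERIV_mult[OF dA dA]]]])
       (simp add: algebra_simps numeral_2_eq_2)
  have "1 * (LBINT t:{0..1}. t powr \<beta> * bessel_C \<beta> (a * t) * bessel_C \<beta> (a * t)) = \<Phi> 1"
  proof (rule bessel_C_integral_FTC[OF assms])
    show "continuous_on {0..1} \<Phi>"
      using d by (meson DERIV_isCont continuous_at_imp_continuous_on)
    fix t :: real assume t: "0 < t" "t < 1"
    have "(\<beta> + 1) * \<Phi> t + t * (- 2 * a * (A 0 t * A 1 t) + a * (A 1 t * A 1 t) + (a * t) * (- 2 * a * (A 1 t * A 2 t))
      - \<beta> * (- a * (A 1 t * A 1 t) - a * (A 0 t * A 2 t)))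
      = (\<beta> + 1) * \<Phi> t - 2 * (a * t) * (A 0 t * A 1 t) + (a * t) * (A 1 t * A 1 t) - 2 * (a * t) * A 1 t * (a * t * A 2 t)
        + \<beta> * (a * t) * (A 1 t * A 1 t) + \<beta> * A 0 t * (a * t * A 2 t)"
      by (simp add: algebra_simps)
    also have "\<dots> = A 0 t * A 0 t"
      unfolding rec[symmetric] \<Phi>_def by (simp add: algebra_simps)
    finally show "((\<lambda>t. t powr (\<beta> + 1) * \<Phi> t) has_real_derivative 1 * (t powr \<beta> * bessel_C \<beta> (a * t) * bessel_C \<beta> (a * t))) (at t)"
      using powr_Suc_mult_has_derivative[OF t(1) d, of \<beta>] by (simp add: mult_ac A_def)
  qed
  moreover have "\<Phi> 1 = A 0 1 * (A 1 1 - a * A 2 1) + a * A 1 1 * A 1 1"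
  proof -
    have "A 0 1 = (\<beta> + 1) * A 1 1 - a * A 2 1" using rec[of 1] by simp
    then have "A 0 1 * A 0 1 = A 0 1 * ((\<beta> + 1) * A 1 1 - a * A 2 1)" by simp
    then show ?thesis unfolding \<Phi>_def by (simp add: algebra_simps)
  qed
  ultimately show ?thesis by (simp add: bessel_C_kernel_def A_def)
qed

lemma bessel_J_integral_eq:
  assumes "0 \<le> a" "0 \<le> b"
  shows "(LBINT t:{0..1}. bessel_J \<beta> (2 * sqrt (a * t)) * bessel_J \<beta> (2 * sqrt (b * t))) =
    a powr (\<beta> / 2) * b powr (\<beta> / 2) * bessel_C_kernel \<beta> a b"
proof -
  have "(LBINT t:{0..1}. bessel_J \<beta> (2 * sqrt (a * t)) * bessel_J \<beta> (2 * sqrt (b * t))) =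
    (LBINT t:{0..1}. (a powr (\<beta> / 2) * b powr (\<beta> / 2)) * (t powr \<beta> * bessel_C \<beta> (a * t) * bessel_C \<beta> (b * t)))"
  proof (rule set_lebesgue_integral_cong)
    show "\<forall>t. t \<in> {0..1} \<longrightarrow> bessel_J \<beta> (2 * sqrt (a * t)) * bessel_J \<beta> (2 * sqrt (b * t)) =
      (a powr (\<beta> / 2) * b powr (\<beta> / 2)) * (t powr \<beta> * bessel_C \<beta> (a * t) * bessel_C \<beta> (b * t))"
    proof (intro allI impI)
      fix t :: real assume t: "t \<in> {0..1}"
      have "t powr \<beta> = t powr (\<beta> / 2) * t powr (\<beta> / 2)" by (simp flip: powr_add)
      then show "bessel_J \<beta> (2 * sqrt (a * t)) * bessel_J \<beta> (2 * sqrt (b * t)) =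
        (a powr (\<beta> / 2) * b powr (\<beta> / 2)) * (t powr \<beta> * bessel_C \<beta> (a * t) * bessel_C \<beta> (b * t))"
        using assms t by (simp add: bessel_J_eq powr_mult)
    qed
  qed simp
  then show ?thesis by (simp add: bessel_C_kernel_def)
qed

lemma bessel_kernel_eq:
  "bessel_kernel \<beta> (4 * a) (4 * b) =
    1 / 4 * (LBINT t:{0..1}. bessel_J \<beta> (2 * sqrt (a * t)) * bessel_J \<beta> (2 * sqrt (b * t)))"
  unfolding bessel_kernel_def by (simp add: real_sqrt_mult mult.assoc)

text \<open>The Gamma quotient in the normalization of the kernel; it grows like \<open>n\<^sup>2\<close>.\<close>

definition gamma_coeff :: "nat \<Rightarrow> real \<Rightarrow> real \<Rightarrow> real" where
  "gamma_coeff n \<alpha> \<beta> = Gamma (real n + 1) * Gamma (real n + \<alpha> + \<beta> + 1) / (Gamma (real n + \<alpha>) * Gamma (real n + \<beta>))"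

lemma gamma_coeff_pos:
  assumes "n \<ge> 1" "\<alpha> > - 1" "\<beta> > 0"
  shows "gamma_coeff n \<alpha> \<beta> > 0"
  unfolding gamma_coeff_def using assms by (intro divide_pos_pos mult_pos_pos Gamma_real_pos) auto

lemma jacobi_coeff_eq: "jacobi_coeff n \<alpha> \<beta> = - gamma_coeff n \<alpha> \<beta> / (2 * real n + \<alpha> + \<beta>)"
  unfolding jacobi_coeff_def gamma_coeff_def by (simp add: mult_ac add_ac)

lemma gamma_coeff_tendsto: "(\<lambda>n. gamma_coeff n \<alpha> \<beta> / (real n)\<^sup>2) \<longlonglongrightarrow> 1"
proof -
  have 1: "(\<lambda>n. (Gamma (real n + 1) / Gamma (real n + \<alpha>) / real n powr (1 - \<alpha>)) *
     (Gamma (real n + (\<alpha> + \<beta> + 1)) / Gamma (real n + \<beta>) / real n powr (\<alpha> + \<beta> + 1 - \<beta>))) \<longlonglongrightarrow> 1 * 1"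
    by (intro tendsto_mult Gamma_quotient_tendsto)
  have "\<forall>\<^sub>F n in sequentially. (Gamma (real n + 1) / Gamma (real n + \<alpha>) / real n powr (1 - \<alpha>)) *
     (Gamma (real n + (\<alpha> + \<beta> + 1)) / Gamma (real n + \<beta>) / real n powr (\<alpha> + \<beta> + 1 - \<beta>)) = gamma_coeff n \<alpha> \<beta> / (real n)\<^sup>2"
    using eventually_gt_at_top[of 0]
  proof eventually_elim
    case (elim n)
    define p q where "p = real n powr (1 - \<alpha>)" and "q = real n powr (\<alpha> + \<beta> + 1 - \<beta>)"
    have "p * q = real n powr 2" by (simp add: p_def q_def flip: powr_add)
    also have "\<dots> = (real n)\<^sup>2" using elim by simp
    finally have e: "(real n)\<^sup>2 = p * q" ..
    show ?case unfolding gamma_coeff_def e p_def[symmetric] q_def[symmetric] by (simp add: add.assoc)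
  qed
  then show ?thesis using Lim_transform_eventually[OF 1] by simp
qed

text \<open>The relation between \<open>P\<^sub>n\<^sub>-\<^sub>1\<close>, \<open>P\<^sub>n\<close> and the polynomial with raised \<open>\<beta>\<close> is linear, and its multiple of \<open>P\<^sub>n\<close> cancels in the
antisymmetric numerator. So \<open>P\<^sub>n\<^sub>-\<^sub>1\<close> can be replaced at the price of a constant factor.\<close>

lemma jacobi_quotient_raise_beta:
  assumes "n \<ge> 1" "\<alpha> > - 1" "\<beta> > 0"
  defines "P \<equiv> \<lambda>y. jacobi_P n \<alpha> \<beta> (1 - 2 * y)"
    and "p \<equiv> \<lambda>y. (1 - y) * jacobi_P (n - 1) \<alpha> (\<beta> + 1) (1 - 2 * y)"
  shows "jacobi_coeff n \<alpha> \<beta> * jacobi_quotient n \<alpha> \<beta> x y =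
    gamma_coeff n \<alpha> \<beta> / (real n + \<beta>) * ((p x * P y - P x * p y) / (x - y))"
proof -
  define s where "s = 2 * real n + \<alpha> + \<beta>"
  have pos: "s \<noteq> 0" "real n + \<beta> \<noteq> 0" using assms by (auto simp: s_def)
  have r: "jacobi_P (n - 1) \<alpha> \<beta> (1 - 2 * y) = (s * p y - real n * P y) / (real n + \<beta>)" for y
  proof -
    have "s * p y = real n * P y + (real n + \<beta>) * jacobi_P (n - 1) \<alpha> \<beta> (1 - 2 * y)"
      unfolding P_def p_def s_def by (rule jacobi_P_raise_beta[OF assms(1)])
    then show ?thesis using pos by (simp add: eq_divide_eq mult.commute)
  qed
  have Pe: "jacobi_P n \<alpha> \<beta> (1 - 2 * z) = P z" for z by (simp add: P_def)
  define B where "B = real n + \<beta>"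
  have num: "P x * ((s * p y - real n * P y) / B) - (s * p x - real n * P x) / B * P y = (s / B) * (P x * p y - p x * P y)"
    by (simp add: diff_divide_distrib algebra_simps)
  have q: "jacobi_quotient n \<alpha> \<beta> x y = (s / B) * ((P x * p y - p x * P y) / (x - y))"
    unfolding jacobi_quotient_def r Pe B_def[symmetric] num by simp
  have neg: "(p x * P y - P x * p y) / (x - y) = - ((P x * p y - p x * P y) / (x - y))"
    by (simp add: minus_divide_left)
  show ?thesis unfolding q neg jacobi_coeff_eq s_def[symmetric] B_def[symmetric] using pos by simp
qed

text \<open>As \<open>jacobi_quotient_raise_beta\<close>, but with the polynomial of the same degree \<open>n\<close> and lowered \<open>\<beta>\<close>. This
choice keeps the Rodrigues order \<open>n\<close> for both polynomials in the numerator.\<close>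

lemma jacobi_quotient_lower_beta:
  assumes "n \<ge> 1" "\<alpha> > - 1" "\<beta> > 0"
  defines "P \<equiv> \<lambda>y. jacobi_P n \<alpha> \<beta> (1 - 2 * y)"
    and "p \<equiv> \<lambda>y. jacobi_P n \<alpha> (\<beta> - 1) (1 - 2 * y)"
  shows "jacobi_coeff n \<alpha> \<beta> * jacobi_quotient n \<alpha> \<beta> x y =
    gamma_coeff n \<alpha> \<beta> / (real n + \<alpha>) * ((p x * P y - P x * p y) / (x - y))"
proof -
  define s where "s = 2 * real n + \<alpha> + \<beta>"
  define K where "K = real n + \<alpha> + \<beta>"
  have pos: "s \<noteq> 0" "real n + \<alpha> \<noteq> 0" using assms by (auto simp: s_def)
  have r: "jacobi_P (n - 1) \<alpha> \<beta> (1 - 2 * y) = (s * p y - K * P y) / (real n + \<alpha>)" for y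
  proof -
    have "s * p y = K * P y + (real n + \<alpha>) * jacobi_P (n - 1) \<alpha> \<beta> (1 - 2 * y)"
      unfolding P_def p_def s_def K_def by (rule jacobi_P_lower_beta[OF assms(1)])
    then show ?thesis using pos by (simp add: eq_divide_eq mult.commute)
  qed
  have Pe: "jacobi_P n \<alpha> \<beta> (1 - 2 * z) = P z" for z by (simp add: P_def)
  define B where "B = real n + \<alpha>"
  have num: "P x * ((s * p y - K * P y) / B) - (s * p x - K * P x) / B * P y = (s / B) * (P x * p y - p x * P y)"
    by (simp add: diff_divide_distrib algebra_simps)
  have q: "jacobi_quotient n \<alpha> \<beta> x y = (s / B) * ((P x * p y - p x * P y) / (x - y))"
    unfolding jacobi_quotient_def r Pe B_def[symmetric] num by simp
  have neg: "(p x * P y - P x * p y) / (x - y) = - ((P x * p y - p x * P y) / (x - y))"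
    by (simp add: minus_divide_left)
  show ?thesis unfolding q neg jacobi_coeff_eq s_def[symmetric] B_def[symmetric] using pos by simp
qed


definition edge_D :: "real \<Rightarrow> real \<Rightarrow> nat \<Rightarrow> nat \<Rightarrow> real \<Rightarrow> real" where
  "edge_D \<alpha> b d n a = (\<Sum>m. diffs (edge_coeff \<alpha> b d n) m * a ^ m)"

text \<open>The numerator of the kernel in edge coordinates divided by \<open>b - a\<close>, completed by its derivative on the
diagonal.\<close>

definition edge_wronskian :: "nat \<Rightarrow> real \<Rightarrow> real \<Rightarrow> real \<Rightarrow> real \<Rightarrow> real" where
  "edge_wronskian n \<alpha> \<beta> a b =
     (if a = b then
        edge_P \<alpha> \<beta> 0 n a * (edge_P \<alpha> (\<beta> + 1) 1 n a + a * edge_D \<alpha> (\<beta> + 1) 1 n a)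
        - a * edge_P \<alpha> (\<beta> + 1) 1 n a * edge_D \<alpha> \<beta> 0 n a
      else (edge_P \<alpha> \<beta> 0 n a * (b * edge_P \<alpha> (\<beta> + 1) 1 n b)
        - a * edge_P \<alpha> (\<beta> + 1) 1 n a * edge_P \<alpha> \<beta> 0 n b) / (b - a))"

lemma edge_wronskian_tendsto:
  assumes "\<beta> > 0"
  shows "(\<lambda>n. edge_wronskian n \<alpha> \<beta> a b) \<longlonglongrightarrow> bessel_C_kernel \<beta> a b"
proof -
  have P: "(\<lambda>n. edge_P \<alpha> c d n x) \<longlonglongrightarrow> bessel_C c x" if "c > - 1" for c d x
    using edge_P_tendsto[OF that] .
  have D: "(\<lambda>n. edge_D \<alpha> c d n x) \<longlonglongrightarrow> - bessel_C (c + 1) x" if "c > - 1" for c d x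
    unfolding edge_D_def using edge_P_derivative_tendsto[OF that] .
  show ?thesis
  proof (cases "a = b")
    case True
    have "bessel_C_kernel \<beta> a b = bessel_C \<beta> a * (bessel_C (\<beta> + 1) a + a * - bessel_C (\<beta> + 1 + 1) a) - a * bessel_C (\<beta> + 1) a * - bessel_C (\<beta> + 1) a"
      using bessel_C_kernel_diagonal[OF assms] True by (simp add: add.assoc)
    moreover have "edge_wronskian n \<alpha> \<beta> a b = edge_P \<alpha> \<beta> 0 n a * (edge_P \<alpha> (\<beta> + 1) 1 n a + a * edge_D \<alpha> (\<beta> + 1) 1 n a)
        - a * edge_P \<alpha> (\<beta> + 1) 1 n a * edge_D \<alpha> \<beta> 0 n a" for n
      using True by (simp add: edge_wronskian_def)
    ultimately show ?thesis using assms
      by (simp only:) (intro tendsto_diff tendsto_mult tendsto_add tendsto_const P D, auto)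
  next
    case False
    then show ?thesis unfolding edge_wronskian_def using assms bessel_C_kernel_off_diagonal[OF assms False]
      by (auto intro!: tendsto_intros P D)
  qed
qed

text \<open>Off the diagonal this is substitution. On the diagonal the limiting value of the quotient is the
derivative of the numerator, as the numerator vanishes at \<open>b = a\<close>.\<close>

lemma jacobi_K_at_edge:
  assumes n: "n \<ge> 1" and par: "\<alpha> > - 1" "\<beta> > 0" and a: "0 \<le> a" "a \<le> (real n)\<^sup>2"
  shows "jacobi_K n \<alpha> \<beta> (1 - a / (real n)\<^sup>2) (1 - b / (real n)\<^sup>2) =
    gamma_coeff n \<alpha> \<beta> * real n / (real n + \<beta>) * (1 - a / (real n)\<^sup>2) powr \<alpha> * a powr \<beta> * edge_wronskian n \<alpha> \<beta> a b"
proof -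
  define N where "N = (real n)\<^sup>2"
  have N: "N > 0" using n by (simp add: N_def)
  define x where "x = 1 - a / N"
  define E0 where "E0 = edge_P \<alpha> \<beta> 0 n"
  define E1 where "E1 b = b * edge_P \<alpha> (\<beta> + 1) 1 n b" for b
  define g where "g b = E0 a * E1 b - E1 a * E0 b" for b
  define g' where "g' = E0 a * (edge_P \<alpha> (\<beta> + 1) 1 n a + a * edge_D \<alpha> (\<beta> + 1) 1 n a) - E1 a * edge_D \<alpha> \<beta> 0 n a"
  define c where "c = gamma_coeff n \<alpha> \<beta> / (real n + \<beta>) * (real n powr (2 * \<beta>) / real n)"
  have jc: "jacobi_coeff n \<alpha> \<beta> \<noteq> 0"
    using gamma_coeff_pos[OF n par] n par unfolding jacobi_coeff_eq by auto
  have ga: "g a = 0" by (simp add: g_def)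
  have P: "jacobi_P n \<alpha> \<beta> (1 - 2 * (1 - b / N)) = (- 1) ^ n * real n powr \<beta> * E0 b" for b
    using jacobi_P_edge[OF n, of 0] by (simp add: E0_def N_def)
  have p: "(1 - (1 - b / N)) * jacobi_P (n - 1) \<alpha> (\<beta> + 1) (1 - 2 * (1 - b / N)) = - ((- 1) ^ n * (real n powr \<beta> / real n) * E1 b)" for b
  proof -
    obtain m where m: "n = Suc m" using n by (cases n) auto
    have e: "real n powr (\<beta> + 1) / N = real n powr \<beta> / real n"
      using n by (simp add: N_def powr_add power2_eq_square)
    have "(b / N) * ((- 1) ^ m * real n powr (\<beta> + 1) * edge_P \<alpha> (\<beta> + 1) 1 n b) = (- 1) ^ m * (real n powr (\<beta> + 1) / N) * E1 b"
      unfolding E1_def by simp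
    then have "(b / N) * ((- 1) ^ m * real n powr (\<beta> + 1) * edge_P \<alpha> (\<beta> + 1) 1 n b) = (- 1) ^ m * (real n powr \<beta> / real n) * E1 b"
      unfolding e .
    then show ?thesis
      using jacobi_P_edge[OF n, of 1 \<alpha> "\<beta> + 1" b] m by (simp add: N_def)
  qed
  have q: "jacobi_coeff n \<alpha> \<beta> * jacobi_quotient n \<alpha> \<beta> x (1 - b / N) = c * N * (g b / (b - a))" for b
  proof -
    have sgn: "((- 1) ^ n) * ((- 1) ^ n) = (1 :: real)" by (simp flip: power_mult_distrib)
    define p Y where "p = real n powr \<beta>" and "Y = real n powr \<beta> / real n"
    have pY: "real n powr (2 * \<beta>) / real n = p * Y" by (simp add: p_def Y_def flip: powr_add)
    have "- ((- 1) ^ n * Y * E1 a) * ((- 1) ^ n * p * E0 b) - ((- 1) ^ n * p * E0 a) * - ((- 1) ^ n * Y * E1 b) =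
       ((- 1) ^ n * (- 1) ^ n) * (p * Y) * g b"
      unfolding g_def by (simp add: algebra_simps)
    then have e1: "- ((- 1) ^ n * (real n powr \<beta> / real n) * E1 a) * ((- 1) ^ n * real n powr \<beta> * E0 b)
       - ((- 1) ^ n * real n powr \<beta> * E0 a) * - ((- 1) ^ n * (real n powr \<beta> / real n) * E1 b) =
       (real n powr (2 * \<beta>) / real n) * g b"
      unfolding sgn pY p_def Y_def by simp
    have e2: "x - (1 - b / N) = (b - a) / N" by (simp add: x_def diff_divide_distrib)
    have "jacobi_coeff n \<alpha> \<beta> * jacobi_quotient n \<alpha> \<beta> x (1 - b / N) =
       gamma_coeff n \<alpha> \<beta> / (real n + \<beta>) * ((real n powr (2 * \<beta>) / real n) * g b / ((b - a) / N))"
      unfolding jacobi_quotient_raise_beta[OF n par] e2[symmetric] e1[symmetric]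
      unfolding x_def P p ..
    then show ?thesis by (simp add: c_def mult_ac)
  qed
  have x01: "0 \<le> x" "x \<le> 1" using a N by (auto simp: x_def N_def field_simps)
  have pw: "(1 - x) powr \<beta> = a powr \<beta> / real n powr (2 * \<beta>)"
  proof -
    have "1 - x = a / N" by (simp add: x_def)
    moreover have "N powr \<beta> = real n powr (2 * \<beta>)" using n by (simp add: N_def powr_powr flip: powr_numeral)
    ultimately show ?thesis using a N by (simp add: powr_divide)
  qed
  have "jacobi_coeff n \<alpha> \<beta> * (if x = 1 - b / N then Lim (at x) (jacobi_quotient n \<alpha> \<beta> x) else jacobi_quotient n \<alpha> \<beta> x (1 - b / N))
     = c * N * edge_wronskian n \<alpha> \<beta> a b"
  proof (cases "a = b")
    case False
    then show ?thesis using q[of b] N by (auto simp: x_def edge_wronskian_def g_def E0_def E1_def)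
  next
    case True
    have dg: "(g has_real_derivative g') (at a)"
    proof -
      have d0: "(E0 has_real_derivative edge_D \<alpha> \<beta> 0 n a) (at a)"
        unfolding E0_def edge_D_def by (rule edge_P_has_derivative)
      have d1: "(E1 has_real_derivative edge_P \<alpha> (\<beta> + 1) 1 n a + a * edge_D \<alpha> (\<beta> + 1) 1 n a) (at a)"
        unfolding E1_def[abs_def] edge_D_def
        by (rule DERIV_cong[OF DERIV_mult[OF DERIV_ident edge_P_has_derivative]]) simp
      show ?thesis unfolding g_def[abs_def] g'_def by (intro DERIV_diff DERIV_cmult d0 d1)
    qed
    then have lim: "((\<lambda>b. (g b - g a) / (b - a)) \<longlongrightarrow> g') (at a)"
      by (simp add: has_field_derivative_iff)
    have "filterlim (\<lambda>y. N * (1 - y)) (at a) (at x)"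
    proof (rule filterlim_atI)
      have "((\<lambda>y. N * (1 - y)) \<longlongrightarrow> N * (1 - x)) (at x)" by (intro tendsto_intros)
      then show "((\<lambda>y. N * (1 - y)) \<longlongrightarrow> a) (at x)" using N by (simp add: x_def)
      show "\<forall>\<^sub>F y in at x. N * (1 - y) \<noteq> a"
        using N by (auto simp: eventually_at_filter x_def field_simps)
    qed
    from filterlim_compose[OF lim this]
    have "((\<lambda>y. c * N / jacobi_coeff n \<alpha> \<beta> * (g (N * (1 - y)) / (N * (1 - y) - a))) \<longlongrightarrow> c * N / jacobi_coeff n \<alpha> \<beta> * g') (at x)"
      unfolding ga diff_0_right by (intro tendsto_mult tendsto_const)
    moreover have "c * N / jacobi_coeff n \<alpha> \<beta> * (g (N * (1 - y)) / (N * (1 - y) - a)) = jacobi_quotient n \<alpha> \<beta> x y" for y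
    proof -
      have "1 - N * (1 - y) / N = y" using N by simp
      then have Z: "jacobi_coeff n \<alpha> \<beta> * jacobi_quotient n \<alpha> \<beta> x y = c * N * (g (N * (1 - y)) / (N * (1 - y) - a))"
        using q[of "N * (1 - y)"] by (simp only:)
      have "c * N / jacobi_coeff n \<alpha> \<beta> * (g (N * (1 - y)) / (N * (1 - y) - a)) =
          c * N * (g (N * (1 - y)) / (N * (1 - y) - a)) / jacobi_coeff n \<alpha> \<beta>"
        by (simp only: times_divide_eq_left)
      then show ?thesis unfolding Z[symmetric] using jc by simp
    qed
    ultimately have "(jacobi_quotient n \<alpha> \<beta> x \<longlongrightarrow> c * N / jacobi_coeff n \<alpha> \<beta> * g') (at x)"
      by simp
    then have "Lim (at x) (jacobi_quotient n \<alpha> \<beta> x) = c * N / jacobi_coeff n \<alpha> \<beta> * g'"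
      by (intro tendsto_Lim) simp_all
    then show ?thesis using True jc by (simp add: x_def edge_wronskian_def g'_def E0_def E1_def)
  qed
  then have "jacobi_K n \<alpha> \<beta> x (1 - b / N) = x powr \<alpha> * (1 - x) powr \<beta> * (c * N * edge_wronskian n \<alpha> \<beta> a b)"
    unfolding jacobi_K_def using x01 by (simp add: mult_ac)
  also have "\<dots> = (c * N / real n powr (2 * \<beta>)) * x powr \<alpha> * a powr \<beta> * edge_wronskian n \<alpha> \<beta> a b"
    unfolding pw by simp
  also have "c * N / real n powr (2 * \<beta>) = gamma_coeff n \<alpha> \<beta> * real n / (real n + \<beta>)"
    using n by (simp add: c_def N_def power2_eq_square)
  finally show ?thesis by (simp add: x_def N_def)
qed

lemma tendsto_edge_point: "(\<lambda>n. 1 - a / (real n)\<^sup>2) \<longlonglongrightarrow> 1"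
proof -
  have "(\<lambda>n. 1 - a * (inverse (real n) * inverse (real n))) \<longlonglongrightarrow> 1 - a * (0 * 0)"
    by (intro tendsto_intros lim_inverse_n)
  then show ?thesis by (simp add: power2_eq_square divide_inverse)
qed

lemma eventually_le_n_squared: "\<forall>\<^sub>F n in sequentially. a \<le> (real n)\<^sup>2"
proof -
  have "filterlim (\<lambda>n. (real n)\<^sup>2) at_top sequentially"
    by (intro filterlim_pow_at_top filterlim_real_sequentially) simp
  then show ?thesis by (simp add: filterlim_at_top)
qed

lemma jacobi_K_edge_tendsto:
  assumes par: "\<alpha> > - 1" "\<beta> > 0" and a: "0 \<le> a"
  shows "(\<lambda>n. jacobi_K n \<alpha> \<beta> (1 - a / (real n)\<^sup>2) (1 - b / (real n)\<^sup>2) / (real n)\<^sup>2) \<longlonglongrightarrow>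
    a powr \<beta> * bessel_C_kernel \<beta> a b"
proof -
  have 1: "(\<lambda>n. gamma_coeff n \<alpha> \<beta> / (real n)\<^sup>2 / ((real n + \<beta>) / real n) * (1 - a / (real n)\<^sup>2) powr \<alpha>
      * (a powr \<beta> * edge_wronskian n \<alpha> \<beta> a b)) \<longlonglongrightarrow> 1 / 1 * 1 powr \<alpha> * (a powr \<beta> * bessel_C_kernel \<beta> a b)"
    by (intro tendsto_mult tendsto_divide gamma_coeff_tendsto tendsto_add_const_over_n tendsto_const
        tendsto_powr tendsto_edge_point edge_wronskian_tendsto par) auto
  have "\<forall>\<^sub>F n in sequentially. gamma_coeff n \<alpha> \<beta> / (real n)\<^sup>2 / ((real n + \<beta>) / real n) * (1 - a / (real n)\<^sup>2) powr \<alpha>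
      * (a powr \<beta> * edge_wronskian n \<alpha> \<beta> a b) = jacobi_K n \<alpha> \<beta> (1 - a / (real n)\<^sup>2) (1 - b / (real n)\<^sup>2) / (real n)\<^sup>2"
    using eventually_ge_at_top[of 1] eventually_le_n_squared[of a]
  proof eventually_elim
    case (elim n)
    show ?case unfolding jacobi_K_at_edge[OF elim(1) par a elim(2)] by (simp add: mult_ac)
  qed
  then show ?thesis using Lim_transform_eventually[OF 1] by simp
qed

section \<open>Beta integrals and the truncated negative binomial series\<close>

lemma set_lebesgue_halfline_open_closed:
  fixes f :: "real \<Rightarrow> real"
  assumes [measurable]: "f \<in> borel_measurable borel"
  shows "set_integrable lborel {0..} f \<longleftrightarrow> set_integrable lborel {0<..} f"
    and "(LBINT t:{0..}. f t) = (LBINT t:{0<..}. f t)"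
proof -
  have ae: "AE t in lborel. indicator {0..} t *\<^sub>R f t = indicator {0<..} t *\<^sub>R f t"
    using AE_lborel_singleton[of 0] by eventually_elim (auto simp: indicator_def)
  show "set_integrable lborel {0..} f \<longleftrightarrow> set_integrable lborel {0<..} f"
    unfolding set_integrable_def by (rule integrable_cong_AE[OF _ _ ae]) auto
  show "(LBINT t:{0..}. f t) = (LBINT t:{0<..}. f t)"
    unfolding set_lebesgue_integral_def by (rule integral_cong_AE[OF _ _ ae]) auto
qed

text \<open>Antiderivative \<open>- (1+t)\<^sup>1\<^sup>-\<^sup>N / (N-1)\<close>.\<close>

lemma inverse_power_integral:
  assumes "N \<ge> 2"
  shows "set_integrable lborel {0<..} (\<lambda>t::real. 1 / (1 + t) ^ N)"
    "(LBINT t:{0<..}. 1 / (1 + t) ^ N) = 1 / (real N - 1)"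
proof -
  obtain M where M: "N = Suc (Suc M)" using assms by (metis Suc_le_D numeral_2_eq_2 Suc_le_mono)
  define F where "F t = - (1 / (real M + 1)) * inverse ((1 + t) ^ Suc M)" for t :: real
  have d: "(F has_real_derivative 1 / (1 + t) ^ N) (at t)" if "0 < t" for t
  proof -
    have nz: "1 + t \<noteq> 0" using that by simp
    have "((\<lambda>t. 1 + t) has_real_derivative 1) (at t)" by (auto intro!: derivative_eq_intros)
    from DERIV_inverse_fun[OF DERIV_power[OF this, of "Suc M"]] nz
    have "((\<lambda>t. inverse ((1 + t) ^ Suc M)) has_real_derivative
        - (real (Suc M) * (1 * (1 + t) ^ M) * inverse (((1 + t) ^ Suc M) ^ 2))) (at t)"
      by (simp add: numeral_2_eq_2 del: power_Suc)
    then have "(F has_real_derivative - (1 / (real M + 1)) * - (real (Suc M) * (1 * (1 + t) ^ M) * inverse (((1 + t) ^ Suc M) ^ 2))) (at t)"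
      unfolding F_def by (rule DERIV_cmult)
    also have "- (1 / (real M + 1)) * - (real (Suc M) * (1 * (1 + t) ^ M) * inverse (((1 + t) ^ Suc M) ^ 2)) = 1 / (1 + t) ^ N"
    proof -
      define z where "z = 1 + t"
      have "z \<noteq> 0" "real (Suc M) = real M + 1" "real M + 1 \<noteq> 0" using nz by (auto simp: z_def)
      then show ?thesis unfolding M z_def[symmetric] by (simp add: divide_simps power2_eq_square)
    qed
    finally show ?thesis .
  qed
  have top: "(F \<longlongrightarrow> - (1 / (real M + 1)) * 0) at_top"
    unfolding F_def
    by (intro tendsto_mult tendsto_const tendsto_inverse_0_at_top filterlim_pow_at_top filterlim_tendsto_add_at_top[OF tendsto_const]
        filterlim_ident) auto
  have c: "isCont F 0" unfolding F_def by (intro continuous_intros) auto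
  have "((F \<circ> real_of_ereal) \<longlongrightarrow> - (1 / (real M + 1))) (at_right (ereal 0))"
    using c unfolding isCont_def by (simp add: ereal_tendsto_simps F_def filterlim_at_split)
  moreover have "((F \<circ> real_of_ereal) \<longlongrightarrow> 0) (at_left \<infinity>)"
    using top by (simp add: ereal_tendsto_simps)
  ultimately have "set_integrable lborel (einterval (ereal 0) \<infinity>) (\<lambda>t. 1 / (1 + t) ^ N)
     \<and> (LBINT t=ereal 0..\<infinity>. 1 / (1 + t) ^ N) = 0 - (- (1 / (real M + 1)))"
    by (intro conjI interval_integral_FTC_nonneg[where F = F]) (auto intro!: d continuous_intros AE_I2)
  then show "set_integrable lborel {0<..} (\<lambda>t::real. 1 / (1 + t) ^ N)"
    "(LBINT t:{0<..}. 1 / (1 + t) ^ N) = 1 / (real N - 1)"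
    by (auto simp: interval_integral_to_infinity_eq M)
qed

lemma power_quotient_integrable:
  assumes "j + 2 \<le> N"
  shows "set_integrable lborel {0<..} (\<lambda>t::real. t ^ j / (1 + t) ^ N)"
proof (rule set_integrable_bound)
  show "set_integrable lborel {0<..} (\<lambda>t::real. 1 / (1 + t) ^ (N - j))"
    using assms by (intro inverse_power_integral) auto
  show "set_borel_measurable lborel {0<..} (\<lambda>t::real. t ^ j / (1 + t) ^ N)"
    unfolding set_borel_measurable_def by measurable
  show "AE t in lborel. (t::real) \<in> {0<..} \<longrightarrow> norm (t ^ j / (1 + t) ^ N) \<le> norm (1 / (1 + t) ^ (N - j))"
  proof (intro AE_I2 impI)
    fix t :: real assume "t \<in> {0<..}"
    then have t: "0 < t" by simp
    have e: "(1 + t) ^ N = (1 + t) ^ j * (1 + t) ^ (N - j)"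
      using assms by (simp flip: power_add)
    have "t ^ j / (1 + t) ^ N \<le> (1 + t) ^ j / (1 + t) ^ N"
      using t by (intro divide_right_mono power_mono) auto
    also have "\<dots> = 1 / (1 + t) ^ (N - j)"
      unfolding e using t by simp
    finally show "norm (t ^ j / (1 + t) ^ N) \<le> norm (1 / (1 + t) ^ (N - j))"
      using t by simp
  qed
qed

text \<open>Integer case of the beta integral on the half-line. The derivative of \<open>t\<^sup>j\<^sup>+\<^sup>1 (1+t)\<^sup>-\<^sup>M\<close> has integral zero
and links the integrals for \<open>(j, M)\<close> and \<open>(j+1, M+1)\<close>.\<close>

lemma power_quotient_integral:
  assumes "j + 2 \<le> N"
  shows "(LBINT t:{0<..}. (t::real) ^ j / (1 + t) ^ N) = fact j * fact (N - 2 - j) / fact (N - 1)"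
  using assms
proof (induction j arbitrary: N)
  case 0
  then obtain M where M: "N = Suc (Suc M)" by (metis Suc_le_D numeral_2_eq_2 Suc_le_mono add_0)
  have "(LBINT t:{0<..}. (t::real) ^ 0 / (1 + t) ^ N) = 1 / (real N - 1)"
    unfolding power_0 by (rule inverse_power_integral(2)) (simp add: M)
  also have "\<dots> = fact 0 * fact (N - 2 - 0) / fact (N - 1)"
    by (simp add: M)
  finally show ?case .
next
  case (Suc j)
  then obtain M where M: "N = Suc M" "j + 2 \<le> M" by (cases N) auto
  define F where "F t = t ^ Suc j * inverse ((1 + t) ^ M)" for t :: real
  define f where "f t = (real j + 1) * (t ^ j / (1 + t) ^ M) - real M * (t ^ Suc j / (1 + t) ^ N)" for t :: real
  have d: "(F has_real_derivative f t) (at t)" if "0 < t" for t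
  proof -
    have nz: "1 + t \<noteq> 0" using that by simp
    have "((\<lambda>t. 1 + t) has_real_derivative 1) (at t)" by (auto intro!: derivative_eq_intros)
    from DERIV_inverse_fun[OF DERIV_power[OF this, of M]] nz
    have 1: "((\<lambda>t. inverse ((1 + t) ^ M)) has_real_derivative
        - (real M * (1 * (1 + t) ^ (M - 1)) * inverse (((1 + t) ^ M) ^ 2))) (at t)"
      by (simp add: numeral_2_eq_2 del: power_Suc)
    have 2: "((\<lambda>t. t ^ Suc j) has_real_derivative real (Suc j) * t ^ j) (at t)"
      using DERIV_pow[of "Suc j" t] by (simp del: power_Suc)
    have key: "(1 + t) ^ (M - 1) * inverse (((1 + t) ^ M)\<^sup>2) = 1 / (1 + t) ^ N"
    proof -
      obtain K where K: "M = Suc K" using M(2) by (cases M) auto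
      define z where "z = 1 + t"
      have "z \<noteq> 0" using nz by (simp add: z_def)
      then show ?thesis unfolding z_def[symmetric] M(1) K by (simp add: divide_simps power2_eq_square)
    qed
    have "real M * (1 * (1 + t) ^ (M - 1)) * inverse (((1 + t) ^ M) ^ 2) = real M * (1 / (1 + t) ^ N)"
      unfolding mult_1_left mult.assoc key ..
    then have "real (Suc j) * t ^ j * inverse ((1 + t) ^ M) + - (real M * (1 * (1 + t) ^ (M - 1)) * inverse (((1 + t) ^ M) ^ 2)) * t ^ Suc j = f t"
      unfolding f_def by (simp only: divide_inverse of_nat_Suc) (simp add: mult_ac add.commute[of 1])
    then show ?thesis unfolding F_def using DERIV_mult[OF 2 1] by simp
  qed
  have i: "set_integrable lborel {0<..} (\<lambda>t::real. t ^ j / (1 + t) ^ M)" "set_integrable lborel {0<..} (\<lambda>t::real. t ^ Suc j / (1 + t) ^ N)"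
    by (rule power_quotient_integrable[OF M(2)] power_quotient_integrable[OF Suc.prems])+
  have top: "(F \<longlongrightarrow> 0) at_top"
  proof (rule tendsto_sandwich)
    show "\<forall>\<^sub>F t in at_top. 0 \<le> F t" using eventually_gt_at_top[of 0] by eventually_elim (simp add: F_def)
    show "\<forall>\<^sub>F t in at_top. F t \<le> inverse t" using eventually_gt_at_top[of 0]
    proof eventually_elim
      case (elim t)
      have "t ^ Suc j * t \<le> (1 + t) ^ Suc (Suc j)"
        using elim power_mono[of t "1 + t" "Suc (Suc j)"] by (simp add: mult_ac)
      also have "\<dots> \<le> (1 + t) ^ M" using elim M by (intro power_increasing) auto
      finally show ?case using elim by (simp add: F_def divide_simps mult_ac)
    qed
    show "((\<lambda>t::real. inverse t) \<longlongrightarrow> 0) at_top" by (rule tendsto_inverse_0_at_top[OF filterlim_ident])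
  qed auto
  have c: "isCont F 0" unfolding F_def by (intro continuous_intros) auto
  have "(LBINT t=ereal 0..\<infinity>. f t) = 0 - 0"
  proof (rule interval_integral_FTC_integrable[where F = F])
    show "((F \<circ> real_of_ereal) \<longlongrightarrow> 0) (at_right (ereal 0))"
      using c unfolding isCont_def by (simp add: ereal_tendsto_simps F_def filterlim_at_split)
    show "((F \<circ> real_of_ereal) \<longlongrightarrow> 0) (at_left \<infinity>)"
      using top by (simp add: ereal_tendsto_simps)
    show "set_integrable lborel (einterval (ereal 0) \<infinity>) f"
      unfolding f_def einterval_eq_Ici by (intro set_integral_diff(1) set_integrable_mult_right i)
    fix t assume "ereal 0 < ereal t"
    then have t: "0 < t" by simp
    show "(F has_vector_derivative f t) (at t)"
      using d[OF t] by (simp add: has_real_derivative_iff_has_vector_derivative)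
    show "isCont f t" unfolding f_def using t by (intro continuous_intros) auto
  qed auto
  then have "(LBINT t:{0<..}. f t) = 0" by (simp add: interval_integral_to_infinity_eq)
  moreover have "(LBINT t:{0<..}. f t) = (real j + 1) * (LBINT t:{0<..}. t ^ j / (1 + t) ^ M) - real M * (LBINT t:{0<..}. t ^ Suc j / (1 + t) ^ N)"
    unfolding f_def using i by (simp only: set_integral_diff(2) set_integrable_mult_right set_integral_mult_right)
  ultimately have A: "real M * (LBINT t:{0<..}. t ^ Suc j / (1 + t) ^ N) = (real j + 1) * (fact j * fact (M - 2 - j) / fact (M - 1))"
    unfolding Suc.IH[OF M(2)] by linarith
  have nz: "real M \<noteq> 0" using M(2) by simp
  have B: "fact M = real M * fact (M - 1)" using M(2) by (intro fact_reduce) simp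
  have "(LBINT t:{0<..}. t ^ Suc j / (1 + t) ^ N) = (real j + 1) * (fact j * fact (M - 2 - j) / fact (M - 1)) / real M"
    unfolding A[symmetric] using nz by simp
  also have "\<dots> = fact (Suc j) * fact (M - 2 - j) / fact M"
    unfolding B by (simp add: add.commute mult_ac)
  finally show ?case unfolding M(1) by (simp del: power_Suc fact_Suc)
qed

lemma gbinomial_shift_pos:
  assumes "c > - 1" "k \<le> n"
  shows "((real n + c) gchoose k) > 0"
proof -
  have "real n + c - real k + 1 > 0" using assms by linarith
  then show ?thesis unfolding gbinomial_pochhammer' by (intro divide_pos_pos pochhammer_pos) auto
qed

text \<open>To the right of the interval of orthogonality, which is \<open>y \<le> 0\<close> for the argument \<open>1 - 2y\<close>, every summand of
the definition is nonnegative.\<close>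

lemma jacobi_P_nonneg:
  assumes "\<alpha> > - 1" "\<beta> > - 1" "s \<ge> 0"
  shows "0 \<le> jacobi_P n \<alpha> \<beta> (1 - 2 * (- s))"
  unfolding jacobi_P_eq_sum using assms
  by (intro sum_nonneg mult_nonneg_nonneg) (auto intro!: less_imp_le[OF gbinomial_shift_pos])

text \<open>Up to a shift by \<open>\<alpha>\<close> in the index these are the coefficients \<open>Gamma (N+j)/j!\<close> of the negative binomial
series of \<open>(1-r)\<^sup>-\<^sup>N\<close> with \<open>N = n + \<beta> + 1\<close>.\<close>

definition nb_coeff :: "nat \<Rightarrow> real \<Rightarrow> real \<Rightarrow> nat \<Rightarrow> real" where
  "nb_coeff n \<alpha> \<beta> j = Gamma (real n + real j + \<alpha> + \<beta> + 1) / Gamma (real j + \<alpha> + 1)"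

definition nb_sum :: "nat \<Rightarrow> real \<Rightarrow> real \<Rightarrow> real \<Rightarrow> real" where
  "nb_sum n \<alpha> \<beta> r = (\<Sum>j<n. nb_coeff n \<alpha> \<beta> j * r ^ j)"

definition nb_moment :: "nat \<Rightarrow> real \<Rightarrow> real \<Rightarrow> real \<Rightarrow> real" where
  "nb_moment n \<alpha> \<beta> r = (\<Sum>j<n. real j * (nb_coeff n \<alpha> \<beta> j * r ^ j))"

lemma nb_coeff_pos:
  assumes "n \<ge> 1" "\<alpha> > - 1" "\<beta> > 0"
  shows "nb_coeff n \<alpha> \<beta> j > 0"
  unfolding nb_coeff_def using assms by (intro divide_pos_pos Gamma_real_pos) auto

text \<open>Consecutive coefficients satisfy \<open>(j+1+\<alpha>) c\<^sub>j\<^sub>+\<^sub>1 = (n+j+\<alpha>+\<beta>+1) c\<^sub>j\<close>. Multiplying by \<open>r\<^sup>j\<^sup>+\<^sup>1\<close> and summing relates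
the sum and the first moment. The two ends of the sum leave a term at \<open>j = 0\<close> and the cut-off term at
\<open>j = n - 1\<close>; the latter carries the limit law.\<close>

lemma nb_recurrence:
  assumes n: "n \<ge> 1" and par: "\<alpha> > - 1" "\<beta> > 0"
  shows "(1 - r) * (nb_moment n \<alpha> \<beta> r + \<alpha> * nb_sum n \<alpha> \<beta> r) =
    (real n + \<beta> + 1) * r * nb_sum n \<alpha> \<beta> r + \<alpha> * nb_coeff n \<alpha> \<beta> 0
    - (2 * real n + \<alpha> + \<beta>) * nb_coeff n \<alpha> \<beta> (n - 1) * r ^ n"
proof -
  obtain m where m: "n = Suc m" using n by (cases n) auto
  define c where "c = nb_coeff n \<alpha> \<beta>"
  have rec: "(real (Suc j) + \<alpha>) * c (Suc j) = (real n + real j + \<alpha> + \<beta> + 1) * c j" for j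
  proof -
    have 1: "Gamma (real n + real (Suc j) + \<alpha> + \<beta> + 1) = (real n + real j + \<alpha> + \<beta> + 1) * Gamma (real n + real j + \<alpha> + \<beta> + 1)"
      using Gamma_pochhammer[of "real n + real j + \<alpha> + \<beta> + 1" 1] n par by (simp add: add_ac)
    have 2: "Gamma (real (Suc j) + \<alpha> + 1) = (real j + \<alpha> + 1) * Gamma (real j + \<alpha> + 1)"
      using Gamma_pochhammer[of "real j + \<alpha> + 1" 1] par by (simp add: add_ac)
    have nz: "real j + \<alpha> + 1 \<noteq> 0" and e: "real (Suc j) + \<alpha> = real j + \<alpha> + 1" using par by auto
    show ?thesis unfolding c_def nb_coeff_def 1 2 unfolding e using nz by simp
  qed
  define T where "T = (\<Sum>j<n. (real j + \<alpha>) * (c j * r ^ j))"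
  have T: "nb_moment n \<alpha> \<beta> r + \<alpha> * nb_sum n \<alpha> \<beta> r = T"
    unfolding T_def nb_moment_def nb_sum_def c_def by (simp add: sum_distrib_left sum.distrib distrib_right)
  have "T = \<alpha> * c 0 + (\<Sum>j<m. (real (Suc j) + \<alpha>) * c (Suc j) * r ^ Suc j)"
    unfolding T_def m by (subst sum.lessThan_Suc_shift) (simp add: mult.assoc)
  also have "\<dots> = \<alpha> * c 0 + (\<Sum>j<m. (real n + real j + \<alpha> + \<beta> + 1) * c j * r ^ Suc j)"
    unfolding rec ..
  also have "(\<Sum>j<m. (real n + real j + \<alpha> + \<beta> + 1) * c j * r ^ Suc j) =
      (\<Sum>j<n. (real n + real j + \<alpha> + \<beta> + 1) * c j * r ^ Suc j) - (2 * real n + \<alpha> + \<beta>) * c (n - 1) * r ^ n"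
    unfolding m by simp
  finally have T1: "T = \<alpha> * c 0 + ((\<Sum>j<n. (real n + real j + \<alpha> + \<beta> + 1) * c j * r ^ Suc j) - (2 * real n + \<alpha> + \<beta>) * c (n - 1) * r ^ n)" .
  have "T - r * T = (\<alpha> * c 0 + ((\<Sum>j<n. (real n + real j + \<alpha> + \<beta> + 1) * c j * r ^ Suc j) - (2 * real n + \<alpha> + \<beta>) * c (n - 1) * r ^ n)) - r * T"
    using T1 by (simp only:)
  also have "\<dots> = \<alpha> * c 0 - (2 * real n + \<alpha> + \<beta>) * c (n - 1) * r ^ n +
      (\<Sum>j<n. (real n + real j + \<alpha> + \<beta> + 1) * c j * r ^ Suc j - r * ((real j + \<alpha>) * (c j * r ^ j)))"
    by (simp add: sum_subtractf T_def sum_distrib_left)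
  also have "(\<Sum>j<n. (real n + real j + \<alpha> + \<beta> + 1) * c j * r ^ Suc j - r * ((real j + \<alpha>) * (c j * r ^ j))) =
      (real n + \<beta> + 1) * r * nb_sum n \<alpha> \<beta> r"
    unfolding nb_sum_def sum_distrib_left c_def by (intro sum.cong refl) (simp add: algebra_simps)
  finally show ?thesis unfolding T c_def by (simp add: algebra_simps)
qed

text \<open>Log-convexity of Gamma: \<open>x + s\<close> and \<open>y\<close> are complementary convex combinations of \<open>x\<close> and \<open>y + s\<close>.\<close>

lemma Gamma_ratio_mono:
  assumes "0 < x" "x \<le> y" "0 \<le> (s::real)"
  shows "Gamma (x + s) / Gamma x \<le> Gamma (y + s) / Gamma y"
proof (cases "y + s = x")
  case True
  then have "s = 0" "y = x" using assms by linarith+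
  then show ?thesis by simp
next
  case False
  define f where "f = ln \<circ> (Gamma :: real \<Rightarrow> real)"
  have L: "y + s - x > 0" using False assms by linarith
  define t where "t = s / (y + s - x)"
  have t: "0 \<le> t" "t \<le> 1" using assms L by (auto simp: t_def)
  have tl: "t * (y + s - x) = s" using L by (simp add: t_def)
  have e1: "(1 - t) * x + t * (y + s) = x + s" using tl by (simp add: algebra_simps)
  have e2: "(1 - (1 - t)) * x + (1 - t) * (y + s) = y" using tl by (simp add: algebra_simps)
  have "f ((1 - t) *\<^sub>R x + t *\<^sub>R (y + s)) \<le> (1 - t) * f x + t * f (y + s)"
    unfolding f_def by (rule convex_onD[OF log_convex_Gamma_real]) (use assms t in auto)
  moreover have "f ((1 - (1 - t)) *\<^sub>R x + (1 - t) *\<^sub>R (y + s)) \<le> (1 - (1 - t)) * f x + (1 - t) * f (y + s)"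
    unfolding f_def by (rule convex_onD[OF log_convex_Gamma_real]) (use assms t in auto)
  ultimately have "f (x + s) + f y \<le> f x + f (y + s)"
    unfolding real_scaleR_def e1 e2 by (simp add: algebra_simps)
  moreover have g0: "0 < Gamma x" "0 < Gamma y" "0 < Gamma (x + s)" "0 < Gamma (y + s)"
    using assms by (auto intro!: Gamma_real_pos)
  moreover from g0 have g: "Gamma x \<noteq> 0" "Gamma y \<noteq> 0" "Gamma (x + s) \<noteq> 0" "Gamma (y + s) \<noteq> 0"
    by (metis less_irrefl)+
  ultimately have "ln (Gamma (x + s) * Gamma y) \<le> ln (Gamma x * Gamma (y + s))"
    using g by (simp add: f_def ln_mult)
  then have "Gamma (x + s) * Gamma y \<le> Gamma x * Gamma (y + s)"
    using g0 by (subst (asm) ln_le_cancel_iff) auto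
  moreover note g0
  ultimately show ?thesis by (simp add: divide_le_eq pos_le_divide_eq mult.commute) 
qed

text \<open>The binomial series with negative exponent, with its coefficients written as Gamma quotients.\<close>

lemma negative_binomial_sums:
  assumes "0 < N" "0 \<le> r" "r < (1::real)"
  shows "(\<lambda>i. Gamma (real i + N) / fact i * r ^ i) sums (Gamma N * (1 - r) powr (- N))"
proof -
  have "(\<lambda>i. (- N gchoose i) * (- r) ^ i) sums (1 + - r) powr (- N)"
    by (rule gen_binomial_real) (use assms in auto)
  from sums_mult[OF this, of "Gamma N"]
  have "(\<lambda>i. Gamma N * ((- N gchoose i) * (- r) ^ i)) sums (Gamma N * (1 - r) powr (- N))" by simp
  moreover have "Gamma N * ((- N gchoose i) * (- r) ^ i) = Gamma (real i + N) / fact i * r ^ i" for i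
  proof -
    have "Gamma (real i + N) = pochhammer N i * Gamma N"
      using Gamma_pochhammer[OF assms(1), of i] by (simp add: add.commute)
    moreover have "(- N gchoose i) * (- r) ^ i = pochhammer N i / fact i * r ^ i"
    proof -
      have sgn: "(- 1) ^ i * (- 1) ^ i = (1 :: real)" by (simp flip: power_mult_distrib)
      have "(- N gchoose i) * (- r) ^ i = ((- 1) ^ i * (- 1) ^ i) * (pochhammer N i / fact i * r ^ i)"
        unfolding gbinomial_pochhammer power_minus[of r] minus_minus by (simp only: times_divide_eq_left times_divide_eq_right mult_ac)
      then show ?thesis unfolding sgn by simp
    qed
    ultimately show ?thesis by simp
  qed
  ultimately show ?thesis by simp
qed

text \<open>Replacing \<open>\<alpha>\<close> by an integer \<open>m \<ge> \<alpha>\<close> increases the coefficients (\<open>Gamma_ratio_mono\<close>) and makes them those of the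
full negative binomial series, shifted by \<open>m\<close>.\<close>

lemma nb_sum_le:
  assumes n: "n \<ge> 1" and par: "\<alpha> > - 1" "\<beta> > 0" and m: "\<alpha> \<le> real m" and r: "0 < r" "r < 1"
  shows "nb_sum n \<alpha> \<beta> r \<le> Gamma (real n + \<beta> + 1) * (1 - r) powr (- (real n + \<beta> + 1)) / r ^ m"
proof -
  define N where "N = real n + \<beta> + 1"
  define g where "g i = Gamma (real i + N) / fact i * r ^ i" for i
  have N: "N > 0" using par by (simp add: N_def)
  have gs: "g sums (Gamma N * (1 - r) powr (- N))"
    unfolding g_def using negative_binomial_sums[OF N] r by simp
  have gpos: "g i \<ge> 0" for i unfolding g_def using N r by (intro mult_nonneg_nonneg divide_nonneg_pos less_imp_le[OF Gamma_real_pos]) auto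
  have "nb_sum n \<alpha> \<beta> r * r ^ m = (\<Sum>j<n. nb_coeff n \<alpha> \<beta> j * r ^ (j + m))"
    by (simp add: nb_sum_def sum_distrib_right power_add mult.assoc)
  also have "\<dots> \<le> (\<Sum>j<n. g (j + m))"
  proof (rule sum_mono)
    fix j
    have "Gamma ((real j + \<alpha> + 1) + (real n + \<beta>)) / Gamma (real j + \<alpha> + 1) \<le> Gamma ((real j + real m + 1) + (real n + \<beta>)) / Gamma (real j + real m + 1)"
      by (rule Gamma_ratio_mono) (use par m in auto)
    moreover have "Gamma (real j + real m + 1) = fact (j + m)"
      using Gamma_fact[of "j + m", where 'a = real] by (simp add: add_ac)
    ultimately have "nb_coeff n \<alpha> \<beta> j \<le> Gamma (real (j + m) + N) / fact (j + m)"
      by (simp add: nb_coeff_def N_def add_ac)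
    then show "nb_coeff n \<alpha> \<beta> j * r ^ (j + m) \<le> g (j + m)"
      unfolding g_def using r by (intro mult_right_mono) auto
  qed
  also have "\<dots> = sum g ((\<lambda>j. j + m) ` {..<n})"
    by (subst sum.reindex) auto
  also have "\<dots> \<le> suminf g"
    using gs gpos by (intro sum_le_suminf) (auto simp: sums_iff)
  also have "suminf g = Gamma N * (1 - r) powr (- N)" using gs by (simp add: sums_iff)
  finally show ?thesis using r by (simp add: N_def pos_le_divide_eq)
qed

section \<open>Averages of the kernel over the radial variable\<close>

text \<open>Writing \<open>1 - v = (y - v) + (1 - y)\<close> in the numerator with lowered \<open>\<beta>\<close> frees one Rodrigues derivative from the
denominator. It gives the main term; the two summands with \<open>1/(y - v)\<close> turn out to be smaller.\<close>

lemma jacobi_K_split: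
  assumes n: "n \<ge> 1" and par: "\<alpha> > - 1" "\<beta> > 0" and v: "0 < v" "v < 1" "v < y"
  shows "jacobi_K n \<alpha> \<beta> v y = gamma_coeff n \<alpha> \<beta> / (real n + \<alpha>) *
    (- jacobi_P n \<alpha> \<beta> (1 - 2 * y) * rodrigues (real n + \<alpha>) (real n + (\<beta> - 1)) n v
     + (- jacobi_P n \<alpha> \<beta> (1 - 2 * y) * (1 - y) * (1 / (y - v) * rodrigues (real n + \<alpha>) (real n + (\<beta> - 1)) n v)
     + jacobi_P n \<alpha> (\<beta> - 1) (1 - 2 * y) * (1 / (y - v) * rodrigues (real n + \<alpha>) (real n + \<beta>) n v)))"
proof -
  define P where "P y = jacobi_P n \<alpha> \<beta> (1 - 2 * y)" for y
  define p where "p y = jacobi_P n \<alpha> (\<beta> - 1) (1 - 2 * y)" for y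
  define g where "g = gamma_coeff n \<alpha> \<beta> / (real n + \<alpha>)"
  define q where "q = v powr \<alpha> * (1 - v) powr (\<beta> - 1) * p v"
  define z where "z = v powr \<alpha> * (1 - v) powr \<beta> * P v"
  have q: "rodrigues (real n + \<alpha>) (real n + (\<beta> - 1)) n v = q"
    and z: "rodrigues (real n + \<alpha>) (real n + \<beta>) n v = z"
    unfolding q_def z_def p_def P_def using v by (intro rodrigues_eq_jacobi_P; simp)+
  have w: "v powr \<alpha> * (1 - v) powr \<beta> * p v = (1 - v) * q"
    using v by (simp add: q_def powr_diff)
  have "jacobi_K n \<alpha> \<beta> v y = v powr \<alpha> * (1 - v) powr \<beta> * (jacobi_coeff n \<alpha> \<beta> * jacobi_quotient n \<alpha> \<beta> v y)"
    using v by (simp add: jacobi_K_def)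
  also have "\<dots> = g * ((v powr \<alpha> * (1 - v) powr \<beta> * p v * P y - z * p y) / (v - y))"
    unfolding jacobi_quotient_lower_beta[OF n par] P_def[symmetric] p_def[symmetric] g_def[symmetric] z_def
    by (simp add: right_diff_distrib mult_ac)
  also have "(v powr \<alpha> * (1 - v) powr \<beta> * p v * P y - z * p y) / (v - y) =
      - P y * q + (- P y * (1 - y) * (1 / (y - v) * q) + p y * (1 / (y - v) * z))"
    unfolding w using v by (simp add: divide_simps) (simp add: algebra_simps)
  finally show ?thesis unfolding q z P_def p_def g_def .
qed

text \<open>The averages over \<open>v\<close> involve the two exponents \<open>e = n - 1\<close> and \<open>e = n - 2\<close>.\<close>

definition power_mean :: "real \<Rightarrow> nat \<Rightarrow> (real \<Rightarrow> real) \<Rightarrow> real" where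
  "power_mean r e f = (LBINT v:{0<..<r}. (1 - v / r) ^ e * f v)"

text \<open>All but \<open>n - 1 - e\<close> of the derivatives are integrated away.\<close>

lemma power_mean_rodrigues:
  assumes "r > 0" "r < 1" "A > real n - 1" "e < n"
  shows "power_mean r e (rodrigues A B n) = fact e * fact (n - 1 - e) / fact n * rodrigues A B (n - 1 - e) r / r ^ e"
proof -
  obtain m where m: "n = Suc m" using assms by (cases n) auto
  have "power_mean r e (rodrigues A B n) = (LBINT v:{0<..<r}. (1 / r ^ e) * ((r - v) ^ e * rodrigues A B n v))"
    unfolding power_mean_def
  proof (rule set_lebesgue_integral_cong)
    have "1 - v / r = (r - v) / r" for v using assms by (simp add: diff_divide_distrib)
    then show "\<forall>v. v \<in> {0<..<r} \<longrightarrow> (1 - v / r) ^ e * rodrigues A B n v = (1 / r ^ e) * ((r - v) ^ e * rodrigues A B n v)"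
      by (simp add: power_divide)
  qed simp
  also have "\<dots> = (1 / r ^ e) * (LBINT v:{0<..<r}. (r - v) ^ e * rodrigues A B n v)"
    by simp
  also have "(LBINT v:{0<..<r}. (r - v) ^ e * rodrigues A B n v) = fact e * fact (n - 1 - e) / fact n * rodrigues A B (n - 1 - e) r"
    using rodrigues_integral_power[of m A r e B] assms unfolding m by (simp add: field_simps del: fact_Suc)
  finally show ?thesis by simp
qed

lemma power_mean_quotient:
  assumes "r > 0" "r < 1" "r < y" "A > real n - 1" "e \<le> n"
  shows "power_mean r e (\<lambda>v. 1 / (y - v) * rodrigues A B n v) =
    (- (y - r)) ^ e / (fact n * r ^ e) *
      ((\<Sum>i\<in>{e..<n}. (- 1) ^ i * fact i * fact (n - 1 - i) * rodrigues A B (n - 1 - i) r / (y - r) ^ (i + 1))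
      + (- 1) ^ n * fact n * (LBINT v:{0<..<r}. 1 / (y - v) ^ Suc n * rodrigues A B 0 v))"
    (is "_ = _ * ?X")
proof -
  have "power_mean r e (\<lambda>v. 1 / (y - v) * rodrigues A B n v) = (LBINT v:{0<..<r}. (1 / r ^ e) * ((r - v) ^ e / (y - v) * rodrigues A B n v))"
    unfolding power_mean_def
  proof (rule set_lebesgue_integral_cong)
    have "1 - v / r = (r - v) / r" for v using assms by (simp add: diff_divide_distrib)
    then show "\<forall>v. v \<in> {0<..<r} \<longrightarrow> (1 - v / r) ^ e * (1 / (y - v) * rodrigues A B n v) = (1 / r ^ e) * ((r - v) ^ e / (y - v) * rodrigues A B n v)"
      by (simp add: power_divide)
  qed simp
  also have "\<dots> = (1 / r ^ e) * (LBINT v:{0<..<r}. (r - v) ^ e / (y - v) * rodrigues A B n v)"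
    by (rule set_integral_mult_right)
  also have "(LBINT v:{0<..<r}. (r - v) ^ e / (y - v) * rodrigues A B n v) = (- (y - r)) ^ e * ?X / fact n"
  proof -
    have "fact n * (LBINT v:{0<..<r}. (r - v) ^ e / (y - v) * rodrigues A B n v) = (- (y - r)) ^ e * ?X"
      by (rule rodrigues_integral_power_quotient) (use assms in auto)
    then show ?thesis by (simp add: eq_divide_eq mult.commute)
  qed
  finally show ?thesis by (simp add: mult_ac)
qed

lemma one_plus_over_square_power_le:
  assumes "n \<ge> 1" "A \<ge> 0"
  shows "(1 + A / (real n)\<^sup>2) ^ n \<le> exp A"
proof -
  have "(1 + A / (real n)\<^sup>2) ^ n \<le> exp (A / (real n)\<^sup>2) ^ n"
    using assms exp_ge_add_one_self[of "A / (real n)\<^sup>2"] by (intro power_mono) auto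
  also have "\<dots> = exp (real n * (A / (real n)\<^sup>2))" by (rule exp_of_nat_mult[symmetric])
  also have "real n * (A / (real n)\<^sup>2) = A / real n" using assms by (simp add: power2_eq_square)
  also have "exp (A / real n) \<le> exp A"
    using assms by (simp add: divide_le_eq mult_le_cancel_left1)
  finally show ?thesis .
qed

lemma powr_le_of_quarter:
  assumes "1 / 4 \<le> z" "z \<le> (1::real)"
  shows "z powr b \<le> 4 powr \<bar>b\<bar>"
proof (cases "b \<ge> 0")
  case True
  have "z powr b \<le> 1 powr b" using assms True by (intro powr_mono2) auto
  also have "\<dots> \<le> 4 powr \<bar>b\<bar>" by (simp add: ge_one_powr_ge_zero)
  finally show ?thesis .
next
  case False
  have "z powr b \<le> (1 / 4) powr b" using assms False by (intro powr_mono2') auto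
  also have "(1 / 4 :: real) powr b = 4 powr \<bar>b\<bar>" using False by (simp add: powr_divide powr_minus_divide)
  finally show ?thesis .
qed

text \<open>Any bound depending on \<open>\<alpha>\<close>, \<open>b\<close> and \<open>A\<close> alone would do; this one is what the estimates below add up to.\<close>

definition remainder_const :: "real \<Rightarrow> real \<Rightarrow> real \<Rightarrow> real" where
  "remainder_const \<alpha> b A = 4 powr \<bar>\<alpha>\<bar> * 4 powr \<bar>b\<bar> * (64 * (3 + \<bar>\<alpha>\<bar> + \<bar>b\<bar>)) + 16 * (8 * exp (8 * A) * 4 powr \<bar>b\<bar>) * 4 powr \<bar>\<alpha>\<bar>"

context
  fixes n :: nat and r y \<alpha> b A :: real
  assumes n: "n \<ge> 2" and r: "1 / 4 \<le> r" "r \<le> 3 / 4" and y: "y \<le> 1" "1 / 8 \<le> y - r" "1 - y \<le> A / (real n)\<^sup>2"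
    and par: "\<alpha> > - 1" and A: "A \<ge> 0"
begin

text \<open>As \<open>1 - y \<le> A/n\<^sup>2\<close>, the quotient \<open>(1-v)/(y-v)\<close> is at most \<open>1 + 8A/n\<^sup>2\<close>, so its \<open>n\<close>-th power is bounded. What remains is the
integral of \<open>v\<^sup>n\<^sup>+\<^sup>\<alpha>\<close>, and this gives the factor \<open>1/n\<close>.\<close>

lemma remainder_integral_bound:
  "\<bar>LBINT v:{0<..<r}. 1 / (y - v) ^ Suc n * rodrigues (real n + \<alpha>) (real n + b) 0 v\<bar>
     \<le> 8 * exp (8 * A) * 4 powr \<bar>b\<bar> * (r powr (real n + \<alpha> + 1) / real n)"
proof -
  define M where "M = 8 * exp (8 * A) * 4 powr \<bar>b\<bar>"
  have i: "set_integrable lborel {0<..<r} (\<lambda>v. v powr (real n + \<alpha>) * 1)"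
    using r par by (intro set_integrable_powr_times_continuous) auto
  have bnd: "norm (1 / (y - v) ^ Suc n * rodrigues (real n + \<alpha>) (real n + b) 0 v) \<le> M * v powr (real n + \<alpha>)"
    if v: "v \<in> {0<..<r}" for v
  proof -
    have yv: "1 / 8 \<le> y - v" using v y by auto
    have ov: "1 / 4 \<le> 1 - v" "1 - v \<le> 1" using v r by auto
    have "(1 - v) / (y - v) = 1 + (1 - y) / (y - v)" using yv by (simp add: field_simps)
    also have "(1 - y) / (y - v) \<le> (A / (real n)\<^sup>2) / (1 / 8)"
      using yv y A by (intro frac_le) auto
    finally have "(1 - v) / (y - v) \<le> 1 + 8 * A / (real n)\<^sup>2" by (simp add: mult.commute)
    then have "((1 - v) / (y - v)) ^ n \<le> (1 + 8 * A / (real n)\<^sup>2) ^ n"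
      using yv ov by (intro power_mono divide_nonneg_pos) auto
    also have "\<dots> \<le> exp (8 * A)" using n A by (intro one_plus_over_square_power_le) auto
    finally have 1: "((1 - v) / (y - v)) ^ n \<le> exp (8 * A)" .
    have 2: "(1 - v) powr b \<le> 4 powr \<bar>b\<bar>" by (rule powr_le_of_quarter[OF ov])
    have 3: "1 / (y - v) \<le> 8" using yv by (simp add: divide_le_eq)
    have "1 / (y - v) ^ Suc n * rodrigues (real n + \<alpha>) (real n + b) 0 v =
       (1 / (y - v)) * ((1 - v) / (y - v)) ^ n * (1 - v) powr b * v powr (real n + \<alpha>)"
      using ov by (simp add: rodrigues_0 powr_add powr_realpow power_divide)
    moreover have "(1 / (y - v)) * ((1 - v) / (y - v)) ^ n * (1 - v) powr b * v powr (real n + \<alpha>) \<le>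
       8 * exp (8 * A) * 4 powr \<bar>b\<bar> * v powr (real n + \<alpha>)"
      using 1 2 3 yv ov by (intro mult_right_mono mult_mono) auto
    ultimately show ?thesis using yv ov by (simp add: M_def rodrigues_0)
  qed
  have "\<bar>LBINT v:{0<..<r}. 1 / (y - v) ^ Suc n * rodrigues (real n + \<alpha>) (real n + b) 0 v\<bar>
      \<le> (LBINT v:{0<..<r}. M * v powr (real n + \<alpha>))"
  proof -
    have "norm (LBINT v:{0<..<r}. 1 / (y - v) ^ Suc n * rodrigues (real n + \<alpha>) (real n + b) 0 v)
      \<le> (LBINT v:{0<..<r}. norm (1 / (y - v) ^ Suc n * rodrigues (real n + \<alpha>) (real n + b) 0 v))"
      by (intro set_integral_norm_bound set_integrable_rodrigues continuous_intros) (use r y par in auto)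
    also have "\<dots> \<le> (LBINT v:{0<..<r}. M * v powr (real n + \<alpha>))"
    proof (rule set_integral_mono)
      show "set_integrable lborel {0<..<r} (\<lambda>v. norm (1 / (y - v) ^ Suc n * rodrigues (real n + \<alpha>) (real n + b) 0 v))"
        by (intro set_integrable_norm set_integrable_rodrigues continuous_intros) (use r y par in auto)
      show "set_integrable lborel {0<..<r} (\<lambda>v. M * v powr (real n + \<alpha>))"
        using i by (intro set_integrable_mult_right) simp
    qed (use bnd in blast)
    finally show ?thesis by simp
  qed
  also have "(LBINT v:{0<..<r}. M * v powr (real n + \<alpha>)) = M * (r powr (real n + \<alpha> + 1) / (real n + \<alpha> + 1))"
  proof -
    have "(LBINT v:{0<..<r}. v powr (real n + \<alpha>)) = integral {0<..<r} (\<lambda>v. v powr (real n + \<alpha>))"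
      using set_borel_integral_eq_integral(2)[OF i] by simp
    also have "\<dots> = integral {0..r} (\<lambda>v. v powr (real n + \<alpha>))"
      by (rule integral_open_interval_real[symmetric])
    also have "\<dots> = r powr (real n + \<alpha> + 1) / (real n + \<alpha> + 1)"
      using r par by (intro integral_unique has_integral_powr_from_0) auto
    finally show ?thesis by simp
  qed
  also have "\<dots> \<le> M * (r powr (real n + \<alpha> + 1) / real n)"
    using n par by (intro mult_left_mono divide_left_mono) (auto simp: M_def)
  finally show ?thesis by (simp add: M_def)
qed

text \<open>Each derivative of \<open>v\<^sup>n\<^sup>+\<^sup>\<alpha> (1-v)\<^sup>n\<^sup>+\<^sup>b\<close> costs a factor of order \<open>n\<close> in the bulk.\<close>

lemma rodrigues_bounds:
  defines "KL \<equiv> 4 powr \<bar>\<alpha>\<bar> * 4 powr \<bar>b\<bar>"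
  shows "\<bar>rodrigues (real n + \<alpha>) (real n + b) 0 r\<bar> \<le> r ^ n * (1 - r) ^ n * KL"
    and "\<bar>rodrigues (real n + \<alpha>) (real n + b) 1 r\<bar> \<le> r ^ n * (1 - r) ^ n * KL * (4 * (2 + \<bar>\<alpha>\<bar> + \<bar>b\<bar>) * real n)"
proof -
  have ra: "r powr \<alpha> \<le> 4 powr \<bar>\<alpha>\<bar>" and rb: "(1 - r) powr b \<le> 4 powr \<bar>b\<bar>"
    using r by (intro powr_le_of_quarter; simp)+
  have R0: "rodrigues (real n + \<alpha>) (real n + b) 0 r = r ^ n * (1 - r) ^ n * (r powr \<alpha> * (1 - r) powr b)"
    using r by (simp add: rodrigues_0 powr_add powr_realpow mult_ac)
  have "r powr \<alpha> * (1 - r) powr b \<le> KL"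
    unfolding KL_def by (intro mult_mono ra rb) auto
  then have R0b: "r ^ n * (1 - r) ^ n * (r powr \<alpha> * (1 - r) powr b) \<le> r ^ n * (1 - r) ^ n * KL"
    using r by (intro mult_left_mono) auto
  then show "\<bar>rodrigues (real n + \<alpha>) (real n + b) 0 r\<bar> \<le> r ^ n * (1 - r) ^ n * KL"
    unfolding R0 using r by simp
  have R1: "rodrigues (real n + \<alpha>) (real n + b) 1 r =
     r ^ n * (1 - r) ^ n * (r powr \<alpha> * (1 - r) powr b) * ((real n + \<alpha>) / r - (real n + b) / (1 - r))"
  proof -
    define w where "w = 1 - r"
    have e: "rodrigues A B 1 r = A * (r powr (A - 1) * (1 - r) powr B) - B * (r powr A * (1 - r) powr (B - 1))" for A B
      by (simp add: rodrigues_def)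
    have "0 < w" "0 < r" using r by (auto simp: w_def)
    then show ?thesis unfolding e w_def[symmetric]
      by (simp add: powr_add powr_diff powr_realpow divide_simps) (simp add: algebra_simps)
  qed
  have "\<bar>(real n + \<alpha>) / r - (real n + b) / (1 - r)\<bar> \<le> \<bar>real n + \<alpha>\<bar> / r + \<bar>real n + b\<bar> / (1 - r)"
    using r abs_triangle_ineq4[of "(real n + \<alpha>) / r" "(real n + b) / (1 - r)"] by (simp add: abs_divide)
  also have "\<dots> \<le> (real n + \<bar>\<alpha>\<bar> * real n) / (1 / 4) + (real n + \<bar>b\<bar> * real n) / (1 / 4)"
  proof -
    have "\<bar>\<alpha>\<bar> * 1 \<le> \<bar>\<alpha>\<bar> * real n" "\<bar>b\<bar> * 1 \<le> \<bar>b\<bar> * real n" using n by (intro mult_left_mono; simp)+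
    then have "\<bar>real n + \<alpha>\<bar> \<le> real n + \<bar>\<alpha>\<bar> * real n" "\<bar>real n + b\<bar> \<le> real n + \<bar>b\<bar> * real n" by linarith+
    then show ?thesis using r by (intro add_mono frac_le) auto
  qed
  also have "\<dots> = 4 * (2 + \<bar>\<alpha>\<bar> + \<bar>b\<bar>) * real n" by (simp add: algebra_simps)
  finally have 1: "\<bar>(real n + \<alpha>) / r - (real n + b) / (1 - r)\<bar> \<le> 4 * (2 + \<bar>\<alpha>\<bar> + \<bar>b\<bar>) * real n" .
  have "\<bar>rodrigues (real n + \<alpha>) (real n + b) 1 r\<bar> =
     (r ^ n * (1 - r) ^ n * (r powr \<alpha> * (1 - r) powr b)) * \<bar>(real n + \<alpha>) / r - (real n + b) / (1 - r)\<bar>"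
    unfolding R1 using r by (simp add: abs_mult)
  also have "\<dots> \<le> (r ^ n * (1 - r) ^ n * KL) * (4 * (2 + \<bar>\<alpha>\<bar> + \<bar>b\<bar>) * real n)"
    using R0b 1 r by (intro mult_mono) (auto simp: KL_def)
  finally show "\<bar>rodrigues (real n + \<alpha>) (real n + b) 1 r\<bar> \<le> r ^ n * (1 - r) ^ n * KL * (4 * (2 + \<bar>\<alpha>\<bar> + \<bar>b\<bar>) * real n)" .
qed

text \<open>By \<open>power_mean_quotient\<close> only one or two boundary values and the fully integrated remainder are left.
The factorials give each of them a factor \<open>1/n\<close>, and \<open>y - r \<le> 1 - r\<close> makes the powers of \<open>y - r\<close> at most
\<open>(1-r)\<^sup>n\<close> up to constants.\<close>

lemma power_mean_quotient_bound:
  assumes e: "e = n - 1 \<or> e = n - 2"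
  shows "\<bar>power_mean r e (\<lambda>v. 1 / (y - v) * rodrigues (real n + \<alpha>) (real n + b) n v)\<bar> \<le> remainder_const \<alpha> b A / real n * (1 - r) ^ n"
proof -
  define c where "c = y - r"
  define KL where "KL = 4 powr \<bar>\<alpha>\<bar> * 4 powr \<bar>b\<bar>"
  define L where "L = 4 powr \<bar>\<alpha>\<bar>"
  define C0 where "C0 = 8 * exp (8 * A) * 4 powr \<bar>b\<bar>"
  define R where "R i = \<bar>rodrigues (real n + \<alpha>) (real n + b) i r\<bar>" for i
  define V where "V = \<bar>LBINT v:{0<..<r}. 1 / (y - v) ^ Suc n * rodrigues (real n + \<alpha>) (real n + b) 0 v\<bar>"
  define D where "D = 2 + \<bar>\<alpha>\<bar> + \<bar>b\<bar>"
  have c: "1 / 8 \<le> c" "c \<le> 1 - r" "0 < c" using y r by (auto simp: c_def)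
  have pos: "KL \<ge> 0" "L \<ge> 0" "C0 \<ge> 0" "D \<ge> 0" "(1 - r) ^ n \<ge> 0" "0 < r ^ n"
    using r by (auto simp: KL_def L_def C0_def D_def)
  have R0: "R 0 \<le> r ^ n * ((1 - r) ^ n * KL)" and R1: "R 1 \<le> r ^ n * ((1 - r) ^ n * KL * (4 * D * real n))"
    using rodrigues_bounds unfolding R_def KL_def D_def by (simp_all add: mult_ac)
  have V: "V \<le> r ^ n * (C0 * L / real n)"
  proof -
    have "r powr (real n + \<alpha> + 1) = r ^ n * (r powr \<alpha> * r)"
      using r by (simp add: powr_add powr_realpow)
    also have "\<dots> \<le> r ^ n * (L * 1)"
      unfolding L_def using r by (intro mult_left_mono mult_mono powr_le_of_quarter) auto
    finally have "C0 * (r powr (real n + \<alpha> + 1) / real n) \<le> C0 * (r ^ n * L / real n)"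
      using pos by (intro mult_left_mono divide_right_mono) auto
    then show ?thesis using remainder_integral_bound unfolding V_def C0_def[symmetric] by (simp add: mult_ac)
  qed
  \<comment> \<open>the constant \<open>16\<close> pays for at most two missing factors \<open>1 - r \<ge> 1/4\<close>\<close>
  have cp: "c ^ k / r ^ k * (r ^ n * Z) \<le> 16 * ((1 - r) ^ n * Z)" if "k \<le> n" "n - k \<le> 2" "0 \<le> Z" for k Z
  proof -
    have "c ^ k \<le> (1 - r) ^ k" using c by (intro power_mono) auto
    also have "(1 - r) ^ k \<le> 16 * (1 - r) ^ n"
    proof -
      have "(1 / 4) ^ 2 \<le> (1 / 4 :: real) ^ (n - k)" using that by (intro power_decreasing) auto
      also have "\<dots> \<le> (1 - r) ^ (n - k)" using r by (intro power_mono) auto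
      finally have "1 \<le> 16 * (1 - r) ^ (n - k)" by (simp add: power2_eq_square)
      then have "(1 - r) ^ k * 1 \<le> (1 - r) ^ k * (16 * (1 - r) ^ (n - k))" using r by (intro mult_left_mono) auto
      also have "\<dots> = 16 * ((1 - r) ^ k * (1 - r) ^ (n - k))" by simp
      also have "(1 - r) ^ k * (1 - r) ^ (n - k) = (1 - r) ^ n" using that by (simp flip: power_add)
      finally show ?thesis by simp
    qed
    finally have ck: "c ^ k \<le> 16 * (1 - r) ^ n" .
    have rk: "r ^ n = r ^ k * r ^ (n - k)" using that by (simp flip: power_add)
    have "c ^ k / r ^ k * (r ^ n * Z) = c ^ k * (r ^ (n - k) * Z)"
      unfolding rk using r by simp
    also have "\<dots> \<le> (16 * (1 - r) ^ n) * (1 * Z)"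
      using ck r c that by (intro mult_mono mult_nonneg_nonneg) (auto intro: power_le_one)
    finally show ?thesis by simp
  qed
  have rq: "1 / r ^ k * (r ^ n * Z) \<le> Z" if "k \<le> n" "0 \<le> Z" for k Z
  proof -
    have rk: "r ^ n = r ^ k * r ^ (n - k)" using that by (simp flip: power_add)
    have "1 / r ^ k * (r ^ n * Z) = r ^ (n - k) * Z" unfolding rk using r by simp
    also have "\<dots> \<le> 1 * Z" using r that by (intro mult_right_mono power_le_one) auto
    finally show ?thesis by simp
  qed
  have t0: "1 / (real n * c * r ^ k) * R 0 \<le> 8 / real n * ((1 - r) ^ n * KL)" if "k \<le> n" for k
  proof -
    have "1 / r ^ k * R 0 \<le> 1 / r ^ k * (r ^ n * ((1 - r) ^ n * KL))"
      using R0 r by (intro mult_left_mono) auto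
    also have "\<dots> \<le> (1 - r) ^ n * KL" using that pos by (intro rq) auto
    finally have 1: "1 / r ^ k * R 0 \<le> (1 - r) ^ n * KL" .
    have "1 / c \<le> 8" using c by (simp add: divide_le_eq)
    then have "1 / c * (1 / r ^ k * R 0) \<le> 8 * ((1 - r) ^ n * KL)"
      by (rule mult_mono[OF _ 1]) (use c r in \<open>auto simp: R_def\<close>)
    then have "1 / real n * (1 / c * (1 / r ^ k * R 0)) \<le> 1 / real n * (8 * ((1 - r) ^ n * KL))"
      by (intro mult_left_mono) auto
    then show ?thesis by simp
  qed
  have tV: "c ^ k / r ^ k * V \<le> 16 * ((1 - r) ^ n * (C0 * L / real n))" if "k \<le> n" "n - k \<le> 2" for k
  proof -
    have "c ^ k / r ^ k * V \<le> c ^ k / r ^ k * (r ^ n * (C0 * L / real n))"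
      using V c r by (intro mult_left_mono) auto
    also have "\<dots> \<le> 16 * ((1 - r) ^ n * (C0 * L / real n))"
      using that pos by (intro cp) auto
    finally show ?thesis .
  qed
  have tri: "\<bar>power_mean r e (\<lambda>v. 1 / (y - v) * rodrigues (real n + \<alpha>) (real n + b) n v)\<bar> \<le>
     c ^ e / (fact n * r ^ e) * ((\<Sum>i\<in>{e..<n}. fact i * fact (n - 1 - i) * R (n - 1 - i) / c ^ (i + 1)) + fact n * V)"
  proof -
    define S where "S = (\<Sum>i\<in>{e..<n}. (- 1) ^ i * fact i * fact (n - 1 - i) * rodrigues (real n + \<alpha>) (real n + b) (n - 1 - i) r / (y - r) ^ (i + 1))"
    define W where "W = (LBINT v:{0<..<r}. 1 / (y - v) ^ Suc n * rodrigues (real n + \<alpha>) (real n + b) 0 v)"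
    have "\<bar>S\<bar> \<le> (\<Sum>i\<in>{e..<n}. \<bar>(- 1) ^ i * fact i * fact (n - 1 - i) * rodrigues (real n + \<alpha>) (real n + b) (n - 1 - i) r / (y - r) ^ (i + 1)\<bar>)"
      unfolding S_def by (rule sum_abs)
    also have "\<dots> = (\<Sum>i\<in>{e..<n}. fact i * fact (n - 1 - i) * R (n - 1 - i) / c ^ (i + 1))"
      using c by (intro sum.cong refl) (simp add: R_def c_def[symmetric] abs_mult abs_divide power_abs del: power_Suc)
    finally have S: "\<bar>S\<bar> \<le> \<dots>" .
    have "\<bar>S + (- 1) ^ n * fact n * W\<bar> \<le> \<bar>S\<bar> + fact n * V"
      using abs_triangle_ineq[of S "(- 1) ^ n * fact n * W"] by (simp add: abs_mult V_def W_def)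
    then have T: "\<bar>S + (- 1) ^ n * fact n * W\<bar> \<le> (\<Sum>i\<in>{e..<n}. fact i * fact (n - 1 - i) * R (n - 1 - i) / c ^ (i + 1)) + fact n * V"
      using S by linarith
    have "power_mean r e (\<lambda>v. 1 / (y - v) * rodrigues (real n + \<alpha>) (real n + b) n v) = (- c) ^ e / (fact n * r ^ e) * (S + (- 1) ^ n * fact n * W)"
      unfolding S_def W_def c_def using r y par e by (intro power_mean_quotient) auto
    then have "\<bar>power_mean r e (\<lambda>v. 1 / (y - v) * rodrigues (real n + \<alpha>) (real n + b) n v)\<bar> = c ^ e / (fact n * r ^ e) * \<bar>S + (- 1) ^ n * fact n * W\<bar>"
      using c r by (simp add: abs_mult power_abs)
    also have "\<dots> \<le> c ^ e / (fact n * r ^ e) * ((\<Sum>i\<in>{e..<n}. fact i * fact (n - 1 - i) * R (n - 1 - i) / c ^ (i + 1)) + fact n * V)"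
      using T c r by (intro mult_left_mono) auto
    finally show ?thesis .
  qed
  obtain m where m: "n = Suc (Suc m)" using n by (metis Suc_le_D numeral_2_eq_2 Suc_le_mono)
  have fin: "8 / real n * ((1 - r) ^ n * KL) * 8 + 16 * ((1 - r) ^ n * (C0 * L / real n)) + 64 * D / real n * ((1 - r) ^ n * KL)
     = remainder_const \<alpha> b A / real n * (1 - r) ^ n"
    unfolding remainder_const_def KL_def L_def C0_def D_def
    by (simp add: add_divide_distrib algebra_simps)
  from e show ?thesis
  proof
    assume e1: "e = n - 1"
    have "c ^ e / (fact n * r ^ e) * ((\<Sum>i\<in>{e..<n}. fact i * fact (n - 1 - i) * R (n - 1 - i) / c ^ (i + 1)) + fact n * V)
      = 1 / (real n * c * r ^ e) * R 0 + c ^ e / r ^ e * V"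
      using c r unfolding e1 m by (simp add: divide_simps) (simp add: algebra_simps)
    also have "\<dots> \<le> 8 / real n * ((1 - r) ^ n * KL) + 16 * ((1 - r) ^ n * (C0 * L / real n))"
      using e1 n by (intro add_mono t0 tV) auto
    also have "\<dots> \<le> 8 / real n * ((1 - r) ^ n * KL) * 8 + 16 * ((1 - r) ^ n * (C0 * L / real n)) + 64 * D / real n * ((1 - r) ^ n * KL)"
    proof -
      have "0 \<le> 8 / real n * ((1 - r) ^ n * KL)" "0 \<le> 64 * D / real n * ((1 - r) ^ n * KL)" using pos by auto
      moreover have "x + w \<le> x * 8 + w + d" if "0 \<le> x" "0 \<le> d" for x w d :: real
        using that by linarith
      ultimately show ?thesis by blast
    qed
    finally show ?thesis using tri fin by linarith
  next
    assume e2: "e = n - 2"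
    have ivl: "{e..<n} = {m, Suc m}" unfolding e2 m by auto
    have "c ^ e / (fact n * r ^ e) * ((\<Sum>i\<in>{e..<n}. fact i * fact (n - 1 - i) * R (n - 1 - i) / c ^ (i + 1)) + fact n * V)
      = 1 / (real n * (real n - 1)) * (1 / c * (1 / r ^ e * R 1)) + 1 / c * (1 / (real n * c * r ^ e) * R 0) + c ^ e / r ^ e * V"
      using c r unfolding ivl unfolding e2 m by (simp add: divide_simps) (simp add: algebra_simps)
    also have "\<dots> \<le> 64 * D / real n * ((1 - r) ^ n * KL) + 8 * (8 / real n * ((1 - r) ^ n * KL)) + 16 * ((1 - r) ^ n * (C0 * L / real n))"
    proof (intro add_mono)
      show "c ^ e / r ^ e * V \<le> 16 * ((1 - r) ^ n * (C0 * L / real n))" using e2 n by (intro tV) auto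
      have c8: "1 / c \<le> 8" using c by (simp add: divide_le_eq)
      show "1 / c * (1 / (real n * c * r ^ e) * R 0) \<le> 8 * (8 / real n * ((1 - r) ^ n * KL))"
        by (rule mult_mono[OF c8 t0]) (use e2 c r in \<open>auto simp: R_def\<close>)
      have "1 / r ^ e * R 1 \<le> 1 / r ^ e * (r ^ n * ((1 - r) ^ n * KL * (4 * D * real n)))"
        using R1 r by (intro mult_left_mono) auto
      also have "\<dots> \<le> (1 - r) ^ n * KL * (4 * D * real n)" using e2 pos by (intro rq) auto
      finally have re: "1 / r ^ e * R 1 \<le> (1 - r) ^ n * KL * (4 * D * real n)" .
      have c1: "1 / c * (1 / r ^ e * R 1) \<le> 8 * ((1 - r) ^ n * KL * (4 * D * real n))"
        by (rule mult_mono[OF c8 re]) (use c r in \<open>auto simp: R_def\<close>)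
      have n1: "1 / (real n * (real n - 1)) \<le> 2 / (real n * real n)"
        using n by (simp add: divide_simps)
      have "1 / (real n * (real n - 1)) * (1 / c * (1 / r ^ e * R 1)) \<le> 2 / (real n * real n) * (8 * ((1 - r) ^ n * KL * (4 * D * real n)))"
        by (rule mult_mono[OF n1 c1]) (use c r n in \<open>auto simp: R_def\<close>)
      also have "\<dots> = 64 * D / real n * ((1 - r) ^ n * KL)" using n by (simp add: field_simps)
      finally show "1 / (real n * (real n - 1)) * (1 / c * (1 / r ^ e * R 1)) \<le> 64 * D / real n * ((1 - r) ^ n * KL)" .
    qed
    finally show ?thesis using tri fin by linarith
  qed
qed

end

text \<open>With \<open>v_average'\<close>, the two averages over \<open>v\<close> that arise from the two products in \<open>phi_n_split\<close>.\<close>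

definition v_average :: "nat \<Rightarrow> real \<Rightarrow> real \<Rightarrow> real \<Rightarrow> real \<Rightarrow> real" where
  "v_average n \<alpha> \<beta> r y = (LBINT v:{0<..<r}. 1 / r * (1 - v / r) ^ (n - 2) * (1 - v / (r * real n)) * jacobi_K n \<alpha> \<beta> v y)"

definition v_average' :: "nat \<Rightarrow> real \<Rightarrow> real \<Rightarrow> real \<Rightarrow> real \<Rightarrow> real" where
  "v_average' n \<alpha> \<beta> r y = (LBINT v:{0<..<r}. 1 / r * (1 - v / r) ^ (n - 1) * (1 + 1 / real n) * jacobi_K n \<alpha> \<beta> v y)"

lemma set_integrable_power_rodrigues:
  assumes "0 < r" "r < 1" "A > real n - 1" "continuous_on {0..r} h"
  shows "set_integrable lborel {0<..<r} (\<lambda>v. (1 - v / r) ^ e * (h v * rodrigues A B n v))"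
proof -
  have "set_integrable lborel {0<..<r} (\<lambda>v. ((1 - v / r) ^ e * h v) * rodrigues A B n v)"
    using assms by (intro set_integrable_rodrigues continuous_intros) auto
  then show ?thesis by (simp add: mult.assoc)
qed

lemma power_mean_jacobi_K:
  assumes n: "n \<ge> 1" and par: "\<alpha> > - 1" "\<beta> > 0" and r: "0 < r" "r < 1" "r < y"
  shows "set_integrable lborel {0<..<r} (\<lambda>v. (1 - v / r) ^ e * jacobi_K n \<alpha> \<beta> v y)" (is ?I)
    and "power_mean r e (\<lambda>v. jacobi_K n \<alpha> \<beta> v y) = gamma_coeff n \<alpha> \<beta> / (real n + \<alpha>) *
    (- jacobi_P n \<alpha> \<beta> (1 - 2 * y) * power_mean r e (rodrigues (real n + \<alpha>) (real n + (\<beta> - 1)) n)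
     + (- jacobi_P n \<alpha> \<beta> (1 - 2 * y) * (1 - y) * power_mean r e (\<lambda>v. 1 / (y - v) * rodrigues (real n + \<alpha>) (real n + (\<beta> - 1)) n v)
     + jacobi_P n \<alpha> (\<beta> - 1) (1 - 2 * y) * power_mean r e (\<lambda>v. 1 / (y - v) * rodrigues (real n + \<alpha>) (real n + \<beta>) n v)))" (is ?E)
proof -
  define g where "g = gamma_coeff n \<alpha> \<beta> / (real n + \<alpha>)"
  define c1 where "c1 = - jacobi_P n \<alpha> \<beta> (1 - 2 * y)"
  define c2 where "c2 = - jacobi_P n \<alpha> \<beta> (1 - 2 * y) * (1 - y)"
  define c3 where "c3 = jacobi_P n \<alpha> (\<beta> - 1) (1 - 2 * y)"
  define f1 where "f1 v = (1 - v / r) ^ e * rodrigues (real n + \<alpha>) (real n + (\<beta> - 1)) n v" for v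
  define f2 where "f2 v = (1 - v / r) ^ e * (1 / (y - v) * rodrigues (real n + \<alpha>) (real n + (\<beta> - 1)) n v)" for v
  define f3 where "f3 v = (1 - v / r) ^ e * (1 / (y - v) * rodrigues (real n + \<alpha>) (real n + \<beta>) n v)" for v
  have i1: "set_integrable lborel {0<..<r} f1"
    unfolding f1_def using set_integrable_power_rodrigues[where h = "\<lambda>_. 1" and A = "real n + \<alpha>" and n = n] r par by simp
  have i2: "set_integrable lborel {0<..<r} f2" and i3: "set_integrable lborel {0<..<r} f3"
    unfolding f2_def f3_def using r par by (intro set_integrable_power_rodrigues continuous_intros; auto)+
  have eq: "(1 - v / r) ^ e * jacobi_K n \<alpha> \<beta> v y = g * (c1 * f1 v + (c2 * f2 v + c3 * f3 v))" if "v \<in> {0<..<r}" for v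
  proof -
    have v: "0 < v" "v < 1" "v < y" using that r by auto
    show ?thesis
      unfolding jacobi_K_split[OF n par v] g_def[symmetric] c2_def[symmetric] c3_def[symmetric] f1_def f2_def f3_def
      unfolding c1_def by (simp add: algebra_simps)
  qed
  have i: "set_integrable lborel {0<..<r} (\<lambda>v. g * (c1 * f1 v + (c2 * f2 v + c3 * f3 v)))"
    using i1 i2 i3 by (intro set_integrable_mult_right set_integral_add(1))
  show ?I
    using i by (subst set_integrable_cong[OF refl refl eq]) auto
  have "power_mean r e (\<lambda>v. jacobi_K n \<alpha> \<beta> v y) = (LBINT v:{0<..<r}. g * (c1 * f1 v + (c2 * f2 v + c3 * f3 v)))"
    unfolding power_mean_def using eq by (intro set_lebesgue_integral_cong) auto
  also have "\<dots> = g * (c1 * (LBINT v:{0<..<r}. f1 v) + (c2 * (LBINT v:{0<..<r}. f2 v) + c3 * (LBINT v:{0<..<r}. f3 v)))"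
    using i1 i2 i3 by (simp only: set_integral_mult_right set_integral_add set_integrable_mult_right)
  finally show ?E unfolding power_mean_def g_def c1_def c2_def c3_def f1_def f2_def f3_def .
qed

text \<open>Since \<open>1 - x/n = ((n-1) + (1-x))/n\<close>, both averages are combinations of power means.\<close>

lemma v_average_power_mean:
  assumes n: "n \<ge> 2" and par: "\<alpha> > - 1" "\<beta> > 0" and r: "0 < r" "r < 1" "r < y"
  shows "v_average n \<alpha> \<beta> r y = 1 / (r * real n) *
      ((real n - 1) * power_mean r (n - 2) (\<lambda>v. jacobi_K n \<alpha> \<beta> v y) + power_mean r (n - 1) (\<lambda>v. jacobi_K n \<alpha> \<beta> v y))"
    and "v_average' n \<alpha> \<beta> r y = (real n + 1) / (r * real n) * power_mean r (n - 1) (\<lambda>v. jacobi_K n \<alpha> \<beta> v y)"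
proof -
  obtain m where m: "n = Suc (Suc m)" using n by (metis Suc_le_D numeral_2_eq_2 Suc_le_mono)
  define f where "f e v = (1 - v / r) ^ e * jacobi_K n \<alpha> \<beta> v y" for e v
  have i: "set_integrable lborel {0<..<r} (f e)" for e
    unfolding f_def using n by (intro power_mean_jacobi_K par r) auto
  have eq: "1 / r * (1 - v / r) ^ (n - 2) * (1 - v / (r * real n)) * jacobi_K n \<alpha> \<beta> v y
      = 1 / (r * real n) * ((real n - 1) * f (n - 2) v + f (n - 1) v)" for v
  proof -
    define x where "x = v / r"
    have gen: "1 / r * c * ((s + u) / real n) * K = 1 / (r * real n) * (s * (c * K) + (u * c) * K)" for c s u K :: real
      by (simp add: add_divide_distrib algebra_simps)
    have "v / (r * real n) = x / real n" by (simp add: x_def)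
    moreover have "1 - x / real n = ((real n - 1) + (1 - x)) / real n" using n by (simp add: field_simps)
    ultimately have "1 / r * (1 - v / r) ^ (n - 2) * (1 - v / (r * real n)) * jacobi_K n \<alpha> \<beta> v y
       = 1 / (r * real n) * ((real n - 1) * ((1 - x) ^ (n - 2) * jacobi_K n \<alpha> \<beta> v y) + ((1 - x) * (1 - x) ^ (n - 2)) * jacobi_K n \<alpha> \<beta> v y)"
      unfolding x_def[symmetric] by (simp only: gen)
    also have "(1 - x) * (1 - x) ^ (n - 2) = (1 - x) ^ (n - 1)" by (simp add: m)
    finally show ?thesis by (simp add: f_def x_def)
  qed
  have eq': "1 / r * (1 - v / r) ^ (n - 1) * (1 + 1 / real n) * jacobi_K n \<alpha> \<beta> v y = (real n + 1) / (r * real n) * f (n - 1) v" for v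
  proof -
    have "1 + 1 / real n = (real n + 1) / real n" using n by (simp add: field_simps)
    then show ?thesis by (simp add: f_def)
  qed
  show "v_average n \<alpha> \<beta> r y = 1 / (r * real n) *
      ((real n - 1) * power_mean r (n - 2) (\<lambda>v. jacobi_K n \<alpha> \<beta> v y) + power_mean r (n - 1) (\<lambda>v. jacobi_K n \<alpha> \<beta> v y))"
    unfolding v_average_def power_mean_def eq f_def[symmetric]
    using i by (simp only: set_integral_mult_right set_integral_add set_integrable_mult_right)
  show "v_average' n \<alpha> \<beta> r y = (real n + 1) / (r * real n) * power_mean r (n - 1) (\<lambda>v. jacobi_K n \<alpha> \<beta> v y)"
    unfolding v_average'_def power_mean_def eq' f_def[symmetric] by (simp only: set_integral_mult_right)
qed

text \<open>The weight of the Rodrigues derivative at \<open>r\<close> without its factor \<open>r\<^sup>n\<close>, which the normalization of the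
power means cancels.\<close>

definition v_main_weight :: "nat \<Rightarrow> real \<Rightarrow> real \<Rightarrow> real \<Rightarrow> real" where
  "v_main_weight n \<alpha> \<beta> r = r powr \<alpha> * (1 - r) powr (real n + \<beta> - 1)"

text \<open>Main term of \<open>v_average\<close>: the boundary values of orders \<open>1\<close> and \<open>0\<close> left by \<open>power_mean_rodrigues\<close> for
\<open>e = n - 2\<close> and \<open>e = n - 1\<close>.\<close>

definition v_main :: "nat \<Rightarrow> real \<Rightarrow> real \<Rightarrow> real \<Rightarrow> real \<Rightarrow> real" where
  "v_main n \<alpha> \<beta> r y = - (gamma_coeff n \<alpha> \<beta> / ((real n + \<alpha>) * (real n)\<^sup>2)) * jacobi_P n \<alpha> \<beta> (1 - 2 * y) * v_main_weight n \<alpha> \<beta> r *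
     (real n + 1 + \<alpha> - (real n + \<beta> - 1) * (r / (1 - r)))"

definition v_main' :: "nat \<Rightarrow> real \<Rightarrow> real \<Rightarrow> real \<Rightarrow> real \<Rightarrow> real" where
  "v_main' n \<alpha> \<beta> r y = - (gamma_coeff n \<alpha> \<beta> / ((real n + \<alpha>) * (real n)\<^sup>2)) * jacobi_P n \<alpha> \<beta> (1 - 2 * y) * v_main_weight n \<alpha> \<beta> r * (real n + 1)"

text \<open>The error contains \<open>P\<^sub>n (1 - y)\<close> and the polynomial with lowered \<open>\<beta>\<close>. At the hard edge both are smaller than
\<open>P\<^sub>n\<close>, the latter by the factor \<open>1/n\<close>.\<close>

lemma v_average_approx:
  assumes n: "n \<ge> 2" and r: "1 / 4 \<le> r" "r \<le> 3 / 4" and y: "y \<le> 1" "1 / 8 \<le> y - r" "1 - y \<le> A / (real n)\<^sup>2"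
    and par: "\<alpha> > - 1" "\<beta> > 0" and A: "A \<ge> 0"
  defines "E \<equiv> 8 * (gamma_coeff n \<alpha> \<beta> / (real n + \<alpha>)) *
     (\<bar>jacobi_P n \<alpha> \<beta> (1 - 2 * y)\<bar> * (1 - y) + \<bar>jacobi_P n \<alpha> (\<beta> - 1) (1 - 2 * y)\<bar>) *
     ((remainder_const \<alpha> (\<beta> - 1) A + remainder_const \<alpha> \<beta> A) / real n * (1 - r) ^ n)"
  shows "\<bar>v_average n \<alpha> \<beta> r y - v_main n \<alpha> \<beta> r y\<bar> \<le> E"
    and "\<bar>v_average' n \<alpha> \<beta> r y - v_main' n \<alpha> \<beta> r y\<bar> \<le> E"
proof -
  define g where "g = gamma_coeff n \<alpha> \<beta> / (real n + \<alpha>)"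
  define P where "P = jacobi_P n \<alpha> \<beta> (1 - 2 * y)"
  define p where "p = jacobi_P n \<alpha> (\<beta> - 1) (1 - 2 * y)"
  define G where "G = v_main_weight n \<alpha> \<beta> r"
  define R where "R = (remainder_const \<alpha> (\<beta> - 1) A + remainder_const \<alpha> \<beta> A) / real n * (1 - r) ^ n"
  define T where "T e = power_mean r e (rodrigues (real n + \<alpha>) (real n + (\<beta> - 1)) n)" for e
  define err where "err e = - P * (1 - y) * power_mean r e (\<lambda>v. 1 / (y - v) * rodrigues (real n + \<alpha>) (real n + (\<beta> - 1)) n v)
     + p * power_mean r e (\<lambda>v. 1 / (y - v) * rodrigues (real n + \<alpha>) (real n + \<beta>) n v)" for e
  have g: "g \<ge> 0" unfolding g_def using gamma_coeff_pos[of n \<alpha> \<beta>] n par by simp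
  have rc: "0 \<le> remainder_const \<alpha> b A" for b
    unfolding remainder_const_def by (intro add_nonneg_nonneg mult_nonneg_nonneg) auto
  have K: "power_mean r e (\<lambda>v. jacobi_K n \<alpha> \<beta> v y) = g * (- P * T e + err e)" for e
    unfolding g_def P_def p_def T_def err_def using n r y par by (intro power_mean_jacobi_K(2)) auto
  have err: "\<bar>err e\<bar> \<le> (\<bar>P\<bar> * (1 - y) + \<bar>p\<bar>) * R" if e: "e = n - 1 \<or> e = n - 2" for e
  proof -
    have b: "\<bar>power_mean r e (\<lambda>v. 1 / (y - v) * rodrigues (real n + \<alpha>) (real n + b) n v)\<bar> \<le> R"
      if "b = \<beta> \<or> b = \<beta> - 1" for b
    proof -
      have "remainder_const \<alpha> b A / real n * (1 - r) ^ n \<le> R"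
        unfolding R_def using that rc r by (intro mult_right_mono divide_right_mono) auto
      then show ?thesis using power_mean_quotient_bound[OF n r y par(1) A e, of b] by linarith
    qed
    have "\<bar>err e\<bar> \<le> \<bar>- P * (1 - y) * power_mean r e (\<lambda>v. 1 / (y - v) * rodrigues (real n + \<alpha>) (real n + (\<beta> - 1)) n v)\<bar>
      + \<bar>p * power_mean r e (\<lambda>v. 1 / (y - v) * rodrigues (real n + \<alpha>) (real n + \<beta>) n v)\<bar>"
      unfolding err_def by (rule abs_triangle_ineq)
    also have "\<dots> \<le> (\<bar>P\<bar> * (1 - y)) * R + \<bar>p\<bar> * R"
      unfolding abs_mult using y b by (intro add_mono mult_mono) auto
    finally show ?thesis by (simp add: distrib_right)
  qed
  define D where "D = (\<bar>P\<bar> * (1 - y) + \<bar>p\<bar>) * R"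
  have D: "D \<ge> 0" unfolding D_def R_def using y rc r by (intro mult_nonneg_nonneg add_nonneg_nonneg divide_nonneg_nonneg) auto
  have E: "E = 8 * g * D" unfolding E_def g_def P_def p_def D_def R_def by (simp add: mult_ac)
  have rn: "1 / r \<le> 4" using r by (simp add: divide_le_eq)
  obtain m where m: "n = Suc (Suc m)" using n by (metis Suc_le_D numeral_2_eq_2 Suc_le_mono)
  have r0: "r > 0" "r < 1" using r by auto
  have F: "rodrigues (real n + \<alpha>) (real n + (\<beta> - 1)) 0 r = r ^ n * G"
    unfolding rodrigues_0 G_def v_main_weight_def using r0 by (simp add: powr_add powr_realpow add_diff_eq)
  have F1: "rodrigues (real n + \<alpha>) (real n + (\<beta> - 1)) 1 r = r ^ n * G * ((real n + \<alpha>) / r - (real n + \<beta> - 1) / (1 - r))"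
  proof -
    define w where "w = 1 - r"
    have e: "rodrigues A B 1 r = A * (r powr (A - 1) * (1 - r) powr B) - B * (r powr A * (1 - r) powr (B - 1))" for A B
      by (simp add: rodrigues_def)
    have "0 < w" using r0 by (auto simp: w_def)
    then show ?thesis unfolding e G_def v_main_weight_def w_def[symmetric] using r0
      by (simp add: powr_add powr_diff powr_realpow divide_simps) (simp add: algebra_simps power2_eq_square)
  qed
  have T1: "T (n - 1) = r * G / real n"
  proof -
    have "T (n - 1) = fact (n - 1) * fact (n - 1 - (n - 1)) / fact n * rodrigues (real n + \<alpha>) (real n + (\<beta> - 1)) (n - 1 - (n - 1)) r / r ^ (n - 1)"
      unfolding T_def using r0 par n by (intro power_mean_rodrigues) auto
    then show ?thesis using F r0 by (simp add: m)
  qed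
  have T2: "(real n - 1) * T (n - 2) = r\<^sup>2 * G / real n * ((real n + \<alpha>) / r - (real n + \<beta> - 1) / (1 - r))"
  proof -
    have "T (n - 2) = fact (n - 2) * fact (n - 1 - (n - 2)) / fact n * rodrigues (real n + \<alpha>) (real n + (\<beta> - 1)) (n - 1 - (n - 2)) r / r ^ (n - 2)"
      unfolding T_def using r0 par n by (intro power_mean_rodrigues) auto
    also have "n - 1 - (n - 2) = 1" by (simp add: m)
    also have "fact (n - 2) * fact 1 / fact n = 1 / (real n * (real n - 1))" by (simp add: m)
    also have "1 / (real n * (real n - 1)) * rodrigues (real n + \<alpha>) (real n + (\<beta> - 1)) 1 r / r ^ (n - 2)
       = 1 / (real n * (real n - 1)) * (r\<^sup>2 * G * ((real n + \<alpha>) / r - (real n + \<beta> - 1) / (1 - r)))"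
      unfolding F1 using r0 by (simp add: m power2_eq_square)
    finally have "T (n - 2) = 1 / (real n * (real n - 1)) * (r\<^sup>2 * G * ((real n + \<alpha>) / r - (real n + \<beta> - 1) / (1 - r)))" .
    then show ?thesis using n by simp
  qed
  have M: "v_main n \<alpha> \<beta> r y = 1 / (r * real n) * (g * - P * ((real n - 1) * T (n - 2) + T (n - 1)))"
  proof -
    have gen: "r * ((real n + \<alpha>) / r - X / (1 - r)) + 1 = real n + 1 + \<alpha> - X * (r / (1 - r))" for X
      using r0 by (simp add: right_diff_distrib)
    have "(real n - 1) * T (n - 2) + T (n - 1) = r * G / real n * (r * ((real n + \<alpha>) / r - (real n + \<beta> - 1) / (1 - r)) + 1)"
      unfolding T1 T2 by (simp add: power2_eq_square distrib_left mult_ac)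
    also have "r * ((real n + \<alpha>) / r - (real n + \<beta> - 1) / (1 - r)) + 1 = real n + 1 + \<alpha> - (real n + \<beta> - 1) * (r / (1 - r))"
      by (rule gen)
    finally have e: "(real n - 1) * T (n - 2) + T (n - 1) = r * G / real n * (real n + 1 + \<alpha> - (real n + \<beta> - 1) * (r / (1 - r)))" .
    show ?thesis unfolding e v_main_def P_def[symmetric] G_def[symmetric] g_def using r0 n by (simp add: power2_eq_square mult_ac)
  qed
  have M': "v_main' n \<alpha> \<beta> r y = (real n + 1) / (r * real n) * (g * - P * T (n - 1))"
    unfolding T1 v_main'_def P_def[symmetric] G_def[symmetric] g_def using r0 n by (simp add: power2_eq_square mult_ac)
  have "v_average n \<alpha> \<beta> r y - v_main n \<alpha> \<beta> r y = 1 / (r * real n) * (g * ((real n - 1) * err (n - 2) + err (n - 1)))"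
    using n par r0 y unfolding M by (subst v_average_power_mean) (auto simp: K algebra_simps)
  then have "\<bar>v_average n \<alpha> \<beta> r y - v_main n \<alpha> \<beta> r y\<bar> = 1 / (r * real n) * (g * \<bar>(real n - 1) * err (n - 2) + err (n - 1)\<bar>)"
    using r0 g by (simp add: abs_mult)
  also have "\<dots> \<le> 1 / (r * real n) * (g * (real n * D))"
  proof -
    have "\<bar>(real n - 1) * err (n - 2) + err (n - 1)\<bar> \<le> \<bar>(real n - 1) * err (n - 2)\<bar> + \<bar>err (n - 1)\<bar>" by (rule abs_triangle_ineq)
    also have "\<dots> \<le> (real n - 1) * D + D"
      unfolding abs_mult D_def using n by (intro add_mono mult_mono err) auto
    also have "\<dots> = real n * D" by (simp add: algebra_simps)
    finally show ?thesis using r0 g by (intro mult_left_mono) auto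
  qed
  also have "\<dots> = 1 / r * (g * D)" using n by simp
  also have "\<dots> \<le> 8 * (g * D)" using rn g D by (intro mult_right_mono) auto
  finally show "\<bar>v_average n \<alpha> \<beta> r y - v_main n \<alpha> \<beta> r y\<bar> \<le> E" unfolding E by simp
  have "v_average' n \<alpha> \<beta> r y - v_main' n \<alpha> \<beta> r y = (real n + 1) / (r * real n) * (g * err (n - 1))"
    using n par r0 y unfolding M' by (subst v_average_power_mean) (auto simp: K algebra_simps)
  then have "\<bar>v_average' n \<alpha> \<beta> r y - v_main' n \<alpha> \<beta> r y\<bar> = (real n + 1) / (r * real n) * (g * \<bar>err (n - 1)\<bar>)"
    using r0 g by (simp add: abs_mult)
  also have "\<dots> \<le> (real n + 1) / (r * real n) * (g * D)"
    unfolding D_def using r0 g by (intro mult_left_mono err) auto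
  also have "\<dots> \<le> 8 * (g * D)"
  proof -
    have "(real n + 1) / (r * real n) = (1 / r) * ((real n + 1) / real n)" by simp
    also have "\<dots> \<le> 4 * 2" using rn r0 n by (intro mult_mono) (auto simp: divide_le_eq)
    finally show ?thesis using g D by (intro mult_right_mono) auto
  qed
  finally show "\<bar>v_average' n \<alpha> \<beta> r y - v_main' n \<alpha> \<beta> r y\<bar> \<le> E" unfolding E by simp
qed

section \<open>Averages of the kernel over the half-line\<close>

lemma continuous_on_jacobi_P:
  assumes "continuous_on S f"
  shows "continuous_on S (\<lambda>t. jacobi_P n \<alpha> \<beta> (f t))"
  unfolding jacobi_P_def using assms by (intro continuous_intros) auto

definition t_average :: "nat \<Rightarrow> nat \<Rightarrow> real \<Rightarrow> real \<Rightarrow> real \<Rightarrow> real \<Rightarrow> real" where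
  "t_average N n \<alpha> \<beta> r x = (LBINT t:{0..}. jacobi_K n \<alpha> \<beta> x (- r * t) / (1 + t) ^ N)"

text \<open>What is left of \<open>t_average\<close> at the hard edge after the factor depending on \<open>x\<close> has been split off.\<close>

definition p_moment :: "nat \<Rightarrow> nat \<Rightarrow> real \<Rightarrow> real \<Rightarrow> real \<Rightarrow> real" where
  "p_moment N n \<alpha> \<beta> r = (LBINT t:{0<..}. jacobi_P (n - 1) \<alpha> (\<beta> + 1) (1 - 2 * (- (r * t))) / (1 + t) ^ N)"

text \<open>The factorials from the beta integrals cancel the denominators of both binomial coefficients.\<close>

lemma nb_coeff_eq:
  assumes n: "n \<ge> 1" and par: "\<alpha> > - 1" "\<beta> > 0" and j: "j < n"
  shows "((real (n - 1) + \<alpha>) gchoose (n - 1 - j)) * ((real (n - 1 + j) + \<alpha> + (\<beta> + 1)) gchoose j) * (fact j * fact (n - 1 - j)) =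
    Gamma (real n + \<alpha>) / Gamma (real n + \<alpha> + \<beta> + 1) * nb_coeff n \<alpha> \<beta> j"
proof -
  obtain m where m: "n = Suc m" using n by (cases n) auto
  have jm: "j \<le> m" using j m by simp
  have 1: "((real (n - 1) + \<alpha>) gchoose (n - 1 - j)) * fact (n - 1 - j) = Gamma (real n + \<alpha>) / Gamma (real j + \<alpha> + 1)"
  proof -
    have e: "real (n - 1) + \<alpha> - real (n - 1 - j) + 1 = real j + \<alpha> + 1" using jm by (simp add: m of_nat_diff)
    have A: "((real (n - 1) + \<alpha>) gchoose (n - 1 - j)) * fact (n - 1 - j) = pochhammer (real j + \<alpha> + 1) (n - 1 - j)"
      unfolding gbinomial_pochhammer' e by simp
    have "Gamma (real j + \<alpha> + 1 + real (n - 1 - j)) = pochhammer (real j + \<alpha> + 1) (n - 1 - j) * Gamma (real j + \<alpha> + 1)"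
      using par by (intro Gamma_pochhammer) auto
    moreover have C: "real j + \<alpha> + 1 + real (n - 1 - j) = real n + \<alpha>" using jm by (simp add: m of_nat_diff)
    ultimately have B: "Gamma (real n + \<alpha>) = pochhammer (real j + \<alpha> + 1) (n - 1 - j) * Gamma (real j + \<alpha> + 1)"
      by (simp only:)
    have "Gamma (real j + \<alpha> + 1) > 0" using par by (intro Gamma_real_pos) auto
    then have "Gamma (real j + \<alpha> + 1) \<noteq> 0" by (metis less_irrefl)
    then show ?thesis unfolding A B by simp
  qed
  have 2: "((real (n - 1 + j) + \<alpha> + (\<beta> + 1)) gchoose j) * fact j = Gamma (real n + real j + \<alpha> + \<beta> + 1) / Gamma (real n + \<alpha> + \<beta> + 1)"
  proof -
    have e: "real (n - 1 + j) + \<alpha> + (\<beta> + 1) - real j + 1 = real n + \<alpha> + \<beta> + 1" by (simp add: m)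
    have A: "((real (n - 1 + j) + \<alpha> + (\<beta> + 1)) gchoose j) * fact j = pochhammer (real n + \<alpha> + \<beta> + 1) j"
      unfolding gbinomial_pochhammer' e by simp
    have "Gamma (real n + \<alpha> + \<beta> + 1 + real j) = pochhammer (real n + \<alpha> + \<beta> + 1) j * Gamma (real n + \<alpha> + \<beta> + 1)"
      using par n by (intro Gamma_pochhammer) auto
    moreover have "real n + \<alpha> + \<beta> + 1 + real j = real n + real j + \<alpha> + \<beta> + 1" by simp
    ultimately have B: "Gamma (real n + real j + \<alpha> + \<beta> + 1) = pochhammer (real n + \<alpha> + \<beta> + 1) j * Gamma (real n + \<alpha> + \<beta> + 1)"
      by (simp only:)
    have "Gamma (real n + \<alpha> + \<beta> + 1) > 0" using par n by (intro Gamma_real_pos) auto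
    then have "Gamma (real n + \<alpha> + \<beta> + 1) \<noteq> 0" by (metis less_irrefl)
    then show ?thesis unfolding A B by simp
  qed
  have "((real (n - 1) + \<alpha>) gchoose (n - 1 - j)) * ((real (n - 1 + j) + \<alpha> + (\<beta> + 1)) gchoose j) * (fact j * fact (n - 1 - j)) =
    (((real (n - 1) + \<alpha>) gchoose (n - 1 - j)) * fact (n - 1 - j)) * (((real (n - 1 + j) + \<alpha> + (\<beta> + 1)) gchoose j) * fact j)"
    by (simp only: mult_ac)
  also have "\<dots> = Gamma (real n + \<alpha>) / Gamma (real n + \<alpha> + \<beta> + 1) * nb_coeff n \<alpha> \<beta> j"
    unfolding 1 2 nb_coeff_def by simp
  finally show ?thesis .
qed

text \<open>Term by term, by \<open>power_quotient_integral\<close>. The bound on \<open>N\<close> is what convergence requires, as the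
polynomial has degree \<open>n - 1\<close>.\<close>

lemma p_moment_sum:
  assumes n: "n \<ge> 1" and N: "n + 1 \<le> N"
  shows "set_integrable lborel {0<..} (\<lambda>t. jacobi_P (n - 1) \<alpha> (\<beta> + 1) (1 - 2 * (- (r * t))) / (1 + t) ^ N)"
    and "p_moment N n \<alpha> \<beta> r = (\<Sum>j<n. ((real (n - 1) + \<alpha>) gchoose (n - 1 - j)) * ((real (n - 1 + j) + \<alpha> + (\<beta> + 1)) gchoose j)
      * r ^ j * (fact j * fact (N - 2 - j) / fact (N - 1)))"
proof -
  define c where "c j = ((real (n - 1) + \<alpha>) gchoose (n - 1 - j)) * ((real (n - 1 + j) + \<alpha> + (\<beta> + 1)) gchoose j) * r ^ j" for j
  have f: "jacobi_P (n - 1) \<alpha> (\<beta> + 1) (1 - 2 * (- (r * t))) / (1 + t) ^ N = (\<Sum>j<n. c j * (t ^ j / (1 + t) ^ N))" for t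
  proof -
    have "{..n - 1} = {..<n}" using n by auto
    then show ?thesis
      unfolding jacobi_P_expansion c_def by (simp add: sum_divide_distrib power_mult_distrib mult_ac)
  qed
  have i: "set_integrable lborel {0<..} (\<lambda>t. c j * (t ^ j / (1 + t) ^ N))" if "j < n" for j
    using that N by (intro set_integrable_mult_right power_quotient_integrable) auto
  show "set_integrable lborel {0<..} (\<lambda>t. jacobi_P (n - 1) \<alpha> (\<beta> + 1) (1 - 2 * (- (r * t))) / (1 + t) ^ N)"
    unfolding f set_integrable_def scaleR_sum_right
    using i unfolding set_integrable_def by (intro Bochner_Integration.integrable_sum) auto
  have "p_moment N n \<alpha> \<beta> r = (\<Sum>j<n. (LBINT t:{0<..}. c j * (t ^ j / (1 + t) ^ N)))"
    unfolding p_moment_def f set_lebesgue_integral_def scaleR_sum_right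
    using i unfolding set_integrable_def by (intro Bochner_Integration.integral_sum) auto
  also have "\<dots> = (\<Sum>j<n. c j * (fact j * fact (N - 2 - j) / fact (N - 1)))"
  proof (intro sum.cong refl)
    fix j assume "j \<in> {..<n}"
    then have "j + 2 \<le> N" using N by auto
    then show "(LBINT t:{0<..}. c j * (t ^ j / (1 + t) ^ N)) = c j * (fact j * fact (N - 2 - j) / fact (N - 1))"
      by (simp only: set_integral_mult_right power_quotient_integral)
  qed
  finally show "p_moment N n \<alpha> \<beta> r = (\<Sum>j<n. ((real (n - 1) + \<alpha>) gchoose (n - 1 - j)) * ((real (n - 1 + j) + \<alpha> + (\<beta> + 1)) gchoose j)
      * r ^ j * (fact j * fact (N - 2 - j) / fact (N - 1)))"
    unfolding c_def .
qed

text \<open>Normalization between the beta integrals and \<open>nb_coeff\<close>; see \<open>gamma_lambda\<close> for its purpose.\<close>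

definition lambda_coeff :: "nat \<Rightarrow> real \<Rightarrow> real \<Rightarrow> real" where
  "lambda_coeff n \<alpha> \<beta> = Gamma (real n + \<alpha>) / Gamma (real n + \<alpha> + \<beta> + 1) / fact n"

text \<open>For \<open>N = n + 2\<close> the beta integrals have an additional factor \<open>(n - j)/(n + 1)\<close>, whence the first moment.\<close>

lemma p_moment_eq:
  assumes n: "n \<ge> 1" and par: "\<alpha> > - 1" "\<beta> > 0"
  shows "p_moment (n + 1) n \<alpha> \<beta> r = lambda_coeff n \<alpha> \<beta> * nb_sum n \<alpha> \<beta> r"
    and "p_moment (n + 2) n \<alpha> \<beta> r = lambda_coeff n \<alpha> \<beta> * ((real n * nb_sum n \<alpha> \<beta> r - nb_moment n \<alpha> \<beta> r) / (real n + 1))"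
proof -
  define C where "C j = ((real (n - 1) + \<alpha>) gchoose (n - 1 - j)) * ((real (n - 1 + j) + \<alpha> + (\<beta> + 1)) gchoose j)" for j
  have C: "C j * (fact j * fact (n - 1 - j)) = (lambda_coeff n \<alpha> \<beta> * fact n) * nb_coeff n \<alpha> \<beta> j" if "j < n" for j
    unfolding C_def nb_coeff_eq[OF n par that] by (simp add: lambda_coeff_def)
  have "p_moment (n + 1) n \<alpha> \<beta> r = (\<Sum>j<n. C j * r ^ j * (fact j * fact (n + 1 - 2 - j) / fact (n + 1 - 1)))"
    unfolding C_def using n by (intro p_moment_sum) auto
  also have "\<dots> = (\<Sum>j<n. lambda_coeff n \<alpha> \<beta> * (nb_coeff n \<alpha> \<beta> j * r ^ j))"
  proof (intro sum.cong refl)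
    fix j assume "j \<in> {..<n}"
    then have c: "C j * (fact j * fact (n - 1 - j)) = (lambda_coeff n \<alpha> \<beta> * fact n) * nb_coeff n \<alpha> \<beta> j" by (intro C) auto
    have "C j * r ^ j * (fact j * fact (n + 1 - 2 - j) / fact (n + 1 - 1)) = (C j * (fact j * fact (n - 1 - j))) * r ^ j / fact n"
      by simp
    then show "C j * r ^ j * (fact j * fact (n + 1 - 2 - j) / fact (n + 1 - 1)) = lambda_coeff n \<alpha> \<beta> * (nb_coeff n \<alpha> \<beta> j * r ^ j)"
      unfolding c by simp
  qed
  finally show "p_moment (n + 1) n \<alpha> \<beta> r = lambda_coeff n \<alpha> \<beta> * nb_sum n \<alpha> \<beta> r"
    by (simp add: nb_sum_def sum_distrib_left)
  have "p_moment (n + 2) n \<alpha> \<beta> r = (\<Sum>j<n. C j * r ^ j * (fact j * fact (n + 2 - 2 - j) / fact (n + 2 - 1)))"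
    unfolding C_def using n by (intro p_moment_sum) auto
  also have "\<dots> = (\<Sum>j<n. lambda_coeff n \<alpha> \<beta> * ((real n - real j) * (nb_coeff n \<alpha> \<beta> j * r ^ j) / (real n + 1)))"
  proof (intro sum.cong refl)
    fix j assume "j \<in> {..<n}"
    then have j: "j < n" by auto
    have c: "C j * (fact j * fact (n - 1 - j)) = (lambda_coeff n \<alpha> \<beta> * fact n) * nb_coeff n \<alpha> \<beta> j" by (intro C j)
    have f1: "fact (n - j) = (real n - real j) * fact (n - 1 - j)"
    proof -
      have "fact (n - j) = real (n - j) * fact (n - j - 1)" using j by (intro fact_reduce) simp
      then show ?thesis using j by (simp add: of_nat_diff)
    qed
    have f2: "fact (n + 2 - 1) = (real n + 1) * fact n" by (simp add: add.commute)
    have "C j * r ^ j * (fact j * fact (n + 2 - 2 - j) / fact (n + 2 - 1)) =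
       (C j * (fact j * fact (n - 1 - j))) * ((real n - real j) * r ^ j) / ((real n + 1) * fact n)"
      unfolding f2[symmetric] by (simp add: f1)
    then show "C j * r ^ j * (fact j * fact (n + 2 - 2 - j) / fact (n + 2 - 1)) =
        lambda_coeff n \<alpha> \<beta> * ((real n - real j) * (nb_coeff n \<alpha> \<beta> j * r ^ j) / (real n + 1))"
      unfolding c by simp
  qed
  also have "\<dots> = lambda_coeff n \<alpha> \<beta> * ((real n * nb_sum n \<alpha> \<beta> r - nb_moment n \<alpha> \<beta> r) / (real n + 1))"
    by (simp add: nb_sum_def nb_moment_def sum_distrib_left sum_divide_distrib left_diff_distrib sum_subtractf diff_divide_distrib right_diff_distrib)
  finally show "p_moment (n + 2) n \<alpha> \<beta> r = lambda_coeff n \<alpha> \<beta> * ((real n * nb_sum n \<alpha> \<beta> r - nb_moment n \<alpha> \<beta> r) / (real n + 1))" .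
qed

lemma gamma_lambda:
  assumes n: "n \<ge> 1" and par: "\<alpha> > - 1" "\<beta> > 0"
  shows "gamma_coeff n \<alpha> \<beta> / (real n + \<beta>) * lambda_coeff n \<alpha> \<beta> = 1 / Gamma (real n + \<beta> + 1)"
proof -
  have G: "Gamma (real n + \<beta> + 1) = (real n + \<beta>) * Gamma (real n + \<beta>)"
    using Gamma_pochhammer[of "real n + \<beta>" 1] par by simp
  have F: "Gamma (real n + 1) = fact n" using Gamma_fact[of n, where 'a = real] by (simp add: add.commute)
  have "Gamma (real n + \<alpha>) > 0" "Gamma (real n + \<alpha> + \<beta> + 1) > 0" using n par by (auto intro!: Gamma_real_pos)
  then have "Gamma (real n + \<alpha>) \<noteq> 0" "Gamma (real n + \<alpha> + \<beta> + 1) \<noteq> 0" by (metis less_irrefl)+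
  then show ?thesis unfolding gamma_coeff_def lambda_coeff_def G F by simp
qed

text \<open>In the numerator with raised \<open>\<beta>\<close> the polynomial at \<open>- r t\<close> has the factor \<open>1 + r t = (x + r t) + (1 - x)\<close>. The
part \<open>x + r t\<close> cancels the denominator and gives the main term. The other terms are small because
\<open>1 - x\<close> is; to integrate them, \<open>P\<^sub>n\<close> is dominated by \<open>(1 + r t)\<close> times the raised polynomial, which the
contiguous relation with nonnegative summands provides.\<close>

lemma t_average_approx:
  assumes n: "n \<ge> 1" and par: "\<alpha> > - 1" "\<beta> > 0" and r: "r > 0" and x: "1 / 2 \<le> x" "x \<le> 1" and N: "n + 1 \<le> N"
  defines "c \<equiv> gamma_coeff n \<alpha> \<beta> / (real n + \<beta>) * (x powr \<alpha> * (1 - x) powr \<beta>)"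
    and "P \<equiv> jacobi_P n \<alpha> \<beta> (1 - 2 * x)"
    and "D \<equiv> 2 * ((2 * real n + \<alpha> + \<beta>) / real n) * \<bar>(1 - x) * jacobi_P (n - 1) \<alpha> (\<beta> + 1) (1 - 2 * x)\<bar>
      + 2 * (1 - x) * \<bar>jacobi_P n \<alpha> \<beta> (1 - 2 * x)\<bar>"
  shows "set_integrable lborel {0..} (\<lambda>t. jacobi_K n \<alpha> \<beta> x (- r * t) / (1 + t) ^ N)"
    and "\<bar>t_average N n \<alpha> \<beta> r x - (- c * P * p_moment N n \<alpha> \<beta> r)\<bar> \<le> c * D * p_moment N n \<alpha> \<beta> r"
proof -
  define p where "p t = jacobi_P (n - 1) \<alpha> (\<beta> + 1) (1 - 2 * (- (r * t)))" for t
  define Q where "Q t = jacobi_P n \<alpha> \<beta> (1 - 2 * (- (r * t)))" for t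
  define px where "px = (1 - x) * jacobi_P (n - 1) \<alpha> (\<beta> + 1) (1 - 2 * x)"
  define s where "s = 2 * real n + \<alpha> + \<beta>"
  \<comment> \<open>\<open>f\<close> is the main term of the kernel, \<open>d\<close> the rest\<close>
  define f where "f t = c * (- P * p t)" for t
  define d where "d t = c * (px * Q t / (x + r * t) - P * p t * ((1 - x) / (x + r * t)))" for t
  have c: "c \<ge> 0"
    unfolding c_def using gamma_coeff_pos[OF n par] n par by simp
  have s: "s > 0" using n par by (simp add: s_def)
  have p0: "p t \<ge> 0" if "t \<ge> 0" for t
    unfolding p_def using par r that by (intro jacobi_P_nonneg) auto
  have Q0: "0 \<le> Q t" "Q t \<le> s / real n * ((1 + r * t) * p t)" if "t \<ge> 0" for t
  proof -
    show "0 \<le> Q t" unfolding Q_def using par r that by (intro jacobi_P_nonneg) auto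
    have "s * ((1 + r * t) * p t) = real n * Q t + (real n + \<beta>) * jacobi_P (n - 1) \<alpha> \<beta> (1 - 2 * (- (r * t)))"
      using jacobi_P_raise_beta[OF n, of \<alpha> \<beta> "- (r * t)"] unfolding s_def p_def Q_def by simp
    moreover have "0 \<le> jacobi_P (n - 1) \<alpha> \<beta> (1 - 2 * (- (r * t)))" using par r that by (intro jacobi_P_nonneg) auto
    ultimately have "real n * Q t \<le> s * ((1 + r * t) * p t)" using n par by simp
    then show "Q t \<le> s / real n * ((1 + r * t) * p t)" using n by (simp add: pos_le_divide_eq mult.commute)
  qed
  have xr: "x + r * t > 0" "1 / (x + r * t) \<le> 2" "(1 + r * t) / (x + r * t) \<le> 2" if "t \<ge> 0" for t
  proof -
    have rt: "0 \<le> r * t" using r that by simp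
    then show "x + r * t > 0" using x by linarith
    then show "1 / (x + r * t) \<le> 2" "(1 + r * t) / (x + r * t) \<le> 2" using x rt by (simp_all add: divide_le_eq)
  qed
  have K: "jacobi_K n \<alpha> \<beta> x (- r * t) = f t + d t" if t: "t \<ge> 0" for t
  proof -
    have ne: "x \<noteq> - (r * t)" using xr[OF t] by linarith
    have "jacobi_K n \<alpha> \<beta> x (- r * t) = x powr \<alpha> * (1 - x) powr \<beta> * (jacobi_coeff n \<alpha> \<beta> * jacobi_quotient n \<alpha> \<beta> x (- (r * t)))"
      using x ne by (simp add: jacobi_K_def)
    also have "\<dots> = c * ((px * Q t - P * ((1 + r * t) * p t)) / (x + r * t))"
      unfolding jacobi_quotient_raise_beta[OF n par] c_def P_def px_def Q_def p_def by simp
    also have "(px * Q t - P * ((1 + r * t) * p t)) / (x + r * t) = - P * p t + (px * Q t / (x + r * t) - P * p t * ((1 - x) / (x + r * t)))"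
      using xr[OF t] by (simp add: divide_simps) (simp add: algebra_simps)
    finally show ?thesis unfolding f_def d_def by (simp only: distrib_left)
  qed
  have db: "\<bar>d t\<bar> \<le> c * D * p t" if t: "t \<ge> 0" for t
  proof -
    have "Q t / (x + r * t) \<le> s / real n * ((1 + r * t) * p t) / (x + r * t)"
      using Q0[OF t] xr[OF t] by (intro divide_right_mono) auto
    also have "\<dots> = s / real n * p t * ((1 + r * t) / (x + r * t))" by simp
    also have "\<dots> \<le> s / real n * p t * 2"
      using xr[OF t] p0[OF t] s by (intro mult_left_mono) auto
    finally have q: "Q t / (x + r * t) \<le> s / real n * p t * 2" .
    have q0: "0 \<le> Q t / (x + r * t)" using Q0[OF t] xr[OF t] by simp
    have "\<bar>px * Q t / (x + r * t) - P * p t * ((1 - x) / (x + r * t))\<bar> \<le> \<bar>px * (Q t / (x + r * t))\<bar> + \<bar>P * p t * ((1 - x) * (1 / (x + r * t)))\<bar>"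
      using abs_triangle_ineq4[of "px * (Q t / (x + r * t))" "P * p t * ((1 - x) * (1 / (x + r * t)))"] by simp
    also have "\<dots> = \<bar>px\<bar> * (Q t / (x + r * t)) + \<bar>P\<bar> * p t * ((1 - x) * (1 / (x + r * t)))"
    proof -
      have "\<bar>P * p t * Z\<bar> = \<bar>P\<bar> * p t * Z" if "0 \<le> Z" for Z
        using that p0[OF t] by (simp add: abs_mult)
      moreover have "0 \<le> (1 - x) * (1 / (x + r * t))" using x xr[OF t] by simp
      moreover have "\<bar>px * (Q t / (x + r * t))\<bar> = \<bar>px\<bar> * (Q t / (x + r * t))"
        by (simp only: abs_mult[of px] abs_of_nonneg[OF q0])
      ultimately show ?thesis by (simp only:)
    qed
    also have "\<dots> \<le> \<bar>px\<bar> * (s / real n * p t * 2) + \<bar>P\<bar> * p t * ((1 - x) * 2)"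
      using q xr[OF t] x p0[OF t] by (intro add_mono mult_left_mono) auto
    also have "\<dots> = D * p t" by (simp add: D_def px_def P_def s_def algebra_simps)
    finally show ?thesis using c unfolding d_def by (simp add: abs_mult mult.assoc mult_left_mono)
  qed
  have cont: "continuous_on UNIV p" "continuous_on UNIV Q"
    unfolding p_def Q_def by (intro continuous_on_jacobi_P continuous_intros)+
  then have [measurable]: "p \<in> borel_measurable borel" "Q \<in> borel_measurable borel"
    by (auto intro: borel_measurable_continuous_onI)
  have ip: "set_integrable lborel {0<..} (\<lambda>t. p t / (1 + t) ^ N)"
    unfolding p_def by (rule p_moment_sum(1)[OF n N])
  have fd: "f t / (1 + t) ^ N = (- c * P) * (p t / (1 + t) ^ N)" for t by (simp add: f_def)
  have ifi: "set_integrable lborel {0<..} (\<lambda>t. f t / (1 + t) ^ N)"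
    unfolding fd by (intro set_integrable_mult_right ip)
  have ib: "set_integrable lborel {0<..} (\<lambda>t. c * D * (p t / (1 + t) ^ N))"
    by (intro set_integrable_mult_right ip)
  have dbN: "\<bar>d t / (1 + t) ^ N\<bar> \<le> c * D * (p t / (1 + t) ^ N)" if "t \<in> {0<..}" for t
  proof -
    have "\<bar>d t\<bar> / (1 + t) ^ N \<le> c * D * p t / (1 + t) ^ N" using that by (intro divide_right_mono db) auto
    then show ?thesis using that by simp
  qed
  have id: "set_integrable lborel {0<..} (\<lambda>t. d t / (1 + t) ^ N)"
  proof (rule set_integrable_bound[OF ib])
    show "set_borel_measurable lborel {0<..} (\<lambda>t. d t / (1 + t) ^ N)"
      unfolding set_borel_measurable_def d_def by measurable
    show "AE t in lborel. t \<in> {0<..} \<longrightarrow> norm (d t / (1 + t) ^ N) \<le> norm (c * D * (p t / (1 + t) ^ N))"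
      using dbN by (intro AE_I2 impI) (simp only: real_norm_def, smt (verit))
  qed
  have ms: "(\<lambda>t. (f t + d t) / (1 + t) ^ N) \<in> borel_measurable borel"
    unfolding f_def d_def by measurable
  have ifd: "set_integrable lborel {0<..} (\<lambda>t. (f t + d t) / (1 + t) ^ N)"
    unfolding add_divide_distrib by (intro set_integral_add(1) ifi id)
  then have "set_integrable lborel {0..} (\<lambda>t. (f t + d t) / (1 + t) ^ N)"
    using set_lebesgue_halfline_open_closed(1)[OF ms] by simp
  then show "set_integrable lborel {0..} (\<lambda>t. jacobi_K n \<alpha> \<beta> x (- r * t) / (1 + t) ^ N)"
    by (subst set_integrable_cong[OF refl refl, of _ _ "\<lambda>t. (f t + d t) / (1 + t) ^ N"]) (simp_all add: K[unfolded mult_minus_left])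
  have "t_average N n \<alpha> \<beta> r x = (LBINT t:{0..}. (f t + d t) / (1 + t) ^ N)"
    unfolding t_average_def by (intro set_lebesgue_integral_cong) (simp_all add: K[unfolded mult_minus_left])
  also have "\<dots> = (LBINT t:{0<..}. (f t + d t) / (1 + t) ^ N)"
    by (rule set_lebesgue_halfline_open_closed(2)[OF ms])
  also have "\<dots> = (LBINT t:{0<..}. f t / (1 + t) ^ N) + (LBINT t:{0<..}. d t / (1 + t) ^ N)"
    unfolding add_divide_distrib by (rule set_integral_add(2)[OF ifi id])
  also have "(LBINT t:{0<..}. f t / (1 + t) ^ N) = - c * P * p_moment N n \<alpha> \<beta> r"
    unfolding fd p_moment_def p_def by (rule set_integral_mult_right)
  finally have "t_average N n \<alpha> \<beta> r x - (- c * P * p_moment N n \<alpha> \<beta> r) = (LBINT t:{0<..}. d t / (1 + t) ^ N)" by simp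
  then have "\<bar>t_average N n \<alpha> \<beta> r x - (- c * P * p_moment N n \<alpha> \<beta> r)\<bar> \<le> (LBINT t:{0<..}. \<bar>d t / (1 + t) ^ N\<bar>)"
    using set_integral_norm_bound[OF id] by simp
  also have "\<dots> \<le> (LBINT t:{0<..}. c * D * (p t / (1 + t) ^ N))"
    using dbN by (intro set_integral_mono ib set_integrable_abs id) auto
  also have "\<dots> = c * D * p_moment N n \<alpha> \<beta> r"
    unfolding p_moment_def p_def by (rule set_integral_mult_right)
  finally show "\<bar>t_average N n \<alpha> \<beta> r x - (- c * P * p_moment N n \<alpha> \<beta> r)\<bar> \<le> c * D * p_moment N n \<alpha> \<beta> r" .
qed

section \<open>Asymptotics of the paired averages\<close>

lemma jacobi_P_edge_bigo:
  assumes "b > - 1"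
  shows "(\<lambda>n. jacobi_P (n - d) \<alpha> b (1 - 2 * (1 - a / (real n)\<^sup>2))) \<in> O(\<lambda>n. real n powr b)"
proof -
  have "(\<lambda>n. edge_P \<alpha> b d n a) \<in> O(\<lambda>_. 1)"
    by (rule bigoI_tendsto[where c = "bessel_C b a"]) (use edge_P_tendsto[OF assms] in auto)
  then have "(\<lambda>n. real n powr b * edge_P \<alpha> b d n a) \<in> O(\<lambda>n. real n powr b * 1)"
    by (intro landau_o.big.mult landau_o.big_refl)
  moreover have "(\<lambda>n. jacobi_P (n - d) \<alpha> b (1 - 2 * (1 - a / (real n)\<^sup>2))) \<in> O(\<lambda>n. real n powr b * edge_P \<alpha> b d n a)"
  proof (rule bigoI[where c = 1])
    show "\<forall>\<^sub>F n in sequentially. norm (jacobi_P (n - d) \<alpha> b (1 - 2 * (1 - a / (real n)\<^sup>2))) \<le> 1 * norm (real n powr b * edge_P \<alpha> b d n a)"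
      using eventually_ge_at_top[of 1]
    proof eventually_elim
      case (elim n)
      show ?case unfolding jacobi_P_edge[OF elim] by (simp add: abs_mult power_abs)
    qed
  qed
  ultimately show ?thesis using landau_o.big_trans by simp blast
qed

lemma inverse_sqrt_tendsto: "(\<lambda>n. inverse (sqrt (real n))) \<longlonglongrightarrow> 0"
  by (rule tendsto_inverse_0_at_top[OF filterlim_compose[OF sqrt_at_top filterlim_real_sequentially]])

text \<open>One entry of the cofactor sum: \<open>a\<close> belongs to the row, hence to the first argument of the kernel under
the \<open>t\<close> average, and \<open>b\<close> to the column, hence to the second argument under the \<open>v\<close> average.\<close>

locale edge_scaling =
  fixes \<alpha> \<beta> r a b :: real
  assumes \<alpha>: "\<alpha> > - 1" and \<beta>: "\<beta> > 0" and a: "a \<ge> 0" and b: "b \<ge> 0"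
begin

definition rad :: "nat \<Rightarrow> real" where "rad n = 1 / 2 - r / sqrt (real n)"
definition xpt :: "nat \<Rightarrow> real" where "xpt n = 1 - a / (real n)\<^sup>2"
definition ypt :: "nat \<Rightarrow> real" where "ypt n = 1 - b / (real n)\<^sup>2"

lemma rad_tendsto: "rad \<longlonglongrightarrow> 1 / 2"
proof -
  have "(\<lambda>n. r * inverse (sqrt (real n))) \<longlonglongrightarrow> r * 0"
    by (intro tendsto_mult tendsto_const inverse_sqrt_tendsto)
  then have "(\<lambda>n. 1 / 2 - r * inverse (sqrt (real n))) \<longlonglongrightarrow> 1 / 2 - r * 0"
    by (intro tendsto_diff tendsto_const)
  moreover have "rad = (\<lambda>n. 1 / 2 - r * inverse (sqrt (real n)))"
    unfolding rad_def[abs_def] divide_inverse[of r] ..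
  ultimately show ?thesis by simp
qed

text \<open>The explicit margins in the estimates above, all of which hold for large \<open>n\<close>.\<close>

definition good :: "nat \<Rightarrow> bool" where
  "good n \<longleftrightarrow> n \<ge> 3 \<and> 1 / 4 \<le> rad n \<and> rad n \<le> 3 / 4 \<and> 7 / 8 \<le> ypt n \<and> 7 / 8 \<le> xpt n \<and> ypt n \<le> 1 \<and> xpt n \<le> 1
     \<and> 1 / 8 \<le> ypt n - rad n \<and> a \<le> (real n)\<^sup>2"

lemma eventually_good: "eventually good sequentially"
proof -
  have "\<forall>\<^sub>F n in sequentially. 1 / 4 < rad n" "\<forall>\<^sub>F n in sequentially. rad n < 3 / 4"
    by (rule order_tendstoD[OF rad_tendsto]; simp)+
  moreover have "\<forall>\<^sub>F n in sequentially. 7 / 8 < ypt n" "\<forall>\<^sub>F n in sequentially. 7 / 8 < xpt n"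
    unfolding xpt_def ypt_def by (rule order_tendstoD(1)[OF tendsto_edge_point]; simp)+
  ultimately show ?thesis using eventually_ge_at_top[of 3] eventually_le_n_squared[of a]
  proof eventually_elim
    case (elim n)
    have "ypt n \<le> 1" "xpt n \<le> 1" using a b by (auto simp: ypt_def xpt_def)
    then show ?case using elim unfolding good_def by linarith
  qed
qed

definition weight_x :: "nat \<Rightarrow> real" where "weight_x n = xpt n powr \<alpha> * (1 - xpt n) powr \<beta>"

lemma weight_x_eq: "n \<ge> 1 \<Longrightarrow> weight_x n = xpt n powr \<alpha> * (a powr \<beta> / real n powr (2 * \<beta>))"
proof -
  assume n: "n \<ge> 1"
  have "(1 - xpt n) powr \<beta> = a powr \<beta> / ((real n)\<^sup>2) powr \<beta>"
    using a by (simp add: xpt_def powr_divide)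
  also have "((real n)\<^sup>2) powr \<beta> = real n powr (2 * \<beta>)" using n by (simp add: powr_powr flip: powr_numeral)
  finally show ?thesis by (simp add: weight_x_def)
qed

lemma xpt_powr_tendsto: "(\<lambda>n. xpt n powr c) \<longlonglongrightarrow> 1"
  using tendsto_powr[OF tendsto_edge_point tendsto_const, of a c] by (simp add: xpt_def)

abbreviation Px where "Px n \<equiv> jacobi_P n \<alpha> \<beta> (1 - 2 * xpt n)"
abbreviation Py where "Py n \<equiv> jacobi_P n \<alpha> \<beta> (1 - 2 * ypt n)"

text \<open>The constant of \<open>v_main\<close>, asymptotically \<open>1/n\<close>.\<close>

definition prefactor :: "nat \<Rightarrow> real" where "prefactor n = gamma_coeff n \<alpha> \<beta> / ((real n + \<alpha>) * (real n)\<^sup>2)"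

lemma prefactor_tendsto: "(\<lambda>n. prefactor n * real n) \<longlonglongrightarrow> 1"
proof -
  have 1: "(\<lambda>n. gamma_coeff n \<alpha> \<beta> / (real n)\<^sup>2 / ((real n + \<alpha>) / real n)) \<longlonglongrightarrow> 1 / 1"
    by (intro tendsto_divide gamma_coeff_tendsto tendsto_add_const_over_n) auto
  then show ?thesis by (simp add: prefactor_def mult_ac)
qed

text \<open>Two Jacobi polynomials of size \<open>n\<^sup>\<beta>\<close> against the weight of size \<open>n\<^sup>-\<^sup>2\<^sup>\<beta>\<close>; the signs \<open>(-1)\<^sup>n\<close> cancel.\<close>

lemma main_prefactor_tendsto:
  "(\<lambda>n. prefactor n * real n * (Py n * weight_x n * Px n)) \<longlonglongrightarrow> a powr \<beta> * bessel_C \<beta> a * bessel_C \<beta> b"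
proof -
  have 1: "(\<lambda>n. prefactor n * real n * (xpt n powr \<alpha> * (a powr \<beta> * edge_P \<alpha> \<beta> 0 n a * edge_P \<alpha> \<beta> 0 n b))) \<longlonglongrightarrow>
     1 * (1 * (a powr \<beta> * bessel_C \<beta> a * bessel_C \<beta> b))"
    using \<beta> by (intro tendsto_mult prefactor_tendsto xpt_powr_tendsto tendsto_const edge_P_tendsto) auto
  have "\<forall>\<^sub>F n in sequentially. prefactor n * real n * (xpt n powr \<alpha> * (a powr \<beta> * edge_P \<alpha> \<beta> 0 n a * edge_P \<alpha> \<beta> 0 n b)) =
     prefactor n * real n * (Py n * weight_x n * Px n)"
    using eventually_ge_at_top[of 1]
  proof eventually_elim
    case (elim n)
    define N where "N = real n powr \<beta>"
    have N: "real n powr (2 * \<beta>) = N * N" by (simp add: N_def flip: powr_add)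
    have N0: "N \<noteq> 0" using elim by (simp add: N_def)
    have sgn: "((- 1) ^ n) * ((- 1) ^ n) = (1 :: real)" by (simp flip: power_mult_distrib)
    have x: "Px n = (- 1) ^ n * N * edge_P \<alpha> \<beta> 0 n a" and y: "Py n = (- 1) ^ n * N * edge_P \<alpha> \<beta> 0 n b"
      using jacobi_P_edge[OF elim, of 0 \<alpha> \<beta>] by (simp_all add: xpt_def ypt_def N_def)
    have "Py n * weight_x n * Px n = ((- 1) ^ n * (- 1) ^ n) * (xpt n powr \<alpha> * (a powr \<beta> * (N * N / (N * N)) * edge_P \<alpha> \<beta> 0 n a * edge_P \<alpha> \<beta> 0 n b))"
      unfolding x y weight_x_eq[OF elim] N by (simp add: mult_ac)
    then show ?case unfolding sgn using N0 by simp
  qed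
  then show ?thesis using Lim_transform_eventually[OF 1] by simp
qed

text \<open>The series cut off after \<open>n\<close> terms, in the normalization in which, for \<open>\<alpha> = 0\<close>, the full series
is \<open>(1-\<rho>)\<^sup>-\<^sup>N\<close> with \<open>N = n + \<beta> + 1\<close>.\<close>

definition nb_mass :: "nat \<Rightarrow> real" where "nb_mass n = nb_sum n \<alpha> \<beta> (rad n) / Gamma (real n + \<beta> + 1)"

lemma nb_mass_nonneg: "good n \<Longrightarrow> 0 \<le> nb_mass n"
proof -
  assume g: "good n"
  have "0 < Gamma (real n + \<beta> + 1)" using \<beta> by (intro Gamma_real_pos) auto
  moreover have "0 \<le> nb_sum n \<alpha> \<beta> (rad n)"
    unfolding nb_sum_def using g \<alpha> \<beta> by (intro sum_nonneg mult_nonneg_nonneg less_imp_le[OF nb_coeff_pos]) (auto simp: good_def)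
  ultimately show ?thesis by (simp add: nb_mass_def)
qed

lemma v_main_weight_eq: "good n \<Longrightarrow> v_main_weight n \<alpha> \<beta> (rad n) = (1 - rad n) ^ n * (rad n powr \<alpha> * (1 - rad n) powr (\<beta> - 1))"
proof -
  assume "good n"
  then have "0 < 1 - rad n" by (auto simp: good_def)
  moreover have "real n + \<beta> - 1 = real n + (\<beta> - 1)" by simp
  ultimately show ?thesis by (simp only: v_main_weight_def powr_add powr_realpow mult_ac)
qed

text \<open>The truncated series is at most of the order of the full one.\<close>

lemma nb_mass_bound: "\<exists>C. \<forall>n. good n \<longrightarrow> (1 - rad n) ^ n * nb_mass n \<le> C"
proof -
  obtain m :: nat where m: "\<alpha> \<le> real m" using real_arch_simple by blast
  have "(1 - rad n) ^ n * nb_mass n \<le> 4 powr \<bar>- (\<beta> + 1)\<bar> * 4 ^ m" if g: "good n" for n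
  proof -
    define w where "w = 1 - rad n"
    have w: "1 / 4 \<le> w" "w \<le> 1" "rad n \<ge> 1 / 4" "rad n \<le> 1" using g by (auto simp: w_def good_def)
    have G: "0 < Gamma (real n + \<beta> + 1)" using \<beta> by (intro Gamma_real_pos) auto
    have "nb_sum n \<alpha> \<beta> (rad n) \<le> Gamma (real n + \<beta> + 1) * w powr (- (real n + \<beta> + 1)) / rad n ^ m"
      unfolding w_def using g \<alpha> \<beta> m by (intro nb_sum_le) (auto simp: good_def)
    then have "nb_mass n \<le> w powr (- (real n + \<beta> + 1)) / rad n ^ m"
      unfolding nb_mass_def using G by (simp add: divide_le_eq mult.commute)
    then have "w ^ n * nb_mass n \<le> w ^ n * (w powr (- (real n + \<beta> + 1)) / rad n ^ m)"
      using w by (intro mult_left_mono) auto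
    also have "w powr (- (real n + \<beta> + 1)) = w powr (- (\<beta> + 1)) / w ^ n"
    proof -
      have "- (real n + \<beta> + 1) = - (\<beta> + 1) - real n" by simp
      then show ?thesis using w by (simp only: powr_diff) (simp add: powr_realpow)
    qed
    also have "w ^ n * (w powr (- (\<beta> + 1)) / w ^ n / rad n ^ m) = w powr (- (\<beta> + 1)) * (1 / rad n) ^ m"
      using w by (simp add: power_divide)
    also have "\<dots> \<le> 4 powr \<bar>- (\<beta> + 1)\<bar> * 4 ^ m"
      using w by (intro mult_mono powr_le_of_quarter power_mono) (auto simp: divide_le_eq)
    finally show ?thesis by (simp add: w_def)
  qed
  then show ?thesis by blast
qed

text \<open>The combination of sum and moment in the difference of the two main products; see \<open>main_product\<close>.\<close>

definition bracket :: "nat \<Rightarrow> real" where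
  "bracket n = (1 + \<alpha> - (real n + \<beta> - 1) * (rad n / (1 - rad n))) * nb_sum n \<alpha> \<beta> (rad n) + nb_moment n \<alpha> \<beta> (rad n)"

text \<open>Here the leading order cancels. The sum \<open>S\<close> enters \<open>bracket\<close> with a coefficient of order \<open>n\<close>, and the
moment, expressed by \<open>nb_recurrence\<close>, compensates it up to a bounded multiple of \<open>S\<close>. The cut-off term is
the only other large contribution.\<close>

lemma bracket_eq:
  assumes g: "good n"
  shows "bracket n = (1 + 2 * (rad n / (1 - rad n))) * nb_sum n \<alpha> \<beta> (rad n)
     + \<alpha> * nb_coeff n \<alpha> \<beta> 0 / (1 - rad n)
     - Gamma (2 * real n + \<alpha> + \<beta> + 1) / Gamma (real n + \<alpha>) * rad n ^ n / (1 - rad n)"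
proof -
  define \<rho> where "\<rho> = rad n"
  define S where "S = nb_sum n \<alpha> \<beta> \<rho>"
  define M where "M = nb_moment n \<alpha> \<beta> \<rho>"
  define T where "T = \<alpha> * nb_coeff n \<alpha> \<beta> 0"
  define Z where "Z = (2 * real n + \<alpha> + \<beta>) * nb_coeff n \<alpha> \<beta> (n - 1) * \<rho> ^ n"
  have n: "n \<ge> 1" "n \<ge> 3" and w: "1 - \<rho> > 0" using g by (auto simp: good_def \<rho>_def)
  have rec: "(1 - \<rho>) * (M + \<alpha> * S) = (real n + \<beta> + 1) * \<rho> * S + T - Z"
    unfolding M_def S_def T_def Z_def by (rule nb_recurrence[OF n(1) \<alpha> \<beta>])
  have "Z = Gamma (2 * real n + \<alpha> + \<beta> + 1) / Gamma (real n + \<alpha>) * \<rho> ^ n"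
  proof -
    have "Gamma (2 * real n + \<alpha> + \<beta> + 1) = (2 * real n + \<alpha> + \<beta>) * Gamma (2 * real n + \<alpha> + \<beta>)"
      using Gamma_pochhammer[of "2 * real n + \<alpha> + \<beta>" 1] n \<alpha> \<beta> by simp
    moreover have "nb_coeff n \<alpha> \<beta> (n - 1) = Gamma (2 * real n + \<alpha> + \<beta>) / Gamma (real n + \<alpha>)"
    proof -
      have e: "real n + real (n - 1) + \<alpha> + \<beta> + 1 = 2 * real n + \<alpha> + \<beta>" "real (n - 1) + \<alpha> + 1 = real n + \<alpha>"
        using n by (simp_all add: of_nat_diff)
      show ?thesis unfolding nb_coeff_def e ..
    qed
    ultimately show ?thesis by (simp add: Z_def)
  qed
  moreover have "M = ((real n + \<beta> + 1) * \<rho> * S + T - Z) / (1 - \<rho>) - \<alpha> * S"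
    unfolding rec[symmetric] using w by simp
  moreover have "(1 + \<alpha> - (real n + \<beta> - 1) * (\<rho> / (1 - \<rho>))) * S + (((real n + \<beta> + 1) * \<rho> * S + T - Z) / (1 - \<rho>) - \<alpha> * S) =
     (1 + 2 * (\<rho> / (1 - \<rho>))) * S + T / (1 - \<rho>) - Z / (1 - \<rho>)"
    using w by (simp add: divide_simps) (simp add: algebra_simps)
  ultimately show ?thesis
    unfolding bracket_def \<rho>_def[symmetric] S_def[symmetric] M_def[symmetric] T_def[symmetric] by simp
qed

text \<open>\<open>4\<rho>(1-\<rho>) = 1 - 4r\<^sup>2/n\<close> at \<open>\<rho> = 1/2 - r/sqrt n\<close>: the maximum of \<open>\<rho>(1-\<rho>)\<close> at \<open>1/2\<close> is the reason for this
centre and for the scale \<open>sqrt n\<close>.\<close>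

lemma gaussian_tendsto: "(\<lambda>n. (4 * (rad n * (1 - rad n))) ^ n) \<longlonglongrightarrow> exp (- 4 * r\<^sup>2)"
proof -
  have "(\<lambda>n. (1 + (- 4 * r\<^sup>2) / real n) ^ n) \<longlonglongrightarrow> exp (- 4 * r\<^sup>2)"
    by (rule tendsto_exp_limit_sequentially)
  moreover have "\<forall>\<^sub>F n in sequentially. (1 + (- 4 * r\<^sup>2) / real n) ^ n = (4 * (rad n * (1 - rad n))) ^ n"
    using eventually_gt_at_top[of 0]
  proof eventually_elim
    case (elim n)
    define s where "s = sqrt (real n)"
    have s: "s * s = real n" "s \<noteq> 0" using elim by (auto simp: s_def)
    have "1 + (- 4 * r\<^sup>2) / (s * s) = 4 * ((1 / 2 - r / s) * (1 - (1 / 2 - r / s)))"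
      using s(2) by (simp add: field_simps power2_eq_square)
    then show ?case by (simp add: rad_def s(1) flip: s_def)
  qed
  ultimately show ?thesis by (rule Lim_transform_eventually)
qed

text \<open>After multiplication by \<open>(1-\<rho>)\<^sup>n/Gamma (n+\<beta>+1)\<close> the first two terms of \<open>bracket_eq\<close> are bounded, hence
negligible after division by \<open>sqrt n\<close>. The cut-off term becomes the product of \<open>gaussian_tendsto\<close> and
\<open>central_Gamma_quotient_tendsto\<close>.\<close>

lemma main_factor_tendsto:
  "(\<lambda>n. v_main_weight n \<alpha> \<beta> (rad n) / Gamma (real n + \<beta> + 1) * bracket n / sqrt (real n)) \<longlonglongrightarrow> - (4 / sqrt pi) * exp (- 4 * r\<^sup>2)"
proof -
  define h where "h n = rad n powr \<alpha> * (1 - rad n) powr (\<beta> - 1)" for n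
  have r1: "(\<lambda>n. 1 - rad n) \<longlonglongrightarrow> 1 / 2"
    using tendsto_diff[OF tendsto_const rad_tendsto, of 1] by simp
  have h: "h \<longlonglongrightarrow> (1 / 2) powr \<alpha> * (1 / 2) powr (\<beta> - 1)"
    unfolding h_def[abs_def] by (intro tendsto_mult tendsto_powr rad_tendsto r1 tendsto_const) auto
  have ev0: "\<forall>\<^sub>F n in sequentially. \<bar>(1 - rad n) ^ n * nb_mass n\<bar> \<le> C" if "\<forall>n. good n \<longrightarrow> (1 - rad n) ^ n * nb_mass n \<le> C" for C
    using eventually_good
  proof eventually_elim
    case (elim n)
    have "0 \<le> (1 - rad n) ^ n * nb_mass n" using nb_mass_nonneg[OF elim] elim by (auto simp: good_def)
    then show ?case using that elim by simp
  qed
  obtain C where C: "\<forall>n. good n \<longrightarrow> (1 - rad n) ^ n * nb_mass n \<le> C" using nb_mass_bound by blast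
  have isq: "(\<lambda>n. inverse (sqrt (real n))) \<longlonglongrightarrow> 0"
    by (rule inverse_sqrt_tendsto)
  have zero: "(\<lambda>n. f n * inverse (sqrt (real n))) \<longlonglongrightarrow> 0" if "\<forall>\<^sub>F n in sequentially. \<bar>f n\<bar> \<le> K" for f K
  proof (rule tendsto_0_le[OF isq])
    show "\<forall>\<^sub>F n in sequentially. norm (f n * inverse (sqrt (real n))) \<le> norm (inverse (sqrt (real n))) * K"
      using that by eventually_elim (simp add: abs_mult mult.commute[of _ K] mult_right_mono)
  qed
  have t1: "(\<lambda>n. h n * (1 + 2 * (rad n / (1 - rad n))) * (((1 - rad n) ^ n * nb_mass n) * inverse (sqrt (real n)))) \<longlonglongrightarrow>
      ((1 / 2) powr \<alpha> * (1 / 2) powr (\<beta> - 1)) * (1 + 2 * ((1 / 2) / (1 / 2))) * 0"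
    by (intro tendsto_mult h tendsto_add tendsto_divide tendsto_const rad_tendsto r1 zero[OF ev0[OF C]]) auto
  \<comment> \<open>the term at \<open>j = 0\<close> is one summand of the truncated series, hence no larger than it\<close>
  define c0 where "c0 n = nb_coeff n \<alpha> \<beta> 0 / Gamma (real n + \<beta> + 1)" for n
  have "\<forall>\<^sub>F n in sequentially. \<bar>(1 - rad n) ^ n * c0 n\<bar> \<le> C"
    using eventually_good ev0[OF C]
  proof eventually_elim
    case (elim n)
    have G: "0 < Gamma (real n + \<beta> + 1)" using \<beta> by (intro Gamma_real_pos) auto
    have "nb_coeff n \<alpha> \<beta> 0 * rad n ^ 0 \<le> nb_sum n \<alpha> \<beta> (rad n)"
      unfolding nb_sum_def
    proof (rule member_le_sum)
      fix j
      show "0 \<le> nb_coeff n \<alpha> \<beta> j * rad n ^ j"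
        using elim(1) \<alpha> \<beta> by (intro mult_nonneg_nonneg less_imp_le[OF nb_coeff_pos]) (auto simp: good_def)
    qed (use elim(1) in \<open>auto simp: good_def\<close>)
    then have "c0 n \<le> nb_mass n" using G by (simp add: c0_def nb_mass_def divide_right_mono)
    moreover have "0 \<le> c0 n" unfolding c0_def using G nb_coeff_pos[of n \<alpha> \<beta> 0] \<alpha> \<beta> elim(1) by (auto simp: good_def)
    moreover have "0 \<le> (1 - rad n) ^ n" using elim(1) by (auto simp: good_def)
    ultimately have "0 \<le> (1 - rad n) ^ n * c0 n" "(1 - rad n) ^ n * c0 n \<le> (1 - rad n) ^ n * nb_mass n"
      by (auto intro: mult_left_mono)
    then show ?case using elim(2) by linarith
  qed
  then have t2: "(\<lambda>n. h n * (\<alpha> / (1 - rad n)) * (((1 - rad n) ^ n * c0 n) * inverse (sqrt (real n)))) \<longlonglongrightarrow>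
      ((1 / 2) powr \<alpha> * (1 / 2) powr (\<beta> - 1)) * (\<alpha> / (1 / 2)) * 0"
    by (intro tendsto_mult h tendsto_divide tendsto_const r1 zero) auto
  \<comment> \<open>the cut-off term, which carries the limit\<close>
  define q where "q n = Gamma (2 * real n + \<alpha> + \<beta> + 1) / (Gamma (real n + \<alpha>) * Gamma (real n + \<beta> + 1)) / (4 ^ n * sqrt (real n))" for n
  have t3: "(\<lambda>n. q n * (4 * (rad n * (1 - rad n))) ^ n * (h n / (1 - rad n))) \<longlonglongrightarrow>
      (2 powr (\<alpha> + \<beta>) / sqrt pi) * exp (- 4 * r\<^sup>2) * ((1 / 2) powr \<alpha> * (1 / 2) powr (\<beta> - 1) / (1 / 2))"
    unfolding q_def by (intro tendsto_mult tendsto_divide h r1 gaussian_tendsto central_Gamma_quotient_tendsto) auto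
  have pw: "(2 powr (\<alpha> + \<beta>) / sqrt pi) * exp (- 4 * r\<^sup>2) * ((1 / 2) powr \<alpha> * (1 / 2) powr (\<beta> - 1) / (1 / 2)) = (4 / sqrt pi) * exp (- 4 * r\<^sup>2)"
    by (simp add: powr_divide powr_add powr_diff)
  have lim: "(\<lambda>n. h n * (1 + 2 * (rad n / (1 - rad n))) * (((1 - rad n) ^ n * nb_mass n) * inverse (sqrt (real n)))
      + h n * (\<alpha> / (1 - rad n)) * (((1 - rad n) ^ n * c0 n) * inverse (sqrt (real n)))
      - q n * (4 * (rad n * (1 - rad n))) ^ n * (h n / (1 - rad n))) \<longlonglongrightarrow> - (4 / sqrt pi) * exp (- 4 * r\<^sup>2)"
    using tendsto_diff[OF tendsto_add[OF t1 t2] t3] unfolding pw by simp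
  have "\<forall>\<^sub>F n in sequentially. h n * (1 + 2 * (rad n / (1 - rad n))) * (((1 - rad n) ^ n * nb_mass n) * inverse (sqrt (real n)))
      + h n * (\<alpha> / (1 - rad n)) * (((1 - rad n) ^ n * c0 n) * inverse (sqrt (real n)))
      - q n * (4 * (rad n * (1 - rad n))) ^ n * (h n / (1 - rad n)) =
      v_main_weight n \<alpha> \<beta> (rad n) / Gamma (real n + \<beta> + 1) * bracket n / sqrt (real n)"
    using eventually_good
  proof eventually_elim
    case (elim n)
    define G where "G = Gamma (real n + \<beta> + 1)"
    define s where "s = sqrt (real n)"
    define W where "W = 1 - rad n"
    define u where "u = W ^ n"
    define H where "H = h n"
    have mG: "v_main_weight n \<alpha> \<beta> (rad n) = u * H"
      unfolding v_main_weight_eq[OF elim] by (simp add: u_def W_def H_def h_def)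
    define Z where "Z = Gamma (2 * real n + \<alpha> + \<beta> + 1) / Gamma (real n + \<alpha>)"
    define S where "S = nb_sum n \<alpha> \<beta> (rad n)"
    define k where "k = nb_coeff n \<alpha> \<beta> 0"
    have q: "q n * (4 * (rad n * W)) ^ n = Z * rad n ^ n * u / (G * s)"
      by (simp add: q_def Z_def G_def s_def u_def W_def power_mult_distrib)
    show ?case
      unfolding bracket_eq[OF elim] mG H_def[symmetric] nb_mass_def c0_def
        G_def[symmetric] s_def[symmetric] W_def[symmetric] Z_def[symmetric] S_def[symmetric] k_def[symmetric]
      unfolding q u_def[symmetric]
      by (simp add: divide_inverse algebra_simps)
  qed
  then show ?thesis by (rule Lim_transform_eventually[OF lim])
qed

text \<open>The weight of one cofactor in \<open>cross_covariance_cofactors\<close>.\<close>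

definition paired_averages :: "nat \<Rightarrow> real" where
  "paired_averages n = v_average n \<alpha> \<beta> (rad n) (ypt n) * t_average (n + 1) n \<alpha> \<beta> (rad n) (xpt n)
     - v_average' n \<alpha> \<beta> (rad n) (ypt n) * t_average (n + 2) n \<alpha> \<beta> (rad n) (xpt n)"

text \<open>The analogue of \<open>nb_mass\<close> for the exponent \<open>n + 2\<close>; see \<open>p_moment_eq\<close>.\<close>

definition nb_mass' :: "nat \<Rightarrow> real" where
  "nb_mass' n = (real n * nb_sum n \<alpha> \<beta> (rad n) - nb_moment n \<alpha> \<beta> (rad n)) / (real n + 1) / Gamma (real n + \<beta> + 1)"

definition t_main :: "nat \<Rightarrow> real" where "t_main n = - (weight_x n * Px n * nb_mass n)"
definition t_main' :: "nat \<Rightarrow> real" where "t_main' n = - (weight_x n * Px n * nb_mass' n)"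

abbreviation mA where "mA n \<equiv> v_main n \<alpha> \<beta> (rad n) (ypt n)"
abbreviation mA' where "mA' n \<equiv> v_main' n \<alpha> \<beta> (rad n) (ypt n)"
abbreviation oA where "oA n \<equiv> v_average n \<alpha> \<beta> (rad n) (ypt n)"
abbreviation oA' where "oA' n \<equiv> v_average' n \<alpha> \<beta> (rad n) (ypt n)"
abbreviation oB where "oB n \<equiv> t_average (n + 1) n \<alpha> \<beta> (rad n) (xpt n)"
abbreviation oB' where "oB' n \<equiv> t_average (n + 2) n \<alpha> \<beta> (rad n) (xpt n)"

lemma main_product:
  assumes "n \<ge> 1"
  shows "mA n * t_main n - mA' n * t_main' n =
    prefactor n * (Py n * weight_x n * Px n) * (v_main_weight n \<alpha> \<beta> (rad n) / Gamma (real n + \<beta> + 1) * bracket n)"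
proof -
  define S where "S = nb_sum n \<alpha> \<beta> (rad n)"
  define M where "M = nb_moment n \<alpha> \<beta> (rad n)"
  define t where "t = rad n / (1 - rad n)"
  define G where "G = Gamma (real n + \<beta> + 1)"
  define Q where "Q = prefactor n * Py n * v_main_weight n \<alpha> \<beta> (rad n) * (weight_x n * Px n)"
  have "mA n * t_main n = Q * ((real n + 1 + \<alpha> - (real n + \<beta> - 1) * t) * S) / G"
    unfolding v_main_def t_main_def nb_mass_def prefactor_def[symmetric] S_def t_def G_def Q_def by simp
  moreover have "mA' n * t_main' n = Q * (real n * S - M) / G"
  proof -
    have "mA' n * t_main' n = Q * ((real n + 1) * ((real n * S - M) / (real n + 1))) / G"
      unfolding v_main'_def t_main'_def nb_mass'_def prefactor_def[symmetric] S_def M_def G_def Q_def by (simp add: mult_ac)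
    then show ?thesis by simp
  qed
  moreover have "bracket n = (1 + \<alpha> - (real n + \<beta> - 1) * t) * S + M"
    by (simp add: bracket_def S_def M_def t_def)
  ultimately show ?thesis
    unfolding Q_def[symmetric] by (simp add: Q_def G_def[symmetric] diff_divide_distrib[symmetric] right_diff_distrib[symmetric] mult_ac)
      (simp add: algebra_simps)?
qed

lemma main_product_tendsto:
  "(\<lambda>n. sqrt (real n) * (mA n * t_main n - mA' n * t_main' n)) \<longlonglongrightarrow>
     - (4 / sqrt pi) * exp (- 4 * r\<^sup>2) * (a powr \<beta> * bessel_C \<beta> a * bessel_C \<beta> b)"
proof -
  have 1: "(\<lambda>n. (v_main_weight n \<alpha> \<beta> (rad n) / Gamma (real n + \<beta> + 1) * bracket n / sqrt (real n)) * (prefactor n * real n * (Py n * weight_x n * Px n))) \<longlonglongrightarrow>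
     - (4 / sqrt pi) * exp (- 4 * r\<^sup>2) * (a powr \<beta> * bessel_C \<beta> a * bessel_C \<beta> b)"
    by (rule tendsto_mult[OF main_factor_tendsto main_prefactor_tendsto])
  have "\<forall>\<^sub>F n in sequentially. (v_main_weight n \<alpha> \<beta> (rad n) / Gamma (real n + \<beta> + 1) * bracket n / sqrt (real n)) * (prefactor n * real n * (Py n * weight_x n * Px n)) =
     sqrt (real n) * (mA n * t_main n - mA' n * t_main' n)"
    using eventually_ge_at_top[of 1]
  proof eventually_elim
    case (elim n)
    have "X / sqrt (real n) * (Y * real n * Z) = sqrt (real n) * (Y * Z * X)" for X Y Z
    proof -
      have "X / sqrt (real n) * (Y * real n * Z) = (real n / sqrt (real n)) * (Y * Z * X)" by simp
      then show ?thesis by (simp only: real_div_sqrt of_nat_0_le_iff)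
    qed
    then show ?case unfolding main_product[OF elim] by (simp only:)
  qed
  then show ?thesis by (rule Lim_transform_eventually[OF 1])
qed

text \<open>Exponential decay of the \<open>v\<close> averages. It compensates the growth of \<open>nb_mass\<close> in the \<open>t\<close> averages.\<close>

definition decay :: "nat \<Rightarrow> real" where "decay n = (1 - rad n) ^ n"

lemma Py_bigo: "Py \<in> O(\<lambda>n. real n powr \<beta>)" and Px_bigo: "Px \<in> O(\<lambda>n. real n powr \<beta>)"
  using jacobi_P_edge_bigo[of \<beta> 0 \<alpha>] \<beta> by (simp_all add: xpt_def ypt_def)

lemma bigo_of_tendsto_one:
  assumes "(f :: nat \<Rightarrow> real) \<longlonglongrightarrow> c"
  shows "f \<in> O(\<lambda>_. 1)"
  by (rule bigoI_tendsto[where c = c]) (use assms in auto)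

lemma prefactor_bigo: "prefactor \<in> O(\<lambda>n. 1 / real n)"
  by (rule bigoI_tendsto[where c = 1]) (use prefactor_tendsto in \<open>auto intro: eventually_mono[OF eventually_gt_at_top[of 0]]\<close>)

lemma gamma_ratio_bigo: "(\<lambda>n. gamma_coeff n \<alpha> \<beta> / (real n + \<alpha>)) \<in> O(\<lambda>n. real n)"
proof -
  have "(\<lambda>n. gamma_coeff n \<alpha> \<beta> / (real n + \<alpha>) / real n) \<longlonglongrightarrow> 1"
  proof (rule Lim_transform_eventually[OF prefactor_tendsto])
    show "\<forall>\<^sub>F n in sequentially. prefactor n * real n = gamma_coeff n \<alpha> \<beta> / (real n + \<alpha>) / real n"
      using eventually_gt_at_top[of 0] by eventually_elim (simp add: prefactor_def power2_eq_square)
  qed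
  then show ?thesis
    by (rule bigoI_tendsto) (auto intro: eventually_mono[OF eventually_gt_at_top[of 0]])
qed

lemma rad_ratio_bigo: "(\<lambda>n. rad n / (1 - rad n)) \<in> O(\<lambda>_. 1)"
proof (rule bigo_of_tendsto_one)
  show "(\<lambda>n. rad n / (1 - rad n)) \<longlonglongrightarrow> (1 / 2) / (1 - 1 / 2)"
    by (intro tendsto_divide tendsto_diff tendsto_const rad_tendsto) auto
qed

lemma linear_bigo: "(\<lambda>n. real n + c) \<in> O(\<lambda>n. real n)"
  by (rule bigoI_tendsto[where c = 1]) (use tendsto_add_const_over_n[of c] in \<open>auto intro: eventually_mono[OF eventually_gt_at_top[of 0]]\<close>)

lemma v_main_weight_bigo: "(\<lambda>n. v_main_weight n \<alpha> \<beta> (rad n)) \<in> O(decay)"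
proof -
  have "(\<lambda>n. rad n powr \<alpha> * (1 - rad n) powr (\<beta> - 1)) \<longlonglongrightarrow> (1 / 2) powr \<alpha> * (1 - 1 / 2) powr (\<beta> - 1)"
    by (intro tendsto_mult tendsto_powr rad_tendsto tendsto_diff tendsto_const) auto
  from landau_o.big.mult[OF landau_o.big_refl bigo_of_tendsto_one[OF this], of decay]
  have "(\<lambda>n. decay n * (rad n powr \<alpha> * (1 - rad n) powr (\<beta> - 1))) \<in> O(decay)" by simp
  then show ?thesis
    by (rule landau_o.big.in_cong[THEN iffD1, rotated])
       (use eventually_good in \<open>eventually_elim, simp add: v_main_weight_eq decay_def\<close>)
qed

lemma v_main_bigo: "mA \<in> O(\<lambda>n. real n powr \<beta> * decay n)" and v_main'_bigo: "mA' \<in> O(\<lambda>n. real n powr \<beta> * decay n)"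
proof -
  have br: "(\<lambda>n. real n + 1 + \<alpha> - (real n + \<beta> - 1) * (rad n / (1 - rad n))) \<in> O(\<lambda>n. real n)"
  proof (rule sum_in_bigo)
    show "(\<lambda>n. real n + 1 + \<alpha>) \<in> O(\<lambda>n. real n)" using linear_bigo[of "1 + \<alpha>"] by (simp add: add.assoc)
    have "(\<lambda>n. (real n + (\<beta> - 1)) * (rad n / (1 - rad n))) \<in> O(\<lambda>n. real n * 1)"
      by (intro landau_o.big.mult linear_bigo rad_ratio_bigo)
    then show "(\<lambda>n. (real n + \<beta> - 1) * (rad n / (1 - rad n))) \<in> O(\<lambda>n. real n)" by (simp add: add_diff_eq)
  qed
  have gen: "(\<lambda>n. prefactor n * Py n * v_main_weight n \<alpha> \<beta> (rad n) * f n) \<in> O(\<lambda>n. real n powr \<beta> * decay n)"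
    if f: "f \<in> O(\<lambda>n. real n)" for f
  proof -
    have "(\<lambda>n. prefactor n * Py n * v_main_weight n \<alpha> \<beta> (rad n) * f n) \<in> O(\<lambda>n. 1 / real n * real n powr \<beta> * decay n * real n)"
      by (intro landau_o.big.mult prefactor_bigo Py_bigo v_main_weight_bigo f)
    also have "(\<lambda>n. 1 / real n * real n powr \<beta> * decay n * real n) \<in> O(\<lambda>n. real n powr \<beta> * decay n)"
      by (rule bigoI[where c = 1]) (use eventually_gt_at_top[of 0] in \<open>eventually_elim, simp\<close>)
    finally show ?thesis .
  qed
  have "(\<lambda>n. - (prefactor n * Py n * v_main_weight n \<alpha> \<beta> (rad n) * (real n + 1 + \<alpha> - (real n + \<beta> - 1) * (rad n / (1 - rad n))))) \<in> O(\<lambda>n. real n powr \<beta> * decay n)"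
    using gen[OF br] by simp
  then show "mA \<in> O(\<lambda>n. real n powr \<beta> * decay n)" by (simp add: v_main_def prefactor_def)
  have "(\<lambda>n. - (prefactor n * Py n * v_main_weight n \<alpha> \<beta> (rad n) * (real n + 1))) \<in> O(\<lambda>n. real n powr \<beta> * decay n)"
    using gen[OF linear_bigo] by simp
  then show "mA' \<in> O(\<lambda>n. real n powr \<beta> * decay n)" by (simp add: v_main'_def prefactor_def)
qed

lemma decay_nonneg: "good n \<Longrightarrow> 0 \<le> decay n"
  by (auto simp: decay_def good_def)

text \<open>One power of \<open>n\<close> better than the main term \<open>v_main\<close>.\<close>

lemma A_error_bigo:
  "(\<lambda>n. oA n - mA n) \<in> O(\<lambda>n. real n powr (\<beta> - 1) * decay n)"
  "(\<lambda>n. oA' n - mA' n) \<in> O(\<lambda>n. real n powr (\<beta> - 1) * decay n)"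
proof -
  define R where "R = remainder_const \<alpha> (\<beta> - 1) b + remainder_const \<alpha> \<beta> b"
  define E where "E n = 8 * (gamma_coeff n \<alpha> \<beta> / (real n + \<alpha>)) *
     (\<bar>Py n\<bar> * (1 - ypt n) + \<bar>jacobi_P n \<alpha> (\<beta> - 1) (1 - 2 * ypt n)\<bar>) * (R / real n * (1 - rad n) ^ n)" for n
  have P: "(\<lambda>n. \<bar>Py n\<bar> * (1 - ypt n) + \<bar>jacobi_P n \<alpha> (\<beta> - 1) (1 - 2 * ypt n)\<bar>) \<in> O(\<lambda>n. real n powr (\<beta> - 1))"
  proof (rule sum_in_bigo)
    show "(\<lambda>n. \<bar>jacobi_P n \<alpha> (\<beta> - 1) (1 - 2 * ypt n)\<bar>) \<in> O(\<lambda>n. real n powr (\<beta> - 1))"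
      using jacobi_P_edge_bigo[of "\<beta> - 1" 0 \<alpha> b] \<beta> by (simp add: ypt_def)
    have "(\<lambda>n. 1 - ypt n) \<in> O(\<lambda>n. 1 / real n)"
    proof (rule bigoI[where c = b])
      show "\<forall>\<^sub>F n in sequentially. norm (1 - ypt n) \<le> b * norm (1 / real n)"
        using eventually_ge_at_top[of 1]
      proof eventually_elim
        case (elim n)
        have "b * 1 \<le> b * real n" using elim b by (intro mult_left_mono) auto
        then show ?case using elim b by (simp add: ypt_def power2_eq_square divide_simps)
      qed
    qed
    then have "(\<lambda>n. \<bar>Py n\<bar> * (1 - ypt n)) \<in> O(\<lambda>n. real n powr \<beta> * (1 / real n))"
      using Py_bigo by (intro landau_o.big.mult) auto
    also have "(\<lambda>n. real n powr \<beta> * (1 / real n)) \<in> O(\<lambda>n. real n powr (\<beta> - 1))"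
      by (rule bigoI[where c = 1]) (use eventually_gt_at_top[of 0] in \<open>eventually_elim, simp add: powr_diff\<close>)
    finally show "(\<lambda>n. \<bar>Py n\<bar> * (1 - ypt n)) \<in> O(\<lambda>n. real n powr (\<beta> - 1))" .
  qed
  have c: "(\<lambda>n. R / real n * (1 - rad n) ^ n) \<in> O(\<lambda>n. 1 / real n * decay n)"
    by (rule bigoI[where c = "\<bar>R\<bar>"]) (simp add: decay_def abs_mult)
  have "E \<in> O(\<lambda>n. real n * real n powr (\<beta> - 1) * (1 / real n * decay n))"
  proof -
    have "(\<lambda>n. 8 * (gamma_coeff n \<alpha> \<beta> / (real n + \<alpha>))) \<in> O(\<lambda>n. real n)"
      by (subst landau_o.big.cmult_in_iff) (use gamma_ratio_bigo in simp_all)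
    from landau_o.big.mult[OF landau_o.big.mult[OF this P] c] show ?thesis
      unfolding E_def[abs_def] .
  qed
  also have "(\<lambda>n. real n * real n powr (\<beta> - 1) * (1 / real n * decay n)) \<in> O(\<lambda>n. real n powr (\<beta> - 1) * decay n)"
    by (rule bigoI[where c = 1]) (use eventually_gt_at_top[of 0] in \<open>eventually_elim, simp\<close>)
  finally have E: "E \<in> O(\<lambda>n. real n powr (\<beta> - 1) * decay n)" .
  have bnd: "\<bar>oA n - mA n\<bar> \<le> E n \<and> \<bar>oA' n - mA' n\<bar> \<le> E n" if g: "good n" for n
    unfolding E_def R_def using g \<alpha> \<beta> b by (intro conjI v_average_approx) (auto simp: good_def ypt_def)
  have tr: "f \<in> O(E)" if "\<And>n. good n \<Longrightarrow> \<bar>f n\<bar> \<le> E n" for f :: "nat \<Rightarrow> real"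
    by (rule bigoI[where c = 1]) (use eventually_good in \<open>eventually_elim, use that in fastforce\<close>)
  show "(\<lambda>n. oA n - mA n) \<in> O(\<lambda>n. real n powr (\<beta> - 1) * decay n)"
    by (rule landau_o.big_trans[OF tr E]) (use bnd in auto)
  show "(\<lambda>n. oA' n - mA' n) \<in> O(\<lambda>n. real n powr (\<beta> - 1) * decay n)"
    by (rule landau_o.big_trans[OF tr E]) (use bnd in auto)
qed

lemma weight_x_bigo: "weight_x \<in> O(\<lambda>n. real n powr (- 2 * \<beta>))"
proof -
  have "(\<lambda>n. xpt n powr \<alpha> * a powr \<beta>) \<in> O(\<lambda>_. 1)"
    by (rule bigo_of_tendsto_one[OF tendsto_mult[OF xpt_powr_tendsto tendsto_const]])
  then have "(\<lambda>n. (xpt n powr \<alpha> * a powr \<beta>) * real n powr (- 2 * \<beta>)) \<in> O(\<lambda>n. 1 * real n powr (- 2 * \<beta>))"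
    by (intro landau_o.big.mult landau_o.big_refl)
  moreover have "\<forall>\<^sub>F n in sequentially. (xpt n powr \<alpha> * a powr \<beta>) * real n powr (- 2 * \<beta>) = weight_x n"
    using eventually_ge_at_top[of 1] by eventually_elim (simp add: weight_x_eq powr_minus divide_inverse)
  ultimately show ?thesis using landau_o.big.in_cong by fastforce
qed

lemma nb_mass'_bounds: "good n \<Longrightarrow> 0 \<le> nb_mass' n \<and> nb_mass' n \<le> nb_mass n"
proof -
  assume g: "good n"
  have n: "n \<ge> 1" "0 \<le> rad n" using g by (auto simp: good_def)
  have G: "0 < Gamma (real n + \<beta> + 1)" using \<beta> by (intro Gamma_real_pos) auto
  define S where "S = nb_sum n \<alpha> \<beta> (rad n)"
  define M where "M = nb_moment n \<alpha> \<beta> (rad n)"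
  have t: "0 \<le> nb_coeff n \<alpha> \<beta> j * rad n ^ j" for j
    using n \<alpha> \<beta> by (intro mult_nonneg_nonneg less_imp_le[OF nb_coeff_pos]) auto
  have M0: "0 \<le> M" unfolding M_def nb_moment_def by (intro sum_nonneg mult_nonneg_nonneg[OF _ t]) auto
  have "M \<le> (\<Sum>j<n. real n * (nb_coeff n \<alpha> \<beta> j * rad n ^ j))"
    unfolding M_def nb_moment_def using t by (intro sum_mono mult_right_mono) auto
  then have MS: "M \<le> real n * S" by (simp add: S_def nb_sum_def sum_distrib_left)
  have S0: "0 \<le> S" unfolding S_def nb_sum_def by (intro sum_nonneg t)
  have "(real n * S - M) / (real n + 1) \<le> S"
    using M0 S0 by (simp add: divide_le_eq algebra_simps)
  then have "nb_mass' n \<le> nb_mass n"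
    unfolding nb_mass'_def nb_mass_def S_def[symmetric] M_def[symmetric] by (rule divide_right_mono) (use G in simp)
  moreover have "0 \<le> nb_mass' n"
    unfolding nb_mass'_def S_def[symmetric] M_def[symmetric] using MS G by (intro divide_nonneg_nonneg) auto
  ultimately show "0 \<le> nb_mass' n \<and> nb_mass' n \<le> nb_mass n" by simp
qed

lemma B_error:
  assumes g: "good n"
  defines "D \<equiv> 2 * ((2 * real n + \<alpha> + \<beta>) / real n) * \<bar>(1 - xpt n) * jacobi_P (n - 1) \<alpha> (\<beta> + 1) (1 - 2 * xpt n)\<bar>
      + 2 * (1 - xpt n) * \<bar>Px n\<bar>"
  shows "\<bar>oB n - t_main n\<bar> \<le> weight_x n * D * nb_mass n" "\<bar>oB' n - t_main' n\<bar> \<le> weight_x n * D * nb_mass n"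
proof -
  define c where "c = gamma_coeff n \<alpha> \<beta> / (real n + \<beta>) * weight_x n"
  have n: "n \<ge> 1" "0 < rad n" "1 / 2 \<le> xpt n" "xpt n \<le> 1" using g by (auto simp: good_def)
  have gl: "c * (X * lambda_coeff n \<alpha> \<beta>) = weight_x n * X / Gamma (real n + \<beta> + 1)" for X
  proof -
    have "c * (X * lambda_coeff n \<alpha> \<beta>) = (gamma_coeff n \<alpha> \<beta> / (real n + \<beta>) * lambda_coeff n \<alpha> \<beta>) * (weight_x n * X)"
      by (simp add: c_def mult_ac)
    then show ?thesis unfolding gamma_lambda[OF n(1) \<alpha> \<beta>] by simp
  qed
  have s: "c * X * p_moment (n + 1) n \<alpha> \<beta> (rad n) = weight_x n * X * nb_mass n" for X
    unfolding p_moment_eq[OF n(1) \<alpha> \<beta>] using gl[of "X * nb_sum n \<alpha> \<beta> (rad n)"] by (simp add: nb_mass_def mult_ac)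
  have t: "c * X * p_moment (n + 2) n \<alpha> \<beta> (rad n) = weight_x n * X * nb_mass' n" for X
    unfolding p_moment_eq[OF n(1) \<alpha> \<beta>]
    using gl[of "X * ((real n * nb_sum n \<alpha> \<beta> (rad n) - nb_moment n \<alpha> \<beta> (rad n)) / (real n + 1))"] by (simp add: nb_mass'_def mult_ac)
  have D: "0 \<le> weight_x n * D" unfolding D_def weight_x_def using n \<alpha> \<beta> by (intro mult_nonneg_nonneg add_nonneg_nonneg) auto
  have "\<bar>oB n - (- c * Px n * p_moment (n + 1) n \<alpha> \<beta> (rad n))\<bar> \<le> c * D * p_moment (n + 1) n \<alpha> \<beta> (rad n)"
    unfolding c_def D_def weight_x_def by (rule t_average_approx(2)[OF n(1) \<alpha> \<beta> n(2,3,4)]) simp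
  then show "\<bar>oB n - t_main n\<bar> \<le> weight_x n * D * nb_mass n"
    unfolding t_main_def s[symmetric] by simp
  have "\<bar>oB' n - (- c * Px n * p_moment (n + 2) n \<alpha> \<beta> (rad n))\<bar> \<le> c * D * p_moment (n + 2) n \<alpha> \<beta> (rad n)"
    unfolding c_def D_def weight_x_def by (rule t_average_approx(2)[OF n(1) \<alpha> \<beta> n(2,3,4)]) simp
  then have "\<bar>oB' n - t_main' n\<bar> \<le> weight_x n * D * nb_mass' n"
    unfolding t_main'_def t[symmetric] by simp
  also have "\<dots> \<le> weight_x n * D * nb_mass n" using nb_mass'_bounds[OF g] D by (intro mult_left_mono) auto
  finally show "\<bar>oB' n - t_main' n\<bar> \<le> weight_x n * D * nb_mass n" .
qed

text \<open>With \<open>A_scale\<close>, the orders of magnitude of the \<open>t\<close> and \<open>v\<close> averages. Their product is bounded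
(\<open>scales_product_bigo\<close>), so relative errors \<open>O(1/n)\<close> are negligible against \<open>1/sqrt n\<close>.\<close>

definition B_scale :: "nat \<Rightarrow> real" where "B_scale n = real n powr (- \<beta>) * nb_mass n"
definition A_scale :: "nat \<Rightarrow> real" where "A_scale n = real n powr \<beta> * decay n"

lemma bigo_powr_simplify:
  assumes "f \<in> O(\<lambda>n. real n powr p * real n powr q * h n)" "p + q = s"
  shows "f \<in> O(\<lambda>n. real n powr s * h n)"
  using assms(1) unfolding assms(2)[symmetric] powr_add .

lemma t_main_bigo: "t_main \<in> O(B_scale)" "t_main' \<in> O(B_scale)"
proof -
  have 1: "(\<lambda>n. weight_x n * Px n) \<in> O(\<lambda>n. real n powr (- 2 * \<beta>) * real n powr \<beta>)"
    by (rule landau_o.big.mult[OF weight_x_bigo Px_bigo])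
  have gen: "(\<lambda>n. weight_x n * Px n * f n) \<in> O(B_scale)" if f: "f \<in> O(nb_mass)" for f
    unfolding B_scale_def[abs_def]
    by (rule bigo_powr_simplify[OF landau_o.big.mult[OF 1 f]]) simp
  have "nb_mass' \<in> O(nb_mass)"
    by (rule bigoI[where c = 1]) (use eventually_good in \<open>eventually_elim, use nb_mass'_bounds in fastforce\<close>)
  then show "t_main \<in> O(B_scale)" "t_main' \<in> O(B_scale)"
    using gen[of nb_mass] gen[of nb_mass'] by (simp_all add: t_main_def[abs_def] t_main'_def[abs_def])
qed

text \<open>One power of \<open>n\<close> better than the main term: \<open>1 - x = a/n\<^sup>2\<close>, while raising \<open>\<beta>\<close> costs only one factor \<open>n\<close>.\<close>

lemma B_error_bigo: "(\<lambda>n. oB n - t_main n) \<in> O(\<lambda>n. 1 / real n * B_scale n)" "(\<lambda>n. oB' n - t_main' n) \<in> O(\<lambda>n. 1 / real n * B_scale n)"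
proof -
  define D where "D n = 2 * ((2 * real n + \<alpha> + \<beta>) / real n) * \<bar>(1 - xpt n) * jacobi_P (n - 1) \<alpha> (\<beta> + 1) (1 - 2 * xpt n)\<bar>
      + 2 * (1 - xpt n) * \<bar>Px n\<bar>" for n
  have x: "(\<lambda>n. 1 - xpt n) \<in> O(\<lambda>n. real n powr (- 2))"
  proof (rule bigoI[where c = a])
    show "\<forall>\<^sub>F n in sequentially. norm (1 - xpt n) \<le> a * norm (real n powr (- 2))"
      using eventually_ge_at_top[of 1]
      by eventually_elim (use a in \<open>simp add: xpt_def powr_minus divide_inverse\<close>)
  qed
  have "(\<lambda>n. 2 * ((2 * real n + \<alpha> + \<beta>) / real n)) \<longlonglongrightarrow> 4"
  proof (rule Lim_transform_eventually)
    show "(\<lambda>n. 2 * (1 + (real n + (\<alpha> + \<beta>)) / real n)) \<longlonglongrightarrow> 4"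
      using tendsto_mult[OF tendsto_const tendsto_add[OF tendsto_const tendsto_add_const_over_n[of "\<alpha> + \<beta>"]], of 2 1] by simp
    show "\<forall>\<^sub>F n in sequentially. 2 * (1 + (real n + (\<alpha> + \<beta>)) / real n) = 2 * ((2 * real n + \<alpha> + \<beta>) / real n)"
      using eventually_gt_at_top[of 0] by eventually_elim (simp add: field_simps)
  qed
  from bigo_of_tendsto_one[OF this]
  have c: "(\<lambda>n. 2 * ((2 * real n + \<alpha> + \<beta>) / real n)) \<in> O(\<lambda>_. 1)" .
  have p: "(\<lambda>n. jacobi_P (n - 1) \<alpha> (\<beta> + 1) (1 - 2 * xpt n)) \<in> O(\<lambda>n. real n powr (\<beta> + 1))"
    unfolding xpt_def using \<beta> by (intro jacobi_P_edge_bigo) auto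
  have "(\<lambda>n. 2 * ((2 * real n + \<alpha> + \<beta>) / real n) * \<bar>(1 - xpt n) * jacobi_P (n - 1) \<alpha> (\<beta> + 1) (1 - 2 * xpt n)\<bar>)
    \<in> O(\<lambda>n. 1 * (real n powr (- 2) * real n powr (\<beta> + 1)))"
    by (rule landau_o.big.mult[OF c]) (use landau_o.big.mult[OF x p] in simp)
  then have t1: "(\<lambda>n. 2 * ((2 * real n + \<alpha> + \<beta>) / real n) * \<bar>(1 - xpt n) * jacobi_P (n - 1) \<alpha> (\<beta> + 1) (1 - 2 * xpt n)\<bar>)
    \<in> O(\<lambda>n. real n powr (\<beta> - 1) * 1)"
    by (intro bigo_powr_simplify[of _ "- 2" "\<beta> + 1"]) simp_all
  have "(\<lambda>n. (1 - xpt n) * \<bar>Px n\<bar>) \<in> O(\<lambda>n. real n powr (- 2) * real n powr \<beta>)"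
    by (rule landau_o.big.mult[OF x]) (use Px_bigo in simp)
  then have "(\<lambda>n. (1 - xpt n) * \<bar>Px n\<bar>) \<in> O(\<lambda>n. real n powr (\<beta> - 2) * 1)"
    by (intro bigo_powr_simplify[of _ "- 2" "\<beta>"]) simp_all
  also have "(\<lambda>n. real n powr (\<beta> - 2) * 1) \<in> O(\<lambda>n. real n powr (\<beta> - 1) * 1)"
    by (rule bigoI[where c = 1]) (use eventually_ge_at_top[of 1] in \<open>eventually_elim, simp add: powr_mono\<close>)
  finally have "(\<lambda>n. 2 * ((1 - xpt n) * \<bar>Px n\<bar>)) \<in> O(\<lambda>n. real n powr (\<beta> - 1) * 1)"
    by (subst landau_o.big.cmult_in_iff) simp_all
  then have "(\<lambda>n. 2 * (1 - xpt n) * \<bar>Px n\<bar>) \<in> O(\<lambda>n. real n powr (\<beta> - 1) * 1)"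
    by (simp only: mult.assoc)
  from sum_in_bigo(1)[OF t1 this] have D: "D \<in> O(\<lambda>n. real n powr (\<beta> - 1))"
    unfolding D_def[abs_def] by simp
  have "(\<lambda>n. weight_x n * D n * nb_mass n) \<in> O(\<lambda>n. real n powr (- 2 * \<beta>) * real n powr (\<beta> - 1) * nb_mass n)"
    by (rule landau_o.big.mult[OF landau_o.big.mult[OF weight_x_bigo D] landau_o.big_refl])
  then have "(\<lambda>n. weight_x n * D n * nb_mass n) \<in> O(\<lambda>n. real n powr (- \<beta> - 1) * nb_mass n)"
    by (rule bigo_powr_simplify) simp
  also have "(\<lambda>n. real n powr (- \<beta> - 1) * nb_mass n) \<in> O(\<lambda>n. 1 / real n * B_scale n)"
    by (rule bigoI[where c = 1]) (use eventually_gt_at_top[of 0] in \<open>eventually_elim, simp add: B_scale_def powr_diff\<close>)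
  finally have W: "(\<lambda>n. weight_x n * D n * nb_mass n) \<in> O(\<lambda>n. 1 / real n * B_scale n)" .
  have tr: "f \<in> O(\<lambda>n. weight_x n * D n * nb_mass n)" if "\<And>n. good n \<Longrightarrow> \<bar>f n\<bar> \<le> weight_x n * D n * nb_mass n" for f :: "nat \<Rightarrow> real"
  proof (rule bigoI[where c = 1])
    show "\<forall>\<^sub>F n in sequentially. norm (f n) \<le> 1 * norm (weight_x n * D n * nb_mass n)"
      using eventually_good
    proof eventually_elim
      case (elim n)
      have "\<bar>f n\<bar> \<le> weight_x n * D n * nb_mass n" by (rule that[OF elim])
      then show ?case by (simp only: real_norm_def mult_1_left)
    qed
  qed
  show "(\<lambda>n. oB n - t_main n) \<in> O(\<lambda>n. 1 / real n * B_scale n)"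
    by (rule landau_o.big_trans[OF tr W]) (use B_error(1) in \<open>simp add: D_def\<close>)
  show "(\<lambda>n. oB' n - t_main' n) \<in> O(\<lambda>n. 1 / real n * B_scale n)"
    by (rule landau_o.big_trans[OF tr W]) (use B_error(2) in \<open>simp add: D_def\<close>)
qed

lemma over_n_bigo: "(\<lambda>n. 1 / real n * h n) \<in> O(h)" for h :: "nat \<Rightarrow> real"
proof (rule bigoI[where c = 1])
  show "\<forall>\<^sub>F n in sequentially. norm (1 / real n * h n) \<le> 1 * norm (h n)"
    using eventually_ge_at_top[of 1]
  proof eventually_elim
    case (elim n)
    have "\<bar>1 / real n\<bar> * \<bar>h n\<bar> \<le> 1 * \<bar>h n\<bar>" using elim by (intro mult_right_mono) auto
    then show ?case by (simp add: abs_mult)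
  qed
qed

lemma scales_product_bigo: "(\<lambda>n. A_scale n * B_scale n) \<in> O(\<lambda>_. 1)"
proof -
  obtain C where C: "\<forall>n. good n \<longrightarrow> (1 - rad n) ^ n * nb_mass n \<le> C" using nb_mass_bound by blast
  show ?thesis
  proof (rule bigoI[where c = C])
    show "\<forall>\<^sub>F n in sequentially. norm (A_scale n * B_scale n) \<le> C * norm (1 :: real)"
      using eventually_good
    proof eventually_elim
      case (elim n)
      have "real n powr \<beta> * real n powr (- \<beta>) = 1" using elim by (simp add: good_def flip: powr_add)
      then have "A_scale n * B_scale n = (1 - rad n) ^ n * nb_mass n"
        by (simp add: A_scale_def B_scale_def decay_def mult.assoc mult.left_commute)
      moreover have "0 \<le> (1 - rad n) ^ n * nb_mass n" using decay_nonneg[OF elim] nb_mass_nonneg[OF elim] by (simp add: decay_def)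
      ultimately show ?case using C elim by simp
    qed
  qed
qed

text \<open>Telescoping \<open>A B - A\<^sub>0 B\<^sub>0 = A\<^sub>0 (B - B\<^sub>0) + (A - A\<^sub>0) B\<close> in both products.\<close>

lemma product_error_bigo:
  "(\<lambda>n. paired_averages n - (mA n * t_main n - mA' n * t_main' n)) \<in> O(\<lambda>n. 1 / real n)"
proof -
  have A: "mA \<in> O(A_scale)" "mA' \<in> O(A_scale)"
    using v_main_bigo v_main'_bigo by (simp_all add: A_scale_def[abs_def])
  have pow: "(\<lambda>n. real n powr (\<beta> - 1) * decay n) \<in> O(\<lambda>n. 1 / real n * A_scale n)"
    by (rule bigoI[where c = 1]) (use eventually_gt_at_top[of 0] in \<open>eventually_elim, simp add: A_scale_def powr_diff\<close>)
  have EA: "(\<lambda>n. oA n - mA n) \<in> O(\<lambda>n. 1 / real n * A_scale n)" "(\<lambda>n. oA' n - mA' n) \<in> O(\<lambda>n. 1 / real n * A_scale n)"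
    using A_error_bigo pow by (blast intro: landau_o.big_trans)+
  have B: "oB \<in> O(B_scale)" "oB' \<in> O(B_scale)"
  proof -
    have "(\<lambda>n. (oB n - t_main n) + t_main n) \<in> O(B_scale)" "(\<lambda>n. (oB' n - t_main' n) + t_main' n) \<in> O(B_scale)"
      by (intro sum_in_bigo(1) t_main_bigo landau_o.big_trans[OF B_error_bigo(1) over_n_bigo] landau_o.big_trans[OF B_error_bigo(2) over_n_bigo])+
    then show "oB \<in> O(B_scale)" "oB' \<in> O(B_scale)" by simp_all
  qed
  define h where "h n = 1 / real n * (A_scale n * B_scale n)" for n
  have e: "(\<lambda>n. A_scale n * (1 / real n * B_scale n)) = h" "(\<lambda>n. 1 / real n * A_scale n * B_scale n) = h"
    by (simp_all add: h_def fun_eq_iff)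
  have "(\<lambda>n. mA n * (oB n - t_main n)) \<in> O(h)" "(\<lambda>n. mA' n * (oB' n - t_main' n)) \<in> O(h)"
    using landau_o.big.mult[OF A(1) B_error_bigo(1)] landau_o.big.mult[OF A(2) B_error_bigo(2)] unfolding e .
  moreover have "(\<lambda>n. (oA n - mA n) * oB n) \<in> O(h)" "(\<lambda>n. (oA' n - mA' n) * oB' n) \<in> O(h)"
    using landau_o.big.mult[OF EA(1) B(1)] landau_o.big.mult[OF EA(2) B(2)] unfolding e .
  ultimately have "(\<lambda>n. mA n * (oB n - t_main n) + (oA n - mA n) * oB n - (mA' n * (oB' n - t_main' n) + (oA' n - mA' n) * oB' n)) \<in> O(h)"
    by (intro sum_in_bigo)
  moreover have "(\<lambda>n. paired_averages n - (mA n * t_main n - mA' n * t_main' n)) =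
      (\<lambda>n. mA n * (oB n - t_main n) + (oA n - mA n) * oB n - (mA' n * (oB' n - t_main' n) + (oA' n - mA' n) * oB' n))"
    by (simp add: paired_averages_def fun_eq_iff algebra_simps)
  moreover have "h \<in> O(\<lambda>n. 1 / real n * 1)"
    unfolding h_def[abs_def] by (rule landau_o.big.mult[OF landau_o.big_refl scales_product_bigo])
  ultimately show ?thesis using landau_o.big_trans by fastforce
qed

lemma paired_averages_tendsto:
  "(\<lambda>n. sqrt (real n) * paired_averages n) \<longlonglongrightarrow> - (4 / sqrt pi) * exp (- 4 * r\<^sup>2) * (a powr \<beta> * bessel_C \<beta> a * bessel_C \<beta> b)"
proof -
  define m where "m n = mA n * t_main n - mA' n * t_main' n" for n
  obtain c where c: "\<forall>\<^sub>F n in sequentially. norm (paired_averages n - m n) \<le> c * norm (1 / real n)"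
    using product_error_bigo landau_o.bigE unfolding m_def by blast
  have "(\<lambda>n. sqrt (real n) * (paired_averages n - m n)) \<longlonglongrightarrow> 0"
  proof (rule tendsto_0_le[OF inverse_sqrt_tendsto])
    show "\<forall>\<^sub>F n in sequentially. norm (sqrt (real n) * (paired_averages n - m n)) \<le> norm (inverse (sqrt (real n))) * c"
      using c eventually_gt_at_top[of 0]
    proof eventually_elim
      case (elim n)
      have "sqrt (real n) * \<bar>paired_averages n - m n\<bar> \<le> sqrt (real n) * (c * (1 / real n))"
        using elim by (intro mult_left_mono) auto
      also have "\<dots> = c * (sqrt (real n) / real n)" by simp
      also have "sqrt (real n) / real n = inverse (sqrt (real n))"
        using elim(2) by (simp add: sqrt_divide_self_eq)
      finally show ?case by (simp add: abs_mult mult.commute)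
    qed
  qed
  from tendsto_add[OF this main_product_tendsto]
  show ?thesis unfolding m_def[symmetric] by (simp add: algebra_simps)
qed

end

section \<open>The cross-covariance as a sum over cofactors\<close>

text \<open>For fixed \<open>x\<close> the numerator is a polynomial in \<open>y\<close> of degree at most \<open>n\<close> that vanishes at \<open>y = x\<close>, so
\<open>x - y\<close> divides it. The coefficients of the quotient are continuous in \<open>x\<close>. This settles the integrability
of the double integral for the eigenradius.\<close>

lemma jacobi_quotient_polynomial:
  assumes "n \<ge> 1"
  obtains c :: "nat \<Rightarrow> real \<Rightarrow> real"
  where "\<And>j. continuous_on UNIV (c j)"
    and "\<And>x y. x \<noteq> y \<Longrightarrow> jacobi_quotient n \<alpha> \<beta> x y = (\<Sum>j<n. c j x * y ^ j)"
proof -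
  define p where "p i = ((real n + \<alpha>) gchoose (n - i)) * ((real (n + i) + \<alpha> + \<beta>) gchoose i) * (- 1) ^ i" for i
  define q where "q i = (if i < n then ((real (n - 1) + \<alpha>) gchoose (n - 1 - i)) * ((real (n - 1 + i) + \<alpha> + \<beta>) gchoose i) * (- 1) ^ i else 0)" for i
  have P: "jacobi_P n \<alpha> \<beta> (1 - 2 * y) = (\<Sum>i\<le>n. p i * y ^ i)" for y
    unfolding jacobi_P_expansion p_def by (intro sum.cong refl) (simp add: power_minus[of y] mult_ac)
  have Q: "jacobi_P (n - 1) \<alpha> \<beta> (1 - 2 * y) = (\<Sum>i\<le>n. q i * y ^ i)" for y
  proof -
    have "(\<Sum>i\<le>n. q i * y ^ i) = (\<Sum>i\<le>n - 1. q i * y ^ i)"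
      using assms by (intro sum.mono_neutral_right) (auto simp: q_def)
    also have "\<dots> = jacobi_P (n - 1) \<alpha> \<beta> (1 - 2 * y)"
      unfolding jacobi_P_expansion q_def using assms
      by (intro sum.cong refl) (auto simp: power_minus[of y] mult_ac)
    finally show ?thesis ..
  qed
  define a where "a x i = jacobi_P n \<alpha> \<beta> (1 - 2 * x) * q i - jacobi_P (n - 1) \<alpha> \<beta> (1 - 2 * x) * p i" for x i
  \<comment> \<open>coefficients of the quotient by \<open>x - y\<close>, by synthetic division at \<open>x\<close>\<close>
  define c where "c j x = - (\<Sum>i = j + 1..n. a x i * x ^ (i - j - 1))" for j and x :: real
  show thesis
  proof
    show "continuous_on UNIV (c j)" for j
      unfolding c_def a_def P Q by (intro continuous_intros)
    fix x y :: real assume xy: "x \<noteq> y"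
    have F: "jacobi_P n \<alpha> \<beta> (1 - 2 * x) * jacobi_P (n - 1) \<alpha> \<beta> (1 - 2 * z)
      - jacobi_P (n - 1) \<alpha> \<beta> (1 - 2 * x) * jacobi_P n \<alpha> \<beta> (1 - 2 * z) = (\<Sum>i\<le>n. a x i * z ^ i)" for z
      unfolding a_def P[of z] Q[of z] by (simp add: left_diff_distrib sum_subtractf sum_distrib_left mult.assoc)
    have "(\<Sum>i\<le>n. a x i * x ^ i) = 0" unfolding F[of x, symmetric] by simp
    then have "(\<Sum>i\<le>n. a x i * y ^ i) = (\<Sum>i\<le>n. a x i * y ^ i) - (\<Sum>i\<le>n. a x i * x ^ i)" by simp
    also have "\<dots> = (y - x) * (\<Sum>j<n. (\<Sum>i = j + 1..n. a x i * x ^ (i - j - 1)) * y ^ j)"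
      unfolding sub_polyfun sum_distrib_right by simp
    also have "\<dots> = (x - y) * (\<Sum>j<n. c j x * y ^ j)"
      unfolding c_def by (simp add: sum_negf algebra_simps)
    finally show "jacobi_quotient n \<alpha> \<beta> x y = (\<Sum>j<n. c j x * y ^ j)"
      unfolding jacobi_quotient_def F using xy by simp
  qed
qed

lemma set_integral_sum_mult:
  fixes f :: "'i \<Rightarrow> real \<Rightarrow> real"
  assumes "\<And>j. j \<in> J \<Longrightarrow> set_integrable lborel S (f j)"
  shows "set_integrable lborel S (\<lambda>v. \<Sum>j\<in>J. c j * f j v)"
    and "(LBINT v:S. (\<Sum>j\<in>J. c j * f j v)) = (\<Sum>j\<in>J. c j * (LBINT v:S. f j v))"
proof -
  have e: "indicator S v *\<^sub>R (\<Sum>j\<in>J. c j * f j v) = (\<Sum>j\<in>J. c j * (indicator S v *\<^sub>R f j v))" for v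
    by (simp add: sum_distrib_left mult_ac)
  have i: "integrable lborel (\<lambda>v. c j * (indicator S v *\<^sub>R f j v))" if "j \<in> J" for j
    using assms[OF that] unfolding set_integrable_def by (intro integrable_mult_right)
  show "set_integrable lborel S (\<lambda>v. \<Sum>j\<in>J. c j * f j v)"
    unfolding set_integrable_def e by (intro Bochner_Integration.integrable_sum i)
  show "(LBINT v:S. (\<Sum>j\<in>J. c j * f j v)) = (\<Sum>j\<in>J. c j * (LBINT v:S. f j v))"
    unfolding set_lebesgue_integral_def e
    by (subst Bochner_Integration.integral_sum[OF i]) simp_all
qed

text \<open>A polynomial of degree less than \<open>n\<close> in \<open>y\<close>; at \<open>y = - \<rho> t\<close> it is integrable against \<open>(1+t)\<^sup>-\<^sup>N\<close> for \<open>N > n\<close>.\<close>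

lemma kernel_average_polynomial:
  assumes n: "n \<ge> 1" and par: "\<alpha> > - 1" and \<rho>: "0 < \<rho>" "\<rho> < 1" and w: "continuous_on {0..\<rho>} w"
  obtains A :: "nat \<Rightarrow> real"
  where "\<And>y. y \<notin> {0<..<\<rho>} \<Longrightarrow> set_integrable lborel {0<..<\<rho>} (\<lambda>v. w v * jacobi_K n \<alpha> \<beta> v y)"
    and "\<And>y. y \<notin> {0<..<\<rho>} \<Longrightarrow> (LBINT v:{0<..<\<rho>}. w v * jacobi_K n \<alpha> \<beta> v y) = (\<Sum>j<n. A j * y ^ j)"
proof -
  obtain c where c: "\<And>j. continuous_on UNIV (c j)"
    "\<And>x y. x \<noteq> y \<Longrightarrow> jacobi_quotient n \<alpha> \<beta> x y = (\<Sum>j<n. c j x * y ^ j)"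
    using jacobi_quotient_polynomial[OF n] by metis
  define f where "f j v = v powr \<alpha> * (w v * jacobi_coeff n \<alpha> \<beta> * (1 - v) powr \<beta> * c j v)" for j v
  have f: "set_integrable lborel {0<..<\<rho>} (f j)" for j
    unfolding f_def using \<rho> par
    by (intro set_integrable_powr_times_continuous continuous_intros w continuous_on_subset[OF c(1)]) auto
  have eq: "w v * jacobi_K n \<alpha> \<beta> v y = (\<Sum>j<n. y ^ j * f j v)" if "v \<in> {0<..<\<rho>}" "y \<notin> {0<..<\<rho>}" for v y
  proof -
    have "v \<noteq> y" using that by blast
    then show ?thesis using that \<rho> unfolding jacobi_K_def f_def
      by (simp add: c(2) sum_distrib_left mult_ac)
  qed
  show thesis
  proof
    fix y :: real assume y: "y \<notin> {0<..<\<rho>}"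
    have "set_integrable lborel {0<..<\<rho>} (\<lambda>v. \<Sum>j<n. y ^ j * f j v)"
      by (rule set_integral_sum_mult(1)[OF f])
    then show "set_integrable lborel {0<..<\<rho>} (\<lambda>v. w v * jacobi_K n \<alpha> \<beta> v y)"
      by (rule set_integrable_cong[OF refl refl, THEN iffD1, rotated]) (rule eq[symmetric, OF _ y])
    have "(LBINT v:{0<..<\<rho>}. w v * jacobi_K n \<alpha> \<beta> v y) = (LBINT v:{0<..<\<rho>}. \<Sum>j<n. y ^ j * f j v)"
      using eq[OF _ y] by (intro set_lebesgue_integral_cong) auto
    also have "\<dots> = (\<Sum>j<n. (LBINT v:{0<..<\<rho>}. f j v) * y ^ j)"
      by (simp add: set_integral_sum_mult(2)[OF f] mult.commute)
    finally show "(LBINT v:{0<..<\<rho>}. w v * jacobi_K n \<alpha> \<beta> v y) = (\<Sum>j<n. (LBINT v:{0<..<\<rho>}. f j v) * y ^ j)" .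
  qed
qed

lemma power_quotient_integrable_closed:
  assumes "j + 2 \<le> N"
  shows "set_integrable lborel {0..} (\<lambda>t::real. t ^ j / (1 + t) ^ N)"
proof -
  have "(\<lambda>t::real. t ^ j / (1 + t) ^ N) \<in> borel_measurable borel" by measurable
  from set_lebesgue_halfline_open_closed(1)[OF this] power_quotient_integrable[OF assms] show ?thesis by simp
qed

text \<open>The two products of functions of \<open>v\<close> and \<open>t\<close> that make the double integral factorize.\<close>

lemma phi_n_split:
  assumes "n \<ge> 2" "0 < v" "0 < r" "t \<ge> 0"
  shows "1 / v * phi_n n (v / r) t =
    1 / r * (1 - v / r) ^ (n - 2) * (1 - v / (r * real n)) / (1 + t) ^ (n + 1)
    - 1 / r * (1 - v / r) ^ (n - 1) * (1 + 1 / real n) / (1 + t) ^ (n + 2)"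
proof -
  define s where "s = 1 + t"
  define q where "q = 1 - v / r"
  define z where "z = 1 - v / (r * real n)"
  define N where "N = 1 + 1 / real n"
  have s: "s > 0" using assms by (simp add: s_def)
  have m: "n - 1 = Suc (n - 2)" using assms by simp
  have "1 / v * phi_n n (v / r) t = 1 / r * q ^ (n - 2) / s ^ (n + 2) * (z * s - q * N)"
    using assms unfolding phi_n_def s_def q_def z_def N_def by simp
  also have "\<dots> = 1 / r * q ^ (n - 2) * z / s ^ (n + 1) - 1 / r * (q * q ^ (n - 2)) * N / s ^ (n + 2)"
  proof -
    have "s ^ (n + 2) = s * s ^ (n + 1)" by simp
    then show ?thesis using s by (simp only: right_diff_distrib diff_divide_distrib) (simp add: mult_ac)
  qed
  finally show ?thesis unfolding m power_Suc s_def q_def z_def N_def .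
qed

text \<open>Used twice: with \<open>y\<close> a singular value beyond \<open>\<rho>\<close>, and with \<open>y = - \<rho> t\<close> for the eigenradius density.\<close>

lemma eigenradius_average:
  assumes n: "n \<ge> 2" and par: "\<alpha> > - 1" and \<rho>: "0 < \<rho>" "\<rho> < 1" and y: "y \<notin> {0<..<\<rho>}" and t: "t \<ge> 0"
  shows "set_integrable lborel {0<..<\<rho>} (\<lambda>v. 1 / v * phi_n n (v / \<rho>) t * jacobi_K n \<alpha> \<beta> v y)"
    and "(LBINT v:{0<..<\<rho>}. 1 / v * phi_n n (v / \<rho>) t * jacobi_K n \<alpha> \<beta> v y) =
      v_average n \<alpha> \<beta> \<rho> y / (1 + t) ^ (n + 1) - v_average' n \<alpha> \<beta> \<rho> y / (1 + t) ^ (n + 2)"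
proof -
  have n1: "n \<ge> 1" using n by simp
  define w where "w v = 1 / \<rho> * (1 - v / \<rho>) ^ (n - 2) * (1 - v / (\<rho> * real n))" for v
  define w' where "w' v = 1 / \<rho> * (1 - v / \<rho>) ^ (n - 1) * (1 + 1 / real n)" for v
  have c: "continuous_on {0..\<rho>} w" "continuous_on {0..\<rho>} w'"
    unfolding w_def[abs_def] w'_def[abs_def] using \<rho> n by (auto intro!: continuous_intros)
  have i: "set_integrable lborel {0<..<\<rho>} (\<lambda>v. w v * jacobi_K n \<alpha> \<beta> v y)"
    "set_integrable lborel {0<..<\<rho>} (\<lambda>v. w' v * jacobi_K n \<alpha> \<beta> v y)"
    by (rule kernel_average_polynomial[OF n1 par \<rho> c(1), of \<beta>], use y in blast)
       (rule kernel_average_polynomial[OF n1 par \<rho> c(2), of \<beta>], use y in blast)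
  have i': "set_integrable lborel {0<..<\<rho>} (\<lambda>v. 1 / (1 + t) ^ (n + 1) * (w v * jacobi_K n \<alpha> \<beta> v y))"
    "set_integrable lborel {0<..<\<rho>} (\<lambda>v. 1 / (1 + t) ^ (n + 2) * (w' v * jacobi_K n \<alpha> \<beta> v y))"
    by (intro set_integrable_mult_right i)+
  have eq: "1 / v * phi_n n (v / \<rho>) t * jacobi_K n \<alpha> \<beta> v y =
      1 / (1 + t) ^ (n + 1) * (w v * jacobi_K n \<alpha> \<beta> v y) - 1 / (1 + t) ^ (n + 2) * (w' v * jacobi_K n \<alpha> \<beta> v y)"
    if "v \<in> {0<..<\<rho>}" for v
  proof -
    have "1 / v * phi_n n (v / \<rho>) t = w v / (1 + t) ^ (n + 1) - w' v / (1 + t) ^ (n + 2)"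
      unfolding w_def w'_def using that t \<rho> n by (intro phi_n_split) auto
    then show ?thesis by (simp only: left_diff_distrib) simp
  qed
  show "set_integrable lborel {0<..<\<rho>} (\<lambda>v. 1 / v * phi_n n (v / \<rho>) t * jacobi_K n \<alpha> \<beta> v y)"
    by (rule set_integrable_cong[OF refl refl, THEN iffD1, OF _ set_integral_diff(1)[OF i']]) (rule eq[symmetric])
  have "(LBINT v:{0<..<\<rho>}. 1 / v * phi_n n (v / \<rho>) t * jacobi_K n \<alpha> \<beta> v y) =
     (LBINT v:{0<..<\<rho>}. 1 / (1 + t) ^ (n + 1) * (w v * jacobi_K n \<alpha> \<beta> v y) - 1 / (1 + t) ^ (n + 2) * (w' v * jacobi_K n \<alpha> \<beta> v y))"
    using eq by (intro set_lebesgue_integral_cong) auto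
  also have "\<dots> = v_average n \<alpha> \<beta> \<rho> y / (1 + t) ^ (n + 1) - v_average' n \<alpha> \<beta> \<rho> y / (1 + t) ^ (n + 2)"
  proof -
    have "(LBINT v:{0<..<\<rho>}. w v * jacobi_K n \<alpha> \<beta> v y) = v_average n \<alpha> \<beta> \<rho> y"
      "(LBINT v:{0<..<\<rho>}. w' v * jacobi_K n \<alpha> \<beta> v y) = v_average' n \<alpha> \<beta> \<rho> y"
      unfolding v_average_def v_average'_def w_def w'_def by (rule refl)+
    then show ?thesis by (simp only: set_integral_diff(2)[OF i'] set_integral_mult_right) simp
  qed
  finally show "(LBINT v:{0<..<\<rho>}. 1 / v * phi_n n (v / \<rho>) t * jacobi_K n \<alpha> \<beta> v y) =
      v_average n \<alpha> \<beta> \<rho> y / (1 + t) ^ (n + 1) - v_average' n \<alpha> \<beta> \<rho> y / (1 + t) ^ (n + 2)" .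
qed

lemma polynomial_quotient_integrable:
  fixes A :: "nat \<Rightarrow> real"
  assumes "\<And>t. t \<ge> 0 \<Longrightarrow> f t = (\<Sum>j<n. A j * (- \<rho> * t) ^ j)" and "n + 1 \<le> N"
  shows "set_integrable lborel {0..} (\<lambda>t. f t / (1 + t) ^ N)"
proof -
  have "set_integrable lborel {0..} (\<lambda>t. \<Sum>j<n. (A j * (- \<rho>) ^ j) * (t ^ j / (1 + t) ^ N))"
    using assms(2) by (intro set_integral_sum_mult(1) power_quotient_integrable_closed) auto
  then show ?thesis
  proof (rule set_integrable_cong[OF refl refl, THEN iffD1, rotated])
    fix t :: real assume "t \<in> {0..}"
    then show "(\<Sum>j<n. (A j * (- \<rho>) ^ j) * (t ^ j / (1 + t) ^ N)) = f t / (1 + t) ^ N"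
      by (simp only: assms(1) atLeast_iff power_mult_distrib sum_divide_distrib) (simp add: mult.assoc)
  qed
qed

lemma eigenradius_integrable:
  assumes n: "n \<ge> 2" and par: "\<alpha> > - 1" and \<rho>: "0 < \<rho>" "\<rho> < 1"
  shows "set_integrable lborel {0..}
    (\<lambda>t. LBINT v:{0<..<\<rho>}. 1 / v * phi_n n (v / \<rho>) t * jacobi_K n \<alpha> \<beta> v (- \<rho> * t))"
proof -
  have n1: "n \<ge> 1" using n by simp
  have neg: "- \<rho> * t \<notin> {0<..<\<rho>}" if "t \<ge> 0" for t using that \<rho> by (auto simp: mult_less_0_iff)
  have c: "continuous_on {0..\<rho>} (\<lambda>v. 1 / \<rho> * (1 - v / \<rho>) ^ (n - 2) * (1 - v / (\<rho> * real n)))"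
    "continuous_on {0..\<rho>} (\<lambda>v. 1 / \<rho> * (1 - v / \<rho>) ^ (n - 1) * (1 + 1 / real n))"
    using \<rho> n by (auto intro!: continuous_intros)
  obtain A where A: "\<And>y. y \<notin> {0<..<\<rho>} \<Longrightarrow> v_average n \<alpha> \<beta> \<rho> y = (\<Sum>j<n. A j * y ^ j)"
    unfolding v_average_def by (rule kernel_average_polynomial[OF n1 par \<rho> c(1), of \<beta>]) blast
  obtain A' where A': "\<And>y. y \<notin> {0<..<\<rho>} \<Longrightarrow> v_average' n \<alpha> \<beta> \<rho> y = (\<Sum>j<n. A' j * y ^ j)"
    unfolding v_average'_def by (rule kernel_average_polynomial[OF n1 par \<rho> c(2), of \<beta>]) blast
  have "set_integrable lborel {0..} (\<lambda>t. v_average n \<alpha> \<beta> \<rho> (- \<rho> * t) / (1 + t) ^ (n + 1) - v_average' n \<alpha> \<beta> \<rho> (- \<rho> * t) / (1 + t) ^ (n + 2))"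
    by (intro set_integral_diff(1) polynomial_quotient_integrable[OF A] polynomial_quotient_integrable[OF A'] neg) auto
  then show ?thesis
    by (rule set_integrable_cong[OF refl refl, THEN iffD1, rotated])
       (rule eigenradius_average(2)[OF n par \<rho> neg, symmetric], simp_all)
qed

text \<open>Each bordered determinant is its corner times the determinant of the block plus the bilinear form in
the border. Integrated, the corner part is the product of the two densities and cancels in the
covariance. It has to be integrable in its own right for the integral to split, which is
\<open>eigenradius_integrable\<close>.\<close>

lemma cross_covariance_cofactors:
  assumes n: "n \<ge> 3" "n \<ge> k" and par: "\<alpha> > - 1" "\<beta> > 0" and \<rho>: "0 < \<rho>" "\<rho> < 1"
    and x: "\<And>i. i < k \<Longrightarrow> \<rho> < x i" "\<And>i. i < k \<Longrightarrow> 1 / 2 \<le> x i" "\<And>i. i < k \<Longrightarrow> x i \<le> 1"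
  shows "point_function_formula k n \<alpha> \<beta> \<rho> x - eigenradius_formula n \<alpha> \<beta> \<rho> * singular_value_formula k n \<alpha> \<beta> x =
    fact (n - k) / fact (n - 1) *
    (\<Sum>c<k. \<Sum>b<k. bordered_cofactor k (\<lambda>b c. jacobi_K n \<alpha> \<beta> (x b) (x c)) b c *
       (v_average n \<alpha> \<beta> \<rho> (x c) * t_average (n + 1) n \<alpha> \<beta> \<rho> (x b) -
        v_average' n \<alpha> \<beta> \<rho> (x c) * t_average (n + 2) n \<alpha> \<beta> \<rho> (x b)))"
proof -
  have n2: "n \<ge> 2" using n by simp
  define K where "K = jacobi_K n \<alpha> \<beta>"
  define cof where "cof b c = bordered_cofactor k (\<lambda>b c. K (x b) (x c)) b c" for b c
  define d where "d = Determinant.det (mat k k (\<lambda>(b, c). K (x b) (x c)))"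
  define D where "D t p u = Determinant.det (bordered_mat k p u (\<lambda>b. K (x b) (- \<rho> * t)) (\<lambda>b c. K (x b) (x c)))" for t p u
  define \<psi> where "\<psi> v t = 1 / v * phi_n n (v / \<rho>) t" for v t
  define g where "g t = (LBINT v:{0<..<\<rho>}. \<psi> v t * K v (- \<rho> * t))" for t
  define A where "A c = v_average n \<alpha> \<beta> \<rho> (x c)" for c
  define A' where "A' c = v_average' n \<alpha> \<beta> \<rho> (x c)" for c
  define B where "B b = t_average (n + 1) n \<alpha> \<beta> \<rho> (x b)" for b
  define B' where "B' b = t_average (n + 2) n \<alpha> \<beta> \<rho> (x b)" for b
  define q where "q N b t = K (x b) (- \<rho> * t) / (1 + t) ^ N" for N b t
  define h where "h p t = A (fst p) * q (n + 1) (snd p) t - A' (fst p) * q (n + 2) (snd p) t" for p t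
  define J where "J = {..<k} \<times> {..<k}"
  have neg: "- \<rho> * t \<notin> {0<..<\<rho>}" if "t \<ge> 0" for t using that \<rho> by (auto simp: mult_less_0_iff)
  have out: "x c \<notin> {0<..<\<rho>}" if "c < k" for c using x(1)[OF that] by simp
  have Dex: "D t p u = d * p + (\<Sum>(c, b)\<in>J. u c * K (x b) (- \<rho> * t) * cof b c)" for t p u
    unfolding D_def det_bordered_expand d_def cof_def J_def sum.cartesian_product by simp
  have inner: "(LBINT v:{0<..<\<rho>}. \<psi> v t * D t (K v (- \<rho> * t)) (\<lambda>c. K v (x c))) =
      d * g t + (\<Sum>p\<in>J. cof (snd p) (fst p) * h p t)" if t: "t \<ge> 0" for t
  proof -
    have i0: "set_integrable lborel {0<..<\<rho>} (\<lambda>v. \<psi> v t * K v (- \<rho> * t))"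
      unfolding \<psi>_def K_def using eigenradius_average(1)[OF n2 par(1) \<rho> neg t] t .
    have i: "set_integrable lborel {0<..<\<rho>} (\<lambda>v. \<psi> v t * K v (x (fst p)))"
      "(LBINT v:{0<..<\<rho>}. \<psi> v t * K v (x (fst p))) = A (fst p) / (1 + t) ^ (n + 1) - A' (fst p) / (1 + t) ^ (n + 2)"
      if "p \<in> J" for p
      unfolding \<psi>_def K_def A_def A'_def using eigenradius_average[OF n2 par(1) \<rho> out t] that by (auto simp: J_def)
    have "(LBINT v:{0<..<\<rho>}. \<psi> v t * D t (K v (- \<rho> * t)) (\<lambda>c. K v (x c))) =
      (LBINT v:{0<..<\<rho>}. d * (\<psi> v t * K v (- \<rho> * t)) +
         (\<Sum>p\<in>J. (K (x (snd p)) (- \<rho> * t) * cof (snd p) (fst p)) * (\<psi> v t * K v (x (fst p)))))"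
      unfolding Dex by (simp add: distrib_left sum_distrib_left case_prod_beta mult_ac)
    also have "\<dots> = d * g t + (\<Sum>p\<in>J. (K (x (snd p)) (- \<rho> * t) * cof (snd p) (fst p)) *
        (LBINT v:{0<..<\<rho>}. \<psi> v t * K v (x (fst p))))"
      by (subst set_integral_add(2)[OF set_integrable_mult_right[OF i0] set_integral_sum_mult(1)[OF i(1)]])
         (simp_all only: set_integral_mult_right set_integral_sum_mult(2)[OF i(1)] g_def)
    also have "\<dots> = d * g t + (\<Sum>p\<in>J. cof (snd p) (fst p) * h p t)"
      by (intro arg_cong2[where f = "(+)"] refl sum.cong)
         (simp_all only: i(2) h_def q_def right_diff_distrib times_divide_eq_right mult_ac)
    finally show ?thesis .
  qed
  have ig: "set_integrable lborel {0..} g"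
    unfolding g_def[abs_def] \<psi>_def K_def by (rule eigenradius_integrable[OF n2 par(1) \<rho>])
  have iq: "set_integrable lborel {0..} (q N (snd p))" if "p \<in> J" "n + 1 \<le> N" for p N
    unfolding q_def[abs_def] K_def using that x n par \<rho>
    by (intro t_average_approx(1)) (auto simp: J_def)
  have ih: "set_integrable lborel {0..} (h p)" if "p \<in> J" for p
    unfolding h_def[abs_def] using that by (intro set_integral_diff(1) set_integrable_mult_right iq) auto
  have hint: "(LBINT t:{0..}. h p t) = A (fst p) * B (snd p) - A' (fst p) * B' (snd p)" if "p \<in> J" for p
    unfolding h_def
    by (subst set_integral_diff(2)[OF set_integrable_mult_right[OF iq[OF that]] set_integrable_mult_right[OF iq[OF that]]])
       (simp, simp, simp only: set_integral_mult_right q_def B_def B'_def t_average_def K_def)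
  \<comment> \<open>no singular value lies below \<open>\<rho>\<close>, so the Dirac terms are absent\<close>
  have empty: "{c. c < k \<and> 0 < x c \<and> x c < \<rho>} = {}" using x(1) by fastforce
  have "point_function_formula k n \<alpha> \<beta> \<rho> x = fact (n - k) / fact (n - 1) *
      (LBINT t:{0..}. LBINT v:{0<..<\<rho>}. \<psi> v t * D t (K v (- \<rho> * t)) (\<lambda>c. K v (x c)))"
    unfolding point_function_formula_def Let_def empty \<psi>_def D_def K_def by simp
  also have "(LBINT t:{0..}. LBINT v:{0<..<\<rho>}. \<psi> v t * D t (K v (- \<rho> * t)) (\<lambda>c. K v (x c))) =
      (LBINT t:{0..}. d * g t + (\<Sum>p\<in>J. cof (snd p) (fst p) * h p t))"
    using inner by (intro set_lebesgue_integral_cong) auto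
  also have "\<dots> = d * (LBINT t:{0..}. g t) + (\<Sum>p\<in>J. cof (snd p) (fst p) * (A (fst p) * B (snd p) - A' (fst p) * B' (snd p)))"
    by (subst set_integral_add(2)[OF set_integrable_mult_right[OF ig] set_integral_sum_mult(1)[OF ih]])
       (simp_all add: set_integral_sum_mult(2)[OF ih] hint)
  also have "(\<Sum>p\<in>J. cof (snd p) (fst p) * (A (fst p) * B (snd p) - A' (fst p) * B' (snd p))) =
      (\<Sum>c<k. \<Sum>b<k. cof b c * (A c * B b - A' c * B' b))"
    unfolding J_def sum.cartesian_product by (simp add: case_prod_beta)
  finally have f1k: "point_function_formula k n \<alpha> \<beta> \<rho> x = fact (n - k) / fact (n - 1) *
      (d * (LBINT t:{0..}. g t) + (\<Sum>c<k. \<Sum>b<k. cof b c * (A c * B b - A' c * B' b)))" .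
  have "fact n = real n * fact (n - 1)" using n by (simp add: fact_reduce)
  then have fact_n: "real n * (fact (n - k) / fact n) = fact (n - k) / fact (n - 1)" using n by simp
  have "eigenradius_formula n \<alpha> \<beta> \<rho> * singular_value_formula k n \<alpha> \<beta> x =
      (real n * (LBINT t:{0..}. g t)) * (fact (n - k) / fact n * d)"
    unfolding eigenradius_formula_def singular_value_formula_def g_def \<psi>_def d_def K_def ..
  also have "\<dots> = (real n * (fact (n - k) / fact n)) * (d * (LBINT t:{0..}. g t))"
    by (simp only: mult_ac)
  finally have "eigenradius_formula n \<alpha> \<beta> \<rho> * singular_value_formula k n \<alpha> \<beta> x =
      fact (n - k) / fact (n - 1) * (d * (LBINT t:{0..}. g t))"
    unfolding fact_n .
  with f1k show ?thesis
    unfolding cof_def A_def A'_def B_def B'_def K_def by (simp only: distrib_left add_diff_cancel_left')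
qed

section \<open>The limit of the scaled cross-covariance\<close>

lemma falling_factorial_tendsto:
  assumes "k \<ge> 1"
  shows "(\<lambda>n. real n ^ (k - 1) * fact (n - k) / fact (n - 1)) \<longlonglongrightarrow> 1"
  using assms
proof (induction k rule: dec_induct)
  case base
  have "\<forall>\<^sub>F n in sequentially. 1 = real n ^ (1 - 1) * fact (n - 1) / fact (n - 1)" by simp
  then show ?case by (rule Lim_transform_eventually[OF tendsto_const])
next
  case (step k)
  have "(\<lambda>n. (real n + - real k) / real n) \<longlonglongrightarrow> 1" by (rule tendsto_add_const_over_n)
  then have "(\<lambda>n. real n ^ (k - 1) * fact (n - k) / fact (n - 1) / ((real n + - real k) / real n)) \<longlonglongrightarrow> 1 / 1"
    by (intro tendsto_divide step.IH) auto
  moreover have "\<forall>\<^sub>F n in sequentially. real n ^ (k - 1) * fact (n - k) / fact (n - 1) / ((real n + - real k) / real n)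
      = real n ^ (Suc k - 1) * fact (n - Suc k) / fact (n - 1)"
    using eventually_gt_at_top[of k]
  proof eventually_elim
    case (elim n)
    obtain m where m: "n = Suc (k + m)" using less_imp_Suc_add[OF elim] by blast
    obtain j where j: "k = Suc j" using step.hyps by (cases k) auto
    have "real n + - real k = real (Suc m)" unfolding m by simp
    moreover have "n - k = Suc m" "n - Suc k = m" unfolding m by simp_all
    ultimately show ?case using elim
      by (simp only: fact_Suc of_nat_mult j diff_Suc_1 power_Suc) (simp add: divide_simps)
  qed
  ultimately show ?case unfolding div_by_1 by (rule Lim_transform_eventually)
qed

text \<open>The \<open>k - 1\<close> kernels in each cofactor contribute \<open>n\<^sup>2\<close> each; half a power of \<open>n\<close> is left for the paired averages.\<close>

lemma covariance_prefactor:
  assumes "k \<ge> 1" "n \<ge> 1"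
  shows "real n powr (3 / 2 - real k) * (real n)\<^sup>2 ^ (k - 1) = sqrt (real n) * real n ^ (k - 1)"
proof -
  obtain j where j: "k = Suc j" using assms(1) by (cases k) auto
  have "real n powr (3 / 2 - real k) = real n powr (1 / 2 - real j)" by (simp add: j)
  also have "\<dots> = sqrt (real n) / real n ^ j"
    using assms(2) by (simp add: powr_diff powr_realpow powr_half_sqrt)
  finally show ?thesis
    using assms(2) by (simp add: j power2_eq_square power_mult_distrib)
qed

text \<open>In \<open>cross_covariance_cofactors\<close> every factor converges after scaling, and the limits are reassembled into
a bordered determinant by the same Laplace expansion.\<close>

lemma scaled_covariance_tendsto:
  fixes r :: real and a :: "nat \<Rightarrow> real"
  assumes k: "k \<ge> 1" and par: "\<alpha> > - 1" "\<beta> > 0" and a: "\<And>i. i < k \<Longrightarrow> a i \<ge> 0"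
  defines "rad \<equiv> \<lambda>n. 1 / 2 - r / sqrt (real n)" and "x \<equiv> \<lambda>n i. 1 - a i / (real n)\<^sup>2"
  shows "(\<lambda>n. real n powr (3 / 2 - real k) *
      (point_function_formula k n \<alpha> \<beta> (rad n) (x n)
        - eigenradius_formula n \<alpha> \<beta> (rad n) * singular_value_formula k n \<alpha> \<beta> (x n))) \<longlonglongrightarrow>
    - (4 / sqrt pi) * exp (- 4 * r\<^sup>2) * Determinant.det (bordered_mat k 0
        (\<lambda>c. bessel_C \<beta> (a c)) (\<lambda>b. a b powr \<beta> * bessel_C \<beta> (a b))
        (\<lambda>b c. a b powr \<beta> * bessel_C_kernel \<beta> (a b) (a c)))"
proof -
  define I where "I n b c = v_average n \<alpha> \<beta> (rad n) (x n c) * t_average (n + 1) n \<alpha> \<beta> (rad n) (x n b)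
     - v_average' n \<alpha> \<beta> (rad n) (x n c) * t_average (n + 2) n \<alpha> \<beta> (rad n) (x n b)" for n b c
  define K where "K n b c = jacobi_K n \<alpha> \<beta> (x n b) (x n c) / (real n)\<^sup>2" for n b c
  define L where "L b c = a b powr \<beta> * bessel_C_kernel \<beta> (a b) (a c)" for b c
  define C where "C = - (4 / sqrt pi) * exp (- 4 * r\<^sup>2)"
  define Q where "Q n = real n ^ (k - 1) * fact (n - k) / fact (n - 1)" for n
  have loc: "edge_scaling \<alpha> \<beta> (a b) (a c)" if "b < k" "c < k" for b c
    using that par a by unfold_locales auto
  have I: "(\<lambda>n. sqrt (real n) * I n b c) \<longlonglongrightarrow> C * (a b powr \<beta> * bessel_C \<beta> (a b) * bessel_C \<beta> (a c))"
    if "b < k" "c < k" for b c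
    using edge_scaling.paired_averages_tendsto[OF loc[OF that], of r]
    unfolding edge_scaling.paired_averages_def[OF loc[OF that]] edge_scaling.rad_def[OF loc[OF that]]
      edge_scaling.xpt_def[OF loc[OF that]] edge_scaling.ypt_def[OF loc[OF that]] I_def C_def rad_def x_def .
  have K: "(\<lambda>n. K n b c) \<longlonglongrightarrow> L b c" if "b < k" "c < k" for b c
    unfolding K_def x_def L_def using that by (intro jacobi_K_edge_tendsto par a)
  have "(\<lambda>n. Q n * (\<Sum>c<k. \<Sum>b<k. bordered_cofactor k (K n) b c * (sqrt (real n) * I n b c))) \<longlonglongrightarrow>
     1 * (\<Sum>c<k. \<Sum>b<k. bordered_cofactor k L b c * (C * (a b powr \<beta> * bessel_C \<beta> (a b) * bessel_C \<beta> (a c))))"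
    unfolding Q_def
    by (intro tendsto_mult falling_factorial_tendsto[OF k] tendsto_sum tendsto_bordered_cofactor K I) auto
  moreover have "1 * (\<Sum>c<k. \<Sum>b<k. bordered_cofactor k L b c * (C * (a b powr \<beta> * bessel_C \<beta> (a b) * bessel_C \<beta> (a c)))) =
      C * Determinant.det (bordered_mat k 0 (\<lambda>c. bessel_C \<beta> (a c)) (\<lambda>b. a b powr \<beta> * bessel_C \<beta> (a b)) L)"
    unfolding det_bordered_expand by (simp add: sum_distrib_left mult_ac)
  moreover have "\<forall>\<^sub>F n in sequentially. Q n * (\<Sum>c<k. \<Sum>b<k. bordered_cofactor k (K n) b c * (sqrt (real n) * I n b c)) =
    real n powr (3 / 2 - real k) *
      (point_function_formula k n \<alpha> \<beta> (rad n) (x n)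
        - eigenradius_formula n \<alpha> \<beta> (rad n) * singular_value_formula k n \<alpha> \<beta> (x n))"
  proof -
    have "\<forall>\<^sub>F n in sequentially. \<forall>i\<in>{..<k}. edge_scaling.good r (a i) (a i) n"
      using edge_scaling.eventually_good[OF loc] by (intro eventually_ball_finite) auto
    then show ?thesis using eventually_ge_at_top[of k]
    proof eventually_elim
      case (elim n)
      have gd: "n \<ge> 3 \<and> 1 / 4 \<le> rad n \<and> rad n \<le> 3 / 4 \<and> 7 / 8 \<le> x n i \<and> x n i \<le> 1" if "i < k" for i
        using elim(1) that unfolding rad_def x_def
        by (auto simp: edge_scaling.good_def[OF loc] edge_scaling.rad_def[OF loc] edge_scaling.ypt_def[OF loc])
      have good: "n \<ge> 3" "0 < rad n" "rad n < 1" using gd[of 0] k by auto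
      have pts: "rad n < x n i" "1 / 2 \<le> x n i" "x n i \<le> 1" if "i < k" for i using gd[OF that] by auto
      have n: "(real n)\<^sup>2 \<noteq> 0" using good by simp
      \<comment> \<open>normalize the kernels by \<open>n\<^sup>2\<close>, the scale on which they converge\<close>
      have cof: "bordered_cofactor k (\<lambda>b c. jacobi_K n \<alpha> \<beta> (x n b) (x n c)) b c = (real n)\<^sup>2 ^ (k - 1) * bordered_cofactor k (K n) b c" for b c
        using bordered_cofactor_scale[OF k n, of "K n" b c] n unfolding K_def by simp
      have "point_function_formula k n \<alpha> \<beta> (rad n) (x n)
          - eigenradius_formula n \<alpha> \<beta> (rad n) * singular_value_formula k n \<alpha> \<beta> (x n) =
        fact (n - k) / fact (n - 1) * (\<Sum>c<k. \<Sum>b<k. (real n)\<^sup>2 ^ (k - 1) * bordered_cofactor k (K n) b c * I n b c)"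
        unfolding cof[symmetric] I_def
        by (rule cross_covariance_cofactors[OF good(1) elim(2) par good(2,3)]) (use pts in auto)
      also have "\<dots> = (real n)\<^sup>2 ^ (k - 1) * (fact (n - k) / fact (n - 1) * (\<Sum>c<k. \<Sum>b<k. bordered_cofactor k (K n) b c * I n b c))"
        by (simp only: sum_distrib_left mult_ac)
      finally have "real n powr (3 / 2 - real k) * (point_function_formula k n \<alpha> \<beta> (rad n) (x n)
          - eigenradius_formula n \<alpha> \<beta> (rad n) * singular_value_formula k n \<alpha> \<beta> (x n)) =
        (real n powr (3 / 2 - real k) * (real n)\<^sup>2 ^ (k - 1)) * (fact (n - k) / fact (n - 1) * (\<Sum>c<k. \<Sum>b<k. bordered_cofactor k (K n) b c * I n b c))"
        by simp
      also have "real n powr (3 / 2 - real k) * (real n)\<^sup>2 ^ (k - 1) = sqrt (real n) * real n ^ (k - 1)"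
        using covariance_prefactor[OF k] good(1) by simp
      finally show ?case unfolding Q_def by (simp add: sum_distrib_left mult_ac)
    qed
  qed
  ultimately show ?thesis
    unfolding C_def L_def by (simp only:) (rule Lim_transform_eventually)
qed

lemma bordered_mat_cong:
  assumes "\<And>i. i < k \<Longrightarrow> u i = u' i" "\<And>i. i < k \<Longrightarrow> w i = w' i" "\<And>i j. i < k \<Longrightarrow> j < k \<Longrightarrow> B i j = B' i j"
  shows "bordered_mat k p u w B = bordered_mat k p u' w' B'"
  unfolding bordered_mat_def by (intro eq_matI) (auto simp: assms)

text \<open>The limit has the asymmetric weight \<open>a\<^sub>b\<^sup>\<beta>\<close> on its rows. Distributing it evenly over rows and columns
turns Bessel-Clifford functions into Bessel functions.\<close>

lemma bordered_bessel_det: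
  assumes a: "\<And>i. i < k \<Longrightarrow> a i \<ge> 0"
  shows "Determinant.det (bordered_mat k 0 (\<lambda>c. bessel_C \<beta> (a c)) (\<lambda>b. a b powr \<beta> * bessel_C \<beta> (a b))
        (\<lambda>b c. a b powr \<beta> * bessel_C_kernel \<beta> (a b) (a c))) =
    Determinant.det (bordered_mat k 0 (\<lambda>c. bessel_J \<beta> (2 * sqrt (a c))) (\<lambda>b. bessel_J \<beta> (2 * sqrt (a b)))
        (\<lambda>b c. LBINT t:{0..1}. bessel_J \<beta> (2 * sqrt (a b * t)) * bessel_J \<beta> (2 * sqrt (a c * t))))"
    (is "_ = Determinant.det ?M")
proof -
  define N where "N = bordered_mat k 0 (\<lambda>c. bessel_C \<beta> (a c)) (\<lambda>b. bessel_C \<beta> (a b)) (\<lambda>b c. bessel_C_kernel \<beta> (a b) (a c))"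
  have "?M = bordered_mat k 0 (\<lambda>c. a c powr (\<beta> / 2) * bessel_C \<beta> (a c)) (\<lambda>b. a b powr (\<beta> / 2) * bessel_C \<beta> (a b))
        (\<lambda>b c. a b powr (\<beta> / 2) * a c powr (\<beta> / 2) * bessel_C_kernel \<beta> (a b) (a c))"
    by (intro bordered_mat_cong bessel_J_eq bessel_J_integral_eq a)
  then have "Determinant.det ?M = (\<Prod>b<k. a b powr (\<beta> / 2)) * (\<Prod>c<k. a c powr (\<beta> / 2)) * Determinant.det N"
    unfolding N_def by (simp only: det_bordered_scale)
  also have "(\<Prod>b<k. a b powr (\<beta> / 2)) * (\<Prod>c<k. a c powr (\<beta> / 2)) = (\<Prod>b<k. a b powr \<beta>)"
    by (simp flip: prod.distrib powr_add)
  also have "\<dots> * Determinant.det N = Determinant.det (bordered_mat k 0 (\<lambda>c. bessel_C \<beta> (a c)) (\<lambda>b. a b powr \<beta> * bessel_C \<beta> (a b))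
        (\<lambda>b c. a b powr \<beta> * bessel_C_kernel \<beta> (a b) (a c)))"
    using det_bordered_scale[of k "\<lambda>_. 1" "\<lambda>c. bessel_C \<beta> (a c)" "\<lambda>b. a b powr \<beta>" "\<lambda>b. bessel_C \<beta> (a b)" "\<lambda>b c. bessel_C_kernel \<beta> (a b) (a c)"]
    unfolding N_def by simp
  finally show ?thesis ..
qed

text \<open>The determinant is affine in \<open>\<mu>\<close>.\<close>

lemma deriv_det_rank_one:
  "deriv (\<lambda>\<mu>. Determinant.det (mat k k (\<lambda>(b, c). B b c + \<mu> * w b * u c))) 0 =
    - Determinant.det (bordered_mat k 0 u w B)"
proof (rule DERIV_imp_deriv)
  have "((\<lambda>\<mu>. Determinant.det (mat k k (\<lambda>(b, c). B b c)) - \<mu> * Determinant.det (bordered_mat k 0 u w B))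
      has_real_derivative 0 - 1 * Determinant.det (bordered_mat k 0 u w B)) (at 0)"
    by (intro DERIV_diff DERIV_const DERIV_cmult_right DERIV_ident)
  then show "((\<lambda>\<mu>. Determinant.det (mat k k (\<lambda>(b, c). B b c + \<mu> * w b * u c))) has_real_derivative
      - Determinant.det (bordered_mat k 0 u w B)) (at 0)"
    unfolding det_rank_one_update by simp
qed

lemma det_bordered_scale_block:
  assumes "k \<ge> 1" "t \<noteq> 0"
  shows "Determinant.det (bordered_mat k 0 u w (\<lambda>b c. t * B b c)) = t ^ (k - 1) * Determinant.det (bordered_mat k 0 u w B)"
  unfolding det_bordered_expand bordered_cofactor_scale[OF assms] by (simp add: sum_distrib_left mult_ac)

lemma det_bordered_1: "Determinant.det (bordered_mat 1 0 u w B) = - (u 0 * w 0)"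
  using det_rank_one_update[of 1 B 1 w u] by (simp add: det_single mult.commute)

theorem theorem3p2:
  fixes k :: nat and \<alpha> \<beta> :: real
    and f1k :: "nat \<Rightarrow> real \<Rightarrow> (nat \<Rightarrow> real) \<Rightarrow> real"
    and f10 :: "nat \<Rightarrow> real \<Rightarrow> real"
    and f0k :: "nat \<Rightarrow> (nat \<Rightarrow> real) \<Rightarrow> real"
    and r :: real and a :: "nat \<Rightarrow> real"
  assumes "k \<ge> 1" and "\<alpha> > -1" and "\<beta> > 0"
    and "\<And>n. n > 2 \<Longrightarrow> n \<ge> k \<Longrightarrow> is_point_function k n \<alpha> \<beta> (f1k n)"
    and "\<And>n. n > 2 \<Longrightarrow> n \<ge> k \<Longrightarrow> is_eigenradius_marginal k (f1k n) (f10 n)"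
    and "\<And>n. n > 2 \<Longrightarrow> n \<ge> k \<Longrightarrow> is_singular_value_marginal k (f1k n) (f0k n)"
    and "\<And>n s b. n > 2 \<Longrightarrow> n \<ge> k \<Longrightarrow> s \<ge> 0 \<Longrightarrow> \<forall>i<k. b i \<ge> 0 \<Longrightarrow>
           f1k n s b = point_function_formula k n \<alpha> \<beta> s b"
    and "\<And>n s. n > 2 \<Longrightarrow> n \<ge> k \<Longrightarrow> s \<ge> 0 \<Longrightarrow> f10 n s = eigenradius_formula n \<alpha> \<beta> s"
    and "\<And>n b. n > 2 \<Longrightarrow> n \<ge> k \<Longrightarrow> \<forall>i<k. b i \<ge> 0 \<Longrightarrow>
           f0k n b = singular_value_formula k n \<alpha> \<beta> b"
    and "\<forall>i<k. a i \<ge> 0"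
  defines "scaled_cov \<equiv> \<lambda>n. real n powr (3 / 2 - real k) *
      cross_covariance (f1k n) (f10 n) (f0k n)
        (1 / 2 - r / sqrt (real n)) (\<lambda>i. 1 - a i / (real n)\<^sup>2)"
    and "limit_cov \<equiv> 4 / sqrt pi * exp (- 4 * r\<^sup>2) *
      deriv (\<lambda>\<mu>. Determinant.det (mat k k (\<lambda>(b, c).
        (LBINT t:{0..1}. bessel_J \<beta> (2 * sqrt (a b * t)) * bessel_J \<beta> (2 * sqrt (a c * t)))
        + \<mu> * bessel_J \<beta> (2 * sqrt (a b)) * bessel_J \<beta> (2 * sqrt (a c))))) 0"
  shows "scaled_cov \<longlonglongrightarrow> limit_cov \<and>
    limit_cov = - (4 ^ k / sqrt pi) * exp (- 4 * r\<^sup>2) *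
      Determinant.det (bordered_mat k 0
        (\<lambda>c. bessel_J \<beta> (2 * sqrt (a c))) (\<lambda>b. bessel_J \<beta> (2 * sqrt (a b)))
        (\<lambda>b c. bessel_kernel \<beta> (4 * a b) (4 * a c))) \<and>
    (k = 1 \<longrightarrow> scaled_cov \<longlonglongrightarrow> 4 / sqrt pi * exp (- 4 * r\<^sup>2) * (bessel_J \<beta> (2 * sqrt (a 0)))\<^sup>2)"
proof -
  define J where "J i = bessel_J \<beta> (2 * sqrt (a i))" for i
  define \<kappa> where "\<kappa> b c = (LBINT t:{0..1}. bessel_J \<beta> (2 * sqrt (a b * t)) * bessel_J \<beta> (2 * sqrt (a c * t)))" for b c
  define d where "d = Determinant.det (bordered_mat k 0 J J \<kappa>)"
  have a: "a i \<ge> 0" if "i < k" for i using assms(10) that by blast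
  have limit_cov: "limit_cov = - (4 / sqrt pi) * exp (- 4 * r\<^sup>2) * d"
    unfolding limit_cov_def J_def[symmetric] \<kappa>_def[symmetric] deriv_det_rank_one d_def by simp
  have d_C: "d = Determinant.det (bordered_mat k 0 (\<lambda>c. bessel_C \<beta> (a c)) (\<lambda>b. a b powr \<beta> * bessel_C \<beta> (a b))
        (\<lambda>b c. a b powr \<beta> * bessel_C_kernel \<beta> (a b) (a c)))"
    unfolding d_def J_def \<kappa>_def by (rule bordered_bessel_det[symmetric]) (rule a)
  have "scaled_cov \<longlonglongrightarrow> limit_cov"
  proof (rule Lim_transform_eventually)
    show "(\<lambda>n. real n powr (3 / 2 - real k) *
      (point_function_formula k n \<alpha> \<beta> (1 / 2 - r / sqrt (real n)) (\<lambda>i. 1 - a i / (real n)\<^sup>2)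
        - eigenradius_formula n \<alpha> \<beta> (1 / 2 - r / sqrt (real n)) *
          singular_value_formula k n \<alpha> \<beta> (\<lambda>i. 1 - a i / (real n)\<^sup>2))) \<longlonglongrightarrow> limit_cov"
      using scaled_covariance_tendsto[where a = a and r = r, OF assms(1-3) a]
      unfolding limit_cov d_C by simp
    have rad: "(\<lambda>n. 1 / 2 - r / sqrt (real n)) \<longlonglongrightarrow> 1 / 2"
    proof -
      have "(\<lambda>n. 1 / 2 - r * inverse (sqrt (real n))) \<longlonglongrightarrow> 1 / 2 - r * 0"
        by (intro tendsto_diff tendsto_mult tendsto_const inverse_sqrt_tendsto)
      then show ?thesis unfolding divide_inverse[of r] by simp
    qed
    have "\<forall>\<^sub>F n in sequentially. \<forall>i\<in>{..<k}. a i \<le> (real n)\<^sup>2"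
      by (intro eventually_ball_finite) (auto intro: eventually_le_n_squared)
    moreover have "\<forall>\<^sub>F n in sequentially. 0 < 1 / 2 - r / sqrt (real n)"
      by (rule order_tendstoD(1)[OF rad]) simp
    ultimately show "\<forall>\<^sub>F n in sequentially. real n powr (3 / 2 - real k) *
      (point_function_formula k n \<alpha> \<beta> (1 / 2 - r / sqrt (real n)) (\<lambda>i. 1 - a i / (real n)\<^sup>2)
        - eigenradius_formula n \<alpha> \<beta> (1 / 2 - r / sqrt (real n)) *
          singular_value_formula k n \<alpha> \<beta> (\<lambda>i. 1 - a i / (real n)\<^sup>2)) = scaled_cov n"
      using eventually_gt_at_top[of 2] eventually_ge_at_top[of k]
    proof eventually_elim
      case (elim n)
      have "\<forall>i<k. 0 \<le> 1 - a i / (real n)\<^sup>2" using elim(1,3) by (simp add: divide_le_eq)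
      with elim show ?case
        unfolding scaled_cov_def cross_covariance_def by (simp add: assms(7-9))
    qed
  qed
  moreover have "limit_cov = - (4 ^ k / sqrt pi) * exp (- 4 * r\<^sup>2) *
      Determinant.det (bordered_mat k 0 J J (\<lambda>b c. bessel_kernel \<beta> (4 * a b) (4 * a c)))"
  proof -
    obtain j where j: "k = Suc j" using assms(1) by (cases k) auto
    \<comment> \<open>the kernel at \<open>(4 a\<^sub>b, 4 a\<^sub>c)\<close> is a quarter of the integral, which explains \<open>4\<^sup>k\<close> against \<open>4\<close>\<close>
    have "Determinant.det (bordered_mat k 0 J J (\<lambda>b c. 1 / 4 * \<kappa> b c)) = (1 / 4) ^ j * d"
      unfolding d_def by (subst det_bordered_scale_block[OF assms(1)]) (simp_all add: j)
    then show ?thesis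
      unfolding limit_cov bessel_kernel_eq \<kappa>_def[symmetric] by (simp add: j power_divide)
  qed
  moreover have "limit_cov = 4 / sqrt pi * exp (- 4 * r\<^sup>2) * (bessel_J \<beta> (2 * sqrt (a 0)))\<^sup>2" if "k = 1"
    unfolding limit_cov d_def that det_bordered_1 by (simp add: J_def power2_eq_square)
  ultimately show ?thesis unfolding J_def by metis
qed

end
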